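(* Let $\omega_0$ be an initial vorticity of one of the following two types, with coordinate representation $\tilde\omega_0$ and $\|\tilde\omega_0\|_{L^\infty}=1$: (i) $\tilde\omega_0\in W^{1,\infty}\left([-\pi,\pi)\times(0,\pi/2]\right)$, i.e. $\omega_0$ is given on the open upper hemisphere $\mathbb{S}^2_+$ (and is extended to $\mathbb{S}^2$ as an odd function of $x_3$); or (ii) $\tilde\omega_0\in W^{1,\infty}\left([-\pi,\pi)\times[-\pi/2,\pi/2]\right)$, i.e. $\omega_0$ is given on all of $\mathbb{S}^2$, with $\int_{\mathbb{S}^2}\omega_0\,d\sigma=0$. Let $\omega$ be the corresponding solution of the Euler equation on $\mathbb{S}^2$, $$\partial_t\omega+u\cdot\nabla\omega=0,\qquad u(\mathbf{x},t)=\frac{1}{2\pi}\int_{\mathbb{S}^2}\frac{\mathbf{x}\wedge\mathbf{y}}{|\mathbf{x}-\mathbf{y}|^2}\,\omega(\mathbf{y},t)\,d\sigma(\mathbf{y}),\qquad \omega(\cdot,0)=\omega_0 .$$ Then $$\limsup_{t\to\infty}\frac{\ln\ln\|\nabla\tilde\omega(\cdot,t)\|_{L^\infty\left([-\pi,\pi)\times(0,\pi/2]\right)}}{t}\le\frac{2}{\pi}.$$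
   Context: $\mathbb{S}^2=\{\mathbf{x}\in\mathbb{R}^3:|\mathbf{x}|=1\}$ with its standard metric and surface measure $\sigma$; $\mathbb{S}^2_+=\{\mathbf{x}\in\mathbb{S}^2:x_3>0\}$; $|\mathbf{x}-\mathbf{y}|$ is the Euclidean distance in $\mathbb{R}^3$ and $\wedge$ the cross product. Spherical coordinates: $\mathbf{x}=(\cos\theta\cos\varphi,\cos\theta\sin\varphi,\sin\theta)$, $(\varphi,\theta)\in[-\pi,\pi)\times[-\pi/2,\pi/2]$, $d\sigma=\cos\theta\,d\varphi\,d\theta$. For a function $f$ on (part of) $\mathbb{S}^2$, $\tilde f(\varphi,\theta):=f(\mathbf{x})$ is its coordinate representation (in particular it is $2\pi$-periodic in the longitude $\varphi$). The set $[-\pi,\pi)\times(0,\pi/2]$ corresponds to $\mathbb{S}^2_+$. The gradient $\nabla$ is taken with respect to the standard metric of $\mathbb{S}^2$; $\tilde f\in W^{1,\infty}$ means that $f$ is bounded and weakly differentiable on the corresponding subset of the sphere ($\mathbb{S}^2_+$ or $\mathbb{S}^2$) with essentially bounded gradient, and $\|\nabla\tilde f\|_{L^\infty}$ is the essential supremum of the length of this gradient over that subset. The velocity is $u=\nabla^\perp\mathcal{G}\omega$ with $\mathcal{G}\omega(\mathbf{x})=\frac1{2\pi}\int_{\mathbb{S}^2}\ln|\mathbf{x}-\mathbf{y}|\,\omega(\mathbf{y})\,d\sigma(\mathbf{y})$ and $\nabla^\perp f(\mathbf{x})=\nabla f(\mathbf{x})\wedge\mathbf{x}$, which is the integral formula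 in the claim. The solution is the unique global bounded (Yudovich) weak solution: $\omega(\cdot,t)=\omega_0\circ\Phi_t^{-1}$, where $\Phi_t$ is the flow of $u$. Oddness in $x_3$ is preserved by the evolution. Convention: $\ln\ln a:=-\infty$ for $0\le a\le 1$. *)

theory Defs
  imports "HOL-Analysis.Analysis" "HOL-Probability.Essential_Supremum"
begin

section \<open>The sphere and its surface measure\<close>

definition S2 :: "(real^3) set" where
  "S2 = sphere 0 1"

definition S2_plus :: "(real^3) set" where
  "S2_plus = {x \<in> S2. x $ 3 > 0}"

definition reflect3 :: "real^3 \<Rightarrow> real^3" where
  "reflect3 x = vector [x $ 1, x $ 2, - (x $ 3)]"

text \<open>Arguments are (longitude, latitude).\<close>

definition sph_coord :: "real \<times> real \<Rightarrow> real^3" where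
  "sph_coord = (\<lambda>(\<phi>, \<theta>). vector [cos \<theta> * cos \<phi>, cos \<theta> * sin \<phi>, sin \<theta>])"

definition coord_domain :: "(real \<times> real) set" where
  "coord_domain = Sigma {-pi..<pi} (\<lambda>_. {-(pi/2)..pi/2})"

text \<open>The surface measure, on the Borel sets of the sphere, is the image of
  \<open>cos \<theta> d\<phi> d\<theta>\<close>.\<close>

definition sph_measure :: "(real^3) measure" where
  "sph_measure =
     distr (density (restrict_space lborel coord_domain) (\<lambda>(\<phi>, \<theta>). ennreal (cos \<theta>)))
           (restrict_space borel S2) sph_coord"

lemma space_sph_measure [simp]: "space sph_measure = S2"
  and sets_sph_measure [simp]: "sets sph_measure = sets (restrict_space borel S2)"
  by (auto simp: sph_measure_def space_restrict_space)

lemma measurable_sph_coord: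
  "sph_coord \<in> density (restrict_space lborel coord_domain) (\<lambda>(\<phi>, \<theta>). ennreal (cos \<theta>))
     \<rightarrow>\<^sub>M restrict_space borel S2"
proof -
  have cont: "continuous_on UNIV sph_coord"
    unfolding continuous_on_componentwise[of UNIV sph_coord] Basis_vec_def
    by (auto simp: sph_coord_def case_prod_beta cart_eq_inner_axis[symmetric] forall_3
             intro!: continuous_intros)
  have in_S2: "sph_coord p \<in> S2" for p
  proof (cases p)
    case (Pair a b)
    have "(norm (sph_coord p))\<^sup>2 = (cos b)\<^sup>2 * ((cos a)\<^sup>2 + (sin a)\<^sup>2) + (sin b)\<^sup>2"
      unfolding power2_norm_eq_inner inner_vec_def sum_3 Pair sph_coord_def
      by (simp del: sin_cos_squared_add sin_cos_squared_add2 sin_cos_squared_add3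
               add: power2_eq_square algebra_simps)
    also have "\<dots> = 1" by simp
    finally have "norm (sph_coord p) = 1"
      by (simp add: power2_eq_1_iff) (smt (verit) norm_ge_zero)
    then show ?thesis by (simp add: S2_def)
  qed
  have "sph_coord \<in> borel_measurable (restrict_space lborel coord_domain)"
    by (intro measurable_restrict_space1)
       (simp add: borel_measurable_continuous_onI[OF cont])
  then show ?thesis
    by (intro measurable_restrict_space2) (auto simp: in_S2)
qed

text \<open>For \<open>U\<close> a relatively open subset of the sphere:\<close>

abbreviation sph_on :: "(real^3) set \<Rightarrow> (real^3) measure" where
  "sph_on U \<equiv> restrict_space sph_measure U"

definition Linf_norm :: "(real^3) set \<Rightarrow> (real^3 \<Rightarrow> 'b::real_normed_vector) \<Rightarrow> ereal" where
  "Linf_norm U f = esssup (sph_on U) (\<lambda>x. ereal (norm (f x)))"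


section \<open>Weak gradients on the sphere\<close>

text \<open>Vector fields on the sphere are represented by vector fields on the ambient space that are
  tangent to the sphere at its points. Every tangential \<open>C\<^sup>1\<close> field on the sphere has a \<open>C\<^sup>1\<close>
  extension to the ambient space, and the notions below depend only on the values on the sphere.
  As usual, \<open>C\<^sup>1\<close> test fields and smooth test fields define the same weak gradients.\<close>

definition test_field :: "(real^3) set \<Rightarrow> (real^3 \<Rightarrow> real^3) \<Rightarrow> bool" where
  "test_field U X \<longleftrightarrow>
     (\<forall>x. X differentiable (at x)) \<and>
     (\<forall>v. continuous_on UNIV (\<lambda>x. frechet_derivative X (at x) v)) \<and>
     (\<forall>x\<in>S2. X x \<bullet> x = 0) \<and>
     (\<exists>K. compact K \<and> K \<subseteq> U \<and> (\<forall>x\<in>S2 - K. X x = 0))"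

text \<open>The divergence of a tangential field with respect to the metric of the sphere: the trace of
  the derivative over the tangent plane, i.e. the full trace minus the contribution of the normal
  direction \<open>x\<close>.\<close>

definition sph_div :: "(real^3 \<Rightarrow> real^3) \<Rightarrow> real^3 \<Rightarrow> real" where
  "sph_div X x =
     (\<Sum>b\<in>Basis. frechet_derivative X (at x) b \<bullet> b) - frechet_derivative X (at x) x \<bullet> x"

definition locally_integrable_on :: "(real^3) set \<Rightarrow> (real^3 \<Rightarrow> 'b::euclidean_space) \<Rightarrow> bool" where
  "locally_integrable_on U f \<longleftrightarrow>
     f \<in> borel_measurable (sph_on U) \<and>
     (\<forall>K. compact K \<and> K \<subseteq> U \<longrightarrow> set_integrable sph_measure K f)"

definition weak_gradient :: "(real^3) set \<Rightarrow> (real^3 \<Rightarrow> real) \<Rightarrow> (real^3 \<Rightarrow> real^3) \<Rightarrow> bool" where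
  "weak_gradient U f g \<longleftrightarrow>
     locally_integrable_on U f \<and> locally_integrable_on U g \<and>
     (AE x in sph_on U. g x \<bullet> x = 0) \<and>
     (\<forall>X. test_field U X \<longrightarrow>
        (\<integral>x. f x * sph_div X x \<partial>sph_on U) = - (\<integral>x. g x \<bullet> X x \<partial>sph_on U))"

definition W1inf :: "(real^3) set \<Rightarrow> (real^3 \<Rightarrow> real) \<Rightarrow> bool" where
  "W1inf U f \<longleftrightarrow>
     f \<in> borel_measurable (sph_on U) \<and> Linf_norm U f < \<infinity> \<and>
     (\<exists>g. weak_gradient U f g \<and> Linf_norm U g < \<infinity>)"

text \<open>The weak gradient is unique up to null sets, so the infimum only serves to give the value
  \<open>\<infinity>\<close> to functions that are not weakly differentiable.\<close>

definition grad_Linf :: "(real^3) set \<Rightarrow> (real^3 \<Rightarrow> real) \<Rightarrow> ereal" where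
  "grad_Linf U f = Inf {Linf_norm U g | g. weak_gradient U f g}"


section \<open>The Euler equation\<close>

text \<open>The integrand takes the value \<open>0\<close> at \<open>y = x\<close>, a null set.\<close>

definition velocity :: "(real^3 \<Rightarrow> real) \<Rightarrow> real^3 \<Rightarrow> real^3" where
  "velocity \<omega> x =
     (1 / (2 * pi)) *\<^sub>R (\<integral>y. (\<omega> y / (norm (x - y))\<^sup>2) *\<^sub>R cross3 x y \<partial>sph_measure)"

text \<open>The flow of a time-dependent divergence-free velocity field: area-preserving homeomorphisms
  whose trajectories solve the differential equation. Preservation of area is what makes
  composition with the inverse flow maps meaningful for vorticities that are only determined up to
  null sets.\<close>

definition sph_flow :: "(real \<Rightarrow> real^3 \<Rightarrow> real^3) \<Rightarrow> (real \<Rightarrow> real^3 \<Rightarrow> real^3) \<Rightarrow> bool" where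
  "sph_flow u \<Phi> \<longleftrightarrow>
     (\<forall>t\<ge>0. \<exists>\<Psi>. homeomorphism S2 S2 (\<Phi> t) \<Psi>) \<and>
     (\<forall>t\<ge>0. distr sph_measure sph_measure (\<Phi> t) = sph_measure) \<and>
     (\<forall>x\<in>S2. \<Phi> 0 x = x) \<and>
     (\<forall>x\<in>S2. \<forall>t\<ge>0. ((\<lambda>s. \<Phi> s x) has_vector_derivative u t (\<Phi> t x)) (at t within {0..}))"

text \<open>The Yudovich solution: the initial vorticity is transported by the flow of the velocity field
  that the vorticity itself generates.\<close>

definition yudovich_solution :: "(real^3 \<Rightarrow> real) \<Rightarrow> (real \<Rightarrow> real^3 \<Rightarrow> real) \<Rightarrow> bool" where
  "yudovich_solution \<omega>0 \<omega> \<longleftrightarrow>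
     (\<exists>\<Phi>. sph_flow (\<lambda>t. velocity (\<omega> t)) \<Phi> \<and>
        (\<forall>t\<ge>0. \<forall>x\<in>S2. \<omega> t x = \<omega>0 (inv_into S2 (\<Phi> t) x)))"


definition lnln :: "ereal \<Rightarrow> ereal" where
  "lnln a = (if a \<le> 1 then -\<infinity> else if a = \<infinity> then \<infinity> else ereal (ln (ln (real_of_ereal a))))"

end

theory Submission imports Defs
begin

text \<open>Two points \<open>x\<close>, \<open>y\<close> at small distance \<open>d\<close> with midpoint direction \<open>m\<close> separate at a
  rate governed by the integral of the vorticity against a kernel that looks like the quadrupole
  \<open>(z \<bullet> e) (z \<bullet> n) / norm (z - m)^4\<close> at distances larger than \<open>d\<close>. Its absolute value has integral
  about \<open>2 ln (1 / \<rho>)\<close> outside the disc of radius \<open>\<rho>\<close>, so that a vorticity bounded by \<open>1\<close> gives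
  \<open>\<bar>(ln d)'\<bar> \<le> 2 / \<pi> * ln (1 / d) + const\<close>, and the inverse flow maps are Hoelder
  continuous with exponent \<open>\<alpha> = exp (- 2 t / \<pi>)\<close>. The transported vorticity then is Hoelder
  continuous too, where in the odd case the jump across the equator is accounted for by a factor
  \<open>sgn z\<^sub>3\<close>. The quadrupole has mean zero on annuli, and its integral against \<open>sgn z\<^sub>3\<close> is bounded
  uniformly, so only scales above \<open>\<delta>\<close> with \<open>ln (1 / \<delta>) = exp (2 t / \<pi>) * O(1 + t)\<close> contribute.
  Hence the inverse flow is Lipschitz with constant \<open>exp (exp (2 t / \<pi>) * O((1 + t)\<^sup>2))\<close>. In the odd
  case this needs that the flow preserves the upper hemisphere: the flow and its conjugate by the
  reflection solve the same differential equation, whose solution is unique by Osgood's criterion.\<close>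

section \<open>Polar coordinates and the surface measure\<close>

text \<open>The rate is a product of two constants: the prefactor \<open>1 / (2 * pi)\<close> of the
  velocity becomes \<open>1 / pi\<close> when the kernels of a pair of points are merged, and
  \<open>\<bar>cos \<phi> * sin \<phi>\<bar>\<close> has integral \<open>2\<close> over the circle.
  All other estimates may be crude, since a constant factor in the gradient, or a polynomial in
  \<open>t\<close> next to \<open>exp (2 / pi * t)\<close>, disappears after two logarithms and
  division by \<open>t\<close>. The data are regular only up to null sets, while the argument
  follows individual points. Mollification over caps turns a bounded weak gradient into a Lipschitz
  estimate on a set of full measure; area preservation carries that set along the flow; at the end a
  bounded functional on test fields is represented, which gives back a weak gradient. The surface
  measure is given in coordinates that single out the third axis. Its invariance under all
  orthogonal maps, on which every kernel integral rests, is derived from that of volume.\<close>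

lemma emeasure_lborel_Times:
  assumes "A \<in> sets borel" "B \<in> sets borel"
  shows "emeasure lborel (A \<times> B) = emeasure lborel A * emeasure lborel B"
  using assms by (subst lborel_prod[symmetric], subst lborel.emeasure_pair_measure_Times) auto

lemma Basis_real3: "(Basis :: (real^3) set) = {axis 1 1, axis 2 1, axis 3 1}"
  unfolding Basis_vec_def by (auto, metis exhaust_3)

text \<open>Identifies the Lebesgue measure of \<open>real^3\<close> with a product measure, so that
  volume integrals can be iterated; vectors are kept because determinants and the change of
  variables are formulated for them.\<close>

lemma lborel_vec3: "distr lborel borel (\<lambda>(a, b, c). vector [a, b, c] :: real^3) = (lborel :: (real^3) measure)"
proof -
  let ?V = "(\<lambda>(a, b, c). vector [a, b, c]) :: real \<times> real \<times> real \<Rightarrow> real^3"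
  have cont: "continuous_on UNIV ?V"
    unfolding continuous_on_componentwise[of UNIV ?V] Basis_vec_def
    by (auto simp: case_prod_beta cart_eq_inner_axis[symmetric] forall_3 intro!: continuous_intros)
  then have meas [measurable]: "?V \<in> borel_measurable borel"
    by (rule borel_measurable_continuous_onI)
  show ?thesis
  proof (rule lborel_eqI[symmetric])
    fix l u :: "real^3"
    assume le: "\<And>b. b \<in> Basis \<Longrightarrow> l \<bullet> b \<le> u \<bullet> b"
    have le': "l $ i \<le> u $ i" for i
      using le[of "axis i 1"] by (simp add: cart_eq_inner_axis)
    have "?V -` box l u = {l$1<..<u$1} \<times> ({l$2<..<u$2} \<times> {l$3<..<u$3})"
      by (auto simp: mem_box_cart forall_3)
    moreover have "emeasure lborel ({l$1<..<u$1} \<times> ({l$2<..<u$2} \<times> {l$3<..<u$3})) =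
        ennreal (u$1 - l$1) * (ennreal (u$2 - l$2) * ennreal (u$3 - l$3))"
      by (simp add: emeasure_lborel_Times borel_Times le')
    moreover have "(\<Prod>b\<in>Basis. (u - l) \<bullet> b) = (u$1 - l$1) * ((u$2 - l$2) * (u$3 - l$3))"
    proof -
      have "(axis 1 1 :: real^3) \<noteq> axis 2 1" "(axis 1 1 :: real^3) \<noteq> axis 3 1" "(axis 2 1 :: real^3) \<noteq> axis 3 1"
        by (simp_all add: axis_eq_axis)
      then show ?thesis by (simp add: Basis_real3 inner_axis)
    qed
    ultimately show "emeasure (distr lborel borel ?V) (box l u) = ennreal (\<Prod>b\<in>Basis. (u - l) \<bullet> b)"
      by (simp add: emeasure_distr le' ennreal_mult)
  qed simp
qed

lemma nn_integral_lborel_vec3: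
  assumes [measurable]: "f \<in> borel_measurable (borel :: (real^3) measure)"
  shows "(\<integral>\<^sup>+x. f x \<partial>lborel) = (\<integral>\<^sup>+a. \<integral>\<^sup>+p. f (vector [a, fst p, snd p]) \<partial>lborel \<partial>lborel)"
proof -
  let ?V = "(\<lambda>(a, b, c). vector [a, b, c]) :: real \<times> real \<times> real \<Rightarrow> real^3"
  have cont: "continuous_on UNIV ?V"
    unfolding continuous_on_componentwise[of UNIV ?V] Basis_vec_def
    by (auto simp: case_prod_beta cart_eq_inner_axis[symmetric] forall_3 intro!: continuous_intros)
  then have meas [measurable]: "?V \<in> borel_measurable borel"
    by (rule borel_measurable_continuous_onI)
  have "(\<integral>\<^sup>+x. f x \<partial>lborel) = (\<integral>\<^sup>+x. f x \<partial>distr lborel borel ?V)"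
    by (simp add: lborel_vec3)
  also have "\<dots> = (\<integral>\<^sup>+x. f (?V x) \<partial>lborel)"
    by (subst nn_integral_distr) auto
  also have "\<dots> = (\<integral>\<^sup>+x. f (?V x) \<partial>(lborel \<Otimes>\<^sub>M lborel))"
    by (simp add: lborel_prod)
  also have "\<dots> = (\<integral>\<^sup>+a. \<integral>\<^sup>+p. f (?V (a, p)) \<partial>lborel \<partial>lborel)"
    by (rule lborel.nn_integral_fst[symmetric]) (simp add: lborel_prod)
  finally show ?thesis by (simp add: case_prod_beta)
qed

lemma continuous_sph_coord: "continuous_on UNIV sph_coord"
    unfolding continuous_on_componentwise[of UNIV sph_coord] Basis_vec_def
    by (auto simp: sph_coord_def case_prod_beta cart_eq_inner_axis[symmetric] forall_3
             intro!: continuous_intros)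

lemma sph_coord_nth: "sph_coord p $ 1 = cos (snd p) * cos (fst p)"
   "sph_coord p $ 2 = cos (snd p) * sin (fst p)" "sph_coord p $ 3 = sin (snd p)"
  by (auto simp: sph_coord_def case_prod_beta)

lemma norm_sph_coord: "norm (sph_coord p) = 1"
proof -
  have "(norm (sph_coord p))\<^sup>2 = (cos (snd p))\<^sup>2 * ((cos (fst p))\<^sup>2 + (sin (fst p))\<^sup>2) + (sin (snd p))\<^sup>2"
    unfolding power2_norm_eq_inner inner_vec_def sum_3 sph_coord_nth
    by (simp del: sin_cos_squared_add sin_cos_squared_add2 sin_cos_squared_add3
             add: power2_eq_square algebra_simps)
  also have "\<dots> = 1" by simp
  finally show ?thesis using norm_ge_zero[of "sph_coord p"] unfolding power2_eq_1_iff by linarith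
qed

lemma sph_coord_S2: "sph_coord p \<in> S2"
  by (simp add: S2_def norm_sph_coord)

lemma S2_borel [measurable]: "S2 \<in> sets borel"
  by (simp add: S2_def borel_closed)

lemma borel_measurable_sph_iff:
  "f \<in> measurable sph_measure M \<longleftrightarrow> f \<in> measurable (restrict_space borel S2) M"
  using measurable_cong_sets[OF sets_sph_measure refl] by blast

lemma coord_domain_borel [measurable]: "coord_domain \<in> sets borel"
  unfolding coord_domain_def by (intro borel_Times) auto

lemma nn_integral_sph:
  assumes f: "f \<in> borel_measurable sph_measure"
  shows "(\<integral>\<^sup>+x. f x \<partial>sph_measure) =
    (\<integral>\<^sup>+p. indicator coord_domain p * (ennreal (cos (snd p)) * f (sph_coord p)) \<partial>lborel)"
proof -
  have f': "f \<in> borel_measurable (restrict_space borel S2)"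
    using f by (simp add: borel_measurable_sph_iff)
  have m: "sph_coord \<in> measurable borel (restrict_space borel S2)"
    using borel_measurable_continuous_onI[OF continuous_sph_coord]
    by (intro measurable_restrict_space2) (auto simp: sph_coord_S2)
  have [measurable]: "(\<lambda>p. f (sph_coord p)) \<in> borel_measurable borel"
    using measurable_compose[OF m f'] .
  have c [measurable]: "(\<lambda>p. ennreal (cos (snd p))) \<in> borel_measurable (borel :: (real\<times>real) measure)"
    by (intro measurable_compose[OF _ measurable_ennreal] borel_measurable_continuous_onI continuous_intros)
  have "(\<integral>\<^sup>+x. f x \<partial>sph_measure) =
    (\<integral>\<^sup>+p. f (sph_coord p) \<partial>density (restrict_space lborel coord_domain) (\<lambda>(\<phi>, \<theta>). ennreal (cos \<theta>)))"
    unfolding sph_measure_def by (rule nn_integral_distr[OF measurable_sph_coord]) (use f' in simp)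
  also have "\<dots> = (\<integral>\<^sup>+p. ennreal (cos (snd p)) * f (sph_coord p) \<partial>restrict_space lborel coord_domain)"
    unfolding case_prod_beta
    by (rule nn_integral_density) (auto intro!: measurable_restrict_space1)
  also have "\<dots> = (\<integral>\<^sup>+p. (ennreal (cos (snd p)) * f (sph_coord p)) * indicator coord_domain p \<partial>lborel)"
    by (rule nn_integral_restrict_space) auto
  finally show ?thesis by (simp add: mult.commute)
qed

text \<open>The solid cone over \<open>A\<close> in the unit ball, without its apex. Orthogonal maps
  act on cones as on their bases, so measuring areas by volumes of cones carries the orthogonal
  invariance of Lebesgue measure over to the sphere.\<close>

definition sph_cone :: "(real^3) set \<Rightarrow> (real^3) set" where
  "sph_cone A = {x. x \<noteq> 0 \<and> norm x < 1 \<and> (1 / norm x) *\<^sub>R x \<in> A}"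

text \<open>Radius, longitude and latitude are packed into one vector so that the map goes from
  \<open>real^3\<close> to itself, as the change of variables requires.\<close>

definition polar3 :: "real^3 \<Rightarrow> real^3" where
  "polar3 v = (v $ 1) *\<^sub>R sph_coord (v $ 2, v $ 3)"

lemma polar3_nth: "polar3 v $ 1 = v$1 * (cos (v$3) * cos (v$2))"
  "polar3 v $ 2 = v$1 * (cos (v$3) * sin (v$2))" "polar3 v $ 3 = v$1 * sin (v$3)"
  by (simp_all add: polar3_def sph_coord_nth)

definition polar3_deriv :: "real^3 \<Rightarrow> real^3 \<Rightarrow> real^3" where
  "polar3_deriv v h = vector [h$1 * (cos (v$3) * cos (v$2)) - v$1 * (sin (v$3) * h$3 * cos (v$2)) - v$1 * (cos (v$3) * (sin (v$2) * h$2)),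
    h$1 * (cos (v$3) * sin (v$2)) - v$1 * (sin (v$3) * h$3 * sin (v$2)) + v$1 * (cos (v$3) * (cos (v$2) * h$2)),
    h$1 * sin (v$3) + v$1 * (cos (v$3) * h$3)]"

lemma has_derivative_polar3: "(polar3 has_derivative polar3_deriv v) (at v within S)"
  unfolding has_derivative_componentwise_within[of polar3] Basis_real3
  by (auto simp: inner_axis polar3_nth polar3_deriv_def
      intro!: derivative_eq_intros bounded_linear_imp_has_derivative[OF bounded_linear_vec_nth]) (auto simp: algebra_simps)

lemma det_polar3: "det (matrix (polar3_deriv v)) = (v$1)\<^sup>2 * cos (v$3)"
proof -
  have *: "det (matrix (polar3_deriv v)) = (v$1)\<^sup>2 * cos (v$3) * (((cos (v$3))\<^sup>2 + (sin (v$3))\<^sup>2) * ((cos (v$2))\<^sup>2 + (sin (v$2))\<^sup>2))"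
    unfolding matrix_def polar3_deriv_def det_3
    by (simp del: sin_cos_squared_add sin_cos_squared_add2 sin_cos_squared_add3 add: axis_def)
       (simp del: sin_cos_squared_add sin_cos_squared_add2 sin_cos_squared_add3 add: power2_eq_square algebra_simps)
  show ?thesis unfolding * by simp
qed

text \<open>The strict inequalities cut away the poles and the meridian of longitude
  \<open>pi\<close>, where the chart fails to be injective; what is lost lies in the plane
  \<open>x $ 2 = 0\<close>.\<close>

definition polar_dom :: "(real^3) set" where
  "polar_dom = {v. 0 < v$1 \<and> v$1 < 1 \<and> \<bar>v$2\<bar> < pi \<and> \<bar>v$3\<bar> < pi / 2}"

lemma inj_on_polar3: "inj_on polar3 polar_dom"
proof (rule inj_onI)
  fix v w assume v: "v \<in> polar_dom" and w: "w \<in> polar_dom" and eq: "polar3 v = polar3 w"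
  have "norm (polar3 v) = v$1" "norm (polar3 w) = w$1"
    using v w by (auto simp: polar3_def norm_sph_coord polar_dom_def)
  then have 1: "v$1 = w$1" using eq by simp
  then have e: "sph_coord (v$2, v$3) = sph_coord (w$2, w$3)"
    using eq v by (simp add: polar3_def polar_dom_def)
  have "sin (v$3) = sin (w$3)" using arg_cong[OF e, of "\<lambda>x. x$3"] by (simp add: sph_coord_nth)
  then have 3: "v$3 = w$3" using v w sin_inj_pi[of "v$3" "w$3"] by (auto simp: polar_dom_def)
  have "-(pi/2) < w$3" "w$3 < pi/2" using w by (auto simp: polar_dom_def abs_less_iff)
  then have "cos (w$3) \<noteq> 0" using cos_gt_zero_pi[of "w$3"] by auto
  then have c: "cos (v$2) = cos (w$2)" "sin (v$2) = sin (w$2)"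
    using arg_cong[OF e, of "\<lambda>x. x$1"] arg_cong[OF e, of "\<lambda>x. x$2"] by (auto simp: sph_coord_nth 3)
  then have "cis (v$2) = cis (w$2)" by (simp add: cis.code)
  moreover have "Arg (cis (v$2)) = v$2" "Arg (cis (w$2)) = w$2"
    using v w by (auto simp: polar_dom_def intro!: Arg_cis)
  ultimately have 2: "v$2 = w$2" by metis
  show "v = w" using 1 2 3 by (simp add: vec_eq_iff forall_3)
qed

lemma sph_coord_surj:
  assumes "x \<in> S2"
  obtains \<phi> \<theta> where "sph_coord (\<phi>, \<theta>) = x" "-pi < \<phi>" "\<phi> \<le> pi" "\<bar>\<theta>\<bar> \<le> pi/2"
proof -
  have n: "(x$1)\<^sup>2 + (x$2)\<^sup>2 + (x$3)\<^sup>2 = 1"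
    using assms by (simp add: S2_def norm_eq_1 inner_vec_def sum_3 power2_eq_square)
  define \<theta> where "\<theta> = arcsin (x$3)"
  define z where "z = Complex (x$1) (x$2)"
  have x3: "-1 \<le> x$3" "x$3 \<le> 1"
  proof -
    have "(x$3)\<^sup>2 \<le> 1" using n zero_le_power2[of "x$1"] zero_le_power2[of "x$2"] by linarith
    then have "\<bar>x$3\<bar> \<le> 1" by (simp add: abs_square_le_1)
    then show "-1 \<le> x$3" "x$3 \<le> 1" by auto
  qed
  have s: "sin \<theta> = x$3" "\<bar>\<theta>\<bar> \<le> pi/2"
    using arcsin[of "x$3"] x3 by (auto simp: \<theta>_def)
  have c: "cos \<theta> = sqrt (1 - (x$3)\<^sup>2)" using cos_arcsin x3 by (simp add: \<theta>_def)
  have "cmod z = cos \<theta>" unfolding c cmod_def z_def using n by (simp add: algebra_simps)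
  then have z: "z = of_real (cos \<theta>) * cis (Arg z)"
    by (metis rcis_cmod_Arg rcis_def)
  have "x$1 = cos \<theta> * cos (Arg z)" "x$2 = cos \<theta> * sin (Arg z)"
    using arg_cong[OF z, of Re] arg_cong[OF z, of Im] by (auto simp: z_def)
  then have "sph_coord (Arg z, \<theta>) = x"
    using s by (simp add: vec_eq_iff forall_3 sph_coord_nth)
  then show ?thesis using that s Arg_bounded[of z] by blast
qed

lemma polar3_image:
  assumes "A \<subseteq> S2"
  shows "polar3 ` (polar_dom \<inter> {v. sph_coord (v$2, v$3) \<in> A}) \<subseteq> sph_cone A"
    and "sph_cone A \<subseteq> polar3 ` (polar_dom \<inter> {v. sph_coord (v$2, v$3) \<in> A}) \<union> {x. x $ 2 = 0}"
proof -
  show "polar3 ` (polar_dom \<inter> {v. sph_coord (v$2, v$3) \<in> A}) \<subseteq> sph_cone A"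
  proof clarsimp
    fix v assume v: "v \<in> polar_dom" "sph_coord (v$2, v$3) \<in> A"
    then have "norm (polar3 v) = v$1" by (simp add: polar3_def norm_sph_coord polar_dom_def)
    then show "polar3 v \<in> sph_cone A" using v by (auto simp: sph_cone_def polar3_def polar_dom_def)
  qed
  show "sph_cone A \<subseteq> polar3 ` (polar_dom \<inter> {v. sph_coord (v$2, v$3) \<in> A}) \<union> {x. x $ 2 = 0}"
  proof
    fix x assume x: "x \<in> sph_cone A"
    define y where "y = (1 / norm x) *\<^sub>R x"
    have y: "y \<in> A" "y \<in> S2" using x assms by (auto simp: sph_cone_def y_def)
    obtain \<phi> \<theta> where p: "sph_coord (\<phi>, \<theta>) = y" "-pi < \<phi>" "\<phi> \<le> pi" "\<bar>\<theta>\<bar> \<le> pi/2"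
      using sph_coord_surj[OF y(2)] by blast
    show "x \<in> polar3 ` (polar_dom \<inter> {v. sph_coord (v$2, v$3) \<in> A}) \<union> {x. x $ 2 = 0}"
    proof (cases "x$2 = 0")
      case False
      then have "y$2 \<noteq> 0" using x by (auto simp: y_def sph_cone_def)
      then have ne: "cos \<theta> \<noteq> 0" "sin \<phi> \<noteq> 0" using arg_cong[OF p(1), of "\<lambda>x. x$2"] by (auto simp: sph_coord_nth)
      have "\<bar>\<theta>\<bar> \<noteq> pi/2"
      proof
        assume "\<bar>\<theta>\<bar> = pi/2"
        then have "\<theta> = pi/2 \<or> \<theta> = -(pi/2)" by linarith
        then show False using ne(1) by (metis cos_minus cos_pi_half)
      qed
      moreover have "\<phi> \<noteq> pi" using ne(2) by auto
      ultimately have v: "vector [norm x, \<phi>, \<theta>] \<in> polar_dom"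
        using p x by (auto simp: polar_dom_def sph_cone_def)
      have "polar3 (vector [norm x, \<phi>, \<theta>]) = x" using x p by (simp add: polar3_def y_def sph_cone_def)
      then show ?thesis using v p y by (auto intro!: image_eqI[of _ _ "vector [norm x, \<phi>, \<theta>]"])
    qed auto
  qed
qed

lemma AE_lborel_fst_neq: "AE p in lborel. fst (p::real\<times>real) \<noteq> c" "AE p in lborel. snd (p::real\<times>real) \<noteq> c"
proof -
  have n: "{c} \<times> (UNIV::real set) \<in> null_sets lborel" "(UNIV::real set) \<times> {c} \<in> null_sets lborel"
    by (auto simp: null_sets_def emeasure_lborel_Times borel_Times)
  show "AE p in lborel. fst (p::real\<times>real) \<noteq> c" using AE_not_in[OF n(1)] by eventually_elim auto
  show "AE p in lborel. snd (p::real\<times>real) \<noteq> c" using AE_not_in[OF n(2)] by eventually_elim auto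
qed

lemma measurable_sph_coord_borel: "sph_coord \<in> measurable borel (restrict_space borel S2)"
  using borel_measurable_continuous_onI[OF continuous_sph_coord]
  by (intro measurable_restrict_space2) (auto simp: sph_coord_S2)

lemma finite_measure_sph: "finite_measure sph_measure"
proof
  have "emeasure sph_measure (space sph_measure) = (\<integral>\<^sup>+x. 1 \<partial>sph_measure)" by simp
  also have "\<dots> = (\<integral>\<^sup>+p. indicator coord_domain p * (ennreal (cos (snd p)) * 1) \<partial>lborel)"
    by (rule nn_integral_sph) simp
  also have "\<dots> \<le> (\<integral>\<^sup>+p. indicator (cbox (-pi, -pi) (pi, pi)) p \<partial>lborel)"
    by (rule nn_integral_mono)
       (auto simp: coord_domain_def indicator_def cbox_Pair_iff ennreal_le_1 split: prod.splits)
  also have "\<dots> < \<infinity>" using emeasure_lborel_cbox_finite[of "(-pi, -pi)" "(pi, pi)"] by simp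
  finally show "emeasure sph_measure (space sph_measure) \<noteq> \<infinity>" by simp
qed

interpretation sph: finite_measure sph_measure by (rule finite_measure_sph)

text \<open>The Jacobian of polar coordinates is \<open>a^2 * cos \<theta>\<close>: its angular part
  is the density that defines \<open>sph_measure\<close>, and its radial part integrates to 1/3 over
  the unit interval.\<close>

lemma measure_sph_cone:
  assumes A: "A \<in> sets sph_measure"
  shows "sph_cone A \<in> lmeasurable" "measure lebesgue (sph_cone A) = measure sph_measure A / 3"
proof -
  have A2: "A \<subseteq> S2" using sets.sets_into_space[OF A] by simp
  have A': "A \<in> sets (restrict_space borel S2)" using A by simp
  let ?I = "\<lambda>p. indicator A (sph_coord p) :: real"
  have mI [measurable]: "(\<lambda>p. ?I p) \<in> borel_measurable borel"
    by (rule measurable_compose[OF measurable_sph_coord_borel borel_measurable_indicator[OF A']])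
  let ?T = "polar_dom \<inter> {v. sph_coord (v$2, v$3) \<in> A}"
  \<comment> \<open>\<open>?F\<close> is the Jacobian on the chart domain, written as a radial
    factor times an angular factor so that the iterated integral separates. The open rectangle
    differs from \<open>coord_domain\<close> by a null set.\<close>
  let ?F = "\<lambda>v::real^3. indicator {0<..<1} (v$1) * (v$1)\<^sup>2 * (indicator ({-pi<..<pi} \<times> {-(pi/2)<..<pi/2}) (v$2, v$3) * (cos (v$3) * ?I (v$2, v$3)))"
  have Fi: "?F v = indicator ?T v * \<bar>det (matrix (polar3_deriv v))\<bar>" for v
    using cos_gt_zero_pi[of "v$3"]
    by (auto simp: det_polar3 polar_dom_def indicator_def abs_mult abs_less_iff)
  have Fnn: "0 \<le> ?F v" for v unfolding Fi by simp
  have mp [measurable]: "(\<lambda>v::real^3. (v$2, v$3)) \<in> borel_measurable borel"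
    by (intro borel_measurable_continuous_onI continuous_intros)
  have mF [measurable]: "?F \<in> borel_measurable borel"
  proof -
    have m: "(\<lambda>v::real^3. v$i) \<in> borel_measurable borel" for i
      by (intro borel_measurable_continuous_onI continuous_intros)
    have R: "({-pi<..<pi} \<times> {-(pi/2)<..<pi/2}) \<in> sets borel" by (intro borel_Times) auto
    have 1: "(\<lambda>v::real^3. indicator {0<..<1} (v$1) :: real) \<in> borel_measurable borel"
      by (rule measurable_compose[OF m borel_measurable_indicator]) simp
    have 2: "(\<lambda>v::real^3. indicator ({-pi<..<pi} \<times> {-(pi/2)<..<pi/2}) (v$2, v$3) :: real) \<in> borel_measurable borel"
      by (rule measurable_compose[OF mp borel_measurable_indicator]) (rule R)
    have 3: "(\<lambda>v::real^3. cos (v$3)) \<in> borel_measurable borel"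
      by (intro borel_measurable_continuous_onI continuous_intros)
    show ?thesis
      by (intro borel_measurable_times borel_measurable_power 1 2 3 m measurable_compose[OF mp mI])
  qed
  have mcos: "(\<lambda>p::real\<times>real. ennreal (cos (snd p))) \<in> borel_measurable borel"
    by (intro measurable_compose[OF _ measurable_ennreal] borel_measurable_continuous_onI continuous_intros)
  have in1: "(\<integral>\<^sup>+p. indicator ({-pi<..<pi} \<times> {-(pi/2)<..<pi/2}) p * (ennreal (cos (snd p)) * ennreal (?I p)) \<partial>lborel)
     = emeasure sph_measure A"
  proof -
    have "emeasure sph_measure A = (\<integral>\<^sup>+x. indicator A x \<partial>sph_measure)" using A by simp
    also have "\<dots> = (\<integral>\<^sup>+p. indicator coord_domain p * (ennreal (cos (snd p)) * indicator A (sph_coord p)) \<partial>lborel)"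
      by (rule nn_integral_sph) (rule borel_measurable_indicator[OF A])
    also have "\<dots> = (\<integral>\<^sup>+p. indicator ({-pi<..<pi} \<times> {-(pi/2)<..<pi/2}) p * (ennreal (cos (snd p)) * ennreal (?I p)) \<partial>lborel)"
      using AE_lborel_fst_neq(1)[of "-pi"] AE_lborel_fst_neq(2)[of "pi/2"] AE_lborel_fst_neq(2)[of "-(pi/2)"]
      by (intro nn_integral_cong_AE, eventually_elim)
         (auto simp: coord_domain_def indicator_def split: prod.splits)
    finally show ?thesis by simp
  qed
  have in2: "(\<integral>\<^sup>+a. ennreal (indicator {0<..<1::real} a * a\<^sup>2) \<partial>lborel) = ennreal (1/3)"
  proof -
    have "(\<integral>\<^sup>+a. ennreal (indicator {0<..<1::real} a * a\<^sup>2) \<partial>lborel) = (\<integral>\<^sup>+a. ennreal (a\<^sup>2) * indicator {0..1::real} a \<partial>lborel)"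
      using AE_lborel_singleton[of "0::real"] AE_lborel_singleton[of "1::real"]
      by (intro nn_integral_cong_AE, eventually_elim) (auto simp: indicator_def)
    also have "\<dots> = ennreal (1^3/3 - 0^3/3)"
      by (rule nn_integral_FTC_Icc) (auto intro!: derivative_eq_intros)
    finally show ?thesis by simp
  qed
  have "(\<integral>\<^sup>+v. ennreal (?F v) \<partial>lborel) = (\<integral>\<^sup>+a. \<integral>\<^sup>+p. ennreal (?F (vector [a, fst p, snd p])) \<partial>lborel \<partial>lborel)"
    by (rule nn_integral_lborel_vec3) simp
  also have "\<dots> = (\<integral>\<^sup>+a. \<integral>\<^sup>+p. ennreal (indicator {0<..<1} a * a\<^sup>2) *
      (indicator ({-pi<..<pi} \<times> {-(pi/2)<..<pi/2}) p * (ennreal (cos (snd p)) * ennreal (?I p))) \<partial>lborel \<partial>lborel)"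
    by (intro nn_integral_cong) (auto simp: indicator_def ennreal_mult')
  also have "\<dots> = (\<integral>\<^sup>+a. ennreal (indicator {0<..<1} a * a\<^sup>2) * emeasure sph_measure A \<partial>lborel)"
    unfolding in1[symmetric]
    by (intro nn_integral_cong nn_integral_cmult borel_measurable_times_ennreal)
       (auto intro!: borel_measurable_indicator borel_Times mcos)
  also have "\<dots> = ennreal (1/3) * emeasure sph_measure A"
    by (subst nn_integral_multc) (simp_all add: in2)
  also have "\<dots> = ennreal (measure sph_measure A / 3)"
    by (simp add: sph.emeasure_eq_measure ennreal_mult[symmetric])
  finally have "(?F has_integral (measure sph_measure A / 3)) UNIV"
    by (intro nn_integral_has_integral mF Fnn) auto
  then have "((\<lambda>v. if v \<in> ?T then \<bar>det (matrix (polar3_deriv v))\<bar> else 0) has_integral (measure sph_measure A / 3)) UNIV"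
    unfolding Fi by (rule has_integral_eq[rotated]) (auto simp: indicator_def)
  then have hi: "((\<lambda>v. \<bar>det (matrix (polar3_deriv v))\<bar>) has_integral (measure sph_measure A / 3)) ?T"
    by (simp only: has_integral_restrict_UNIV)
  have Tm: "?T \<in> sets lebesgue"
  proof -
    have "{v::real^3. sph_coord (v$2, v$3) \<in> A} = (\<lambda>v. sph_coord (v$2, v$3)) -` A \<inter> space borel" by auto
    also have "\<dots> \<in> sets borel"
      using measurable_sets[OF measurable_compose[OF mp measurable_sph_coord_borel] A'] by simp
    finally have 1: "{v::real^3. sph_coord (v$2, v$3) \<in> A} \<in> sets borel" .
    have "open polar_dom" unfolding polar_dom_def
      by (intro open_Collect_conj open_Collect_less continuous_intros)
    with 1 have "?T \<in> sets borel" by auto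
    then show ?thesis by simp
  qed
  have im: "polar3 ` ?T \<in> lmeasurable \<and> measure lebesgue (polar3 ` ?T) = measure sph_measure A / 3"
    using has_measure_differentiable_image[OF Tm has_derivative_polar3 inj_on_subset[OF inj_on_polar3]] hi by blast
  have neg: "negligible {x::real^3. x$2 = 0}"
    by (rule negligible_standard_hyperplane_cart)
  have "negligible ((polar3 ` ?T - sph_cone A) \<union> (sph_cone A - polar3 ` ?T))"
    by (rule negligible_subset[OF neg]) (use polar3_image[OF A2] in blast)
  with im show "sph_cone A \<in> lmeasurable" "measure lebesgue (sph_cone A) = measure sph_measure A / 3"
    using lmeasurable_negligible_symdiff[of "polar3 ` ?T" "sph_cone A"] measure_negligible_symdiff[of "polar3 ` ?T" "sph_cone A"]
    by auto
qed

section \<open>Orthogonal invariance and radial integrals\<close>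

text \<open>In the coordinates defining the measure only symmetries respecting the third axis are
  visible. But an orthogonal map carries the cone over a preimage onto the cone over the set and
  preserves volume, so the areas agree as well.\<close>

lemma measure_sph_orthogonal:
  fixes f :: "real^3 \<Rightarrow> real^3"
  assumes f: "orthogonal_transformation f"
  shows measurable_sph_orthogonal: "f \<in> measurable sph_measure sph_measure"
    and distr_sph_orthogonal: "distr sph_measure sph_measure f = sph_measure"
proof -
  have nf: "norm (f x) = norm x" for x using f by (simp add: orthogonal_transformation)
  have cont: "continuous_on UNIV f"
    using f by (intro linear_continuous_on) (simp add: orthogonal_transformation_linear linear_conv_bounded_linear[symmetric])
  have "f \<in> measurable (restrict_space borel S2) (restrict_space borel S2)"
    using borel_measurable_continuous_onI[OF cont]
    by (intro measurable_restrict_space2 measurable_restrict_space1) (auto simp: S2_def nf space_restrict_space)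
  then show m [measurable]: "f \<in> measurable sph_measure sph_measure"
    using measurable_cong_sets[OF sets_sph_measure sets_sph_measure] by blast
  show "distr sph_measure sph_measure f = sph_measure"
  proof (rule measure_eqI)
    fix A assume "A \<in> sets (distr sph_measure sph_measure f)"
    then have A: "A \<in> sets sph_measure" by simp
    define B where "B = f -` A \<inter> space sph_measure"
    have B: "B \<in> sets sph_measure" unfolding B_def by (rule measurable_sets[OF m A])
    have sc: "f (c *\<^sub>R x) = c *\<^sub>R f x" for c x
      using f by (simp add: orthogonal_transformation_linear linear_scale)
    have f0: "f x = 0 \<longleftrightarrow> x = 0" for x using nf[of x] by (metis norm_eq_zero)
    have "sph_cone A = f ` sph_cone B"
    proof (intro equalityI subsetI)
      fix x assume x: "x \<in> sph_cone A"
      obtain y where y: "x = f y" using orthogonal_transformation_surj[OF f] by (metis surjD)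
      have "y \<in> sph_cone B" using x unfolding y
        by (auto simp: sph_cone_def B_def nf sc S2_def f0)
      then show "x \<in> f ` sph_cone B" using y by blast
    next
      fix x assume "x \<in> f ` sph_cone B"
      then show "x \<in> sph_cone A" by (auto simp: sph_cone_def B_def nf sc f0)
    qed
    then have "measure lebesgue (sph_cone A) = measure lebesgue (sph_cone B)"
      by (simp add: measure_orthogonal_image[OF f measure_sph_cone(1)[OF B]])
    then have "measure sph_measure A = measure sph_measure B"
      using measure_sph_cone(2)[OF A] measure_sph_cone(2)[OF B] by simp
    then show "emeasure (distr sph_measure sph_measure f) A = emeasure sph_measure A"
      unfolding emeasure_distr[OF m A] B_def[symmetric] sph.emeasure_eq_measure by simp
  qed simp
qed

lemma nn_integral_sph_orthogonal:
  fixes f :: "real^3 \<Rightarrow> real^3"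
  assumes f: "orthogonal_transformation f" and g: "g \<in> borel_measurable sph_measure"
  shows "(\<integral>\<^sup>+x. g (f x) \<partial>sph_measure) = (\<integral>\<^sup>+x. g x \<partial>sph_measure)"
  using nn_integral_distr[OF measurable_sph_orthogonal[OF f], of g] g by (simp add: distr_sph_orthogonal[OF f])

lemma integral_sph_orthogonal:
  fixes f :: "real^3 \<Rightarrow> real^3" and g :: "real^3 \<Rightarrow> 'b::{banach, second_countable_topology}"
  assumes f: "orthogonal_transformation f" and g: "g \<in> borel_measurable sph_measure"
  shows "(\<integral>x. g (f x) \<partial>sph_measure) = (\<integral>x. g x \<partial>sph_measure)"
  using integral_distr[OF measurable_sph_orthogonal[OF f], of g] g by (simp add: distr_sph_orthogonal[OF f])

lemma AE_sph_preserving: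
  assumes f: "f \<in> measurable sph_measure sph_measure" "distr sph_measure sph_measure f = sph_measure"
    and P: "AE x in sph_measure. P x"
  shows "AE x in sph_measure. P (f x)"
proof -
  have "AE x in distr sph_measure sph_measure f. P x" unfolding f(2) by (rule P)
  then show ?thesis by (rule AE_distrD[OF f(1)])
qed

text \<open>\<open>m\<close> is a base point on the sphere and \<open>e\<close>, \<open>n\<close>
  span its tangent plane; the triple carries no orientation.\<close>

definition frame3 :: "real^3 \<Rightarrow> real^3 \<Rightarrow> real^3 \<Rightarrow> bool" where
  "frame3 e n m \<longleftrightarrow> norm e = 1 \<and> norm n = 1 \<and> norm m = 1 \<and> e \<bullet> n = 0 \<and> e \<bullet> m = 0 \<and> n \<bullet> m = 0"

text \<open>Moving \<open>m\<close> to the north pole makes latitude a function of the distance to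
  \<open>m\<close> alone, and turns \<open>z \<bullet> e\<close>, \<open>z \<bullet> n\<close> into
  the two horizontal coordinates.\<close>

lemma orthogonal_transformation_frame3:
  assumes "frame3 e n m"
  shows "orthogonal_transformation (\<lambda>z. vector [z \<bullet> e, z \<bullet> n, z \<bullet> m] :: real^3)"
proof -
  let ?A = "vector [e, n, m] :: real^3^3"
  have "orthogonal_matrix ?A"
    using assms unfolding orthogonal_matrix_orthonormal_rows frame3_def
    by (auto simp: row_def orthogonal_def forall_3 vec_nth_inverse inner_commute)
  then have "orthogonal_transformation (\<lambda>z. ?A *v z)"
    by (simp add: orthogonal_transformation_matrix)
  moreover have "?A *v z = vector [z \<bullet> e, z \<bullet> n, z \<bullet> m]" for z
    by (simp add: vec_eq_iff forall_3 matrix_vector_mul_component inner_commute)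
  ultimately show ?thesis by simp
qed

lemma nn_integral_sph_iter:
  assumes f: "f \<in> borel_measurable sph_measure"
  shows "(\<integral>\<^sup>+x. f x \<partial>sph_measure) =
    (\<integral>\<^sup>+\<theta>. ennreal (cos \<theta>) * indicator {-(pi/2)..pi/2} \<theta> * (\<integral>\<^sup>+\<phi>. f (sph_coord (\<phi>, \<theta>)) * indicator {-pi..pi} \<phi> \<partial>lborel) \<partial>lborel)"
proof -
  have f': "f \<in> borel_measurable (restrict_space borel S2)"
    using f by (simp add: borel_measurable_sph_iff)
  have mf [measurable]: "(\<lambda>p. f (sph_coord p)) \<in> borel_measurable borel"
    using measurable_compose[OF measurable_sph_coord_borel f'] .
  let ?g = "\<lambda>p. (ennreal (cos (snd p)) * indicator {-(pi/2)..pi/2} (snd p)) * (f (sph_coord p) * indicator {-pi..pi} (fst p))"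
  have mg: "?g \<in> borel_measurable (lborel \<Otimes>\<^sub>M lborel)"
  proof -
    have "?g \<in> borel_measurable borel"
    proof (intro borel_measurable_times_ennreal mf)
      show "(\<lambda>p::real\<times>real. ennreal (cos (snd p))) \<in> borel_measurable borel"
        by (intro measurable_compose[OF _ measurable_ennreal] borel_measurable_continuous_onI continuous_intros)
      show "(\<lambda>p::real\<times>real. indicator {-(pi/2)..pi/2} (snd p) :: ennreal) \<in> borel_measurable borel"
        by (rule measurable_compose[OF borel_measurable_continuous_onI[OF continuous_on_snd[OF continuous_on_id]] borel_measurable_indicator]) simp
      show "(\<lambda>p::real\<times>real. indicator {-pi..pi} (fst p) :: ennreal) \<in> borel_measurable borel"
        by (rule measurable_compose[OF borel_measurable_continuous_onI[OF continuous_on_fst[OF continuous_on_id]] borel_measurable_indicator]) simp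
    qed
    then show ?thesis by (simp add: lborel_prod)
  qed
  have "(\<integral>\<^sup>+x. f x \<partial>sph_measure) = (\<integral>\<^sup>+p. indicator coord_domain p * (ennreal (cos (snd p)) * f (sph_coord p)) \<partial>lborel)"
    by (rule nn_integral_sph[OF f])
  also have "\<dots> = (\<integral>\<^sup>+p. ?g p \<partial>lborel)"
    using AE_lborel_fst_neq(1)[of "pi"]
    by (intro nn_integral_cong_AE, eventually_elim)
       (auto simp: coord_domain_def indicator_def split: prod.splits)
  also have "\<dots> = (\<integral>\<^sup>+p. ?g p \<partial>(lborel \<Otimes>\<^sub>M lborel))" by (simp add: lborel_prod)
  also have "\<dots> = (\<integral>\<^sup>+\<theta>. \<integral>\<^sup>+\<phi>. ?g (\<phi>, \<theta>) \<partial>lborel \<partial>lborel)"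
    by (rule lborel_pair.nn_integral_snd[symmetric]) (use mg in \<open>simp add: case_prod_beta\<close>)
  also have "\<dots> = (\<integral>\<^sup>+\<theta>. ennreal (cos \<theta>) * indicator {-(pi/2)..pi/2} \<theta> * (\<integral>\<^sup>+\<phi>. f (sph_coord (\<phi>, \<theta>)) * indicator {-pi..pi} \<phi> \<partial>lborel) \<partial>lborel)"
  proof (intro nn_integral_cong)
    fix \<theta> :: real
    have "(\<lambda>\<phi>. (\<phi>, \<theta>)) \<in> borel_measurable borel"
      by (intro borel_measurable_continuous_onI continuous_intros)
    from measurable_compose[OF this mf]
    have [measurable]: "(\<lambda>\<phi>. f (sph_coord (\<phi>, \<theta>))) \<in> borel_measurable borel" .
    show "(\<integral>\<^sup>+\<phi>. ?g (\<phi>, \<theta>) \<partial>lborel) = ennreal (cos \<theta>) * indicator {-(pi/2)..pi/2} \<theta> * (\<integral>\<^sup>+\<phi>. f (sph_coord (\<phi>, \<theta>)) * indicator {-pi..pi} \<phi> \<partial>lborel)"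
      by (simp add: nn_integral_cmult)
  qed
  finally show ?thesis .
qed

lemma frame3_exists:
  assumes "norm (m::real^3) = 1" obtains e n where "frame3 e n m"
proof -
  obtain y :: "real^3" where y: "y \<noteq> 0" "orthogonal m y"
    using orthogonal_to_vector_exists[of m] by auto
  define e where "e = (1 / norm y) *\<^sub>R y"
  have e: "norm e = 1" "orthogonal m e" using y by (auto simp: e_def orthogonal_def)
  have "frame3 e (cross3 m e) m"
  proof -
    have me: "m \<bullet> e = 0" using e by (simp add: orthogonal_def)
    have "(norm (cross3 m e))\<^sup>2 = 1" unfolding norm_cross using assms e me by simp
    then have "norm (cross3 m e) = 1" using norm_ge_zero[of "cross3 m e"] unfolding power2_eq_1_iff by linarith
    then show ?thesis using assms e me by (simp add: frame3_def dot_cross_self inner_commute)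
  qed
  then show ?thesis using that by blast
qed

lemma borel_measurable_sphI: "f \<in> borel_measurable borel \<Longrightarrow> f \<in> borel_measurable sph_measure"
  by (simp add: borel_measurable_sph_iff measurable_restrict_space1)

lemma borel_measurable_vec_nth: "(\<lambda>z::real^3. z $ i) \<in> borel_measurable borel"
  by (intro borel_measurable_continuous_onI continuous_intros)

lemma nn_integral_sph_frame3:
  assumes fr: "frame3 e n m" and F: "(\<lambda>z::real^3. F (z$1) (z$2) (z$3)) \<in> borel_measurable borel"
  shows "(\<integral>\<^sup>+z. F (z \<bullet> e) (z \<bullet> n) (z \<bullet> m) \<partial>sph_measure) = (\<integral>\<^sup>+z. F (z$1) (z$2) (z$3) \<partial>sph_measure)"
  using nn_integral_sph_orthogonal[OF orthogonal_transformation_frame3[OF fr] borel_measurable_sphI[OF F]] by simp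

section \<open>Zonal integrals in height and chordal distance\<close>

lemma nn_integral_sin_substitution:
  fixes g :: "real \<Rightarrow> real"
  assumes [measurable]: "g \<in> borel_measurable borel"
  shows "(\<integral>\<^sup>+\<theta>. ennreal (g (sin \<theta>) * cos \<theta> * indicator {-(pi/2)..pi/2} \<theta>) \<partial>lborel) = (\<integral>\<^sup>+s. ennreal (g s) * indicator {-1..1} s \<partial>lborel)"
proof -
  have "(\<integral>\<^sup>+\<theta>. ennreal (g (sin \<theta>) * cos \<theta> * indicator {-(pi/2)..pi/2} \<theta>) \<partial>lborel) =
      (\<integral>\<^sup>+s. ennreal (g s * indicator {sin (-(pi/2))..sin (pi/2)} s) \<partial>lborel)"
    by (rule nn_integral_substitution[symmetric])
       (auto simp: set_borel_measurable_def cos_ge_zero intro!: derivative_eq_intros continuous_intros)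
  also have "\<dots> = (\<integral>\<^sup>+s. ennreal (g s) * indicator {-1..1} s \<partial>lborel)"
    by (intro nn_integral_cong) (auto simp: indicator_def)
  finally show ?thesis .
qed

text \<open>Archimedes: area projects to \<open>2 * pi\<close> times length on the axis, because the
  factor \<open>cos \<theta>\<close> of the area element is the derivative of the height
  \<open>sin \<theta>\<close>.\<close>

lemma nn_integral_sph_latitude:
  fixes g :: "real \<Rightarrow> real"
  assumes [measurable]: "g \<in> borel_measurable borel"
  shows "(\<integral>\<^sup>+z. ennreal (g (z $ 3)) \<partial>sph_measure) = ennreal (2 * pi) * (\<integral>\<^sup>+s. ennreal (g s) * indicator {-1..1} s \<partial>lborel)"
proof -
  have "(\<integral>\<^sup>+z. ennreal (g (z $ 3)) \<partial>sph_measure) =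
    (\<integral>\<^sup>+\<theta>. ennreal (cos \<theta>) * indicator {-(pi/2)..pi/2} \<theta> * (\<integral>\<^sup>+\<phi>. ennreal (g (sph_coord (\<phi>, \<theta>) $ 3)) * indicator {-pi..pi} \<phi> \<partial>lborel) \<partial>lborel)"
    by (intro nn_integral_sph_iter borel_measurable_sphI measurable_compose[OF borel_measurable_vec_nth]) measurable
  also have "\<dots> = (\<integral>\<^sup>+\<theta>. ennreal (2 * pi) * ennreal (g (sin \<theta>) * cos \<theta> * indicator {-(pi/2)..pi/2} \<theta>) \<partial>lborel)"
  proof (intro nn_integral_cong)
    fix \<theta> :: real
    have in1: "(\<integral>\<^sup>+\<phi>. ennreal (g (sph_coord (\<phi>, \<theta>) $ 3)) * indicator {-pi..pi} \<phi> \<partial>lborel) = ennreal (g (sin \<theta>)) * ennreal (2 * pi)"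
      by (simp add: sph_coord_nth nn_integral_cmult_indicator)
    show "ennreal (cos \<theta>) * indicator {-(pi/2)..pi/2} \<theta> * (\<integral>\<^sup>+\<phi>. ennreal (g (sph_coord (\<phi>, \<theta>) $ 3)) * indicator {-pi..pi} \<phi> \<partial>lborel)
      = ennreal (2 * pi) * ennreal (g (sin \<theta>) * cos \<theta> * indicator {-(pi/2)..pi/2} \<theta>)"
      unfolding in1 by (cases "\<theta> \<in> {-(pi/2)..pi/2}") (simp_all add: ennreal_mult' cos_ge_zero mult_ac)
  qed
  also have "\<dots> = ennreal (2 * pi) * (\<integral>\<^sup>+\<theta>. ennreal (g (sin \<theta>) * cos \<theta> * indicator {-(pi/2)..pi/2} \<theta>) \<partial>lborel)"
    by (rule nn_integral_cmult) measurable
  finally show ?thesis by (simp add: nn_integral_sin_substitution)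
qed

lemma norm_sph_diff:
  assumes "x \<in> S2" "y \<in> S2" shows "(norm (x - y))\<^sup>2 = 2 - 2 * (x \<bullet> y)"
  using assms by (simp add: S2_def norm_eq_1 power2_norm_eq_inner inner_diff_left inner_diff_right inner_commute)

text \<open>The chord \<open>r\<close> from the pole to a point at height \<open>s\<close> satisfies
  \<open>r^2 = 2 - 2 * s\<close>, so \<open>ds\<close> becomes \<open>r dr\<close> up to
  orientation. The substitution is made in two pieces, \<open>s = 1 - q\<close> and
  \<open>q = r^2 / 2\<close>.\<close>

lemma nn_integral_latitude_radial:
  fixes h :: "real \<Rightarrow> real"
  assumes [measurable]: "h \<in> borel_measurable borel"
  shows "(\<integral>\<^sup>+s. ennreal (h (sqrt (2 - 2 * s))) * indicator {-1..1} s \<partial>lborel) = (\<integral>\<^sup>+r. ennreal (h r * r) * indicator {0..2} r \<partial>lborel)"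
proof -
  have "(\<integral>\<^sup>+s. ennreal (h (sqrt (2 - 2 * s))) * indicator {-1..1} s \<partial>lborel) =
     ennreal \<bar>-1\<bar> * (\<integral>\<^sup>+q. ennreal (h (sqrt (2 - 2 * (1 + (-1) * q)))) * indicator {-1..1} (1 + (-1) * q) \<partial>lborel)"
    by (rule nn_integral_real_affine) (auto intro!: borel_measurable_times_ennreal measurable_compose[OF _ measurable_ennreal])
  also have "\<dots> = (\<integral>\<^sup>+q. ennreal (h (sqrt (2 * q)) * indicator {0\<^sup>2/2..2\<^sup>2/2} q) \<partial>lborel)"
    by (simp, intro nn_integral_cong) (auto simp: indicator_def)
  also have "\<dots> = (\<integral>\<^sup>+r. ennreal (h (sqrt (2 * (r\<^sup>2/2))) * r * indicator {0..2} r) \<partial>lborel)"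
    by (rule nn_integral_substitution[where g="\<lambda>r. r\<^sup>2/2"]) (auto simp: set_borel_measurable_def intro!: derivative_eq_intros continuous_intros)
  also have "\<dots> = (\<integral>\<^sup>+r. ennreal (h r * r) * indicator {0..2} r \<partial>lborel)"
    by (intro nn_integral_cong) (auto simp: indicator_def)
  finally show ?thesis .
qed

lemma norm_sph_diff_sqrt:
  assumes "x \<in> S2" "y \<in> S2" shows "norm (x - y) = sqrt (2 - 2 * (x \<bullet> y))"
  using norm_sph_diff[OF assms] by (metis norm_ge_zero real_sqrt_abs abs_of_nonneg)

text \<open>In the Euclidean distance the area element of the sphere is exactly
  \<open>2 * pi * r dr\<close>, as in the plane, only cut off at the antipode \<open>r = 2\<close>.
  This is why the kernel estimates use chords and not arcs.\<close>

lemma nn_integral_sph_radial: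
  fixes h :: "real \<Rightarrow> real"
  assumes [measurable]: "h \<in> borel_measurable borel" and m: "m \<in> S2"
  shows "(\<integral>\<^sup>+z. ennreal (h (norm (z - m))) \<partial>sph_measure) = ennreal (2 * pi) * (\<integral>\<^sup>+r. ennreal (h r * r) * indicator {0..2} r \<partial>lborel)"
proof -
  have "norm m = 1" using m by (simp add: S2_def)
  then obtain e n where fr: "frame3 e n m" by (rule frame3_exists)
  have "(\<integral>\<^sup>+z. ennreal (h (norm (z - m))) \<partial>sph_measure) = (\<integral>\<^sup>+z. ennreal (h (sqrt (2 - 2 * (z \<bullet> m)))) \<partial>sph_measure)"
    by (intro nn_integral_cong) (simp add: norm_sph_diff_sqrt m)
  also have "\<dots> = (\<integral>\<^sup>+z. ennreal (h (sqrt (2 - 2 * (z $ 3)))) \<partial>sph_measure)"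
    by (rule nn_integral_sph_frame3[OF fr, where F="\<lambda>a b c. ennreal (h (sqrt (2 - 2 * c)))"])
       (rule measurable_compose[OF borel_measurable_vec_nth], measurable)
  also have "\<dots> = ennreal (2 * pi) * (\<integral>\<^sup>+s. ennreal (h (sqrt (2 - 2 * s))) * indicator {-1..1} s \<partial>lborel)"
    by (rule nn_integral_sph_latitude) measurable
  finally show ?thesis by (simp add: nn_integral_latitude_radial)
qed

text \<open>Differentiability at the kink is the point: it gives a primitive of
  \<open>2 * \<bar>x\<bar>\<close> on the whole line, used for
  \<open>\<bar>cos \<phi> * sin \<phi>\<bar>\<close> across the zeros of the cosine and for the
  squared positive part in the cut-offs below.\<close>

lemma DERIV_abs_square: "((\<lambda>x::real. x * \<bar>x\<bar>) has_real_derivative 2 * \<bar>x\<bar>) (at x)"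
proof (cases "x = 0")
  case True
  have "((\<lambda>h::real. \<bar>h\<bar>) \<longlongrightarrow> 0) (at 0)" by (rule tendsto_rabs_zero) (rule tendsto_ident_at)
  moreover have "\<forall>\<^sub>F h in at (0::real). \<bar>h\<bar> = ((0 + h) * \<bar>0 + h\<bar> - 0 * \<bar>0\<bar>) / h"
    by (auto simp: eventually_at intro!: exI[of _ 1])
  ultimately show ?thesis unfolding True DERIV_def by (auto intro: Lim_transform_eventually)
next
  case False
  then consider "x > 0" | "x < 0" by linarith
  then show ?thesis
  proof cases
    case 1
    have "((\<lambda>x::real. x * x) has_real_derivative 2 * \<bar>x\<bar>) (at x)"
      using 1 by (auto intro!: derivative_eq_intros)
    then show ?thesis
      by (rule has_field_derivative_transform_within_open[where S="{0<..}"]) (use 1 in auto)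
  next
    case 2
    have "((\<lambda>x::real. - (x * x)) has_real_derivative 2 * \<bar>x\<bar>) (at x)"
      using 2 by (auto intro!: derivative_eq_intros)
    then show ?thesis
      by (rule has_field_derivative_transform_within_open[where S="{..<0}"]) (use 2 in auto)
  qed
qed

text \<open>The numerator of the rate \<open>2 / pi\<close>. On each half circle the sine keeps its
  sign, and a primitive is \<open>cos \<phi> * \<bar>cos \<phi>\<bar> / 2\<close> up to
  sign.\<close>

lemma nn_integral_abs_sin_cos: "(\<integral>\<^sup>+\<phi>. ennreal \<bar>cos \<phi> * sin \<phi>\<bar> * indicator {-pi..pi} \<phi> \<partial>lborel) = 2"
proof -
  have 1: "(\<integral>\<^sup>+\<phi>. ennreal \<bar>cos \<phi> * sin \<phi>\<bar> * indicator {0..pi} \<phi> \<partial>lborel) = ennreal ((- (cos pi * \<bar>cos pi\<bar>) / 2) - (- (cos 0 * \<bar>cos 0\<bar>) / 2))"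
  proof (rule nn_integral_FTC_Icc[where F="\<lambda>x. - (cos x * \<bar>cos x\<bar>) / 2"])
    fix x :: real assume "x \<in> {0..pi}" then have x: "0 \<le> x" "x \<le> pi" by auto
    have "((\<lambda>x. - (cos x * \<bar>cos x\<bar>) / 2) has_real_derivative - (2 * \<bar>cos x\<bar> * - sin x) / 2) (at x)"
      by (intro DERIV_cdivide DERIV_minus DERIV_chain2[OF DERIV_abs_square DERIV_cos])
    moreover have "- (2 * \<bar>cos x\<bar> * - sin x) / 2 = \<bar>cos x * sin x\<bar>"
      using x sin_ge_zero[of x] by (simp add: abs_mult)
    ultimately show "((\<lambda>x. - (cos x * \<bar>cos x\<bar>) / 2) has_real_derivative \<bar>cos x * sin x\<bar>) (at x)"
      by metis
  qed auto
  have 2: "(\<integral>\<^sup>+\<phi>. ennreal \<bar>cos \<phi> * sin \<phi>\<bar> * indicator {-pi..0} \<phi> \<partial>lborel) = ennreal (((cos 0 * \<bar>cos 0\<bar>) / 2) - ((cos (-pi) * \<bar>cos (-pi)\<bar>) / 2))"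
  proof (rule nn_integral_FTC_Icc[where F="\<lambda>x. (cos x * \<bar>cos x\<bar>) / 2"])
    fix x :: real assume "x \<in> {-pi..0}" then have x: "-pi \<le> x" "x \<le> 0" by auto
    have "((\<lambda>x. (cos x * \<bar>cos x\<bar>) / 2) has_real_derivative (2 * \<bar>cos x\<bar> * - sin x) / 2) (at x)"
      by (intro DERIV_cdivide DERIV_chain2[OF DERIV_abs_square DERIV_cos])
    moreover have "(2 * \<bar>cos x\<bar> * - sin x) / 2 = \<bar>cos x * sin x\<bar>"
      using x sin_ge_zero[of "-x"] by (simp add: abs_mult)
    ultimately show "((\<lambda>x. (cos x * \<bar>cos x\<bar>) / 2) has_real_derivative \<bar>cos x * sin x\<bar>) (at x)"
      by metis
  qed auto
  have "(\<integral>\<^sup>+\<phi>. ennreal \<bar>cos \<phi> * sin \<phi>\<bar> * indicator {-pi..pi} \<phi> \<partial>lborel) =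
    (\<integral>\<^sup>+\<phi>. ennreal \<bar>cos \<phi> * sin \<phi>\<bar> * indicator {-pi..0} \<phi> + ennreal \<bar>cos \<phi> * sin \<phi>\<bar> * indicator {0..pi} \<phi> \<partial>lborel)"
    using AE_lborel_singleton[of "0::real"]
    by (intro nn_integral_cong_AE, eventually_elim) (auto simp: indicator_def)
  also have "\<dots> = 1 + 1" by (subst nn_integral_add) (auto simp: 1 2)
  finally show ?thesis by simp
qed

text \<open>With \<open>m\<close> at the pole, the product of the horizontal coordinates is
  \<open>(cos \<theta>)^2\<close> times \<open>cos \<phi> * sin \<phi>\<close>. The longitude
  integrates to 2, and \<open>(cos \<theta>)^2 = 1 - s^2\<close> equals
  \<open>r^2 * (1 - r^2 / 4)\<close>, the planar \<open>r^2\<close> with a curvature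
  correction.\<close>

lemma nn_integral_sph_quadrupole:
  fixes h :: "real \<Rightarrow> real"
  assumes [measurable]: "h \<in> borel_measurable borel" and h0: "\<And>r. 0 \<le> h r" and fr: "frame3 e n m"
  shows "(\<integral>\<^sup>+z. ennreal (\<bar>(z \<bullet> e) * (z \<bullet> n)\<bar> * h (norm (z - m))) \<partial>sph_measure) =
    2 * (\<integral>\<^sup>+r. ennreal (r\<^sup>2 * (1 - r\<^sup>2 / 4) * h r * r) * indicator {0..2} r \<partial>lborel)"
proof -
  have m: "m \<in> S2" using fr by (simp add: frame3_def S2_def)
  let ?k = "\<lambda>s. h (sqrt (2 - 2 * s))"
  have mk: "(\<lambda>z::real^3. \<bar>z$1 * z$2\<bar> * ?k (z$3)) \<in> borel_measurable borel"
    by (intro borel_measurable_times borel_measurable_abs borel_measurable_vec_nth measurable_compose[OF borel_measurable_vec_nth[of 3]]) measurable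
  have "(\<integral>\<^sup>+z. ennreal (\<bar>(z \<bullet> e) * (z \<bullet> n)\<bar> * h (norm (z - m))) \<partial>sph_measure) = (\<integral>\<^sup>+z. ennreal (\<bar>(z \<bullet> e) * (z \<bullet> n)\<bar> * ?k (z \<bullet> m)) \<partial>sph_measure)"
    by (intro nn_integral_cong) (simp add: norm_sph_diff_sqrt m)
  also have "\<dots> = (\<integral>\<^sup>+z. ennreal (\<bar>z$1 * z$2\<bar> * ?k (z$3)) \<partial>sph_measure)"
    by (rule nn_integral_sph_frame3[OF fr, where F="\<lambda>a b c. ennreal (\<bar>a * b\<bar> * ?k c)"])
       (rule measurable_compose[OF mk measurable_ennreal])
  also have "\<dots> =
    (\<integral>\<^sup>+\<theta>. ennreal (cos \<theta>) * indicator {-(pi/2)..pi/2} \<theta> * (\<integral>\<^sup>+\<phi>. ennreal (\<bar>sph_coord (\<phi>, \<theta>) $ 1 * sph_coord (\<phi>, \<theta>) $ 2\<bar> * ?k (sph_coord (\<phi>, \<theta>) $ 3)) * indicator {-pi..pi} \<phi> \<partial>lborel) \<partial>lborel)"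
    by (intro nn_integral_sph_iter borel_measurable_sphI) (rule measurable_compose[OF mk measurable_ennreal])
  also have "\<dots> = (\<integral>\<^sup>+\<theta>. 2 * ennreal ((1 - (sin \<theta>)\<^sup>2) * ?k (sin \<theta>) * cos \<theta> * indicator {-(pi/2)..pi/2} \<theta>) \<partial>lborel)"
  proof (intro nn_integral_cong)
    fix \<theta> :: real
    have "(\<integral>\<^sup>+\<phi>. ennreal (\<bar>sph_coord (\<phi>, \<theta>) $ 1 * sph_coord (\<phi>, \<theta>) $ 2\<bar> * ?k (sph_coord (\<phi>, \<theta>) $ 3)) * indicator {-pi..pi} \<phi> \<partial>lborel) =
      (\<integral>\<^sup>+\<phi>. ennreal ((1 - (sin \<theta>)\<^sup>2) * ?k (sin \<theta>)) * (ennreal \<bar>cos \<phi> * sin \<phi>\<bar> * indicator {-pi..pi} \<phi>) \<partial>lborel)"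
    proof (intro nn_integral_cong)
      fix \<phi> :: real
      have "\<bar>sph_coord (\<phi>, \<theta>) $ 1 * sph_coord (\<phi>, \<theta>) $ 2\<bar> = (cos \<theta>)\<^sup>2 * \<bar>cos \<phi> * sin \<phi>\<bar>"
        by (simp add: sph_coord_nth abs_mult power2_eq_square)
      then have eq: "\<bar>sph_coord (\<phi>, \<theta>) $ 1 * sph_coord (\<phi>, \<theta>) $ 2\<bar> * ?k (sph_coord (\<phi>, \<theta>) $ 3) = \<bar>cos \<phi> * sin \<phi>\<bar> * ((1 - (sin \<theta>)\<^sup>2) * ?k (sin \<theta>))"
        unfolding cos_squared_eq sph_coord_nth(3) by simp
      show "ennreal (\<bar>sph_coord (\<phi>, \<theta>) $ 1 * sph_coord (\<phi>, \<theta>) $ 2\<bar> * ?k (sph_coord (\<phi>, \<theta>) $ 3)) * indicator {-pi..pi} \<phi> =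
         ennreal ((1 - (sin \<theta>)\<^sup>2) * ?k (sin \<theta>)) * (ennreal \<bar>cos \<phi> * sin \<phi>\<bar> * indicator {-pi..pi} \<phi>)"
        unfolding eq ennreal_mult'[OF abs_ge_zero] by (simp only: mult_ac)
    qed
    also have "\<dots> = ennreal ((1 - (sin \<theta>)\<^sup>2) * ?k (sin \<theta>)) * 2"
      by (subst nn_integral_cmult) (auto simp: nn_integral_abs_sin_cos)
    finally have in1: "(\<integral>\<^sup>+\<phi>. ennreal (\<bar>sph_coord (\<phi>, \<theta>) $ 1 * sph_coord (\<phi>, \<theta>) $ 2\<bar> * ?k (sph_coord (\<phi>, \<theta>) $ 3)) * indicator {-pi..pi} \<phi> \<partial>lborel)
      = ennreal ((1 - (sin \<theta>)\<^sup>2) * ?k (sin \<theta>)) * 2" .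
    show "ennreal (cos \<theta>) * indicator {-(pi/2)..pi/2} \<theta> * (\<integral>\<^sup>+\<phi>. ennreal (\<bar>sph_coord (\<phi>, \<theta>) $ 1 * sph_coord (\<phi>, \<theta>) $ 2\<bar> * ?k (sph_coord (\<phi>, \<theta>) $ 3)) * indicator {-pi..pi} \<phi> \<partial>lborel)
      = 2 * ennreal ((1 - (sin \<theta>)\<^sup>2) * ?k (sin \<theta>) * cos \<theta> * indicator {-(pi/2)..pi/2} \<theta>)"
      unfolding in1 by (cases "\<theta> \<in> {-(pi/2)..pi/2}") (simp_all add: ennreal_mult' cos_ge_zero mult_ac)
  qed
  also have "\<dots> = 2 * (\<integral>\<^sup>+\<theta>. ennreal ((1 - (sin \<theta>)\<^sup>2) * ?k (sin \<theta>) * cos \<theta> * indicator {-(pi/2)..pi/2} \<theta>) \<partial>lborel)"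
    by (rule nn_integral_cmult) measurable
  also have "(\<integral>\<^sup>+\<theta>. ennreal ((1 - (sin \<theta>)\<^sup>2) * ?k (sin \<theta>) * cos \<theta> * indicator {-(pi/2)..pi/2} \<theta>) \<partial>lborel) =
      (\<integral>\<^sup>+s. ennreal ((1 - s\<^sup>2) * ?k s) * indicator {-1..1} s \<partial>lborel)"
    by (rule nn_integral_sin_substitution) measurable
  also have "\<dots> = (\<integral>\<^sup>+s. ennreal ((sqrt (2 - 2 * s))\<^sup>2 * (1 - (sqrt (2 - 2 * s))\<^sup>2 / 4) * h (sqrt (2 - 2 * s))) * indicator {-1..1} s \<partial>lborel)"
  proof (intro nn_integral_cong)
    fix s :: real
    have "(1 - s\<^sup>2) = (sqrt (2 - 2 * s))\<^sup>2 * (1 - (sqrt (2 - 2 * s))\<^sup>2 / 4)" if "s \<in> {-1..1}"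
      using that by (simp add: power2_eq_square field_simps)
    then show "ennreal ((1 - s\<^sup>2) * ?k s) * indicator {-1..1} s =
        ennreal ((sqrt (2 - 2 * s))\<^sup>2 * (1 - (sqrt (2 - 2 * s))\<^sup>2 / 4) * h (sqrt (2 - 2 * s))) * indicator {-1..1} s"
      by (cases "s \<in> {-1..1}") (simp_all del: real_sqrt_pow2_iff)
  qed
  also have "\<dots> = (\<integral>\<^sup>+r. ennreal (r\<^sup>2 * (1 - r\<^sup>2 / 4) * h r * r) * indicator {0..2} r \<partial>lborel)"
    by (rule nn_integral_latitude_radial[where h="\<lambda>r. r\<^sup>2 * (1 - r\<^sup>2 / 4) * h r"]) measurable
  finally show ?thesis .
qed

section \<open>Kernel integrals over discs, annuli and strips\<close>

lemma nn_integral_inverse_le: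
  assumes "0 < \<rho>" "\<rho> \<le> b"
  shows "(\<integral>\<^sup>+r. ennreal (1 / r) * indicator {\<rho>..b} r \<partial>lborel) = ennreal (ln (b / \<rho>))"
proof -
  have "(\<integral>\<^sup>+r. ennreal (1 / r) * indicator {\<rho>..b} r \<partial>lborel) = ennreal (ln b - ln \<rho>)"
    by (rule nn_integral_FTC_Icc) (use assms in \<open>auto intro!: derivative_eq_intros\<close>)
  then show ?thesis using assms by (simp add: ln_div)
qed

lemma nn_integral_sph_inverse_near:
  assumes a: "a \<in> S2" and r: "0 \<le> \<rho>"
  shows "(\<integral>\<^sup>+z. ennreal (indicator {..<\<rho>} (norm (z - a)) / norm (z - a)) \<partial>sph_measure) \<le> ennreal (2 * pi * \<rho>)"
proof -
  have "(\<integral>\<^sup>+z. ennreal (indicator {..<\<rho>} (norm (z - a)) / norm (z - a)) \<partial>sph_measure)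
     = ennreal (2 * pi) * (\<integral>\<^sup>+r. ennreal (indicator {..<\<rho>} r / r * r) * indicator {0..2} r \<partial>lborel)"
    by (rule nn_integral_sph_radial[OF _ a]) measurable
  also have "\<dots> \<le> ennreal (2 * pi) * (\<integral>\<^sup>+r. indicator {0..\<rho>} r \<partial>lborel)"
    by (intro mult_left_mono nn_integral_mono) (auto simp: indicator_def)
  also have "\<dots> = ennreal (2 * pi * \<rho>)" using r by (simp add: ennreal_mult)
  finally show ?thesis .
qed

lemma nn_integral_sph_inverse_square_far:
  assumes a: "a \<in> S2" and r: "0 < \<rho>" "\<rho> \<le> 2"
  shows "(\<integral>\<^sup>+z. ennreal (indicator {\<rho>..} (norm (z - a)) / (norm (z - a))\<^sup>2) \<partial>sph_measure) \<le> ennreal (2 * pi * ln (2 / \<rho>))"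
proof -
  have "(\<integral>\<^sup>+z. ennreal (indicator {\<rho>..} (norm (z - a)) / (norm (z - a))\<^sup>2) \<partial>sph_measure)
     = ennreal (2 * pi) * (\<integral>\<^sup>+r. ennreal (indicator {\<rho>..} r / r\<^sup>2 * r) * indicator {0..2} r \<partial>lborel)"
    by (rule nn_integral_sph_radial[OF _ a, where h="\<lambda>r. indicator {\<rho>..} r / r\<^sup>2"]) measurable
  also have "\<dots> = ennreal (2 * pi) * (\<integral>\<^sup>+r. ennreal (1 / r) * indicator {\<rho>..2} r \<partial>lborel)"
    using r by (intro arg_cong[where f="\<lambda>x. ennreal (2 * pi) * x"] nn_integral_cong) (auto simp: indicator_def power2_eq_square)
  finally show ?thesis using r by (simp add: nn_integral_inverse_le ennreal_mult)
qed

lemma nn_integral_sph_inverse_fourth_far: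
  assumes a: "a \<in> S2" and r: "0 < \<rho>"
  shows "(\<integral>\<^sup>+z. ennreal (indicator {\<rho>..} (norm (z - a)) / (norm (z - a))^4) \<partial>sph_measure) \<le> ennreal (pi / \<rho>\<^sup>2)"
proof -
  have "(\<integral>\<^sup>+z. ennreal (indicator {\<rho>..} (norm (z - a)) / (norm (z - a))^4) \<partial>sph_measure)
     = ennreal (2 * pi) * (\<integral>\<^sup>+r. ennreal (indicator {\<rho>..} r / r^4 * r) * indicator {0..2} r \<partial>lborel)"
    by (rule nn_integral_sph_radial[OF _ a, where h="\<lambda>r. indicator {\<rho>..} r / r^4"]) measurable
  also have "\<dots> \<le> ennreal (2 * pi) * (\<integral>\<^sup>+r. ennreal (1 / r^3) * indicator {\<rho>..} r \<partial>lborel)"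
    using r by (intro mult_left_mono nn_integral_mono) (auto simp: indicator_def power4_eq_xxxx power3_eq_cube)
  also have "(\<integral>\<^sup>+r. ennreal (1 / r^3) * indicator {\<rho>..} r \<partial>lborel) = ennreal (0 - (- 1 / (2 * \<rho>\<^sup>2)))"
  proof (rule nn_integral_FTC_atLeast)
    have inv: "((\<lambda>r::real. inverse r) \<longlongrightarrow> 0) at_top" by (rule tendsto_inverse_0_at_top) (rule filterlim_ident)
    show "((\<lambda>r::real. - 1 / (2 * r\<^sup>2)) \<longlongrightarrow> 0) at_top"
    proof -
      have "((\<lambda>r::real. (-1/2) * (inverse r * inverse r)) \<longlongrightarrow> (-1/2) * (0 * 0)) at_top"
        by (intro tendsto_mult tendsto_const inv)
      moreover have "(\<lambda>r::real. (-1/2) * (inverse r * inverse r)) = (\<lambda>r. - 1 / (2 * r\<^sup>2))"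
        by (rule ext) (simp add: power2_eq_square inverse_eq_divide)
      ultimately show ?thesis by simp
    qed
    show "((\<lambda>r. - 1 / (2 * r\<^sup>2)) has_real_derivative 1 / x^3) (at x)" if "\<rho> \<le> x" for x
      using that r by (auto intro!: derivative_eq_intros simp: field_simps power2_eq_square power3_eq_cube)
  qed (use r in auto)
  also have "ennreal (2 * pi) * ennreal (0 - (- 1 / (2 * \<rho>\<^sup>2))) = ennreal (pi / \<rho>\<^sup>2)"
    by (subst ennreal_mult[symmetric]) auto
  finally show ?thesis .
qed

lemma nn_integral_sph_powr_annulus:
  assumes a: "a \<in> S2" and r: "0 < \<rho>" "0 < \<alpha>" "\<rho> \<le> \<delta>"
  shows "(\<integral>\<^sup>+z. ennreal (indicator {\<rho>..<\<delta>} (norm (z - a)) * (norm (z - a)) powr \<alpha> / (norm (z - a))\<^sup>2) \<partial>sph_measure) \<le> ennreal (2 * pi * \<delta> powr \<alpha> / \<alpha>)"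
proof -
  have "(\<integral>\<^sup>+z. ennreal (indicator {\<rho>..<\<delta>} (norm (z - a)) * (norm (z - a)) powr \<alpha> / (norm (z - a))\<^sup>2) \<partial>sph_measure)
     = ennreal (2 * pi) * (\<integral>\<^sup>+r. ennreal (indicator {\<rho>..<\<delta>} r * r powr \<alpha> / r\<^sup>2 * r) * indicator {0..2} r \<partial>lborel)"
    by (rule nn_integral_sph_radial[OF _ a, where h="\<lambda>r. indicator {\<rho>..<\<delta>} r * r powr \<alpha> / r\<^sup>2"]) measurable
  also have "\<dots> \<le> ennreal (2 * pi) * (\<integral>\<^sup>+r. ennreal (r powr (\<alpha> - 1)) * indicator {\<rho>..\<delta>} r \<partial>lborel)"
    using r by (intro mult_left_mono nn_integral_mono) (auto simp: indicator_def power2_eq_square powr_diff)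
  also have "(\<integral>\<^sup>+r. ennreal (r powr (\<alpha> - 1)) * indicator {\<rho>..\<delta>} r \<partial>lborel) = ennreal (\<delta> powr \<alpha> / \<alpha> - \<rho> powr \<alpha> / \<alpha>)"
    by (rule nn_integral_FTC_Icc) (use r in \<open>auto intro!: derivative_eq_intros\<close>)
  also have "ennreal (2 * pi) * \<dots> \<le> ennreal (2 * pi) * ennreal (\<delta> powr \<alpha> / \<alpha>)"
    using r by (intro mult_left_mono ennreal_leI) auto
  also have "\<dots> = ennreal (2 * pi * \<delta> powr \<alpha> / \<alpha>)"
    using r by (subst ennreal_mult[symmetric]) auto
  finally show ?thesis .
qed

text \<open>The curvature factor \<open>1 - r^2 / 4\<close> is dropped; the planar integrand
  \<open>1 / r\<close> then gives the logarithm with the coefficient 2 that enters the rate.\<close>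

lemma nn_integral_sph_quadrupole_far:
  assumes fr: "frame3 e n m" and r: "0 < \<delta>" "\<delta> \<le> 2"
  shows "(\<integral>\<^sup>+z. ennreal (\<bar>(z \<bullet> e) * (z \<bullet> n)\<bar> * (indicator {\<delta>..} (norm (z - m)) / (norm (z - m))^4)) \<partial>sph_measure) \<le> ennreal (2 * ln (2 / \<delta>))"
proof -
  have "(\<integral>\<^sup>+z. ennreal (\<bar>(z \<bullet> e) * (z \<bullet> n)\<bar> * (indicator {\<delta>..} (norm (z - m)) / (norm (z - m))^4)) \<partial>sph_measure)
    = 2 * (\<integral>\<^sup>+r. ennreal (r\<^sup>2 * (1 - r\<^sup>2 / 4) * (indicator {\<delta>..} r / r^4) * r) * indicator {0..2} r \<partial>lborel)"
    by (rule nn_integral_sph_quadrupole[OF _ _ fr, where h="\<lambda>r. indicator {\<delta>..} r / r^4"]) auto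
  also have "\<dots> \<le> 2 * (\<integral>\<^sup>+r. ennreal (1 / r) * indicator {\<delta>..2} r \<partial>lborel)"
  proof (intro mult_left_mono nn_integral_mono)
    fix x :: real
    have "x\<^sup>2 * (1 - x\<^sup>2 / 4) / x^4 * x \<le> 1 / x" if "\<delta> \<le> x"
    proof -
      have "x > 0" using that r by simp
      then have "x\<^sup>2 * (1 - x\<^sup>2 / 4) / x^4 * x = (1 - x\<^sup>2 / 4) / x" by (simp add: power2_eq_square power4_eq_xxxx)
      also have "\<dots> \<le> 1 / x" using \<open>x > 0\<close> by (intro divide_right_mono) auto
      finally show ?thesis .
    qed
    then show "ennreal (x\<^sup>2 * (1 - x\<^sup>2 / 4) * (indicator {\<delta>..} x / x^4) * x) * indicator {0..2} x \<le> ennreal (1 / x) * indicator {\<delta>..2} x"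
      by (auto simp: indicator_def intro!: ennreal_leI)
  qed auto
  also have "\<dots> = ennreal (2 * ln (2 / \<delta>))"
    using r by (simp add: nn_integral_inverse_le ennreal_mult)
  finally show ?thesis .
qed

text \<open>Weaker than Jordan's constant \<open>2 / pi\<close>, but rational. Up to
  \<open>pi / 3\<close> the derivative of the sine is at least 1/2; beyond, \<open>sin x\<close> is
  at least \<open>sqrt 3 / 2\<close>, which exceeds \<open>x / 3\<close> because
  \<open>pi < 4\<close>.\<close>

lemma sin_ge_third:
  assumes "0 \<le> x" "x \<le> pi / 2" shows "x / 3 \<le> sin x"
proof (cases "x \<le> pi / 3")
  case True
  have "(\<lambda>t. sin t - t / 2) 0 \<le> (\<lambda>t. sin t - t / 2) x"
  proof (rule DERIV_nonneg_imp_nondecreasing[OF assms(1)])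
    fix t assume t: "0 \<le> t" "t \<le> x"
    have "cos (pi / 3) \<le> cos t" using t True by (intro cos_monotone_0_pi_le) auto
    then have "0 \<le> cos t - 1 / 2" by (simp add: cos_60)
    moreover have "((\<lambda>t. sin t - t / 2) has_real_derivative cos t - 1 / 2) (at t)"
      by (auto intro!: derivative_eq_intros)
    ultimately show "\<exists>y. ((\<lambda>t. sin t - t / 2) has_real_derivative y) (at t) \<and> 0 \<le> y" by blast
  qed
  then show ?thesis using assms by simp
next
  case False
  have "sin (pi / 3) \<le> sin x" using False assms by (intro sin_monotone_2pi_le) auto
  moreover have "sqrt 3 \<ge> sqrt (1.7\<^sup>2)" by (intro real_sqrt_le_mono) (simp add: power2_eq_square)
  ultimately show ?thesis using assms pi_less_4 by (simp add: sin_60)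
qed

text \<open>\<open>\<bar>cos \<phi>\<bar>\<close> is the sine of the distance from
  \<open>\<bar>\<phi>\<bar>\<close> to \<open>pi / 2\<close>, so it is at most \<open>t\<close> only
  within \<open>3 * t\<close> of \<open>pi / 2\<close> or \<open>- pi / 2\<close>: two intervals of
  length \<open>6 * t\<close>.\<close>

lemma nn_integral_cos_small:
  assumes "0 \<le> t"
  shows "(\<integral>\<^sup>+\<phi>. indicator {..t} \<bar>cos \<phi>\<bar> * indicator {-pi..pi} \<phi> \<partial>lborel) \<le> ennreal (12 * t)"
proof -
  have *: "\<bar>\<bar>\<phi>\<bar> - pi/2\<bar> \<le> 3 * t" if "\<bar>cos \<phi>\<bar> \<le> t" "\<bar>\<phi>\<bar> \<le> pi" for \<phi> :: real
  proof -
    have "\<bar>cos \<phi>\<bar> = \<bar>sin (pi/2 - \<bar>\<phi>\<bar>)\<bar>" by (simp add: sin_diff abs_if)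
    also have "\<dots> = \<bar>sin \<bar>pi/2 - \<bar>\<phi>\<bar>\<bar>\<bar>" by (metis abs_minus_cancel abs_if sin_minus)
    also have "\<dots> \<ge> \<bar>pi/2 - \<bar>\<phi>\<bar>\<bar> / 3"
      using sin_ge_third[of "\<bar>pi/2 - \<bar>\<phi>\<bar>\<bar>"] that(2) by linarith
    finally show ?thesis using that(1) abs_minus_commute[of "pi/2" "\<bar>\<phi>\<bar>"] by linarith
  qed
  have "(\<integral>\<^sup>+\<phi>. indicator {..t} \<bar>cos \<phi>\<bar> * indicator {-pi..pi} \<phi> \<partial>lborel) \<le>
     (\<integral>\<^sup>+\<phi>. indicator {pi/2 - 3*t..pi/2 + 3*t} \<phi> + indicator {-pi/2 - 3*t..-pi/2 + 3*t} \<phi> \<partial>lborel)"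
  proof (rule nn_integral_mono)
    fix \<phi> :: real
    show "indicator {..t} \<bar>cos \<phi>\<bar> * indicator {-pi..pi} \<phi> \<le> (indicator {pi/2 - 3*t..pi/2 + 3*t} \<phi> + indicator {-pi/2 - 3*t..-pi/2 + 3*t} \<phi> :: ennreal)"
    proof (cases "\<bar>cos \<phi>\<bar> \<le> t \<and> \<bar>\<phi>\<bar> \<le> pi")
      case True
      then have "\<phi> \<in> {pi/2 - 3*t..pi/2 + 3*t} \<or> \<phi> \<in> {-pi/2 - 3*t..-pi/2 + 3*t}"
        using *[of \<phi>] by (auto simp: abs_if split: if_splits)
      then show ?thesis by (auto simp: indicator_def)
    qed (auto simp: indicator_def abs_if split: if_splits)
  qed
  also have "\<dots> = ennreal (6 * t) + ennreal (6 * t)"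
    using assms by (subst nn_integral_add) auto
  also have "\<dots> = ennreal (12 * t)" using assms by (simp add: ennreal_plus[symmetric] del: ennreal_plus)
  finally show ?thesis .
qed

text \<open>A circle of chordal radius \<open>r\<close> about \<open>m\<close> meets the strip in an
  angle of at most \<open>12 * \<tau>\<close> over its Euclidean radius. The cut-off at
  \<open>r = 1\<close> keeps that radius above \<open>r / 2\<close>, whereas it shrinks again near
  the antipode of \<open>m\<close>. Integrating \<open>24 * \<tau> / r^2\<close> from
  \<open>\<rho>\<close> gives the bound.\<close>

lemma nn_integral_sph_strip:
  assumes fr: "frame3 e n m" and r: "0 < \<rho>" "0 \<le> \<tau>"
  shows "(\<integral>\<^sup>+z. ennreal (indicator {..\<tau>} \<bar>z \<bullet> e\<bar> * (indicator {\<rho>..1} (norm (z - m)) / (norm (z - m))\<^sup>2)) \<partial>sph_measure) \<le> ennreal (24 * \<tau> / \<rho>)"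
proof -
  have m: "m \<in> S2" using fr by (simp add: frame3_def S2_def)
  define h :: "real \<Rightarrow> real" where "h r = indicator {\<rho>..1} r / r\<^sup>2" for r
  have mh [measurable]: "h \<in> borel_measurable borel" unfolding h_def by measurable
  have h0: "0 \<le> h r" for r by (simp add: h_def)
  let ?k = "\<lambda>s. h (sqrt (2 - 2 * s))"
  have mk: "(\<lambda>z::real^3. indicator {..\<tau>} \<bar>z$1\<bar> * ?k (z$3)) \<in> borel_measurable borel"
    by (intro borel_measurable_times measurable_compose[OF borel_measurable_abs[OF borel_measurable_vec_nth[of 1]]] measurable_compose[OF borel_measurable_vec_nth[of 3]]) measurable
  have "(\<integral>\<^sup>+z. ennreal (indicator {..\<tau>} \<bar>z \<bullet> e\<bar> * (indicator {\<rho>..1} (norm (z - m)) / (norm (z - m))\<^sup>2)) \<partial>sph_measure)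
    = (\<integral>\<^sup>+z. ennreal (indicator {..\<tau>} \<bar>z \<bullet> e\<bar> * ?k (z \<bullet> m)) \<partial>sph_measure)"
    by (intro nn_integral_cong) (simp add: norm_sph_diff_sqrt m h_def)
  also have "\<dots> = (\<integral>\<^sup>+z. ennreal (indicator {..\<tau>} \<bar>z$1\<bar> * ?k (z$3)) \<partial>sph_measure)"
    by (rule nn_integral_sph_frame3[OF fr, where F="\<lambda>a b c. ennreal (indicator {..\<tau>} \<bar>a\<bar> * ?k c)"])
       (rule measurable_compose[OF mk measurable_ennreal])
  also have "\<dots> = (\<integral>\<^sup>+\<theta>. ennreal (cos \<theta>) * indicator {-(pi/2)..pi/2} \<theta> *
      (\<integral>\<^sup>+\<phi>. ennreal (indicator {..\<tau>} \<bar>sph_coord (\<phi>, \<theta>) $ 1\<bar> * ?k (sph_coord (\<phi>, \<theta>) $ 3)) * indicator {-pi..pi} \<phi> \<partial>lborel) \<partial>lborel)"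
    by (intro nn_integral_sph_iter borel_measurable_sphI) (rule measurable_compose[OF mk measurable_ennreal])
  also have "\<dots> \<le> (\<integral>\<^sup>+\<theta>. ennreal (12 * \<tau> / sqrt (1 - (sin \<theta>)\<^sup>2) * ?k (sin \<theta>) * cos \<theta> * indicator {-(pi/2)..pi/2} \<theta>) \<partial>lborel)"
  proof (rule nn_integral_mono)
    fix \<theta> :: real
    show "ennreal (cos \<theta>) * indicator {-(pi/2)..pi/2} \<theta> *
      (\<integral>\<^sup>+\<phi>. ennreal (indicator {..\<tau>} \<bar>sph_coord (\<phi>, \<theta>) $ 1\<bar> * ?k (sph_coord (\<phi>, \<theta>) $ 3)) * indicator {-pi..pi} \<phi> \<partial>lborel)
      \<le> ennreal (12 * \<tau> / sqrt (1 - (sin \<theta>)\<^sup>2) * ?k (sin \<theta>) * cos \<theta> * indicator {-(pi/2)..pi/2} \<theta>)"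
    proof (cases "cos \<theta> > 0 \<and> \<theta> \<in> {-(pi/2)..pi/2}")
      case True
      have "(\<integral>\<^sup>+\<phi>. ennreal (indicator {..\<tau>} \<bar>sph_coord (\<phi>, \<theta>) $ 1\<bar> * ?k (sph_coord (\<phi>, \<theta>) $ 3)) * indicator {-pi..pi} \<phi> \<partial>lborel)
        = (\<integral>\<^sup>+\<phi>. ennreal (?k (sin \<theta>)) * (indicator {..\<tau> / cos \<theta>} \<bar>cos \<phi>\<bar> * indicator {-pi..pi} \<phi>) \<partial>lborel)"
        using True by (intro nn_integral_cong) (auto simp: sph_coord_nth indicator_def abs_mult field_simps)
      also have "\<dots> = ennreal (?k (sin \<theta>)) * (\<integral>\<^sup>+\<phi>. indicator {..\<tau> / cos \<theta>} \<bar>cos \<phi>\<bar> * indicator {-pi..pi} \<phi> \<partial>lborel)"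
        by (rule nn_integral_cmult) measurable
      also have "\<dots> \<le> ennreal (?k (sin \<theta>)) * ennreal (12 * (\<tau> / cos \<theta>))"
        using True r by (intro mult_left_mono nn_integral_cos_small) auto
      also have "\<dots> = ennreal (12 * \<tau> / cos \<theta> * ?k (sin \<theta>))"
        using h0 by (subst ennreal_mult'[symmetric]) (auto simp: mult_ac)
      finally have "ennreal (cos \<theta>) * (\<integral>\<^sup>+\<phi>. ennreal (indicator {..\<tau>} \<bar>sph_coord (\<phi>, \<theta>) $ 1\<bar> * ?k (sph_coord (\<phi>, \<theta>) $ 3)) * indicator {-pi..pi} \<phi> \<partial>lborel)
         \<le> ennreal (cos \<theta>) * ennreal (12 * \<tau> / cos \<theta> * ?k (sin \<theta>))" by (intro mult_left_mono) auto
      also have "\<dots> = ennreal (12 * \<tau> / cos \<theta> * ?k (sin \<theta>) * cos \<theta>)"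
        using True by (subst ennreal_mult'[symmetric]) (auto simp: mult_ac)
      also have "cos \<theta> = sqrt (1 - (sin \<theta>)\<^sup>2)" using True by (simp add: cos_squared_eq[symmetric])
      finally show ?thesis using True by (simp add: cos_squared_eq[symmetric])
    next
      case False
      then have "cos \<theta> = 0 \<or> \<theta> \<notin> {-(pi/2)..pi/2}" using cos_ge_zero[of \<theta>] by force
      then show ?thesis by auto
    qed
  qed
  also have "\<dots> = (\<integral>\<^sup>+s. ennreal (12 * \<tau> / sqrt (1 - s\<^sup>2) * ?k s) * indicator {-1..1} s \<partial>lborel)"
    by (rule nn_integral_sin_substitution) measurable
  also have "\<dots> = (\<integral>\<^sup>+s. ennreal (12 * \<tau> / sqrt ((sqrt (2 - 2 * s))\<^sup>2 * (1 - (sqrt (2 - 2 * s))\<^sup>2 / 4)) * h (sqrt (2 - 2 * s))) * indicator {-1..1} s \<partial>lborel)"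
  proof (intro nn_integral_cong)
    fix s :: real
    have "(1 - s\<^sup>2) = (sqrt (2 - 2 * s))\<^sup>2 * (1 - (sqrt (2 - 2 * s))\<^sup>2 / 4)" if "s \<in> {-1..1}"
      using that by (simp add: power2_eq_square field_simps)
    then show "ennreal (12 * \<tau> / sqrt (1 - s\<^sup>2) * ?k s) * indicator {-1..1} s =
      ennreal (12 * \<tau> / sqrt ((sqrt (2 - 2 * s))\<^sup>2 * (1 - (sqrt (2 - 2 * s))\<^sup>2 / 4)) * h (sqrt (2 - 2 * s))) * indicator {-1..1} s"
      by (cases "s \<in> {-1..1}") (simp_all del: real_sqrt_pow2_iff)
  qed
  also have "\<dots> = (\<integral>\<^sup>+r. ennreal (12 * \<tau> / sqrt (r\<^sup>2 * (1 - r\<^sup>2 / 4)) * h r * r) * indicator {0..2} r \<partial>lborel)"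
    by (rule nn_integral_latitude_radial[where h="\<lambda>r. 12 * \<tau> / sqrt (r\<^sup>2 * (1 - r\<^sup>2 / 4)) * h r"]) measurable
  also have "\<dots> \<le> (\<integral>\<^sup>+x. ennreal (24 * \<tau> / x\<^sup>2) * indicator {\<rho>..} x \<partial>lborel)"
  proof (rule nn_integral_mono)
    fix x :: real
    show "ennreal (12 * \<tau> / sqrt (x\<^sup>2 * (1 - x\<^sup>2 / 4)) * h x * x) * indicator {0..2} x \<le> ennreal (24 * \<tau> / x\<^sup>2) * indicator {\<rho>..} x"
    proof (cases "\<rho> \<le> x \<and> x \<le> 1")
      case True
      then have x: "0 < x" "x \<le> 1" using r by auto
      have "(x/2)\<^sup>2 \<le> x\<^sup>2 * (1 - x\<^sup>2 / 4)"
      proof -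
        have "x\<^sup>2 \<le> 1" using x by (simp add: power_le_one)
        then have "x\<^sup>2 * (1/4) \<le> x\<^sup>2 * (1 - x\<^sup>2 / 4)" by (intro mult_left_mono) auto
        then show ?thesis by (simp add: power_divide)
      qed
      then have "x/2 \<le> sqrt (x\<^sup>2 * (1 - x\<^sup>2 / 4))" by (rule real_le_rsqrt)
      moreover from this have "0 < sqrt (x\<^sup>2 * (1 - x\<^sup>2 / 4))" using x by linarith
      ultimately have "12 * \<tau> / sqrt (x\<^sup>2 * (1 - x\<^sup>2 / 4)) \<le> 12 * \<tau> / (x/2)"
        using x r by (intro divide_left_mono mult_pos_pos) auto
      then have "12 * \<tau> / sqrt (x\<^sup>2 * (1 - x\<^sup>2 / 4)) * (h x * x) \<le> 12 * \<tau> / (x/2) * (h x * x)"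
        using x h0 by (intro mult_right_mono) auto
      also have "\<dots> = 24 * \<tau> / x\<^sup>2" using True x by (simp add: h_def power2_eq_square)
      finally show ?thesis using True x by (auto simp: mult.assoc intro!: ennreal_leI)
    qed (auto simp: h_def indicator_def)
  qed
  also have "\<dots> = ennreal (0 - (- (24 * \<tau>) / \<rho>))"
  proof (rule nn_integral_FTC_atLeast[where F="\<lambda>x. - (24 * \<tau>) / x"])
    show "((\<lambda>x. - (24 * \<tau>) / x) \<longlongrightarrow> 0) at_top"
      by (rule real_tendsto_divide_at_top[OF tendsto_const filterlim_ident])
    show "((\<lambda>x. - (24 * \<tau>) / x) has_real_derivative 24 * \<tau> / x\<^sup>2) (at x)" if "\<rho> \<le> x" for x
      using that r by (auto intro!: derivative_eq_intros simp: power2_eq_square)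
  qed (use r in auto)
  finally show ?thesis by simp
qed

section \<open>The velocity difference at a pair of points\<close>

lemma measurable_ident_sph [measurable]: "(\<lambda>z. z) \<in> borel_measurable sph_measure"
  by (rule borel_measurable_sphI) simp

lemma borel_measurable_cross3 [measurable]:
  assumes "f \<in> borel_measurable M" "g \<in> borel_measurable M"
  shows "(\<lambda>x. cross3 (f x) (g x)) \<in> borel_measurable M"
proof -
  have "continuous_on UNIV (\<lambda>p::(real^3)\<times>(real^3). cross3 (fst p) (snd p))"
    by (intro continuous_on_cross continuous_intros)
  from borel_measurable_continuous_Pair[OF assms this] show ?thesis .
qed

lemma AE_sph_neq: "a \<in> S2 \<Longrightarrow> AE z in sph_measure. z \<noteq> a"
proof -
  assume a: "a \<in> S2"
  have "(\<integral>\<^sup>+z. ennreal (indicator {0} (norm (z - a))) \<partial>sph_measure) = ennreal (2 * pi) * (\<integral>\<^sup>+r. ennreal (indicator {0} r * r) * indicator {0..2} r \<partial>lborel)"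
    by (rule nn_integral_sph_radial[OF _ a]) auto
  also have "(\<integral>\<^sup>+r. ennreal (indicator {0} r * r) * indicator {0..2} r \<partial>lborel) = (\<integral>\<^sup>+r. 0 \<partial>(lborel::real measure))"
    by (intro nn_integral_cong) (auto simp: indicator_def)
  finally have "(\<integral>\<^sup>+z. ennreal (indicator {0} (norm (z - a))) \<partial>sph_measure) = 0" by simp
  then have "AE z in sph_measure. ennreal (indicator {0} (norm (z - a))) = 0"
    by (subst (asm) nn_integral_0_iff_AE) auto
  then show ?thesis by eventually_elim (auto simp: indicator_def split: if_splits)
qed

lemma integrable_norm_bound:
  fixes f :: "'a \<Rightarrow> 'b::{banach, second_countable_topology}"
  assumes f: "f \<in> borel_measurable M" and le: "(\<integral>\<^sup>+x. ennreal (norm (f x)) \<partial>M) \<le> ennreal C" and C: "0 \<le> C"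
  shows "integrable M f" "norm (\<integral>x. f x \<partial>M) \<le> C"
proof -
  show i: "integrable M f"
    by (rule integrableI_bounded[OF f]) (use le in \<open>auto intro: le_less_trans\<close>)
  have "ennreal (norm (\<integral>x. f x \<partial>M)) \<le> (\<integral>\<^sup>+x. ennreal (norm (f x)) \<partial>M)"
    by (rule integral_norm_bound_ennreal[OF i])
  then show "norm (\<integral>x. f x \<partial>M) \<le> C" using le C by (metis ennreal_le_iff order_trans)
qed

lemma norm_cross3_le: "norm (cross3 a b) \<le> norm a * norm b"
proof -
  have "(norm (cross3 a b))\<^sup>2 \<le> (norm a * norm b)\<^sup>2"
    unfolding norm_cross by (simp add: power_mult_distrib)
  then show ?thesis by (rule power2_le_imp_le) simp
qed

lemma norm_cross3_diff:
  assumes "a \<in> S2" shows "norm (cross3 a z) \<le> norm (a - z)"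
proof -
  have "cross3 a z = cross3 a (z - a)" by (simp add: Cross3.right_diff_distrib)
  then show ?thesis using norm_cross3_le[of a "z - a"] assms by (simp add: S2_def norm_minus_commute)
qed

lemma nn_integral_sph_inverse:
  assumes a: "a \<in> S2"
  shows "(\<integral>\<^sup>+z. ennreal (1 / norm (z - a)) \<partial>sph_measure) \<le> ennreal (4 * pi)"
proof -
  have "(\<integral>\<^sup>+z. ennreal (1 / norm (z - a)) \<partial>sph_measure)
     = ennreal (2 * pi) * (\<integral>\<^sup>+r. ennreal (1 / r * r) * indicator {0..2} r \<partial>lborel)"
    by (rule nn_integral_sph_radial[OF _ a]) measurable
  also have "\<dots> \<le> ennreal (2 * pi) * (\<integral>\<^sup>+r. indicator {0..2::real} r \<partial>lborel)"
    by (intro mult_left_mono nn_integral_mono) (auto simp: indicator_def)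
  also have "\<dots> = ennreal (4 * pi)" using ennreal_mult[of "2 * pi" 2] by simp
  finally show ?thesis .
qed

text \<open>The kernel has size at most \<open>1 / norm (x - z)\<close>, since
  \<open>cross3 x z = cross3 x (z - x)\<close>; its integral is at most \<open>4 * pi\<close>, which
  the prefactor turns into 2.\<close>

lemma velocity_integrable:
  assumes x: "x \<in> S2" and w: "\<omega> \<in> borel_measurable sph_measure" "AE z in sph_measure. \<bar>\<omega> z\<bar> \<le> 1"
  shows "integrable sph_measure (\<lambda>z. (\<omega> z / (norm (x - z))\<^sup>2) *\<^sub>R cross3 x z)"
    and "norm (velocity \<omega> x) \<le> 2"
proof -
  let ?f = "\<lambda>z. (\<omega> z / (norm (x - z))\<^sup>2) *\<^sub>R cross3 x z"
  have m: "?f \<in> borel_measurable sph_measure" using w(1) by measurable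
  have "(\<integral>\<^sup>+z. ennreal (norm (?f z)) \<partial>sph_measure) \<le> (\<integral>\<^sup>+z. ennreal (1 / norm (z - x)) \<partial>sph_measure)"
    using w(2)
  proof (intro nn_integral_mono_AE, eventually_elim)
    fix z assume z: "\<bar>\<omega> z\<bar> \<le> 1"
    have "norm (?f z) = \<bar>\<omega> z\<bar> * (norm (cross3 x z) / (norm (x - z))\<^sup>2)" by simp
    also have "\<dots> \<le> 1 * (norm (x - z) / (norm (x - z))\<^sup>2)"
      using z by (intro mult_mono divide_right_mono norm_cross3_diff[OF x]) auto
    also have "\<dots> = 1 / norm (z - x)" by (simp add: power2_eq_square norm_minus_commute)
    finally show "ennreal (norm (?f z)) \<le> ennreal (1 / norm (z - x))" by (rule ennreal_leI)
  qed
  also have "\<dots> \<le> ennreal (4 * pi)" by (rule nn_integral_sph_inverse[OF x])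
  finally have "(\<integral>\<^sup>+z. ennreal (norm (?f z)) \<partial>sph_measure) \<le> ennreal (4 * pi)" .
  from integrable_norm_bound[OF m this] show "integrable sph_measure ?f" "norm (velocity \<omega> x) \<le> 2"
    by (auto simp: velocity_def field_simps)
qed

text \<open>Half the kernel of \<open>(x - y) \<bullet> (u x - u y)\<close>, before the prefactor:
  both velocities contribute the triple product \<open>z \<bullet> cross3 x y\<close>, divided by
  the squared distance from \<open>z\<close> to \<open>x\<close> or to \<open>y\<close>, and the
  difference of these reciprocals is put over a common denominator.\<close>

definition pair_kernel :: "real^3 \<Rightarrow> real^3 \<Rightarrow> real^3 \<Rightarrow> real" where
  "pair_kernel x y z = (z \<bullet> cross3 x y) * ((x - y) \<bullet> z) / ((norm (x - z))\<^sup>2 * (norm (y - z))\<^sup>2)"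

lemma pair_kernel_measurable [measurable]: "pair_kernel x y \<in> borel_measurable sph_measure"
  unfolding pair_kernel_def[abs_def] by measurable

lemma norm_sph_diff_cancel:
  assumes "x \<in> S2" "y \<in> S2" "z \<in> S2"
  shows "2 * ((x - y) \<bullet> z) = (norm (y - z))\<^sup>2 - (norm (x - z))\<^sup>2"
  using norm_sph_diff[OF assms(1,3)] norm_sph_diff[OF assms(2,3)] by (simp add: inner_diff_left)

lemma pair_velocity:
  assumes x: "x \<in> S2" and y: "y \<in> S2"
    and w: "\<omega> \<in> borel_measurable sph_measure" "AE z in sph_measure. \<bar>\<omega> z\<bar> \<le> 1"
  shows "(x - y) \<bullet> (velocity \<omega> x - velocity \<omega> y) = (1 / pi) * (\<integral>z. \<omega> z * pair_kernel x y z \<partial>sph_measure)"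
proof -
  define f where "f x z = (\<omega> z / (norm (x - z))\<^sup>2) *\<^sub>R cross3 x z" for x z
  have i: "integrable sph_measure (f x)" "integrable sph_measure (f y)"
    using velocity_integrable(1)[OF x w] velocity_integrable(1)[OF y w] by (simp_all add: f_def[abs_def])
  have "(x - y) \<bullet> (velocity \<omega> x - velocity \<omega> y) = (1 / (2 * pi)) * ((x - y) \<bullet> ((\<integral>z. f x z \<partial>sph_measure) - (\<integral>z. f y z \<partial>sph_measure)))"
    by (simp add: velocity_def f_def scaleR_diff_right[symmetric] del: scaleR_diff_right)
  also have "(x - y) \<bullet> ((\<integral>z. f x z \<partial>sph_measure) - (\<integral>z. f y z \<partial>sph_measure)) = (\<integral>z. (x - y) \<bullet> (f x z - f y z) \<partial>sph_measure)"
    using i by (simp add: Bochner_Integration.integral_diff[symmetric] del: Bochner_Integration.integral_diff)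
  also have "\<dots> = (\<integral>z. 2 * (\<omega> z * pair_kernel x y z) \<partial>sph_measure)"
  proof (rule integral_cong_AE)
    show "(\<lambda>z. (x - y) \<bullet> (f x z - f y z)) \<in> borel_measurable sph_measure"
      "(\<lambda>z. 2 * (\<omega> z * pair_kernel x y z)) \<in> borel_measurable sph_measure"
      using i w(1) by measurable
    show "AE z in sph_measure. (x - y) \<bullet> (f x z - f y z) = 2 * (\<omega> z * pair_kernel x y z)"
      using AE_sph_neq[OF x] AE_sph_neq[OF y] AE_space
    proof eventually_elim
      fix z assume z: "z \<noteq> x" "z \<noteq> y" "z \<in> space sph_measure"
      define A B D where "A = (norm (x - z))\<^sup>2" "B = (norm (y - z))\<^sup>2" "D = z \<bullet> cross3 x y"
      have AB: "A \<noteq> 0" "B \<noteq> 0" using z by (auto simp: A_B_D_def)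
      \<comment> \<open>On expanding, \<open>x \<bullet> cross3 x z\<close> and
        \<open>y \<bullet> cross3 y z\<close> vanish, and the two mixed terms are the same triple
        product up to sign.\<close>
      have c: "y \<bullet> cross3 x z = - D" "x \<bullet> cross3 y z = D"
        by (simp_all add: A_B_D_def cross3_simps)
      have BA: "2 * ((x - y) \<bullet> z) = B - A" unfolding A_B_D_def using norm_sph_diff_cancel x y z by simp
      have "(x - y) \<bullet> (f x z - f y z) = \<omega> z * (D / A - D / B)"
        by (simp add: f_def inner_diff_left inner_diff_right dot_cross_self c A_B_D_def(1,2)[symmetric] algebra_simps)
      also have "\<dots> = 2 * (\<omega> z * (D * ((B - A) / 2) / (A * B)))" using AB by (simp add: field_simps)
      finally show "(x - y) \<bullet> (f x z - f y z) = 2 * (\<omega> z * pair_kernel x y z)"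
        unfolding pair_kernel_def A_B_D_def[symmetric] BA[symmetric] by simp
    qed
  qed
  finally show ?thesis by simp
qed

text \<open>\<open>m\<close> is the normalised midpoint of the chord and \<open>c\<close> the
  distance of the chord from the origin; \<open>d < 2\<close> excludes antipodal points, for which
  there is no midpoint direction.\<close>

lemma frame3_of_pair:
  assumes x: "x \<in> S2" and y: "y \<in> S2" and d: "d = norm (x - y)" "0 < d" "d < 2"
  obtains e m c where "frame3 e (cross3 m e) m" "0 < c" "c \<le> 1" "c\<^sup>2 = 1 - d\<^sup>2 / 4"
    "x = c *\<^sub>R m + (d / 2) *\<^sub>R e" "y = c *\<^sub>R m - (d / 2) *\<^sub>R e"
proof -
  have n: "x \<bullet> x = 1" "y \<bullet> y = 1" using x y by (simp_all add: S2_def norm_eq_1)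
  have d2: "d\<^sup>2 = 2 - 2 * (x \<bullet> y)" using norm_sph_diff[OF x y] d by simp
  define c where "c = norm (x + y) / 2"
  have c2: "c\<^sup>2 = 1 - d\<^sup>2 / 4"
    unfolding d2 c_def power_divide power2_norm_eq_inner by (simp add: inner_add_left inner_add_right n inner_commute field_simps)
  have "d\<^sup>2 < 2\<^sup>2" using d by (intro power_strict_mono) auto
  then have "0 < c\<^sup>2" "c\<^sup>2 \<le> 1\<^sup>2" unfolding c2 by auto
  then have c: "0 < c" "c \<le> 1" using power2_le_imp_le[of c 1] by (auto simp: c_def)
  define m e where "m = (1 / (2 * c)) *\<^sub>R (x + y)" and "e = (1 / d) *\<^sub>R (x - y)"
  have "norm m = 1" "norm e = 1" using c d by (auto simp: m_def e_def c_def)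
  moreover have "(x + y) \<bullet> (x - y) = 0" by (simp add: inner_add_left inner_diff_right n inner_commute[of y x])
  then have me: "m \<bullet> e = 0" by (simp add: m_def e_def)
  moreover have "(norm (cross3 m e))\<^sup>2 = 1" unfolding norm_cross using calculation me by simp
  then have "norm (cross3 m e) = 1" using norm_ge_zero[of "cross3 m e"] unfolding power2_eq_1_iff by linarith
  ultimately have fr: "frame3 e (cross3 m e) m" using me by (simp add: frame3_def dot_cross_self inner_commute)
  have "c *\<^sub>R m = (1/2) *\<^sub>R (x + y)" "(d/2) *\<^sub>R e = (1/2) *\<^sub>R (x - y)" using c d by (simp_all add: m_def e_def)
  then have "x = c *\<^sub>R m + (d / 2) *\<^sub>R e" "y = c *\<^sub>R m - (d / 2) *\<^sub>R e"
    by (simp_all add: vec_eq_iff field_simps)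
  then show ?thesis using that[OF fr c c2] by blast
qed

text \<open>For use near the pair. The triple product is unchanged when \<open>x\<close>,
  \<open>y\<close> are replaced by \<open>x - z\<close>, \<open>y - z\<close>, hence bounded by the
  product of the two distances. The other factor is a difference of squares of these distances,
  which differ by at most \<open>norm (x - y)\<close>.\<close>

lemma abs_pair_kernel_le:
  assumes x: "x \<in> S2" and y: "y \<in> S2" and z: "z \<in> S2"
  shows "\<bar>pair_kernel x y z\<bar> \<le> norm (x - y) / 2 * (1 / norm (z - x) + 1 / norm (z - y))"
proof (cases "z = x \<or> z = y")
  case True
  then show ?thesis by (auto simp: pair_kernel_def)
next
  case False
  define a b where ab: "a = norm (x - z)" "b = norm (y - z)"
  have p: "0 < a" "0 < b" using False by (auto simp: ab)
  have "z \<bullet> cross3 x y = z \<bullet> cross3 (x - z) (y - z)" by (simp add: cross3_simps)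
  also have "\<bar>\<dots>\<bar> \<le> norm z * norm (cross3 (x - z) (y - z))" by (rule Cauchy_Schwarz_ineq2)
  also have "\<dots> \<le> a * b" using norm_cross3_le[of "x - z" "y - z"] z by (simp add: S2_def ab)
  finally have D: "\<bar>z \<bullet> cross3 x y\<bar> \<le> a * b" .
  have "2 * ((x - y) \<bullet> z) = (b - a) * (b + a)"
    using norm_sph_diff_cancel[OF x y z] by (simp add: ab power2_eq_square algebra_simps)
  then have "2 * \<bar>(x - y) \<bullet> z\<bar> = \<bar>b - a\<bar> * (b + a)" using p by (metis abs_mult abs_of_pos add_pos_pos abs_numeral)
  moreover have "\<bar>b - a\<bar> \<le> norm (x - y)"
    using norm_triangle_ineq3[of "y - z" "x - z"] by (simp add: ab norm_minus_commute)
  then have "\<bar>b - a\<bar> * (b + a) \<le> norm (x - y) * (b + a)" using p by (intro mult_right_mono) auto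
  ultimately have "2 * \<bar>(x - y) \<bullet> z\<bar> \<le> norm (x - y) * (b + a)" by linarith
  then have E: "\<bar>(x - y) \<bullet> z\<bar> \<le> norm (x - y) / 2 * (a + b)" by (simp add: field_simps)
  have "\<bar>pair_kernel x y z\<bar> = \<bar>z \<bullet> cross3 x y\<bar> * \<bar>(x - y) \<bullet> z\<bar> / (a\<^sup>2 * b\<^sup>2)"
    by (simp add: pair_kernel_def abs_mult ab)
  also have "\<dots> \<le> (a * b) * (norm (x - y) / 2 * (a + b)) / (a\<^sup>2 * b\<^sup>2)"
    using D E by (intro divide_right_mono mult_mono) (use p in auto)
  also have "\<dots> = norm (x - y) / 2 * (1 / a + 1 / b)" using p by (simp add: field_simps power2_eq_square)
  finally show ?thesis by (simp add: ab norm_minus_commute)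
qed

lemma frame3_comp_le:
  assumes fr: "frame3 e n m"
  shows "\<bar>z \<bullet> e\<bar> \<le> norm (z - m)" "\<bar>z \<bullet> n\<bar> \<le> norm (z - m)"
proof -
  have "m \<bullet> e = 0" "m \<bullet> n = 0" using fr by (simp_all add: frame3_def inner_commute)
  then have "z \<bullet> e = (z - m) \<bullet> e" "z \<bullet> n = (z - m) \<bullet> n"
    by (simp_all add: inner_diff_left)
  then show "\<bar>z \<bullet> e\<bar> \<le> norm (z - m)" "\<bar>z \<bullet> n\<bar> \<le> norm (z - m)"
    using Cauchy_Schwarz_ineq2[of "z - m" e] Cauchy_Schwarz_ineq2[of "z - m" n] fr by (simp_all add: frame3_def)
qed

text \<open>For use far from the pair. In the midpoint frame the kernel divided by
  \<open>d^2\<close> is exactly \<open>- c * ze * zn / P\<close>. Here \<open>c\<close> differs from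
  1 by a multiple of \<open>d^2\<close> and \<open>P\<close> from \<open>r^4\<close> by a multiple
  of \<open>d^2 * r^2\<close>; the resulting error has an integral over \<open>r \<ge> 2 * d\<close>
  that is bounded independently of \<open>d\<close>.\<close>

lemma pair_kernel_quadrupole:
  assumes fr: "frame3 e (cross3 m e) m" and c: "0 < c" "c \<le> 1" "c\<^sup>2 = 1 - d\<^sup>2 / 4"
    and x: "x = c *\<^sub>R m + (d / 2) *\<^sub>R e" and y: "y = c *\<^sub>R m - (d / 2) *\<^sub>R e"
    and d: "0 < d" "d \<le> 1" and z: "z \<in> S2" and r: "r = norm (z - m)" "2 * d \<le> r"
  shows "\<bar>pair_kernel x y z / d\<^sup>2 + (z \<bullet> e) * (z \<bullet> cross3 m e) / r^4\<bar> \<le> 10 * d\<^sup>2 / r^4"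
proof -
  let ?n = "cross3 m e"
  define ze zn where ez: "ze = z \<bullet> e" "zn = z \<bullet> ?n"
  have nn: "norm m = 1" "norm e = 1" "m \<bullet> e = 0" "e \<bullet> m = 0" using fr by (auto simp: frame3_def inner_commute)
  have mS: "m \<in> S2" using nn by (simp add: S2_def)
  have xy: "x \<in> S2" "y \<in> S2"
  proof -
    have "x \<bullet> x = c\<^sup>2 + d\<^sup>2 / 4" "y \<bullet> y = c\<^sup>2 + d\<^sup>2 / 4"
      using nn by (simp_all add: x y inner_add_left inner_add_right inner_diff_left inner_diff_right norm_eq_1 power2_eq_square)
    then show "x \<in> S2" "y \<in> S2" by (simp_all add: S2_def norm_eq_1 c)
  qed
  have r0: "0 < r" "r \<le> 2" using r d norm_triangle_ineq4[of z m] z nn by (auto simp: S2_def)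
  have r2: "r\<^sup>2 = 2 - 2 * (z \<bullet> m)" using norm_sph_diff[OF z mS] r by simp
  have r4: "r\<^sup>2 \<le> 4" using power_mono[of r 2 2] r0 by simp
  have dr: "4 * d\<^sup>2 \<le> r\<^sup>2" using power_mono[of "2 * d" r 2] r d by (simp add: power_mult_distrib)
  have c1: "1 - c \<le> d\<^sup>2 / 4" using c mult_mono[of c 1 c c] by (simp add: power2_eq_square)
  have "cross3 x y = - (c * d) *\<^sub>R ?n"
    unfolding x y by (simp add: cross_add_left Cross3.right_diff_distrib cross_mult_left cross_mult_right cross_skew[of e m])
       (simp add: vec_eq_iff field_simps)
  then have D: "z \<bullet> cross3 x y = - (c * d * zn)" by (simp add: ez)
  have E: "(x - y) \<bullet> z = d * ze" by (simp add: x y ez inner_commute inner_diff_left inner_add_left scaleR_add_left[symmetric])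
  \<comment> \<open>\<open>A\<close> is the mean of the squared distances from \<open>z\<close> to
    \<open>x\<close> and \<open>y\<close>, and \<open>P\<close> is their product.\<close>
  define A P where "A = 2 - 2 * c * (z \<bullet> m)" "P = A\<^sup>2 - d\<^sup>2 * ze\<^sup>2"
  have nx: "(norm (x - z))\<^sup>2 = A - d * ze" "(norm (y - z))\<^sup>2 = A + d * ze"
    unfolding norm_sph_diff[OF xy(1) z] norm_sph_diff[OF xy(2) z]
    by (simp_all add: x y A_P_def ez inner_add_left inner_diff_left inner_commute[of m z] inner_commute[of e z] field_simps)
  have P: "(norm (x - z))\<^sup>2 * (norm (y - z))\<^sup>2 = P" unfolding nx A_P_def by (simp add: power2_eq_square algebra_simps)
  have pk: "pair_kernel x y z / d\<^sup>2 = - (c * (ze * zn) / P)"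
    unfolding pair_kernel_def P D E using d by (simp add: field_simps power2_eq_square)
  have zr: "\<bar>ze\<bar> \<le> r" "\<bar>zn\<bar> \<le> r" using frame3_comp_le[OF fr, of z] unfolding ez r(1) by auto
  have ze2: "ze\<^sup>2 \<le> r\<^sup>2" using zr r0 abs_le_square_iff[of ze r] by simp
  have zen: "\<bar>ze * zn\<bar> \<le> r\<^sup>2" unfolding abs_mult power2_eq_square using zr r0 by (intro mult_mono) auto
  have A: "A - r\<^sup>2 = (1 - c) * (2 - r\<^sup>2)" unfolding A_P_def r2 by (simp add: algebra_simps)
  have "\<bar>A - r\<^sup>2\<bar> \<le> d\<^sup>2 / 4 * 2"
    unfolding A abs_mult using c1 c r4 zero_le_power2[of r] by (intro mult_mono) (auto simp: abs_le_iff simp del: zero_le_power2)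
  then have A1: "\<bar>A - r\<^sup>2\<bar> \<le> d\<^sup>2 / 2" by simp
  have "\<bar>A\<^sup>2 - (r\<^sup>2)\<^sup>2\<bar> = \<bar>A - r\<^sup>2\<bar> * \<bar>A + r\<^sup>2\<bar>"
    by (simp add: power2_eq_square algebra_simps flip: abs_mult)
  also have "\<dots> \<le> d\<^sup>2 / 2 * (3 * r\<^sup>2)" proof (intro mult_mono A1)
    show "\<bar>A + r\<^sup>2\<bar> \<le> 3 * r\<^sup>2" using A1 dr zero_le_power2[of d] unfolding abs_le_iff by linarith
  qed auto
  finally have Ar: "\<bar>A\<^sup>2 - (r\<^sup>2)\<^sup>2\<bar> \<le> 3/2 * (d\<^sup>2 * r\<^sup>2)" by simp
  have "d\<^sup>2 * ze\<^sup>2 \<le> d\<^sup>2 * r\<^sup>2" using ze2 by (intro mult_left_mono) auto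
  moreover have "0 \<le> d\<^sup>2 * ze\<^sup>2" by simp
  ultimately have Pr: "\<bar>P - (r\<^sup>2)\<^sup>2\<bar> \<le> 5/2 * (d\<^sup>2 * r\<^sup>2)" using Ar unfolding A_P_def(2) by linarith
  have "4 * (d\<^sup>2 * r\<^sup>2) \<le> (r\<^sup>2)\<^sup>2" unfolding power2_eq_square[of "r\<^sup>2"]
    using mult_right_mono[OF dr, of "r\<^sup>2"] by (simp add: mult.assoc)
  then have Pl: "3/8 * (r\<^sup>2)\<^sup>2 \<le> P" using Pr unfolding abs_le_iff by linarith
  have R: "0 < (r\<^sup>2)\<^sup>2" using r0 by simp
  have Pp: "0 < P" using Pl R by linarith
  have "\<bar>(1 - c) * (r\<^sup>2)\<^sup>2\<bar> \<le> d\<^sup>2 * r\<^sup>2"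
  proof -
    have "\<bar>(1 - c) * (r\<^sup>2)\<^sup>2\<bar> = (1 - c) * r\<^sup>2 * r\<^sup>2" using c by (simp add: power2_eq_square[of "r\<^sup>2"] abs_mult)
    also have "\<dots> \<le> d\<^sup>2 / 4 * 4 * r\<^sup>2" using c1 c r4 by (intro mult_mono) auto
    finally show ?thesis by simp
  qed
  note cr = this
  have num: "\<bar>P - c * (r\<^sup>2)\<^sup>2\<bar> \<le> 7/2 * (d\<^sup>2 * r\<^sup>2)"
  proof -
    have "P - c * (r\<^sup>2)\<^sup>2 = (P - (r\<^sup>2)\<^sup>2) + (1 - c) * (r\<^sup>2)\<^sup>2" by (simp add: algebra_simps)
    with cr Pr abs_triangle_ineq[of "P - (r\<^sup>2)\<^sup>2" "(1 - c) * (r\<^sup>2)\<^sup>2"] show ?thesis by linarith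
  qed
  have "pair_kernel x y z / d\<^sup>2 + ze * zn / r^4 = (ze * zn) * ((P - c * (r\<^sup>2)\<^sup>2) / (P * (r\<^sup>2)\<^sup>2))"
    unfolding pk using Pp R by (simp add: field_simps)
  also have "\<bar>\<dots>\<bar> \<le> r\<^sup>2 * (7/2 * (d\<^sup>2 * r\<^sup>2) / (3/8 * (r\<^sup>2)\<^sup>2 * (r\<^sup>2)\<^sup>2))"
    unfolding abs_mult abs_divide using zen num Pl Pp R
    by (intro mult_mono frac_le) auto
  also have "\<dots> = 28/3 * (d\<^sup>2 / r^4)" using r0 by (simp add: field_simps)
  also have "\<dots> \<le> 10 * (d\<^sup>2 / r^4)" by (intro mult_right_mono) auto
  finally show ?thesis by (simp add: ez)
qed

lemma integral_weighted_bound: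
  fixes f g :: "'a \<Rightarrow> real"
  assumes w: "\<omega> \<in> borel_measurable M" "AE z in M. \<bar>\<omega> z\<bar> \<le> 1" and f: "f \<in> borel_measurable M"
    and fg: "\<And>z. z \<in> space M \<Longrightarrow> \<bar>f z\<bar> \<le> g z" and g: "(\<integral>\<^sup>+z. ennreal (g z) \<partial>M) \<le> ennreal C" "0 \<le> C"
  shows "integrable M (\<lambda>z. \<omega> z * f z)" "\<bar>\<integral>z. \<omega> z * f z \<partial>M\<bar> \<le> C"
proof -
  have m: "(\<lambda>z. \<omega> z * f z) \<in> borel_measurable M" using w(1) f by measurable
  have "(\<integral>\<^sup>+z. ennreal (norm (\<omega> z * f z)) \<partial>M) \<le> (\<integral>\<^sup>+z. ennreal (g z) \<partial>M)"
    using w(2) AE_space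
  proof (intro nn_integral_mono_AE, eventually_elim)
    fix z assume z: "\<bar>\<omega> z\<bar> \<le> 1" "z \<in> space M"
    have "\<bar>\<omega> z\<bar> * \<bar>f z\<bar> \<le> 1 * g z" using z fg[OF z(2)] by (intro mult_mono) auto
    then show "ennreal (norm (\<omega> z * f z)) \<le> ennreal (g z)" by (simp add: abs_mult ennreal_leI)
  qed
  then have "(\<integral>\<^sup>+z. ennreal (norm (\<omega> z * f z)) \<partial>M) \<le> ennreal C" using g(1) by (rule order_trans)
  from integrable_norm_bound[OF m this g(2)]
  show "integrable M (\<lambda>z. \<omega> z * f z)" "\<bar>\<integral>z. \<omega> z * f z \<partial>M\<bar> \<le> C" by auto
qed

text \<open>Leading part of \<open>pair_kernel\<close> for a pair with midpoint direction \<open>m\<close>, separated in the direction \<open>e\<close>.\<close>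
definition quadrupole :: "real^3 \<Rightarrow> real^3 \<Rightarrow> real^3 \<Rightarrow> real^3 \<Rightarrow> real" where
  "quadrupole e n m z = (z \<bullet> e) * (z \<bullet> n) / (norm (z - m))^4"

lemma quadrupole_measurable [measurable]: "quadrupole e n m \<in> borel_measurable sph_measure"
  unfolding quadrupole_def[abs_def] by measurable

lemma abs_quadrupole_le:
  assumes "frame3 e n m" shows "\<bar>quadrupole e n m z\<bar> \<le> 1 / (norm (z - m))\<^sup>2"
proof -
  have "\<bar>z \<bullet> e\<bar> * \<bar>z \<bullet> n\<bar> \<le> (norm (z - m))\<^sup>2"
    using frame3_comp_le[OF assms, of z] unfolding power2_eq_square by (intro mult_mono) auto
  then have "\<bar>quadrupole e n m z\<bar> \<le> (norm (z - m))\<^sup>2 / (norm (z - m))^4"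
    unfolding quadrupole_def abs_divide abs_mult by (simp add: divide_right_mono)
  also have "\<dots> = 1 / (norm (z - m))\<^sup>2" by (simp add: power2_eq_square power4_eq_xxxx)
  finally show ?thesis .
qed

lemma quadrupole_far:
  assumes fr: "frame3 e n m" and r: "0 < \<rho>" "\<rho> \<le> 2" and w: "\<omega> \<in> borel_measurable sph_measure" "AE z in sph_measure. \<bar>\<omega> z\<bar> \<le> 1"
    and A: "A \<in> sets borel" "A \<subseteq> {\<rho>..}"
  shows "integrable sph_measure (\<lambda>z. \<omega> z * (indicator A (norm (z - m)) * quadrupole e n m z))"
     "\<bar>\<integral>z. \<omega> z * (indicator A (norm (z - m)) * quadrupole e n m z) \<partial>sph_measure\<bar> \<le> 2 * ln (2 / \<rho>)"
proof -
  have m: "(\<lambda>z. indicator A (norm (z - m)) * quadrupole e n m z) \<in> borel_measurable sph_measure" using A(1) by measurable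
  have b: "\<bar>indicator A (norm (z - m)) * quadrupole e n m z\<bar> \<le> \<bar>(z \<bullet> e) * (z \<bullet> n)\<bar> * (indicator {\<rho>..} (norm (z - m)) / (norm (z - m))^4)" for z
    using A(2) by (auto simp: quadrupole_def indicator_def abs_mult)
  have "0 \<le> 2 * ln (2 / \<rho>)" using r by simp
  from integral_weighted_bound[OF w m b nn_integral_sph_quadrupole_far[OF fr r] this]
  show "integrable sph_measure (\<lambda>z. \<omega> z * (indicator A (norm (z - m)) * quadrupole e n m z))"
     "\<bar>\<integral>z. \<omega> z * (indicator A (norm (z - m)) * quadrupole e n m z) \<partial>sph_measure\<bar> \<le> 2 * ln (2 / \<rho>)" by auto
qed

text \<open>The kernel is split at the distances \<open>2 * d\<close> and \<open>\<delta>\<close>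
  from the midpoint. Only the annulus in between, where cancellation can be exploited, is kept as an
  integral; the inner disc and the approximation error contribute constants, the outside contributes
  the logarithm.\<close>

lemma pair_velocity_estimate:
  assumes fr: "frame3 e (cross3 m e) m" and c: "0 < c" "c \<le> 1" "c\<^sup>2 = 1 - d\<^sup>2 / 4"
    and xe: "x = c *\<^sub>R m + (d / 2) *\<^sub>R e" and ye: "y = c *\<^sub>R m - (d / 2) *\<^sub>R e"
    and x: "x \<in> S2" and y: "y \<in> S2"
    and d: "0 < d" "d \<le> 1" "2 * d \<le> \<delta>" "\<delta> \<le> 2"
    and w: "\<omega> \<in> borel_measurable sph_measure" "AE z in sph_measure. \<bar>\<omega> z\<bar> \<le> 1"
  shows "\<bar>(x - y) \<bullet> (velocity \<omega> x - velocity \<omega> y)\<bar> \<le> d\<^sup>2 * (2 / pi * ln (2 / \<delta>) + 9 +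
     \<bar>\<integral>z. \<omega> z * (indicator {2 * d..<\<delta>} (norm (z - m)) * quadrupole e (cross3 m e) m z) \<partial>sph_measure\<bar>)"
proof -
  let ?n = "cross3 m e"
  let ?G = "quadrupole e ?n m"
  let ?r = "\<lambda>z. norm (z - m)"
  have nn: "norm m = 1" "norm e = 1" "m \<bullet> e = 0" "e \<bullet> m = 0" using fr by (auto simp: frame3_def inner_commute)
  have mS: "m \<in> S2" using nn by (simp add: S2_def)
  have dxy: "norm (x - y) = d" using d nn by (simp add: xe ye scaleR_add_left[symmetric])
  let ?N = "\<lambda>z. pair_kernel x y z / d\<^sup>2"
  \<comment> \<open>\<open>I1\<close> is the disc around the pair, \<open>I2\<close> the error of
    the quadrupole approximation, \<open>I3\<close> the annulus kept in the statement and
    \<open>I4\<close> the far field; \<open>pair_kernel\<close> is \<open>d^2\<close> times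
    \<open>I1 + I2 - I3 - I4\<close>.\<close>
  define I1 where "I1 z = indicator {..<2 * d} (?r z) * ?N z" for z
  define I2 where "I2 z = indicator {2 * d..} (?r z) * (?N z + ?G z)" for z
  define I3 where "I3 z = indicator {2 * d..<\<delta>} (?r z) * ?G z" for z
  define I4 where "I4 z = indicator {\<delta>..} (?r z) * ?G z" for z
  have mI [measurable]: "I1 \<in> borel_measurable sph_measure" "I2 \<in> borel_measurable sph_measure"
    unfolding I1_def[abs_def] I2_def[abs_def] by measurable
  have mx: "norm (x - m) \<le> d" "norm (y - m) \<le> d"
  proof -
    have c1: "1 - c \<le> d\<^sup>2 / 4" using c mult_mono[of c 1 c c] by (simp add: power2_eq_square)
    have "x \<bullet> m = c" "y \<bullet> m = c" using nn by (simp_all add: xe ye inner_add_left inner_diff_left norm_eq_1)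
    then have "(norm (x - m))\<^sup>2 \<le> d\<^sup>2" "(norm (y - m))\<^sup>2 \<le> d\<^sup>2"
      unfolding norm_sph_diff[OF x mS] norm_sph_diff[OF y mS] using c1 zero_le_power2[of d] by linarith+
    then show "norm (x - m) \<le> d" "norm (y - m) \<le> d" using d by (auto intro: power2_le_imp_le)
  qed
  have 1: "integrable sph_measure (\<lambda>z. \<omega> z * I1 z)" "\<bar>\<integral>z. \<omega> z * I1 z \<partial>sph_measure\<bar> \<le> 6 * pi"
  proof -
    \<comment> \<open>The disc of radius \<open>2 * d\<close> about \<open>m\<close> lies in the
      discs of radius \<open>3 * d\<close> about \<open>x\<close> and \<open>y\<close>, over which
      the inverse distances integrate to at most \<open>6 * pi * d\<close> each.\<close>
    let ?h = "\<lambda>a z. indicator {..<3 * d} (norm (z - a)) / norm (z - a)"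
    have b: "\<bar>I1 z\<bar> \<le> 1 / (2 * d) * (?h x z + ?h y z)" if "z \<in> space sph_measure" for z
    proof (cases "?r z < 2 * d")
      case True
      have "norm (z - x) < 3 * d" "norm (z - y) < 3 * d"
        using True mx norm_triangle_ineq[of "z - m" "m - x"] norm_triangle_ineq[of "z - m" "m - y"]
        by (simp_all add: norm_minus_commute)
      moreover have "\<bar>pair_kernel x y z\<bar> / d\<^sup>2 \<le> d / 2 * (1 / norm (z - x) + 1 / norm (z - y)) / d\<^sup>2"
        using abs_pair_kernel_le[OF x y, of z] that by (intro divide_right_mono) (auto simp: dxy)
      ultimately show ?thesis using True d by (simp add: I1_def power2_eq_square field_simps)
    qed (use d in \<open>auto simp: I1_def indicator_def\<close>)
    have "(\<integral>\<^sup>+z. ennreal (1 / (2 * d) * (?h x z + ?h y z)) \<partial>sph_measure)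
      = ennreal (1 / (2 * d)) * ((\<integral>\<^sup>+z. ennreal (?h x z) \<partial>sph_measure) + (\<integral>\<^sup>+z. ennreal (?h y z) \<partial>sph_measure))"
    proof -
      have "(\<integral>\<^sup>+z. ennreal (1 / (2 * d) * (?h x z + ?h y z)) \<partial>sph_measure) = (\<integral>\<^sup>+z. ennreal (1 / (2 * d)) * (ennreal (?h x z) + ennreal (?h y z)) \<partial>sph_measure)"
        using d by (intro nn_integral_cong) (subst ennreal_mult, auto simp: ennreal_plus)
      also have "\<dots> = ennreal (1 / (2 * d)) * (\<integral>\<^sup>+z. ennreal (?h x z) + ennreal (?h y z) \<partial>sph_measure)"
        by (rule nn_integral_cmult) measurable
      also have "(\<integral>\<^sup>+z. ennreal (?h x z) + ennreal (?h y z) \<partial>sph_measure) = (\<integral>\<^sup>+z. ennreal (?h x z) \<partial>sph_measure) + (\<integral>\<^sup>+z. ennreal (?h y z) \<partial>sph_measure)"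
        by (rule nn_integral_add) measurable
      finally show ?thesis .
    qed
    also have "\<dots> \<le> ennreal (1 / (2 * d)) * (ennreal (2 * pi * (3 * d)) + ennreal (2 * pi * (3 * d)))"
      using d by (intro mult_left_mono add_mono nn_integral_sph_inverse_near x y) auto
    also have "\<dots> = ennreal (1 / (2 * d) * (2 * pi * (3 * d) + 2 * pi * (3 * d)))"
      using d by (subst ennreal_plus[symmetric]) (auto simp: ennreal_mult[symmetric])
    also have "1 / (2 * d) * (2 * pi * (3 * d) + 2 * pi * (3 * d)) = 6 * pi" using d by (simp add: field_simps)
    finally have g: "(\<integral>\<^sup>+z. ennreal (1 / (2 * d) * (?h x z + ?h y z)) \<partial>sph_measure) \<le> ennreal (6 * pi)" .
    show "integrable sph_measure (\<lambda>z. \<omega> z * I1 z)" "\<bar>\<integral>z. \<omega> z * I1 z \<partial>sph_measure\<bar> \<le> 6 * pi"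
      using integral_weighted_bound[OF w mI(1) b g] by auto
  qed
  have 2: "integrable sph_measure (\<lambda>z. \<omega> z * I2 z)" "\<bar>\<integral>z. \<omega> z * I2 z \<partial>sph_measure\<bar> \<le> 5/2 * pi"
  proof -
    let ?h = "\<lambda>z. 10 * d\<^sup>2 * (indicator {2 * d..} (?r z) / (?r z)^4)"
    have b: "\<bar>I2 z\<bar> \<le> ?h z" if "z \<in> space sph_measure" for z
    proof (cases "2 * d \<le> ?r z")
      case True
      then show ?thesis using pair_kernel_quadrupole[OF fr c xe ye d(1,2) _ refl True] that
        by (simp add: I2_def quadrupole_def)
    qed (auto simp: I2_def)
    have "(\<integral>\<^sup>+z. ennreal (?h z) \<partial>sph_measure) = ennreal (10 * d\<^sup>2) * (\<integral>\<^sup>+z. ennreal (indicator {2 * d..} (?r z) / (?r z)^4) \<partial>sph_measure)"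
    proof -
      have "ennreal (?h z) = ennreal (10 * d\<^sup>2) * ennreal (indicator {2 * d..} (?r z) / (?r z)^4)" for z
        by (rule ennreal_mult') simp
      then show ?thesis by (simp only:) (rule nn_integral_cmult, measurable)
    qed
    also have "\<dots> \<le> ennreal (10 * d\<^sup>2) * ennreal (pi / (2 * d)\<^sup>2)"
      using d by (intro mult_left_mono nn_integral_sph_inverse_fourth_far mS) auto
    also have "\<dots> = ennreal (5/2 * pi)"
      using d by (subst ennreal_mult[symmetric]) (auto simp: power_mult_distrib)
    finally have g: "(\<integral>\<^sup>+z. ennreal (?h z) \<partial>sph_measure) \<le> ennreal (5/2 * pi)" .
    show "integrable sph_measure (\<lambda>z. \<omega> z * I2 z)" "\<bar>\<integral>z. \<omega> z * I2 z \<partial>sph_measure\<bar> \<le> 5/2 * pi"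
      using integral_weighted_bound[OF w mI(2) b g] by auto
  qed
  have 3: "integrable sph_measure (\<lambda>z. \<omega> z * I3 z)"
    unfolding I3_def by (rule quadrupole_far(1)[OF fr _ _ w, of "2 * d"]) (use d in auto)
  have 4: "integrable sph_measure (\<lambda>z. \<omega> z * I4 z)" "\<bar>\<integral>z. \<omega> z * I4 z \<partial>sph_measure\<bar> \<le> 2 * ln (2 / \<delta>)"
    unfolding I4_def using quadrupole_far[OF fr _ _ w, of \<delta> "{\<delta>..}"] d by auto
  have "\<omega> z * pair_kernel x y z = d\<^sup>2 * (\<omega> z * I1 z + \<omega> z * I2 z - \<omega> z * I3 z - \<omega> z * I4 z)" for z
    using d by (auto simp: I1_def I2_def I3_def I4_def indicator_def field_simps)
  then have "(\<integral>z. \<omega> z * pair_kernel x y z \<partial>sph_measure) = d\<^sup>2 * ((\<integral>z. \<omega> z * I1 z \<partial>sph_measure) + (\<integral>z. \<omega> z * I2 z \<partial>sph_measure)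
      - (\<integral>z. \<omega> z * I3 z \<partial>sph_measure) - (\<integral>z. \<omega> z * I4 z \<partial>sph_measure))" using 1 2 3 4 by simp
  then have "\<bar>\<integral>z. \<omega> z * pair_kernel x y z \<partial>sph_measure\<bar> = d\<^sup>2 * \<bar>(\<integral>z. \<omega> z * I1 z \<partial>sph_measure) + (\<integral>z. \<omega> z * I2 z \<partial>sph_measure)
      - (\<integral>z. \<omega> z * I3 z \<partial>sph_measure) - (\<integral>z. \<omega> z * I4 z \<partial>sph_measure)\<bar>" by (simp add: abs_mult)
  also have "\<dots> \<le> d\<^sup>2 * (6 * pi + 5/2 * pi + \<bar>\<integral>z. \<omega> z * I3 z \<partial>sph_measure\<bar> + 2 * ln (2 / \<delta>))"
    using 1 2 4 by (intro mult_left_mono) auto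
  finally have *: "\<bar>\<integral>z. \<omega> z * pair_kernel x y z \<partial>sph_measure\<bar> \<le> d\<^sup>2 * (6 * pi + 5/2 * pi + \<bar>\<integral>z. \<omega> z * I3 z \<partial>sph_measure\<bar> + 2 * ln (2 / \<delta>))" .
  have "\<bar>(x - y) \<bullet> (velocity \<omega> x - velocity \<omega> y)\<bar> = 1 / pi * \<bar>\<integral>z. \<omega> z * pair_kernel x y z \<partial>sph_measure\<bar>"
    unfolding pair_velocity[OF x y w] abs_mult by simp
  also have "\<dots> \<le> 1 / pi * (d\<^sup>2 * (6 * pi + 5/2 * pi + \<bar>\<integral>z. \<omega> z * I3 z \<partial>sph_measure\<bar> + 2 * ln (2 / \<delta>)))"
    by (intro mult_left_mono *) auto
  also have "\<dots> = d\<^sup>2 * (2 / pi * ln (2 / \<delta>) + 17/2 + 1 / pi * \<bar>\<integral>z. \<omega> z * I3 z \<partial>sph_measure\<bar>)"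
    by (simp add: field_simps)
  \<comment> \<open>\<open>17/2\<close> is \<open>6 + 5/2\<close>, the share of \<open>I1\<close>
    and \<open>I2\<close> after division by \<open>pi\<close>.\<close>
  also have "\<dots> \<le> d\<^sup>2 * (2 / pi * ln (2 / \<delta>) + 9 + 1 * \<bar>\<integral>z. \<omega> z * I3 z \<partial>sph_measure\<bar>)"
    using pi_ge_two by (intro mult_left_mono add_mono mult_right_mono) auto
  finally show ?thesis unfolding I3_def by simp
qed

section \<open>Rotations and the divergence\<close>

text \<open>Rotation about the unit axis \<open>k\<close> (Rodrigues' formula).\<close>
definition rot3 :: "real^3 \<Rightarrow> real \<Rightarrow> real^3 \<Rightarrow> real^3" where
  "rot3 k s x = cos s *\<^sub>R x + sin s *\<^sub>R cross3 k x + ((1 - cos s) * (k \<bullet> x)) *\<^sub>R k"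

lemma orthogonal_transformation_rot3:
  assumes k: "norm k = 1" shows "orthogonal_transformation (rot3 k s)"
  unfolding orthogonal_transformation
proof (intro conjI allI)
  show "linear (rot3 k s)"
    by (rule linearI) (simp_all add: rot3_def cross_add_right cross_mult_right inner_add_right vec_eq_iff algebra_simps)
  fix x
  have kk: "k \<bullet> k = 1" using k by (simp add: norm_eq_1)
  have kx: "cross3 k x \<bullet> cross3 k x = x \<bullet> x - (k \<bullet> x)\<^sup>2"
    using norm_cross[of k x] k by (simp add: power2_norm_eq_inner)
  have z: "x \<bullet> cross3 k x = 0" "cross3 k x \<bullet> x = 0" "k \<bullet> cross3 k x = 0" "cross3 k x \<bullet> k = 0"
    by (simp_all add: dot_cross_self)
  have "rot3 k s x \<bullet> rot3 k s x = (cos s)\<^sup>2 * (x \<bullet> x) + (sin s)\<^sup>2 * (x \<bullet> x - (k \<bullet> x)\<^sup>2) + (1 - (cos s)\<^sup>2) * (k \<bullet> x)\<^sup>2"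
    unfolding rot3_def by (simp add: inner_add_left inner_add_right kx kk z inner_commute[of x k]) (simp add: power2_eq_square algebra_simps)
  also have "\<dots> = x \<bullet> x" unfolding sin_squared_eq by (simp add: algebra_simps)
  finally show "norm (rot3 k s x) = norm x" by (simp add: norm_eq_sqrt_inner)
qed

lemma rot3_0 [simp]: "rot3 k 0 x = x" by (simp add: rot3_def)

lemma cross3_rot3:
  assumes "norm k = 1"
  shows "cross3 k (rot3 k s x) = cos s *\<^sub>R cross3 k x + sin s *\<^sub>R ((k \<bullet> x) *\<^sub>R k - x)"
  using assms by (simp add: rot3_def cross_add_right cross_mult_right Lagrange norm_eq_1)

lemma rot3_inverse:
  assumes k: "norm k = 1" shows "rot3 k (- s) (rot3 k s x) = x"
proof -
  have kk: "k \<bullet> k = 1" using k by (simp add: norm_eq_1)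
  have kr: "k \<bullet> rot3 k s x = k \<bullet> x"
    by (simp add: rot3_def inner_add_right dot_cross_self kk algebra_simps)
  have "rot3 k (- s) (rot3 k s x) = cos s *\<^sub>R rot3 k s x - sin s *\<^sub>R cross3 k (rot3 k s x) + ((1 - cos s) * (k \<bullet> x)) *\<^sub>R k"
    by (simp add: rot3_def[of k "- s"] kr)
  also have "\<dots> = ((cos s)\<^sup>2 + (sin s)\<^sup>2) *\<^sub>R x + ((cos s * (1 - cos s) - (sin s)\<^sup>2 + (1 - cos s)) * (k \<bullet> x)) *\<^sub>R k"
    unfolding cross3_rot3[OF k] by (simp add: rot3_def vec_eq_iff algebra_simps power2_eq_square
         del: sin_cos_squared_add sin_cos_squared_add2 sin_cos_squared_add3)
  also have "cos s * (1 - cos s) - (sin s)\<^sup>2 + (1 - cos s) = 0"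
    unfolding sin_squared_eq by (simp add: power2_eq_square algebra_simps)
  finally show ?thesis by simp
qed

lemma rot3_has_vector_derivative:
  assumes k: "norm k = 1"
  shows "((\<lambda>s. rot3 k s x) has_vector_derivative cross3 k (rot3 k s x)) (at s)"
proof -
  have "((\<lambda>s. rot3 k s x) has_vector_derivative - sin s *\<^sub>R x + cos s *\<^sub>R cross3 k x + (sin s * (k \<bullet> x)) *\<^sub>R k) (at s)"
    unfolding rot3_def by (auto intro!: derivative_eq_intros simp: has_real_derivative_iff_has_vector_derivative[symmetric])
  moreover have "- sin s *\<^sub>R x + cos s *\<^sub>R cross3 k x + (sin s * (k \<bullet> x)) *\<^sub>R k = cross3 k (rot3 k s x)"
    unfolding cross3_rot3[OF k] by (simp add: algebra_simps)
  ultimately show ?thesis by simp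
qed

lemma norm_rot3:
  assumes "norm k = 1" shows "norm (rot3 k s x) = norm x"
  using orthogonal_transformation_rot3[OF assms, of s] by (simp add: orthogonal_transformation)

lemma norm_rot3_diff_le:
  assumes k: "norm k = 1" shows "norm (rot3 k s x - x) \<le> \<bar>s\<bar> * norm x"
proof -
  have *: "norm (rot3 k t x - rot3 k 0 x) \<le> norm x * norm (t - 0)" for t
  proof (rule differentiable_bound[where S=UNIV and f'="\<lambda>t h. h *\<^sub>R cross3 k (rot3 k t x)"])
    fix u :: real
    show "((\<lambda>s. rot3 k s x) has_derivative (\<lambda>h. h *\<^sub>R cross3 k (rot3 k u x))) (at u within UNIV)"
      using rot3_has_vector_derivative[OF k] by (simp add: has_vector_derivative_def)
    have "norm (cross3 k (rot3 k u x)) \<le> norm x"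
    proof -
      have "(norm (cross3 k (rot3 k u x)))\<^sup>2 \<le> (norm x)\<^sup>2" unfolding norm_cross norm_rot3[OF k] using k by simp
      then show ?thesis by (rule power2_le_imp_le) simp
    qed
    then show "onorm (\<lambda>h. h *\<^sub>R cross3 k (rot3 k u x)) \<le> norm x"
      by (intro onorm_le) (simp add: mult.commute mult_left_mono)
  qed auto
  show ?thesis using *[of s] by (simp add: mult.commute)
qed

text \<open>The uniform bound on the derivative dominates all difference quotients, and a constant
  is an integrable majorant for a finite measure. Limits run along sequences, to which dominated
  convergence applies.\<close>

lemma has_real_derivative_integral:
  fixes h h' :: "real \<Rightarrow> 'a \<Rightarrow> real"
  assumes fin: "finite_measure M"
    and h: "\<And>s. h s \<in> borel_measurable M" and h': "\<And>s. h' s \<in> borel_measurable M"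
    and i: "\<And>s. integrable M (h s)"
    and d: "\<And>s z. z \<in> space M \<Longrightarrow> ((\<lambda>s. h s z) has_real_derivative h' s z) (at s)"
    and B: "\<And>s z. z \<in> space M \<Longrightarrow> \<bar>h' s z\<bar> \<le> B"
  shows "((\<lambda>s. \<integral>z. h s z \<partial>M) has_real_derivative (\<integral>z. h' s z \<partial>M)) (at s)"
  unfolding DERIV_def tendsto_at_iff_sequentially comp_def
proof (intro allI impI)
  fix X :: "nat \<Rightarrow> real" assume X: "\<forall>i. X i \<in> UNIV - {0}" "X \<longlonglongrightarrow> 0"
  interpret finite_measure M by (rule fin)
  have lip: "\<bar>h (s + t) z - h s z\<bar> \<le> B * \<bar>t\<bar>" if "z \<in> space M" for t z
    using field_differentiable_bound[where S=UNIV and f="\<lambda>s. h s z" and f'="\<lambda>s. h' s z" and B=B and x="s + t" and y=s] d[OF that] B[OF that]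
    by auto
  have "(\<lambda>i. \<integral>z. (h (s + X i) z - h s z) / X i \<partial>M) \<longlonglongrightarrow> (\<integral>z. h' s z \<partial>M)"
  proof (rule integral_dominated_convergence[where w="\<lambda>_. B"])
    show "AE z in M. (\<lambda>i. (h (s + X i) z - h s z) / X i) \<longlonglongrightarrow> h' s z"
    proof (rule AE_I2)
      fix z assume "z \<in> space M"
      then have "((\<lambda>t. (h (s + t) z - h s z) / t) \<longlongrightarrow> h' s z) (at 0)" using d by (simp add: DERIV_def)
      then show "(\<lambda>i. (h (s + X i) z - h s z) / X i) \<longlonglongrightarrow> h' s z"
        using X unfolding tendsto_at_iff_sequentially comp_def by blast
    qed
    fix i
    show "AE z in M. norm ((h (s + X i) z - h s z) / X i) \<le> B"
    proof (rule AE_I2)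
      fix z assume "z \<in> space M"
      from lip[OF this, of "X i"] show "norm ((h (s + X i) z - h s z) / X i) \<le> B"
        using X by (simp add: divide_le_eq)
    qed
  qed (use h h' in \<open>auto intro: borel_measurable_divide borel_measurable_diff\<close>)
  moreover have e: "(\<integral>z. (h (s + X j) z - h s z) / X j \<partial>M) = ((\<integral>z. h (s + X j) z \<partial>M) - (\<integral>z. h s z \<partial>M)) / X j" for j
    using i by simp
  ultimately show "(\<lambda>j. ((\<integral>z. h (s + X j) z \<partial>M) - (\<integral>z. h s z \<partial>M)) / X j) \<longlonglongrightarrow> (\<integral>z. h' s z \<partial>M)" by (simp only: e)
qed

section \<open>Test fields and the spherical divergence\<close>

lemma test_fieldI:
  assumes d: "\<And>x. (X has_derivative X' x) (at x)" and c: "\<And>v. continuous_on UNIV (\<lambda>x. X' x v)"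
    and t: "\<And>x. x \<in> S2 \<Longrightarrow> X x \<bullet> x = 0" and K: "compact K" "K \<subseteq> U" "\<And>x. x \<in> S2 - K \<Longrightarrow> X x = 0"
  shows "test_field U X"
proof -
  have "frechet_derivative X (at x) = X' x" for x using frechet_derivative_at[OF d] by simp
  then show ?thesis unfolding test_field_def using d c t K by (auto simp: differentiable_def)
qed

lemma test_fieldD:
  assumes "test_field U X"
  shows "(X has_derivative frechet_derivative X (at x)) (at x)" "continuous_on UNIV (\<lambda>x. frechet_derivative X (at x) v)"
    "continuous_on UNIV X" "x \<in> S2 \<Longrightarrow> X x \<bullet> x = 0"
  using assms unfolding test_field_def
  by (auto simp: frechet_derivative_works continuous_on_eq_continuous_at intro: differentiable_imp_continuous_within)

lemma sph_div_eq:
  assumes "(X has_derivative X') (at x)"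
  shows "sph_div X x = (\<Sum>b\<in>Basis. X' b \<bullet> b) - X' x \<bullet> x"
  using frechet_derivative_at[OF assms] by (simp add: sph_div_def)

lemma sum_Basis_real3: "(\<Sum>b\<in>(Basis :: (real^3) set). f b) = f (axis 1 1) + f (axis 2 1) + f (axis 3 1)"
proof -
  have "(axis 1 1 :: real^3) \<noteq> axis 2 1" "(axis 1 1 :: real^3) \<noteq> axis 3 1" "(axis 2 1 :: real^3) \<noteq> axis 3 1"
    by (simp_all add: axis_eq_axis)
  then show ?thesis by (simp add: Basis_real3 add.assoc)
qed

text \<open>The rotation fields \<open>b \<times> x\<close> are divergence free and \<open>X = (\<Sum>b. (X \<bullet> (b \<times> x)) (b \<times> x))\<close> for
  tangential \<open>X\<close>, so the divergence is a sum of derivatives along rotations.\<close>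
lemma sph_div_rotations:
  assumes X: "(X has_derivative X') (at x)" and x: "x \<in> S2"
  shows "sph_div X x = (\<Sum>b\<in>Basis. X' (cross3 b x) \<bullet> cross3 b x + X x \<bullet> cross3 b (cross3 b x)) + 2 * (X x \<bullet> x)"
proof -
  have lin: "linear X'" using X by (simp add: has_derivative_linear)
  have xx: "x$1 * x$1 + x$2 * x$2 + x$3 * x$3 = 1"
    using x by (simp add: S2_def norm_eq_1 inner_vec_def sum_3)
  have xe: "x = x$1 *\<^sub>R axis 1 1 + x$2 *\<^sub>R axis 2 1 + x$3 *\<^sub>R axis 3 1"
    by (simp add: vec_eq_iff forall_3 axis_def)
  have cr: "cross3 (axis 1 1) x = x$2 *\<^sub>R axis 3 1 - x$3 *\<^sub>R axis 2 1"
    "cross3 (axis 2 1) x = x$3 *\<^sub>R axis 1 1 - x$1 *\<^sub>R axis 3 1"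
    "cross3 (axis 3 1) x = x$1 *\<^sub>R axis 2 1 - x$2 *\<^sub>R axis 1 1"
    by (simp_all add: vec_eq_iff forall_3 axis_def cross_components)
  define a b c where "a = X' (axis 1 1)" "b = X' (axis 2 1)" "c = X' (axis 3 1)"
  have Xx: "X' x = x$1 *\<^sub>R a + x$2 *\<^sub>R b + x$3 *\<^sub>R c"
    by (subst xe) (simp add: linear_add[OF lin] linear_scale[OF lin] a_b_c_def)
  have Xc: "X' (cross3 (axis 1 1) x) = x$2 *\<^sub>R c - x$3 *\<^sub>R b"
    "X' (cross3 (axis 2 1) x) = x$3 *\<^sub>R a - x$1 *\<^sub>R c"
    "X' (cross3 (axis 3 1) x) = x$1 *\<^sub>R b - x$2 *\<^sub>R a"
    by (simp_all add: cr linear_diff[OF lin] linear_scale[OF lin] a_b_c_def)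
  \<comment> \<open>The vectors \<open>cross3 b x\<close>, tensored with themselves and summed over
    the basis, give \<open>norm x ^ 2\<close> times the projection to the tangent plane, so this sum
    is the tangential trace of the derivative.\<close>
  have t: "(\<Sum>b\<in>Basis. X' (cross3 b x) \<bullet> cross3 b x) = (x$1 * x$1 + x$2 * x$2 + x$3 * x$3) * (a$1 + b$2 + c$3) - X' x \<bullet> x"
    unfolding sum_Basis_real3 Xc Xx by (simp add: inner_vec_def sum_3 cross_components axis_def algebra_simps)
  \<comment> \<open>\<open>cross3 b (cross3 b x)\<close> sums to \<open>- 2 * x\<close> over the
    basis; the last term of the statement compensates for it.\<close>
  have q: "(\<Sum>b\<in>Basis. X x \<bullet> cross3 b (cross3 b x)) = - 2 * (X x \<bullet> x)"
    unfolding sum_Basis_real3 by (simp add: inner_vec_def sum_3 cross_components axis_def algebra_simps)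
  show ?thesis unfolding sph_div_eq[OF X] sum.distrib q t xx
    by (simp add: sum_Basis_real3 a_b_c_def[symmetric] inner_axis)
qed

section \<open>Cancellation on annuli\<close>

lemma borel_measurable_sgn_real [measurable]:
  assumes [measurable]: "f \<in> borel_measurable M" shows "(\<lambda>x. sgn (f x :: real)) \<in> borel_measurable M"
proof -
  have "(\<lambda>x. sgn (f x)) = (\<lambda>x. indicator {0<..} (f x) - indicator {..<0} (f x))"
    by (auto simp: fun_eq_iff sgn_if indicator_def)
  then show ?thesis by simp
qed

lemma integral_sph_odd_eq_0:
  fixes g :: "real^3 \<Rightarrow> real"
  assumes R: "orthogonal_transformation R" and g: "g \<in> borel_measurable sph_measure"
    and odd: "\<And>z. g (R z) = - g z"
  shows "(\<integral>z. g z \<partial>sph_measure) = 0"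
  using integral_sph_orthogonal[OF R g] unfolding odd by simp

lemma orthogonal_transformation_hyperplane_reflection:
  fixes e :: "real^3"
  assumes "norm e = 1" shows "orthogonal_transformation (\<lambda>z. z - (2 * (z \<bullet> e)) *\<^sub>R e)"
  unfolding orthogonal_transformation
proof (intro conjI allI)
  show "linear (\<lambda>z. z - (2 * (z \<bullet> e)) *\<^sub>R e)"
    by (rule linearI) (simp_all add: inner_add_left vec_eq_iff algebra_simps)
  fix z
  have "(z - (2 * (z \<bullet> e)) *\<^sub>R e) \<bullet> (z - (2 * (z \<bullet> e)) *\<^sub>R e) = z \<bullet> z"
    using assms by (simp add: inner_diff_left inner_diff_right norm_eq_1 inner_commute[of e z])
  then show "norm (z - (2 * (z \<bullet> e)) *\<^sub>R e) = norm z" by (simp add: norm_eq_sqrt_inner)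
qed

lemma orthogonal_transformation_axis_reflection:
  fixes m :: "real^3"
  assumes "norm m = 1" shows "orthogonal_transformation (\<lambda>z. (2 * (z \<bullet> m)) *\<^sub>R m - z)"
  unfolding orthogonal_transformation
proof (intro conjI allI)
  show "linear (\<lambda>z. (2 * (z \<bullet> m)) *\<^sub>R m - z)"
    by (rule linearI) (simp_all add: inner_add_left vec_eq_iff algebra_simps)
  show "norm ((2 * (z \<bullet> m)) *\<^sub>R m - z) = norm z" for z
    using orthogonal_transformation_hyperplane_reflection[OF assms]
    by (simp add: orthogonal_transformation norm_minus_commute)
qed

text \<open>Reflection in the plane orthogonal to \<open>e\<close> fixes \<open>m\<close>, keeps
  distances to it and changes the sign of exactly one factor of the quadrupole.\<close>

lemma integral_annulus_quadrupole:
  assumes fr: "frame3 e n m" and A: "A \<in> sets borel"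
  shows "(\<integral>z. indicator A (norm (z - m)) * quadrupole e n m z \<partial>sph_measure) = 0"
proof -
  let ?R = "\<lambda>z. z - (2 * (z \<bullet> e)) *\<^sub>R e"
  have o: "orthogonal_transformation ?R" using fr by (intro orthogonal_transformation_hyperplane_reflection) (simp add: frame3_def)
  have f: "m \<bullet> e = 0" "e \<bullet> e = 1" "e \<bullet> n = 0" using fr by (simp_all add: frame3_def inner_commute norm_eq_1)
  have eq: "?R z - m = ?R (z - m)" for z by (simp add: f inner_diff_left)
  have on: "norm (?R z) = norm z" for z using o unfolding orthogonal_transformation by blast
  have nr: "norm (?R z - m) = norm (z - m)" for z unfolding eq by (rule on)
  have q: "quadrupole e n m (?R z) = - quadrupole e n m z" for z
    unfolding quadrupole_def nr by (simp add: inner_diff_left f)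
  have m: "(\<lambda>z. indicator A (norm (z - m)) * quadrupole e n m z) \<in> borel_measurable sph_measure" using A by measurable
  show ?thesis by (rule integral_sph_odd_eq_0[OF o m]) (simp add: q nr)
qed

text \<open>The half turn about \<open>m\<close> changes the sign of both factors of the quadrupole,
  which is therefore even, whereas \<open>q \<bullet> z\<close> is odd because \<open>q\<close> is
  orthogonal to \<open>m\<close>.\<close>

lemma integral_annulus_quadrupole_sgn:
  assumes fr: "frame3 e n m" and A: "A \<in> sets borel" and q: "q \<bullet> m = 0"
  shows "(\<integral>z. sgn (q \<bullet> z) * (indicator A (norm (z - m)) * quadrupole e n m z) \<partial>sph_measure) = 0"
proof -
  let ?R = "\<lambda>z. (2 * (z \<bullet> m)) *\<^sub>R m - z"
  have o: "orthogonal_transformation ?R" using fr by (intro orthogonal_transformation_axis_reflection) (simp add: frame3_def)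
  have f: "m \<bullet> e = 0" "m \<bullet> m = 1" "m \<bullet> n = 0" using fr by (simp_all add: frame3_def inner_commute norm_eq_1)
  have eq: "?R z - m = ?R (z - m)" for z by (simp add: f inner_diff_left vec_eq_iff algebra_simps)
  have on: "norm (?R z) = norm z" for z using o unfolding orthogonal_transformation by blast
  have nr: "norm (?R z - m) = norm (z - m)" for z unfolding eq by (rule on)
  have Q: "quadrupole e n m (?R z) = quadrupole e n m z" for z
    unfolding quadrupole_def nr by (simp add: inner_diff_left f)
  have s: "sgn (q \<bullet> ?R z) = - sgn (q \<bullet> z)" for z by (simp add: inner_diff_right q sgn_minus)
  have m: "(\<lambda>z. sgn (q \<bullet> z) * (indicator A (norm (z - m)) * quadrupole e n m z)) \<in> borel_measurable sph_measure" using A by measurable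
  show ?thesis by (rule integral_sph_odd_eq_0[OF o m]) (simp add: Q nr s)
qed

text \<open>Compare \<open>sgn (k \<bullet> z)\<close> with the sign with respect to the component \<open>q\<close> of \<open>k\<close> orthogonal to
  \<open>m\<close>, whose contribution vanishes by symmetry: they differ only on a strip of width
  \<open>\<bar>k \<bullet> m\<bar>\<close>, outside the disc of radius \<open>\<bar>k \<bullet> m\<bar> / 2\<close>.\<close>
lemma integral_annulus_sgn_bound:
  assumes fr: "frame3 e n m" and k: "norm k = 1" and r: "0 < \<rho>" "\<delta> \<le> 1"
  shows "\<bar>\<integral>z. sgn (k \<bullet> z) * (indicator {\<rho>..<\<delta>} (norm (z - m)) * quadrupole e n m z) \<partial>sph_measure\<bar> \<le> 200"
proof (cases "\<rho> < \<delta>")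
  case False
  then show ?thesis by simp
next
  case \<rho>\<delta>: True
  let ?r = "\<lambda>z. norm (z - m)"
  let ?G = "quadrupole e n m"
  define h q where "h = k \<bullet> m" and "q = k - h *\<^sub>R m"
  have nm: "norm m = 1" using fr by (simp add: frame3_def)
  then have mS: "m \<in> S2" "m \<bullet> m = 1" by (simp_all add: S2_def norm_eq_1)
  have h1: "\<bar>h\<bar> \<le> 1" unfolding h_def using Cauchy_Schwarz_ineq2[of k m] k nm by simp
  have qm: "q \<bullet> m = 0" by (simp add: q_def h_def inner_diff_left mS)
  have q2: "(norm q)\<^sup>2 = 1 - h\<^sup>2"
    unfolding q_def power2_norm_eq_inner using k mS
    by (simp add: inner_diff_left inner_diff_right h_def[symmetric] inner_commute[of m k] norm_eq_1 power2_eq_square)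
  have "(norm q)\<^sup>2 \<le> 1\<^sup>2" unfolding q2 by simp
  then have q1: "norm q \<le> 1" by (rule power2_le_imp_le) simp
  have kz: "k \<bullet> z = h * (z \<bullet> m) + q \<bullet> z" for z
    by (simp add: q_def inner_diff_left inner_commute[of m z])
  have qz: "\<bar>q \<bullet> z\<bar> \<le> ?r z" for z
  proof -
    have "\<bar>q \<bullet> z\<bar> = \<bar>q \<bullet> (z - m)\<bar>" by (simp add: inner_diff_right qm)
    also have "\<dots> \<le> norm q * ?r z" by (rule Cauchy_Schwarz_ineq2)
    also have "\<dots> \<le> ?r z" using q1 by (simp add: mult_left_le_one_le)
    finally show ?thesis .
  qed
  let ?A = "{\<rho>..<\<delta>}"
  let ?A1 = "{\<rho>..<\<delta>} \<inter> {..<\<bar>h\<bar> / 2}" and ?A2 = "{\<rho>..<\<delta>} \<inter> {\<bar>h\<bar> / 2..}"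
  define T where "T z = (if ?r z < \<bar>h\<bar> / 2 then 0 else sgn (k \<bullet> z) - sgn (q \<bullet> z)) * (indicator ?A (?r z) * ?G z)" for z
  have mT: "T \<in> borel_measurable sph_measure" unfolding T_def[abs_def] by measurable
  \<comment> \<open>Inside the disc of radius \<open>\<bar>h\<bar> / 2\<close> the sign of
    \<open>k \<bullet> z\<close> is constant, so this part integrates to 0; outside, it is exchanged
    for the sign of \<open>q \<bullet> z\<close>, and \<open>T\<close> collects the
    difference.\<close>
  have split: "sgn (k \<bullet> z) * (indicator ?A (?r z) * ?G z) =
     sgn h * (indicator ?A1 (?r z) * ?G z) + sgn (q \<bullet> z) * (indicator ?A2 (?r z) * ?G z) + T z" if z: "z \<in> S2" for z
  proof (cases "?r z < \<bar>h\<bar> / 2")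
    case True
    \<comment> \<open>Since \<open>\<bar>h\<bar> \<le> 1\<close>, the disc has radius at most 1/2,
      and \<open>z \<bullet> m\<close> is close enough to 1 for \<open>h * (z \<bullet> m)\<close>
      to dominate \<open>q \<bullet> z\<close>.\<close>
    have "(?r z)\<^sup>2 \<le> (1/2)\<^sup>2" using True h1 by (intro power_mono) auto
    then have zm: "7/8 \<le> z \<bullet> m" using norm_sph_diff[OF z mS(1)] by (simp add: power2_eq_square)
    have "\<bar>h\<bar> * (7/8) \<le> \<bar>h\<bar> * (z \<bullet> m)" using zm by (intro mult_left_mono) auto
    then have a: "\<bar>q \<bullet> z\<bar> < \<bar>h\<bar> * (z \<bullet> m)" using qz[of z] True by linarith
    have "sgn (k \<bullet> z) = sgn h"
    proof (cases "h > 0")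
      case True
      then show ?thesis unfolding kz using a by (auto simp: abs_if split: if_splits)
    next
      case False
      with True have "h < 0" using norm_ge_zero[of "z - m"] by (auto simp: abs_if split: if_splits)
      then show ?thesis unfolding kz using a by (auto simp: abs_if sgn_if split: if_splits)
    qed
    then show ?thesis using True by (simp add: T_def indicator_def)
  qed (auto simp: T_def indicator_def algebra_simps)
  have i1: "integrable sph_measure (\<lambda>z. indicator ?A1 (?r z) * ?G z)"
  proof -
    have "?A1 \<subseteq> {\<rho>..}" by auto
    from quadrupole_far(1)[OF fr r(1) _ _ _ _ this, of "\<lambda>_. 1"] show ?thesis using r \<rho>\<delta> by simp
  qed
  have i2: "integrable sph_measure (\<lambda>z. sgn (q \<bullet> z) * (indicator ?A2 (?r z) * ?G z))"
    by (rule quadrupole_far(1)[OF fr r(1), of "\<lambda>z. sgn (q \<bullet> z)" ?A2]) (use r \<rho>\<delta> in \<open>auto simp: sgn_if\<close>)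
  have ik: "integrable sph_measure (\<lambda>z. sgn (k \<bullet> z) * (indicator ?A (?r z) * ?G z))"
    by (rule quadrupole_far(1)[OF fr r(1), of "\<lambda>z. sgn (k \<bullet> z)" ?A]) (use r \<rho>\<delta> in \<open>auto simp: sgn_if\<close>)
  have iT: "integrable sph_measure T"
  proof -
    have "integrable sph_measure (\<lambda>z. sgn (k \<bullet> z) * (indicator ?A (?r z) * ?G z) - sgn h * (indicator ?A1 (?r z) * ?G z) - sgn (q \<bullet> z) * (indicator ?A2 (?r z) * ?G z))"
      using ik i1 i2 by (intro Bochner_Integration.integrable_diff integrable_mult_right) auto
    then show ?thesis by (rule Bochner_Integration.integrable_cong[THEN iffD1, rotated 2]) (auto simp: split)
  qed
  have "(\<integral>z. sgn (k \<bullet> z) * (indicator ?A (?r z) * ?G z) \<partial>sph_measure) =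
     (\<integral>z. sgn h * (indicator ?A1 (?r z) * ?G z) + sgn (q \<bullet> z) * (indicator ?A2 (?r z) * ?G z) + T z \<partial>sph_measure)"
    by (rule Bochner_Integration.integral_cong) (auto simp: split)
  also have "\<dots> = sgn h * (\<integral>z. indicator ?A1 (?r z) * ?G z \<partial>sph_measure) + (\<integral>z. sgn (q \<bullet> z) * (indicator ?A2 (?r z) * ?G z) \<partial>sph_measure) + (\<integral>z. T z \<partial>sph_measure)"
    using i1 i2 iT by simp
  also have "\<dots> = (\<integral>z. T z \<partial>sph_measure)"
    by (simp add: integral_annulus_quadrupole[OF fr] integral_annulus_quadrupole_sgn[OF fr _ qm])
  finally have eqT: "(\<integral>z. sgn (k \<bullet> z) * (indicator ?A (?r z) * ?G z) \<partial>sph_measure) = (\<integral>z. T z \<partial>sph_measure)" .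
  have T_le: "\<bar>T z\<bar> \<le> 2 * (indicator {..\<bar>h\<bar>} \<bar>q \<bullet> z\<bar> * (indicator {\<bar>h\<bar>/2..1} (?r z) / (?r z)\<^sup>2))" if z: "z \<in> S2" for z
  proof (cases "\<bar>h\<bar> / 2 \<le> ?r z \<and> ?r z \<in> ?A \<and> \<bar>q \<bullet> z\<bar> \<le> \<bar>h\<bar>")
    case True
    have "\<bar>sgn (k \<bullet> z) - sgn (q \<bullet> z)\<bar> \<le> 2" by (auto simp: sgn_if)
    then have "\<bar>T z\<bar> \<le> 2 * (1 / (?r z)\<^sup>2)"
      unfolding T_def abs_mult using True abs_quadrupole_le[OF fr, of z] by (intro mult_mono) auto
    then show ?thesis using True r by simp
  next
    case False
    have "\<bar>h * (z \<bullet> m)\<bar> \<le> \<bar>h\<bar>" using Cauchy_Schwarz_ineq2[of z m] z nm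
      by (simp add: S2_def abs_mult mult_left_le)
    then have "sgn (k \<bullet> z) = sgn (q \<bullet> z)" if "\<bar>q \<bullet> z\<bar> > \<bar>h\<bar>"
      using that unfolding kz by (auto simp: sgn_if abs_if split: if_splits)
    then have "T z = 0" using False by (auto simp: T_def)
    then show ?thesis by (auto intro!: mult_nonneg_nonneg)
  qed
  have "(\<integral>\<^sup>+z. ennreal (norm (T z)) \<partial>sph_measure) \<le> ennreal 200"
  proof (cases "h = 0")
    case True
    then have "T z = 0" for z by (simp add: T_def q_def)
    then show ?thesis by simp
  next
    case h0: False
    let ?S = "\<lambda>z. indicator {..\<bar>h\<bar>} \<bar>q \<bullet> z\<bar> * (indicator {\<bar>h\<bar>/2..1} (?r z) / (?r z)\<^sup>2) :: real"
    have "(\<integral>\<^sup>+z. ennreal (norm (T z)) \<partial>sph_measure) \<le> (\<integral>\<^sup>+z. 2 * ennreal (?S z) \<partial>sph_measure)"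
    proof (rule nn_integral_mono)
      fix z assume "z \<in> space sph_measure"
      then have "ennreal (norm (T z)) \<le> ennreal (2 * ?S z)" using T_le by (intro ennreal_leI) simp
      also have "\<dots> = 2 * ennreal (?S z)" by (subst ennreal_mult') auto
      finally show "ennreal (norm (T z)) \<le> 2 * ennreal (?S z)" .
    qed
    also have "\<dots> = 2 * (\<integral>\<^sup>+z. ennreal (?S z) \<partial>sph_measure)" by (rule nn_integral_cmult) measurable
    also have "\<dots> \<le> 2 * ennreal 100"
    proof (intro mult_left_mono)
      show "(\<integral>\<^sup>+z. ennreal (?S z) \<partial>sph_measure) \<le> ennreal 100"
      \<comment> \<open>For small \<open>h\<close> the vector \<open>q\<close> has length at least
        1/2 and the strip estimate applies: half-width \<open>2 * \<bar>h\<bar>\<close> over inner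
        radius \<open>\<bar>h\<bar> / 2\<close> is scale invariant and gives 96. Otherwise only
        radii above 1/4 are left and \<open>2 * pi * ln 8\<close> suffices.\<close>
      proof (cases "\<bar>h\<bar> < 1/2")
        case True
        have "h\<^sup>2 \<le> (1/2)\<^sup>2" using True abs_le_square_iff[of h "1/2"] by simp
        then have "(1/2)\<^sup>2 \<le> (norm q)\<^sup>2" unfolding q2 by (simp add: power2_eq_square)
        then have q12: "1/2 \<le> norm q" by (rule power2_le_imp_le) simp
        define e' where "e' = (1 / norm q) *\<^sub>R q"
        have e': "norm e' = 1" "e' \<bullet> m = 0" using q12 qm by (auto simp: e'_def)
        have "(norm (cross3 m e'))\<^sup>2 = 1" unfolding norm_cross using e' nm by (simp add: inner_commute)
        then have "norm (cross3 m e') = 1" using norm_ge_zero[of "cross3 m e'"] unfolding power2_eq_1_iff by linarith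
        then have fr': "frame3 e' (cross3 m e') m" using e' nm by (simp add: frame3_def dot_cross_self inner_commute)
        have "\<bar>z \<bullet> e'\<bar> \<le> 2 * \<bar>h\<bar>" if "\<bar>q \<bullet> z\<bar> \<le> \<bar>h\<bar>" for z
        proof -
          have "\<bar>z \<bullet> e'\<bar> = \<bar>q \<bullet> z\<bar> / norm q" by (simp add: e'_def inner_commute abs_mult)
          also have "\<dots> \<le> \<bar>h\<bar> / (1/2)" using that q12 by (intro frac_le) auto
          finally show ?thesis by simp
        qed
        then have "(\<integral>\<^sup>+z. ennreal (?S z) \<partial>sph_measure) \<le> (\<integral>\<^sup>+z. ennreal (indicator {..2 * \<bar>h\<bar>} \<bar>z \<bullet> e'\<bar> * (indicator {\<bar>h\<bar>/2..1} (?r z) / (?r z)\<^sup>2)) \<partial>sph_measure)"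
          by (intro nn_integral_mono ennreal_leI mult_right_mono) (auto simp: indicator_def)
        also have "\<dots> \<le> ennreal (24 * (2 * \<bar>h\<bar>) / (\<bar>h\<bar> / 2))"
          using h0 by (intro nn_integral_sph_strip[OF fr']) auto
        also have "24 * (2 * \<bar>h\<bar>) / (\<bar>h\<bar> / 2) = 96" using h0 by simp
        also have "ennreal 96 \<le> ennreal 100" by (intro ennreal_leI) simp
        finally show ?thesis .
      next
        case False
        have "(\<integral>\<^sup>+z. ennreal (?S z) \<partial>sph_measure) \<le> (\<integral>\<^sup>+z. ennreal (indicator {1/4..} (?r z) / (?r z)\<^sup>2) \<partial>sph_measure)"
          using False by (intro nn_integral_mono ennreal_leI) (auto simp: indicator_def)
        also have "\<dots> \<le> ennreal (2 * pi * ln (2 / (1/4)))"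
          by (rule nn_integral_sph_inverse_square_far[OF mS(1)]) auto
        also have "\<dots> \<le> ennreal 100"
        proof (intro ennreal_leI)
          have "ln (8::real) \<le> 8 - 1" by (rule ln_le_minus_one) simp
          then have "2 * pi * ln 8 \<le> 2 * 4 * 7" using pi_less_4 by (intro mult_mono) auto
          then show "2 * pi * ln (2 / (1/4)) \<le> 100" by simp
        qed
        finally show ?thesis .
      qed
    qed simp
    also have "2 * ennreal 100 = ennreal 200" using ennreal_mult'[of 2 100] by simp
    finally show ?thesis .
  qed
  from integrable_norm_bound(2)[OF mT this] show ?thesis unfolding eqT by simp
qed

text \<open>\<open>c\<close> stands for a value of the vorticity near \<open>m\<close>. Subtracting
  \<open>c * s z\<close> leaves an integrand of size \<open>H * r powr (\<alpha> - 2)\<close>, whose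
  integral over the disc costs a factor \<open>1 / \<alpha>\<close>; the subtracted part is bounded
  by the cancellation hypothesis.\<close>

lemma integral_annulus_hoelder:
  assumes fr: "frame3 e n m" and w: "\<omega> \<in> borel_measurable sph_measure" "AE z in sph_measure. \<bar>\<omega> z\<bar> \<le> 1"
    and s: "s \<in> borel_measurable sph_measure" "\<And>z. \<bar>s z\<bar> \<le> 1"
    and S: "\<bar>\<integral>z. s z * (indicator {\<rho>..<\<delta>} (norm (z - m)) * quadrupole e n m z) \<partial>sph_measure\<bar> \<le> 200"
    and r: "0 < \<rho>" "\<rho> \<le> \<delta>" "\<delta> \<le> 1" and a: "0 < \<alpha>" and c: "\<bar>c\<bar> \<le> 1" "0 \<le> H"
    and H: "AE z in sph_measure. norm (z - m) \<in> {\<rho>..<\<delta>} \<longrightarrow> \<bar>\<omega> z - c * s z\<bar> \<le> H * norm (z - m) powr \<alpha>"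
  shows "\<bar>\<integral>z. \<omega> z * (indicator {\<rho>..<\<delta>} (norm (z - m)) * quadrupole e n m z) \<partial>sph_measure\<bar> \<le> 200 + 2 * pi * H * \<delta> powr \<alpha> / \<alpha>"
proof -
  let ?I = "\<lambda>z. indicator {\<rho>..<\<delta>} (norm (z - m)) * quadrupole e n m z"
  have mS: "m \<in> S2" using fr by (simp add: frame3_def S2_def)
  have i: "integrable sph_measure (\<lambda>z. \<omega> z * ?I z)" "integrable sph_measure (\<lambda>z. s z * ?I z)"
    by (rule quadrupole_far(1)[OF fr r(1)]; use w s r in auto)+
  have mD: "(\<lambda>z. (\<omega> z - c * s z) * ?I z) \<in> borel_measurable sph_measure" using w(1) s(1) by measurable
  have "(\<integral>\<^sup>+z. ennreal (norm ((\<omega> z - c * s z) * ?I z)) \<partial>sph_measure) \<le>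
    (\<integral>\<^sup>+z. ennreal H * ennreal (indicator {\<rho>..<\<delta>} (norm (z - m)) * (norm (z - m)) powr \<alpha> / (norm (z - m))\<^sup>2) \<partial>sph_measure)"
    using H
  proof (intro nn_integral_mono_AE, eventually_elim)
    fix z assume z: "norm (z - m) \<in> {\<rho>..<\<delta>} \<longrightarrow> \<bar>\<omega> z - c * s z\<bar> \<le> H * norm (z - m) powr \<alpha>"
    have "norm ((\<omega> z - c * s z) * ?I z) \<le> H * (indicator {\<rho>..<\<delta>} (norm (z - m)) * (norm (z - m)) powr \<alpha> / (norm (z - m))\<^sup>2)"
    proof (cases "norm (z - m) \<in> {\<rho>..<\<delta>}")
      case True
      have "\<bar>\<omega> z - c * s z\<bar> * \<bar>quadrupole e n m z\<bar> \<le> (H * norm (z - m) powr \<alpha>) * (1 / (norm (z - m))\<^sup>2)"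
        using True z c by (intro mult_mono abs_quadrupole_le[OF fr]) auto
      then show ?thesis using True by (simp add: abs_mult)
    qed simp
    then show "ennreal (norm ((\<omega> z - c * s z) * ?I z)) \<le> ennreal H * ennreal (indicator {\<rho>..<\<delta>} (norm (z - m)) * (norm (z - m)) powr \<alpha> / (norm (z - m))\<^sup>2)"
      using c by (subst ennreal_mult'[symmetric]) (auto intro: ennreal_leI)
  qed
  also have "\<dots> = ennreal H * (\<integral>\<^sup>+z. ennreal (indicator {\<rho>..<\<delta>} (norm (z - m)) * (norm (z - m)) powr \<alpha> / (norm (z - m))\<^sup>2) \<partial>sph_measure)"
    by (rule nn_integral_cmult) measurable
  also have "\<dots> \<le> ennreal H * ennreal (2 * pi * \<delta> powr \<alpha> / \<alpha>)"
    by (intro mult_left_mono nn_integral_sph_powr_annulus mS r a) auto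
  also have "\<dots> = ennreal (2 * pi * H * \<delta> powr \<alpha> / \<alpha>)"
    using c by (subst ennreal_mult'[symmetric]) (auto simp: mult_ac)
  finally have le: "(\<integral>\<^sup>+z. ennreal (norm ((\<omega> z - c * s z) * ?I z)) \<partial>sph_measure) \<le> ennreal (2 * pi * H * \<delta> powr \<alpha> / \<alpha>)" .
  have iD: "integrable sph_measure (\<lambda>z. (\<omega> z - c * s z) * ?I z)"
     "\<bar>\<integral>z. (\<omega> z - c * s z) * ?I z \<partial>sph_measure\<bar> \<le> 2 * pi * H * \<delta> powr \<alpha> / \<alpha>"
    using integrable_norm_bound[OF mD le] c a by auto
  have "(\<integral>z. \<omega> z * ?I z \<partial>sph_measure) = (\<integral>z. (\<omega> z - c * s z) * ?I z + c * (s z * ?I z) \<partial>sph_measure)"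
    by (intro Bochner_Integration.integral_cong) (auto simp: algebra_simps)
  also have "\<dots> = (\<integral>z. (\<omega> z - c * s z) * ?I z \<partial>sph_measure) + c * (\<integral>z. s z * ?I z \<partial>sph_measure)"
    using iD(1) i(2) by simp
  finally have "\<bar>\<integral>z. \<omega> z * ?I z \<partial>sph_measure\<bar> \<le> 2 * pi * H * \<delta> powr \<alpha> / \<alpha> + \<bar>c * (\<integral>z. s z * ?I z \<partial>sph_measure)\<bar>"
    using iD(2) by linarith
  moreover have "\<bar>c * (\<integral>z. s z * ?I z \<partial>sph_measure)\<bar> \<le> 1 * 200"
    unfolding abs_mult using c S by (intro mult_mono) auto
  ultimately show ?thesis by linarith
qed

section \<open>Weak gradients of Lipschitz functions\<close>

text \<open>Continuity in each fixed direction extends to varying directions, since the derivative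
  is linear and three directions span the space.\<close>

lemma continuous_frechet:
  fixes X :: "real^3 \<Rightarrow> real^3"
  assumes d: "\<And>x. (X has_derivative X' x) (at x)" and c: "\<And>v. continuous_on UNIV (\<lambda>x. X' x v)"
    and v: "continuous_on UNIV v"
  shows "continuous_on UNIV (\<lambda>x. X' x (v x))"
proof -
  have e: "X' x (v x) = (v x $ 1) *\<^sub>R X' x (axis 1 1) + (v x $ 2) *\<^sub>R X' x (axis 2 1) + (v x $ 3) *\<^sub>R X' x (axis 3 1)" for x
  proof -
    have lin: "linear (X' x)" using d by (rule has_derivative_linear)
    have "v x = v x$1 *\<^sub>R axis 1 1 + v x$2 *\<^sub>R axis 2 1 + v x$3 *\<^sub>R axis 3 1"
      by (simp add: vec_eq_iff forall_3 axis_def)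
    then show ?thesis by (metis linear_add[OF lin] linear_scale[OF lin])
  qed
  show ?thesis unfolding e
    by (intro continuous_intros c v continuous_on_component)
qed

lemma compact_S2: "compact S2" by (simp add: S2_def)

lemma continuous_bounded_S2:
  fixes f :: "real^3 \<Rightarrow> 'b::real_normed_vector"
  assumes "continuous_on UNIV f" obtains B where "0 \<le> B" "\<And>x. x \<in> S2 \<Longrightarrow> norm (f x) \<le> B"
proof -
  have "compact (f ` S2)" using assms compact_S2 by (intro compact_continuous_image) (auto intro: continuous_on_subset)
  then obtain B where "\<And>y. y \<in> f ` S2 \<Longrightarrow> norm y \<le> B" using compact_imp_bounded bounded_iff by metis
  then show ?thesis using that[of "max B 0"] by (simp add: le_max_iff_disj)
qed

lemma borel_measurable_sph_continuous:
  fixes f :: "real^3 \<Rightarrow> 'b::topological_space"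
  shows "continuous_on UNIV f \<Longrightarrow> f \<in> borel_measurable sph_measure"
  by (intro borel_measurable_sphI borel_measurable_continuous_onI)

lemma integrable_sph_bounded:
  fixes f :: "real^3 \<Rightarrow> 'b::{banach, second_countable_topology}"
  assumes "f \<in> borel_measurable sph_measure" "\<And>x. x \<in> S2 \<Longrightarrow> norm (f x) \<le> B"
  shows "integrable sph_measure f"
  using assms by (intro sph.integrable_const_bound[of _ B]) auto

lemma integrable_sph_continuous:
  fixes f :: "real^3 \<Rightarrow> 'b::{banach, second_countable_topology}"
  assumes "continuous_on UNIV f" shows "integrable sph_measure f"
proof -
  obtain B where "\<And>x. x \<in> S2 \<Longrightarrow> norm (f x) \<le> B" using continuous_bounded_S2[OF assms] by blast
  then show ?thesis by (rule integrable_sph_bounded[OF borel_measurable_sph_continuous[OF assms]])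
qed

section \<open>Linear structure and cut-offs of test fields\<close>

lemma test_field_add_scale:
  assumes X: "test_field U X" and Y: "test_field U Y"
  shows "test_field U (\<lambda>x. X x + c *\<^sub>R Y x)"
    "x \<in> S2 \<Longrightarrow> sph_div (\<lambda>x. X x + c *\<^sub>R Y x) x = sph_div X x + c * sph_div Y x"
proof -
  let ?D = "\<lambda>x v. frechet_derivative X (at x) v + c *\<^sub>R frechet_derivative Y (at x) v"
  have d: "((\<lambda>x. X x + c *\<^sub>R Y x) has_derivative ?D x) (at x)" for x
    by (intro derivative_intros test_fieldD(1)[OF X] test_fieldD(1)[OF Y])
  obtain K L where K: "compact K" "K \<subseteq> U" "\<forall>x\<in>S2 - K. X x = 0" and L: "compact L" "L \<subseteq> U" "\<forall>x\<in>S2 - L. Y x = 0"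
    using X Y unfolding test_field_def by blast
  show "test_field U (\<lambda>x. X x + c *\<^sub>R Y x)"
  proof (rule test_fieldI[OF d])
    show "continuous_on UNIV (\<lambda>x. ?D x v)" for v by (intro continuous_intros test_fieldD(2)[OF X] test_fieldD(2)[OF Y])
    show "compact (K \<union> L)" "K \<union> L \<subseteq> U" using K L by auto
    show "(X x + c *\<^sub>R Y x) \<bullet> x = 0" if "x \<in> S2" for x
      using that X Y by (simp add: test_field_def inner_add_left)
  qed (use K L in auto)
  show "sph_div (\<lambda>x. X x + c *\<^sub>R Y x) x = sph_div X x + c * sph_div Y x" if "x \<in> S2"
    unfolding sph_div_eq[OF d] sph_div_def
    by (simp add: inner_add_left sum.distrib sum_distrib_left algebra_simps)
qed

lemma test_field_zero: "test_field U (\<lambda>x. 0)"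
  by (rule test_fieldI[where X'="\<lambda>x v. 0" and K="{}"]) auto

text \<open>A cut-off to be evaluated at the squared length of a field, which stays differentiable
  where the field vanishes. The squared positive part makes it C^1 at the level \<open>c\<close>,
  and the cube in the denominator keeps \<open>pos_cut c (r^2) * r\<close> below 1.\<close>

definition pos_cut :: "real \<Rightarrow> real \<Rightarrow> real" where
  "pos_cut c s = (max 0 (s - c))\<^sup>2 / (1 + s)^3"

text \<open>The squared positive part of \<open>u\<close> is
  \<open>(u^2 + u * \<bar>u\<bar>) / 2\<close>, which is differentiable across the kink.\<close>

lemma DERIV_max_square: "((\<lambda>s. (max 0 (s - c))\<^sup>2) has_real_derivative 2 * max 0 (s - c)) (at s)"
proof -
  have 0: "((\<lambda>s. s - c) has_real_derivative 1) (at s)" by (auto intro!: derivative_eq_intros)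
  have 1: "((\<lambda>s. (s - c)\<^sup>2) has_real_derivative 2 * (s - c)) (at s)" by (auto intro!: derivative_eq_intros)
  have 2: "((\<lambda>s. (s - c) * \<bar>s - c\<bar>) has_real_derivative 2 * \<bar>s - c\<bar> * 1) (at s)"
    by (rule DERIV_chain2[OF DERIV_abs_square 0])
  have "((\<lambda>s. ((s - c)\<^sup>2 + (s - c) * \<bar>s - c\<bar>) / 2) has_real_derivative (2 * (s - c) + 2 * \<bar>s - c\<bar>) / 2) (at s)"
    using DERIV_cdivide[OF DERIV_add[OF 1 2], of 2] by simp
  moreover have "(\<lambda>s. ((s - c)\<^sup>2 + (s - c) * \<bar>s - c\<bar>) / 2) = (\<lambda>s. (max 0 (s - c))\<^sup>2)"
    by (auto simp: fun_eq_iff max_def power2_eq_square abs_if algebra_simps)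
  moreover have "(2 * (s - c) + 2 * \<bar>s - c\<bar>) / 2 = 2 * max 0 (s - c)" by (auto simp: max_def)
  ultimately show ?thesis by simp
qed

lemma DERIV_pos_cut:
  assumes "0 \<le> s"
  shows "(pos_cut c has_real_derivative (2 * max 0 (s - c) * (1 + s)^3 - (max 0 (s - c))\<^sup>2 * (3 * (1 + s)\<^sup>2)) / ((1 + s)^3 * (1 + s)^3)) (at s)"
  unfolding pos_cut_def[abs_def]
  by (rule DERIV_divide[OF DERIV_max_square]) (use assms in \<open>auto intro!: derivative_eq_intros\<close>)

lemma pos_cut_bounds:
  assumes "0 \<le> s" "0 \<le> c" shows "0 \<le> pos_cut c (s\<^sup>2)" "pos_cut c (s\<^sup>2) * s \<le> 1" "0 < pos_cut c (s\<^sup>2) \<longleftrightarrow> c < s\<^sup>2"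
proof -
  have p: "0 < 1 + s\<^sup>2" by (simp add: add_pos_nonneg)
  show "0 \<le> pos_cut c (s\<^sup>2)" using p by (simp add: pos_cut_def)
  show "0 < pos_cut c (s\<^sup>2) \<longleftrightarrow> c < s\<^sup>2" using p by (auto simp: pos_cut_def max_def zero_less_divide_iff)
  have "0 \<le> (s - 1)\<^sup>2" by simp
  then have s: "s \<le> 1 + s\<^sup>2" using assms(1) unfolding power2_diff by simp
  have "max 0 (s\<^sup>2 - c) \<le> 1 + s\<^sup>2" using assms p by auto
  then have "(max 0 (s\<^sup>2 - c))\<^sup>2 \<le> (1 + s\<^sup>2)\<^sup>2" by (intro power_mono) auto
  then have "(max 0 (s\<^sup>2 - c))\<^sup>2 * s \<le> (1 + s\<^sup>2)\<^sup>2 * (1 + s\<^sup>2)" using s assms p by (intro mult_mono) auto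
  then show "pos_cut c (s\<^sup>2) * s \<le> 1" using p by (simp add: pos_cut_def divide_le_eq power3_eq_cube power2_eq_square)
qed

lemma test_field_pos_cut:
  assumes X: "test_field U X" shows "test_field U (\<lambda>x. pos_cut c ((norm (X x))\<^sup>2) *\<^sub>R X x)"
proof -
  let ?X' = "\<lambda>x. frechet_derivative X (at x)"
  define z where "z s = (2 * max 0 (s - c) * (1 + s)^3 - (max 0 (s - c))\<^sup>2 * (3 * (1 + s)\<^sup>2)) / ((1 + s)^3 * (1 + s)^3)" for s :: real
  have nX: "(\<lambda>x. (norm (X x))\<^sup>2) = (\<lambda>x. X x \<bullet> X x)" by (simp add: power2_norm_eq_inner)
  have "((\<lambda>x. pos_cut c (X x \<bullet> X x)) has_derivative (\<lambda>v. z (X x \<bullet> X x) * (2 * (X x \<bullet> ?X' x v)))) (at x)" for x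
  proof -
    have 1: "((\<lambda>x. X x \<bullet> X x) has_derivative (\<lambda>v. X x \<bullet> ?X' x v + ?X' x v \<bullet> X x)) (at x)"
      by (rule has_derivative_inner[OF test_fieldD(1)[OF X] test_fieldD(1)[OF X]])
    have 2: "(pos_cut c has_derivative (\<lambda>h. h * z (X x \<bullet> X x))) (at (X x \<bullet> X x))"
      using DERIV_pos_cut[of "X x \<bullet> X x" c] unfolding z_def[symmetric] has_field_derivative_def
      by (simp add: mult.commute[of _ "z _"])
    from has_derivative_compose[OF 1 2] show ?thesis
      by (simp add: inner_commute mult_ac)
  qed
  from has_derivative_scaleR[OF this test_fieldD(1)[OF X]]
  have d: "((\<lambda>x. pos_cut c (X x \<bullet> X x) *\<^sub>R X x) has_derivative
     (\<lambda>v. pos_cut c (X x \<bullet> X x) *\<^sub>R ?X' x v + (z (X x \<bullet> X x) * (2 * (X x \<bullet> ?X' x v))) *\<^sub>R X x)) (at x)" for x .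
  obtain K where K: "compact K" "K \<subseteq> U" "\<forall>x\<in>S2 - K. X x = 0" using X unfolding test_field_def by blast
  have c0: "continuous_on UNIV (\<lambda>x. X x \<bullet> X x)" by (intro continuous_intros test_fieldD(3)[OF X])
  have nz: "1 + X x \<bullet> X x \<noteq> 0" for x using inner_ge_zero[of "X x"] by linarith
  show ?thesis unfolding nX power2_norm_eq_inner
  proof (rule test_fieldI[OF d])
    show "continuous_on UNIV (\<lambda>x. pos_cut c (X x \<bullet> X x) *\<^sub>R ?X' x v + (z (X x \<bullet> X x) * (2 * (X x \<bullet> ?X' x v))) *\<^sub>R X x)" for v
      unfolding pos_cut_def z_def
      by (intro continuous_intros c0 test_fieldD(2)[OF X] test_fieldD(3)[OF X]) (auto simp: nz)
    show "(pos_cut c (X x \<bullet> X x) *\<^sub>R X x) \<bullet> x = 0" if "x \<in> S2" for x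
      using that X by (simp add: test_field_def)
  qed (use K in auto)
qed

text \<open>Riesz representation without duality theory: minimise \<open>J X = \<integral>\<bar>X\<bar>\<^sup>2 / 2 + T X\<close> over the test
  fields. A minimising sequence converges in \<open>L\<^sup>2\<close> by the parallelogram identity, its limit represents
  \<open>T\<close>, and testing with cut-offs of the minimising sequence itself bounds the limit.\<close>
lemma test_field_representation:
  fixes T :: "(real^3 \<Rightarrow> real^3) \<Rightarrow> real"
  assumes lin: "\<And>X Y c. test_field U X \<Longrightarrow> test_field U Y \<Longrightarrow> T (\<lambda>x. X x + c *\<^sub>R Y x) = T X + c * T Y"
    and bd: "\<And>X. test_field U X \<Longrightarrow> \<bar>T X\<bar> \<le> L * (\<integral>x. norm (X x) \<partial>sph_measure)" and L: "0 \<le> L"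
  obtains g where "g \<in> borel_measurable sph_measure" "AE x in sph_measure. g x \<bullet> x = 0" "AE x in sph_measure. norm (g x) \<le> L"
    "\<And>X. test_field U X \<Longrightarrow> T X = - (\<integral>x. g x \<bullet> X x \<partial>sph_measure)"
proof -
  let ?M = sph_measure
  let ?V = "{X. test_field U X}"
  define J where "J X = (\<integral>x. (norm (X x))\<^sup>2 \<partial>?M) / 2 + T X" for X
  define S where "S = measure ?M (space ?M)"
  have ct: "continuous_on UNIV X" if "X \<in> ?V" for X using that test_fieldD(3) by blast
  have ci: "integrable ?M (\<lambda>x. X x \<bullet> Y x)" if "X \<in> ?V" "Y \<in> ?V" for X Y
    by (intro integrable_sph_continuous continuous_intros ct that)
  have cn: "integrable ?M (\<lambda>x. norm (X x))" if "X \<in> ?V" for X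
    by (intro integrable_sph_continuous continuous_intros ct that)
  \<comment> \<open>\<open>J\<close> is bounded below by completing the square pointwise in
    \<open>norm (X x) - L\<close>.\<close>
  have lb: "- (L\<^sup>2 / 2 * S) \<le> J X" if X: "X \<in> ?V" for X
  proof -
    have "- (L\<^sup>2 / 2 * S) = (\<integral>x. - (L\<^sup>2 / 2) \<partial>?M)" by (simp add: S_def)
    also have "\<dots> \<le> (\<integral>x. (norm (X x))\<^sup>2 / 2 - L * norm (X x) \<partial>?M)"
    proof (rule integral_mono)
      show "integrable ?M (\<lambda>x. (norm (X x))\<^sup>2 / 2 - L * norm (X x))"
        by (intro integrable_sph_continuous continuous_intros ct X) auto
      fix x
      have "0 \<le> (norm (X x) - L)\<^sup>2" by simp
      then show "- (L\<^sup>2 / 2) \<le> (norm (X x))\<^sup>2 / 2 - L * norm (X x)" unfolding power2_diff by (simp add: mult_ac)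
    qed simp
    also have "\<dots> = (\<integral>x. (norm (X x))\<^sup>2 \<partial>?M) / 2 - L * (\<integral>x. norm (X x) \<partial>?M)"
      using ci[OF X X] cn[OF X] by (simp add: power2_norm_eq_inner)
    also have "\<dots> \<le> J X" using bd X unfolding J_def by fastforce
    finally show ?thesis .
  qed
  define j where "j = Inf (J ` ?V)"
  have bb: "bdd_below (J ` ?V)" using lb by (intro bdd_belowI2[where m="- (L\<^sup>2 / 2 * S)"]) auto
  have jl: "j \<le> J X" if "X \<in> ?V" for X unfolding j_def using that bb by (intro cInf_lower) auto
  have ne: "J ` ?V \<noteq> {}" using test_field_zero by blast
  have "\<exists>X. X \<in> ?V \<and> J X < j + (1/4)^n / 8" for n :: nat
  proof -
    have "Inf (J ` ?V) < j + (1/4)^n / 8" unfolding j_def by simp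
    then show ?thesis using cInf_lessD[OF ne] by auto
  qed
  \<comment> \<open>With the tolerance \<open>(1/4)^n / 8\<close> the parallelogram identity puts
    successive fields at \<open>L^2\<close> distance at most \<open>(1/2)^n\<close>.\<close>
  then obtain X where X: "\<And>n. X n \<in> ?V" and XJ: "\<And>n. J (X n) < j + (1/4)^n / 8" by metis
  have J_add: "J (\<lambda>x. Y x + c *\<^sub>R Z x) = J Y + c * ((\<integral>x. Y x \<bullet> Z x \<partial>?M) + T Z) + c\<^sup>2 * (\<integral>x. (norm (Z x))\<^sup>2 \<partial>?M) / 2"
    if Y: "Y \<in> ?V" and Z: "Z \<in> ?V" for Y Z c
  proof -
    have "(\<integral>x. (norm (Y x + c *\<^sub>R Z x))\<^sup>2 \<partial>?M) = (\<integral>x. Y x \<bullet> Y x + 2 * c * (Y x \<bullet> Z x) + c\<^sup>2 * (Z x \<bullet> Z x) \<partial>?M)"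
    proof (intro Bochner_Integration.integral_cong refl)
      show "(norm (Y x + c *\<^sub>R Z x))\<^sup>2 = Y x \<bullet> Y x + 2 * c * (Y x \<bullet> Z x) + c\<^sup>2 * (Z x \<bullet> Z x)" for x
        unfolding power2_norm_eq_inner by (simp add: inner_add_left inner_add_right inner_commute[of "Z x" "Y x"] power2_eq_square algebra_simps)
    qed
    also have "\<dots> = (\<integral>x. Y x \<bullet> Y x \<partial>?M) + 2 * c * (\<integral>x. Y x \<bullet> Z x \<partial>?M) + c\<^sup>2 * (\<integral>x. Z x \<bullet> Z x \<partial>?M)"
      using ci[OF Y Y] ci[OF Y Z] ci[OF Z Z] by simp
    finally show ?thesis unfolding J_def using lin[of Y Z c] Y Z by (simp add: power2_norm_eq_inner algebra_simps)
  qed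
  have D2: "(\<integral>x. (norm (X (Suc n) x - X n x))\<^sup>2 \<partial>?M) \<le> (1/4)^n" for n
  proof -
    define Z where "Z x = X (Suc n) x + (-1) *\<^sub>R X n x" for x
    have Z: "Z \<in> ?V" using X test_field_add_scale(1)[of U "X (Suc n)" "X n" "-1"] by (simp add: Z_def[abs_def])
    define q Q where "q = (\<integral>x. X n x \<bullet> Z x \<partial>?M) + T Z" and "Q = (\<integral>x. (norm (Z x))\<^sup>2 \<partial>?M)"
    have 1: "J (X (Suc n)) = J (X n) + q + Q / 2" unfolding q_def Q_def using J_add[OF X[of n] Z, of 1] by (simp add: Z_def)
    \<comment> \<open>The midpoint of two successive fields is again a test field, so
      \<open>j\<close> bounds its energy from below; combined with the expansion at the end point
      this isolates \<open>Q\<close>.\<close>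
    have 2: "j \<le> J (X n) + q / 2 + Q / 8" unfolding q_def Q_def
      using jl[of "\<lambda>x. X n x + (1/2) *\<^sub>R Z x"] J_add[OF X[of n] Z, of "1/2"] test_field_add_scale(1)[of U "X n" Z "1/2"] X Z
      by (simp add: power2_eq_square)
    have "J (X (Suc n)) < j + (1/4)^n / 8" using XJ[of "Suc n"] by (rule less_le_trans) simp
    with 1 2 XJ[of n] have "Q \<le> (1/4)^n" by linarith
    then show ?thesis by (simp add: Z_def Q_def)
  qed
  have dV: "continuous_on UNIV (\<lambda>x. X (Suc n) x - X n x)" for n by (intro continuous_intros ct X)
  \<comment> \<open>From squared to plain increments by \<open>a \<le> 1 / b + b * a^2\<close> with
    \<open>b = 2^n\<close>: the increments are summable in \<open>L^1\<close>, hence almost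
    everywhere.\<close>
  have D1: "(\<integral>x. norm (X (Suc n) x - X n x) \<partial>?M) \<le> (1/2)^n * (S + 1)" for n
  proof -
    have "(\<integral>x. norm (X (Suc n) x - X n x) \<partial>?M) \<le> (\<integral>x. (1/2)^n + 2^n * (norm (X (Suc n) x - X n x))\<^sup>2 \<partial>?M)"
    proof (rule integral_mono)
      show "integrable ?M (\<lambda>x. norm (X (Suc n) x - X n x))" "integrable ?M (\<lambda>x. (1/2)^n + 2^n * (norm (X (Suc n) x - X n x))\<^sup>2)"
        by (intro integrable_sph_continuous continuous_intros dV)+
      fix x
      define a b where "a = norm (X (Suc n) x - X n x)" and "b = (2::real)^n"
      have b: "0 < b" "(1/2)^n = 1 / b" by (simp_all add: b_def power_one_over)
      have "0 \<le> (b * a - 1)\<^sup>2 / b" using b by simp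
      also have "\<dots> = b * a\<^sup>2 - 2 * a + 1 / b" using b by (simp add: power2_eq_square field_simps)
      finally have "2 * a \<le> 1 / b + b * a\<^sup>2" by simp
      moreover have "0 \<le> a" by (simp add: a_def)
      ultimately show "norm (X (Suc n) x - X n x) \<le> (1/2)^n + 2^n * (norm (X (Suc n) x - X n x))\<^sup>2"
        unfolding b(2) unfolding a_def[symmetric] b_def[symmetric] by linarith
    qed
    also have "\<dots> = (1/2)^n * S + 2^n * (\<integral>x. (norm (X (Suc n) x - X n x))\<^sup>2 \<partial>?M)"
      using integrable_sph_continuous[OF continuous_on_power[OF continuous_on_norm[OF dV[of n]], of 2]]
      by (simp add: S_def)
    also have "\<dots> \<le> (1/2)^n * S + 2^n * (1/4)^n" using D2[of n] by simp
    also have "(2::real)^n * (1/4)^n = (1/2)^n" by (simp add: power_mult_distrib[symmetric])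
    finally show ?thesis by (simp add: algebra_simps)
  qed
  let ?d = "\<lambda>n x. norm (X (Suc n) x - X n x)"
  have sD: "summable (\<lambda>n. \<integral>x. ?d n x \<partial>?M)"
  proof (rule summable_comparison_test'[where N=0])
    show "summable (\<lambda>n. (1/2)^n * (S + 1))" by (intro summable_mult2 summable_geometric) simp
    show "norm (\<integral>x. ?d n x \<partial>?M) \<le> (1/2)^n * (S + 1)" for n
    proof -
      have "0 \<le> (\<integral>x. ?d n x \<partial>?M)" by (rule integral_nonneg_AE) auto
      then show ?thesis using D1[of n] by simp
    qed
  qed
  have iD: "integrable ?M (?d n)" for n by (intro integrable_sph_continuous continuous_intros dV)
  have AEs: "AE x in ?M. summable (\<lambda>n. ?d n x)"
  proof -
    have mD: "?d n \<in> borel_measurable ?M" for n using iD by (rule borel_measurable_integrable)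
    have "(\<integral>\<^sup>+x. (\<Sum>n. ennreal (?d n x)) \<partial>?M) = (\<Sum>n. \<integral>\<^sup>+x. ennreal (?d n x) \<partial>?M)"
      by (rule nn_integral_suminf) (use mD in measurable)
    also have "\<dots> = (\<Sum>n. ennreal (\<integral>x. ?d n x \<partial>?M))"
      by (intro suminf_cong nn_integral_eq_integral iD) auto
    also have "\<dots> = ennreal (\<Sum>n. \<integral>x. ?d n x \<partial>?M)" by (rule suminf_ennreal2[OF _ sD]) simp
    finally have "(\<integral>\<^sup>+x. (\<Sum>n. ennreal (?d n x)) \<partial>?M) \<noteq> \<infinity>" by simp
    then have "AE x in ?M. (\<Sum>n. ennreal (?d n x)) \<noteq> \<infinity>"
      by (intro nn_integral_PInf_AE) (use mD in measurable)
    then show ?thesis by eventually_elim (auto intro: summable_suminf_not_top)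
  qed
  \<comment> \<open>\<open>h\<close> dominates the whole sequence and its limit and is integrable,
    as dominated convergence requires.\<close>
  define h where "h x = norm (X 0 x) + (\<Sum>n. ?d n x)" for x
  have ih: "integrable ?M h" unfolding h_def
    by (intro Bochner_Integration.integrable_add cn[OF X] integrable_suminf iD) (use AEs sD in auto)
  define g where "g x = lim (\<lambda>n. X n x)" for x
  have AEl: "AE x in ?M. (\<lambda>n. X n x) \<longlonglongrightarrow> g x \<and> (\<forall>n. norm (X n x) \<le> h x) \<and> norm (g x) \<le> h x"
    using AEs
  proof eventually_elim
    fix x assume s: "summable (\<lambda>n. ?d n x)"
    have "summable (\<lambda>n. X (Suc n) x - X n x)" by (rule summable_norm_cancel[OF s])
    then have "(\<lambda>n. X 0 x + (\<Sum>k<n. X (Suc k) x - X k x)) \<longlonglongrightarrow> X 0 x + (\<Sum>k. X (Suc k) x - X k x)"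
      by (intro tendsto_add tendsto_const summable_LIMSEQ)
    moreover have tele: "X 0 x + (\<Sum>k<n. X (Suc k) x - X k x) = X n x" for n
      using sum_lessThan_telescope[of "\<lambda>k. X k x" n] by simp
    ultimately have "(\<lambda>n. X n x) \<longlonglongrightarrow> X 0 x + (\<Sum>k. X (Suc k) x - X k x)" by (simp only:)
    then have "convergent (\<lambda>n. X n x)" by (rule convergentI)
    then have l: "(\<lambda>n. X n x) \<longlonglongrightarrow> g x" by (simp add: g_def convergent_LIMSEQ_iff)
    have b: "norm (X n x) \<le> h x" for n
    proof -
      have "X n x = X 0 x + (\<Sum>k<n. X (Suc k) x - X k x)" by (rule tele[symmetric])
      also have "norm \<dots> \<le> norm (X 0 x) + (\<Sum>k<n. ?d k x)" by (rule order_trans[OF norm_triangle_ineq add_left_mono[OF norm_sum]])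
      also have "\<dots> \<le> h x" unfolding h_def using sum_le_suminf[OF s, of "{..<n}"] by simp
      finally show ?thesis .
    qed
    moreover have "norm (g x) \<le> h x" by (rule LIMSEQ_le_const2[OF tendsto_norm[OF l]]) (use b in auto)
    ultimately show "(\<lambda>n. X n x) \<longlonglongrightarrow> g x \<and> (\<forall>n. norm (X n x) \<le> h x) \<and> norm (g x) \<le> h x" using l by blast
  qed
  have mX: "X n \<in> borel_measurable ?M" for n by (intro borel_measurable_sph_continuous ct X)
  have mg: "g \<in> borel_measurable ?M" unfolding g_def[abs_def] by (rule borel_measurable_lim_metric) (rule mX)
  have gX: "T Y = - (\<integral>x. g x \<bullet> Y x \<partial>?M)" if Y: "Y \<in> ?V" for Y
  proof -
    obtain B where B: "0 \<le> B" "\<And>x. x \<in> S2 \<Longrightarrow> norm (Y x) \<le> B" using continuous_bounded_S2[OF ct[OF Y]] by blast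
    have mY: "Y \<in> borel_measurable ?M" by (intro borel_measurable_sph_continuous ct Y)
    have lim: "(\<lambda>n. \<integral>x. X n x \<bullet> Y x \<partial>?M) \<longlonglongrightarrow> (\<integral>x. g x \<bullet> Y x \<partial>?M)"
    proof (rule integral_dominated_convergence[where w="\<lambda>x. h x * B"])
      show "AE x in ?M. (\<lambda>n. X n x \<bullet> Y x) \<longlonglongrightarrow> g x \<bullet> Y x" using AEl by eventually_elim (auto intro: tendsto_intros)
      show "AE x in ?M. norm (X n x \<bullet> Y x) \<le> h x * B" for n using AEl AE_space
      proof eventually_elim
        fix x assume x: "(\<lambda>n. X n x) \<longlonglongrightarrow> g x \<and> (\<forall>n. norm (X n x) \<le> h x) \<and> norm (g x) \<le> h x" "x \<in> space ?M"
        have "norm (X n x \<bullet> Y x) \<le> norm (X n x) * norm (Y x)" using Cauchy_Schwarz_ineq2 by simp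
        also have "\<dots> \<le> h x * B" using x B by (intro mult_mono) (auto intro: order_trans[OF norm_ge_zero])
        finally show "norm (X n x \<bullet> Y x) \<le> h x * B" .
      qed
    qed (use ih mX mg mY in \<open>auto intro!: borel_measurable_inner\<close>)
    let ?Q = "\<integral>x. (norm (Y x))\<^sup>2 \<partial>?M"
    \<comment> \<open>Near-minimality: moving from \<open>X n\<close> by plus or minus
      \<open>(1/2)^n\<close> times \<open>Y\<close> cannot lower \<open>J\<close> by more than the
      tolerance, which bounds the first variation by a multiple of \<open>(1/2)^n\<close>.\<close>
    have cn: "\<bar>(\<integral>x. X n x \<bullet> Y x \<partial>?M) + T Y\<bar> \<le> (1/2)^n * (1 + ?Q)" for n
    proof -
      let ?c = "(\<integral>x. X n x \<bullet> Y x \<partial>?M) + T Y" and ?t = "(1/2::real)^n"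
      have t2: "?t * ?t = (1/4)^n" by (simp add: power_mult_distrib[symmetric])
      have 1: "0 \<le> \<tau> * ?c + ?t * ?t / 8 + \<tau>\<^sup>2 * ?Q / 2" for \<tau>
        using jl[of "\<lambda>x. X n x + \<tau> *\<^sub>R Y x"] J_add[OF X[of n] Y, of \<tau>] test_field_add_scale(1)[of U "X n" Y \<tau>] X[of n] Y XJ[of n]
        unfolding t2 by simp
      have "?t * \<bar>?c\<bar> \<le> ?t * (?t / 8 + ?t * ?Q / 2)"
        using 1[of ?t] 1[of "- ?t"] by (cases "?c \<ge> 0") (auto simp: power2_eq_square algebra_simps)
      then have "\<bar>?c\<bar> \<le> ?t / 8 + ?t * ?Q / 2" by simp
      also have "\<dots> \<le> ?t * (1 + ?Q)"
      proof -
        have "0 \<le> ?t" "0 \<le> ?t * ?Q" by (auto intro!: mult_nonneg_nonneg integral_nonneg)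
        then show ?thesis unfolding distrib_left by linarith
      qed
      finally show ?thesis .
    qed
    have "(\<lambda>n. (1/2)^n * (1 + ?Q)) \<longlonglongrightarrow> 0 * (1 + ?Q)"
      by (intro tendsto_mult_right LIMSEQ_realpow_zero) auto
    then have lz: "(\<lambda>n. (1/2)^n * (1 + ?Q)) \<longlonglongrightarrow> 0" by (simp only: mult_zero_left)
    have "(\<lambda>n. (\<integral>x. X n x \<bullet> Y x \<partial>?M) + T Y) \<longlonglongrightarrow> 0"
      by (rule Lim_null_comparison[OF always_eventually lz]) (simp only: real_norm_def cn simp_thms)
    moreover have "(\<lambda>n. (\<integral>x. X n x \<bullet> Y x \<partial>?M) + T Y) \<longlonglongrightarrow> (\<integral>x. g x \<bullet> Y x \<partial>?M) + T Y"
      by (intro tendsto_add lim tendsto_const)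
    ultimately have "(\<integral>x. g x \<bullet> Y x \<partial>?M) + T Y = 0" using LIMSEQ_unique by blast
    then show ?thesis by simp
  qed
  have gt: "AE x in ?M. g x \<bullet> x = 0" using AEl AE_space
  proof eventually_elim
    fix x assume x: "(\<lambda>n. X n x) \<longlonglongrightarrow> g x \<and> (\<forall>n. norm (X n x) \<le> h x) \<and> norm (g x) \<le> h x" "x \<in> space ?M"
    then have "(\<lambda>n. X n x \<bullet> x) \<longlonglongrightarrow> g x \<bullet> x" by (auto intro: tendsto_intros)
    moreover have "X n x \<bullet> x = 0" for n using X[of n] x(2) by (simp add: test_field_def)
    ultimately show "g x \<bullet> x = 0" by (simp add: LIMSEQ_const_iff)
  qed
  \<comment> \<open>The level \<open>L^2\<close> selects the points where the limit would exceed the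
    claimed bound. As \<open>g\<close> may fail to be a test field, the cut-offs of
    \<open>X n\<close> are inserted and the limit is taken afterwards.\<close>
  let ?c = "L\<^sup>2"
  let ?z = "\<lambda>v::real^3. pos_cut ?c ((norm v)\<^sup>2)"
  have zc: "continuous_on UNIV ?z" unfolding pos_cut_def
    by (intro continuous_intros) (simp add: add_nonneg_eq_0_iff)
  have zb: "0 \<le> ?z v" "?z v * norm v \<le> 1" for v using pos_cut_bounds[of "norm v" ?c] by auto
  have zlim: "(\<lambda>n. ?z (X n x)) \<longlonglongrightarrow> ?z (g x)" if "(\<lambda>n. X n x) \<longlonglongrightarrow> g x" for x
    using continuous_on_tendsto_compose[OF zc that] by simp
  have mz: "(\<lambda>x. ?z (f x)) \<in> borel_measurable ?M" if "f \<in> borel_measurable ?M" for f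
    using measurable_compose[OF that borel_measurable_continuous_onI[OF zc]] .
  have le: "(\<integral>x. g x \<bullet> (?z (X n x) *\<^sub>R X n x) \<partial>?M) \<le> L * (\<integral>x. ?z (X n x) * norm (X n x) \<partial>?M)" for n
  proof -
    have t: "test_field U (\<lambda>x. ?z (X n x) *\<^sub>R X n x)" using X by (intro test_field_pos_cut) simp
    have "(\<integral>x. g x \<bullet> (?z (X n x) *\<^sub>R X n x) \<partial>?M) = - T (\<lambda>x. ?z (X n x) *\<^sub>R X n x)" using gX t by simp
    also have "\<dots> \<le> L * (\<integral>x. norm (?z (X n x) *\<^sub>R X n x) \<partial>?M)" using bd[OF t] by linarith
    finally show ?thesis using zb by simp
  qed
  have l1: "(\<lambda>n. \<integral>x. g x \<bullet> (?z (X n x) *\<^sub>R X n x) \<partial>?M) \<longlonglongrightarrow> (\<integral>x. g x \<bullet> (?z (g x) *\<^sub>R g x) \<partial>?M)"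
  proof (rule integral_dominated_convergence[where w=h])
    show "AE x in ?M. (\<lambda>n. g x \<bullet> (?z (X n x) *\<^sub>R X n x)) \<longlonglongrightarrow> g x \<bullet> (?z (g x) *\<^sub>R g x)" using AEl
      by eventually_elim (intro tendsto_inner tendsto_const tendsto_scaleR zlim, auto)
    show "AE x in ?M. norm (g x \<bullet> (?z (X n x) *\<^sub>R X n x)) \<le> h x" for n using AEl
    proof eventually_elim
      fix x assume x: "(\<lambda>n. X n x) \<longlonglongrightarrow> g x \<and> (\<forall>n. norm (X n x) \<le> h x) \<and> norm (g x) \<le> h x"
      have "norm (g x \<bullet> (?z (X n x) *\<^sub>R X n x)) \<le> norm (g x) * norm (?z (X n x) *\<^sub>R X n x)" unfolding real_norm_def by (rule Cauchy_Schwarz_ineq2)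
      also have "\<dots> \<le> h x * 1" using x zb by (intro mult_mono) (auto intro: order_trans[OF norm_ge_zero])
      finally show "norm (g x \<bullet> (?z (X n x) *\<^sub>R X n x)) \<le> h x" by simp
    qed
  qed (use ih mX mg mz in \<open>auto intro!: borel_measurable_inner borel_measurable_scaleR\<close>)
  have l2: "(\<lambda>n. \<integral>x. ?z (X n x) * norm (X n x) \<partial>?M) \<longlonglongrightarrow> (\<integral>x. ?z (g x) * norm (g x) \<partial>?M)"
  proof (rule integral_dominated_convergence[where w="\<lambda>_. 1"])
    show "AE x in ?M. (\<lambda>n. ?z (X n x) * norm (X n x)) \<longlonglongrightarrow> ?z (g x) * norm (g x)" using AEl
      by eventually_elim (intro tendsto_mult tendsto_norm zlim, auto)
  qed (use zb mX mg mz in auto)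
  have ig: "integrable ?M (\<lambda>x. g x \<bullet> (?z (g x) *\<^sub>R g x))"
  proof (rule Bochner_Integration.integrable_bound[OF ih])
    show "AE x in ?M. norm (g x \<bullet> (?z (g x) *\<^sub>R g x)) \<le> norm (h x)" using AEl
    proof eventually_elim
      fix x assume x: "(\<lambda>n. X n x) \<longlonglongrightarrow> g x \<and> (\<forall>n. norm (X n x) \<le> h x) \<and> norm (g x) \<le> h x"
      have "norm (g x \<bullet> (?z (g x) *\<^sub>R g x)) \<le> norm (g x) * norm (?z (g x) *\<^sub>R g x)" unfolding real_norm_def by (rule Cauchy_Schwarz_ineq2)
      also have "\<dots> \<le> h x * 1" using x zb by (intro mult_mono) (auto intro: order_trans[OF norm_ge_zero])
      finally show "norm (g x \<bullet> (?z (g x) *\<^sub>R g x)) \<le> norm (h x)" by simp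
    qed
  qed (use mg mz in \<open>auto intro!: borel_measurable_inner borel_measurable_scaleR\<close>)
  have ig2: "integrable ?M (\<lambda>x. ?z (g x) * norm (g x))"
    by (rule sph.integrable_const_bound[where B=1]) (use zb mg mz in auto)
  have "(\<integral>x. g x \<bullet> (?z (g x) *\<^sub>R g x) \<partial>?M) \<le> L * (\<integral>x. ?z (g x) * norm (g x) \<partial>?M)"
    by (rule LIMSEQ_le[OF l1 tendsto_mult_left[OF l2]]) (use le in auto)
  then have i0: "(\<integral>x. g x \<bullet> (?z (g x) *\<^sub>R g x) - L * (?z (g x) * norm (g x)) \<partial>?M) \<le> 0"
    using ig ig2 by simp
  have eqz: "g x \<bullet> (?z (g x) *\<^sub>R g x) - L * (?z (g x) * norm (g x)) = ?z (g x) * norm (g x) * (norm (g x) - L)" for x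
    by (simp add: power2_norm_eq_inner[symmetric] power2_eq_square algebra_simps)
  \<comment> \<open>The cut-off vanishes where \<open>norm (g x) \<le> L\<close>, so the integrand
    is nonnegative; its integral is at most 0, so it vanishes almost everywhere.\<close>
  have nz: "0 \<le> ?z (g x) * norm (g x) * (norm (g x) - L)" for x
  proof (cases "?c < (norm (g x))\<^sup>2")
    case True
    then have "L < norm (g x)" by (rule power_less_imp_less_base) simp
    then show ?thesis using zb by (intro mult_nonneg_nonneg) auto
  next
    case False
    then have "?z (g x) = 0" using pos_cut_bounds(1,3)[of "norm (g x)" ?c] by auto
    then show ?thesis by simp
  qed
  have "integrable ?M (\<lambda>x. ?z (g x) * norm (g x) * (norm (g x) - L))"
    unfolding eqz[symmetric] using ig ig2 by (intro Bochner_Integration.integrable_diff integrable_mult_right) auto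
  moreover have "0 \<le> (\<integral>x. ?z (g x) * norm (g x) * (norm (g x) - L) \<partial>?M)"
    by (rule integral_nonneg_AE) (intro AE_I2 nz)
  then have "(\<integral>x. ?z (g x) * norm (g x) * (norm (g x) - L) \<partial>?M) = 0"
    using i0 unfolding eqz by linarith
  ultimately have "AE x in ?M. ?z (g x) * norm (g x) * (norm (g x) - L) = 0"
    by (subst (asm) integral_nonneg_eq_0_iff_AE) (auto intro: nz AE_I2)
  then have "AE x in ?M. norm (g x) \<le> L"
  proof eventually_elim
    fix x assume "?z (g x) * norm (g x) * (norm (g x) - L) = 0"
    moreover have "?z (g x) > 0" if "norm (g x) > L"
      using that L pos_cut_bounds(3)[of "norm (g x)" ?c] power_strict_mono[of L "norm (g x)" 2] by auto
    ultimately show "norm (g x) \<le> L" using L by force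
  qed
  then show ?thesis using that[OF mg gt] gX by blast
qed

lemma integrable_sph_mult_bounded:
  fixes F a :: "real^3 \<Rightarrow> real"
  assumes "F \<in> borel_measurable sph_measure" "a \<in> borel_measurable sph_measure"
    and F: "\<And>x. \<bar>F x\<bar> \<le> 1" and a: "\<And>x. x \<in> S2 \<Longrightarrow> \<bar>a x\<bar> \<le> A"
  shows "integrable sph_measure (\<lambda>x. F x * a x)"
proof (rule integrable_sph_bounded[where B=A])
  show "(\<lambda>x. F x * a x) \<in> borel_measurable sph_measure" using assms by measurable
  show "norm (F x * a x) \<le> A" if "x \<in> S2" for x
    using mult_mono[OF F[of x] a[OF that]] by (simp add: abs_mult)
qed

text \<open>Integrating by parts along the rotations about the coordinate axes turns the divergence into
  difference quotients of \<open>F\<close>.\<close>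
lemma lipschitz_sph_div_bound:
  fixes F :: "real^3 \<Rightarrow> real"
  assumes mF: "F \<in> borel_measurable sph_measure" and F1: "\<And>x. \<bar>F x\<bar> \<le> 1" and M: "0 \<le> M"
    and lip: "AE x in sph_measure. \<forall>y\<in>S2_plus. P x \<longrightarrow> P y \<longrightarrow> x \<in> S2_plus \<longrightarrow> \<bar>F y - F x\<bar> \<le> M * norm (y - x)"
    and P: "AE x in sph_measure. P x"
    and X: "test_field S2_plus X"
  shows "\<bar>\<integral>x. F x * sph_div X x \<partial>sph_measure\<bar> \<le> 3 * M * (\<integral>x. norm (X x) \<partial>sph_measure)"
proof -
  let ?M = sph_measure
  let ?X' = "\<lambda>x. frechet_derivative X (at x)"
  obtain K where K: "compact K" "K \<subseteq> S2_plus" "\<forall>x\<in>S2 - K. X x = 0" using X unfolding test_field_def by blast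
  \<comment> \<open>A rotation by an angle less than \<open>\<eta>\<close> changes heights by less
    than \<open>\<eta>\<close>, so it cannot carry the support of \<open>X\<close> out of the
    hemisphere, where alone \<open>F\<close> is known to be Lipschitz.\<close>
  obtain \<eta> where \<eta>: "0 < \<eta>" "\<And>x. x \<in> K \<Longrightarrow> \<eta> \<le> x $ 3"
  proof (cases "K = {}")
    case False
    have "continuous_on K (\<lambda>x. x $ 3)" by (intro continuous_intros)
    then obtain x0 where x0: "x0 \<in> K" "\<And>x. x \<in> K \<Longrightarrow> x0 $ 3 \<le> x $ 3"
      using continuous_attains_inf[OF K(1) False] by blast
    have "0 < x0 $ 3" using x0(1) K(2) by (auto simp: S2_plus_def)
    then show ?thesis using that[of "x0 $ 3"] x0(2) by blast
  qed (use that[of 1] in auto)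
  have dX: "(X has_derivative ?X' x) (at x)" for x by (rule test_fieldD(1)[OF X])
  have cX: "continuous_on UNIV X" by (rule test_fieldD(3)[OF X])
  have bound: "integrable ?M (\<lambda>x. F x * (?X' x (cross3 b x) \<bullet> cross3 b x + X x \<bullet> cross3 b (cross3 b x)))
     \<and> \<bar>\<integral>x. F x * (?X' x (cross3 b x) \<bullet> cross3 b x + X x \<bullet> cross3 b (cross3 b x)) \<partial>?M\<bar> \<le> M * (\<integral>x. norm (X x) \<partial>?M)"
    if b: "b \<in> Basis" for b :: "real^3"
  proof -
    have nb: "norm b = 1" using b by simp
    define a where "a x = X x \<bullet> cross3 b x" for x
    define D where "D x = ?X' x (cross3 b x) \<bullet> cross3 b x + X x \<bullet> cross3 b (cross3 b x)" for x
    have ccr: "continuous_on UNIV (cross3 b)" by (intro continuous_on_cross continuous_on_const continuous_on_id)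
    have ca: "continuous_on UNIV a" unfolding a_def[abs_def] by (intro continuous_on_inner cX ccr)
    have c1: "continuous_on UNIV (\<lambda>x. ?X' x (cross3 b x))"
      by (rule continuous_frechet[OF dX test_fieldD(2)[OF X] ccr])
    have c2: "continuous_on UNIV (\<lambda>x. cross3 b (cross3 b x))"
      by (intro continuous_on_cross continuous_on_const ccr)
    have cD: "continuous_on UNIV D" unfolding D_def[abs_def]
      by (intro continuous_on_add continuous_on_inner c1 c2 ccr cX)
    obtain B where B: "0 \<le> B" "\<And>x. x \<in> S2 \<Longrightarrow> norm (D x) \<le> B" using continuous_bounded_S2[OF cD] by blast
    obtain A where A: "0 \<le> A" "\<And>x. x \<in> S2 \<Longrightarrow> norm (a x) \<le> A" using continuous_bounded_S2[OF ca] by blast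
    let ?r = "rot3 b"
    have rS: "?r s z \<in> S2" if "z \<in> S2" for s z using that norm_rot3[OF nb] by (simp add: S2_def)
    have mr: "?r s \<in> measurable ?M ?M" for s by (rule measurable_sph_orthogonal[OF orthogonal_transformation_rot3[OF nb]])
    have ma: "a \<in> borel_measurable ?M" and mD: "D \<in> borel_measurable ?M" using ca cD by (auto intro: borel_measurable_sph_continuous)
    have mar: "(\<lambda>z. a (?r s z)) \<in> borel_measurable ?M" "(\<lambda>z. D (?r s z)) \<in> borel_measurable ?M" for s
      using measurable_compose[OF mr ma] measurable_compose[OF mr mD] by auto
    have da: "((\<lambda>s. a (?r s z)) has_real_derivative D (?r s z)) (at s)" for s z
    proof -
      let ?w = "?r s z"
      have 1: "((\<lambda>s. X (?r s z)) has_vector_derivative ?X' ?w (cross3 b ?w)) (at s)"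
        using vector_derivative_diff_chain_within[of "\<lambda>s. ?r s z" "cross3 b ?w" s UNIV X "?X' ?w"]
          rot3_has_vector_derivative[OF nb, of z s] dX[of ?w] by (simp add: comp_def has_derivative_at_withinI)
      have bl: "bounded_linear (cross3 b)"
        by (rule linear_conv_bounded_linear[THEN iffD1]) (rule linearI, simp_all add: cross_add_right cross_mult_right)
      have 2: "((\<lambda>s. cross3 b (?r s z)) has_vector_derivative cross3 b (cross3 b ?w)) (at s)"
        by (rule bounded_linear.has_vector_derivative[OF bl rot3_has_vector_derivative[OF nb]])
      show ?thesis
        using bounded_bilinear.has_vector_derivative[OF bounded_bilinear_inner 1 2]
        by (simp add: a_def D_def has_real_derivative_iff_has_vector_derivative add.commute)
    qed
    define G where "G s = (\<integral>z. F z * a (?r s z) \<partial>?M)" for s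
    have dG: "(G has_real_derivative (\<integral>z. F z * D (?r s z) \<partial>?M)) (at s)" for s unfolding G_def[abs_def]
    proof (rule has_real_derivative_integral[OF finite_measure_sph, where B=B])
      show "integrable ?M (\<lambda>z. F z * a (?r s z))" for s
        by (rule integrable_sph_mult_bounded[OF mF mar(1) F1]) (use A rS in auto)
      show "((\<lambda>s. F z * a (?r s z)) has_real_derivative F z * D (?r s z)) (at s)" for s z
        by (rule DERIV_cmult[OF da])
      show "\<bar>F z * D (?r s z)\<bar> \<le> B" if "z \<in> space ?M" for s z
        using mult_mono[OF F1[of z] B(2)[OF rS[of z s]]] that B(1) by (simp add: abs_mult)
    qed (use mF mar in auto)
    have ia: "integrable ?M (\<lambda>z. \<bar>a z\<bar>)" by (intro integrable_sph_continuous continuous_intros ca)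
    \<comment> \<open>By invariance of the measure the rotation is moved from the field to
      \<open>F\<close>, while the derivative of \<open>G\<close> at 0 is the integral to be
      bounded.\<close>
    have G0: "\<bar>G s - G 0\<bar> \<le> M * \<bar>s\<bar> * (\<integral>z. \<bar>a z\<bar> \<partial>?M)" if s: "\<bar>s\<bar> < \<eta>" for s
    proof -
      let ?R = "?r (- s)"
      have mFR: "(\<lambda>z. F (?R z)) \<in> borel_measurable ?M" using measurable_compose[OF mr mF] .
      have "G s = (\<integral>z. F (?R z) * a (?r s (?R z)) \<partial>?M)" unfolding G_def
        by (rule integral_sph_orthogonal[OF orthogonal_transformation_rot3[OF nb], symmetric]) (use mF mar in auto)
      also have "\<dots> = (\<integral>z. F (?R z) * a z \<partial>?M)" using rot3_inverse[OF nb, of "- s"] by simp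
      finally have Gs: "G s = (\<integral>z. F (?R z) * a z \<partial>?M)" .
      have i: "integrable ?M (\<lambda>z. F (?R z) * a z)" "integrable ?M (\<lambda>z. F z * a z)"
        by (rule integrable_sph_mult_bounded; use mF mFR ma A F1 in auto)+
      have "G s - G 0 = (\<integral>z. (F (?R z) - F z) * a z \<partial>?M)" unfolding Gs using i by (simp add: G_def left_diff_distrib)
      also have "\<bar>\<dots>\<bar> \<le> (\<integral>z. \<bar>(F (?R z) - F z) * a z\<bar> \<partial>?M)" using integral_norm_bound[of ?M "\<lambda>z. (F (?R z) - F z) * a z"] by simp
      also have "\<dots> \<le> (\<integral>z. M * \<bar>s\<bar> * \<bar>a z\<bar> \<partial>?M)"
      proof (rule integral_mono_AE)
        have "integrable ?M (\<lambda>z. (F (?R z) - F z) * a z)" using i by (simp add: left_diff_distrib)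
        then show "integrable ?M (\<lambda>z. \<bar>(F (?R z) - F z) * a z\<bar>)" by (rule integrable_abs)
        show "integrable ?M (\<lambda>z. M * \<bar>s\<bar> * \<bar>a z\<bar>)" using ia by simp
        \<comment> \<open>The rotated point has to avoid the exceptional set as well; rotations
          preserve null sets.\<close>
        have PR: "AE z in ?M. P (?R z)"
          by (rule AE_sph_preserving[OF mr distr_sph_orthogonal[OF orthogonal_transformation_rot3[OF nb]] P])
        show "AE z in ?M. \<bar>(F (?R z) - F z) * a z\<bar> \<le> M * \<bar>s\<bar> * \<bar>a z\<bar>"
          using lip P PR AE_space
        proof eventually_elim
          fix z assume l: "\<forall>y\<in>S2_plus. P z \<longrightarrow> P y \<longrightarrow> z \<in> S2_plus \<longrightarrow> \<bar>F y - F z\<bar> \<le> M * norm (y - z)" and Pz: "P z" "P (?R z)" and z: "z \<in> space ?M"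
          show "\<bar>(F (?R z) - F z) * a z\<bar> \<le> M * \<bar>s\<bar> * \<bar>a z\<bar>"
          proof (cases "z \<in> K")
            case False
            then have "a z = 0" using K(3) z by (simp add: a_def)
            then show ?thesis by simp
          next
            case True
            have d: "norm (?R z - z) \<le> \<bar>s\<bar>" using norm_rot3_diff_le[OF nb, of "- s" z] z by (simp add: S2_def)
            have "\<bar>(?R z - z) $ 3\<bar> \<le> \<bar>s\<bar>" using component_le_norm_cart[of "?R z - z" 3] d by linarith
            then have "0 < ?R z $ 3" using \<eta>(2)[OF True] s by simp
            then have RU: "?R z \<in> S2_plus" using rS z by (simp add: S2_plus_def)
            have "\<bar>F (?R z) - F z\<bar> \<le> M * norm (?R z - z)" using l RU Pz True K(2) by blast
            also have "\<dots> \<le> M * \<bar>s\<bar>" using d M by (intro mult_left_mono)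
            finally show ?thesis unfolding abs_mult by (intro mult_right_mono) auto
          qed
        qed
      qed
      finally show ?thesis using ia by simp
    qed
    have D0: "((\<lambda>h. (G (0 + h) - G 0) / h) \<longlongrightarrow> (\<integral>z. F z * D z \<partial>?M)) (at 0)"
      using dG[of 0] by (simp add: DERIV_def)
    have "\<bar>\<integral>z. F z * D z \<partial>?M\<bar> \<le> M * (\<integral>z. \<bar>a z\<bar> \<partial>?M)"
    proof (rule tendsto_upperbound[OF tendsto_rabs[OF D0]])
      show "\<forall>\<^sub>F h in at 0. \<bar>(G (0 + h) - G 0) / h\<bar> \<le> M * (\<integral>z. \<bar>a z\<bar> \<partial>?M)"
        unfolding eventually_at using \<eta>(1) G0
        by (intro exI[of _ \<eta>]) (auto simp: abs_divide divide_le_eq mult_ac)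
    qed simp
    also have "\<dots> \<le> M * (\<integral>x. norm (X x) \<partial>?M)"
    proof (intro mult_left_mono integral_mono ia M)
      show "integrable ?M (\<lambda>x. norm (X x))" by (intro integrable_sph_continuous continuous_intros cX)
      fix z assume "z \<in> space ?M"
      then have z: "norm z = 1" by (simp add: S2_def)
      have "\<bar>a z\<bar> \<le> norm (X z) * norm (cross3 b z)" unfolding a_def by (rule Cauchy_Schwarz_ineq2)
      also have "\<dots> \<le> norm (X z) * 1" using norm_cross3_le[of b z] nb z by (intro mult_left_mono) auto
      finally show "\<bar>a z\<bar> \<le> norm (X z)" by simp
    qed
    finally have bnd: "\<bar>\<integral>z. F z * D z \<partial>?M\<bar> \<le> M * (\<integral>x. norm (X x) \<partial>?M)" .
    have "integrable ?M (\<lambda>x. F x * D x)"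
      by (rule integrable_sph_mult_bounded[OF mF mD F1]) (use B in auto)
    from conjI[OF this bnd] show ?thesis unfolding D_def .
  qed
  let ?D = "\<lambda>b x. ?X' x (cross3 b x) \<bullet> cross3 b x + X x \<bullet> cross3 b (cross3 b x)"
  have "(\<integral>x. F x * sph_div X x \<partial>?M) = (\<integral>x. (\<Sum>b\<in>Basis. F x * ?D b x) \<partial>?M)"
  proof (rule Bochner_Integration.integral_cong[OF refl])
    fix x assume "x \<in> space ?M"
    then have x: "x \<in> S2" by simp
    show "F x * sph_div X x = (\<Sum>b\<in>Basis. F x * ?D b x)"
      unfolding sph_div_rotations[OF dX x] using test_fieldD(4)[OF X x] by (simp add: sum_distrib_left)
  qed
  also have "\<dots> = (\<Sum>b\<in>Basis. \<integral>x. F x * ?D b x \<partial>?M)" by (rule Bochner_Integration.integral_sum) (use bound in blast)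
  also have "\<bar>\<dots>\<bar> \<le> (\<Sum>b\<in>(Basis::(real^3) set). M * (\<integral>x. norm (X x) \<partial>?M))"
    by (rule order_trans[OF sum_abs sum_mono]) (use bound in blast)
  also have "\<dots> = 3 * M * (\<integral>x. norm (X x) \<partial>?M)" by simp
  finally show ?thesis .
qed

section \<open>A weak gradient for a Lipschitz function on the hemisphere\<close>

lemma S2_plus_sets: "S2_plus \<in> sets sph_measure"
proof -
  have "S2_plus = {x \<in> space sph_measure. x $ 3 > 0}" by (auto simp: S2_plus_def)
  also have "\<dots> \<in> sets sph_measure" using borel_measurable_sphI[OF borel_measurable_vec_nth[of 3]] by measurable
  finally show ?thesis .
qed

lemma S2_plus_Int_space: "S2_plus \<inter> space sph_measure = S2_plus"
  by (auto simp: S2_plus_def)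

lemma Linf_norm_leI:
  assumes "f \<in> borel_measurable (sph_on U)" "AE x in sph_on U. norm (f x) \<le> C" shows "Linf_norm U f \<le> ereal C"
  unfolding Linf_norm_def using assms by (intro esssup_I) auto

lemma AE_sph_on_S2_plus:
  "(AE x in sph_on S2_plus. Q x) \<longleftrightarrow> (AE x in sph_measure. x \<in> S2_plus \<longrightarrow> Q x)"
  by (rule AE_restrict_space_iff) (simp only: S2_plus_Int_space S2_plus_sets)

text \<open>Integrating \<open>f\<close> against the divergence is a functional on test fields
  bounded in the \<open>L^1\<close> norm, so it is represented by a bounded field, and this field is
  a weak gradient. The 3 comes from the three coordinate rotations.\<close>

lemma grad_Linf_le_lipschitz:
  fixes f :: "real^3 \<Rightarrow> real"
  assumes mf: "f \<in> borel_measurable sph_measure" and f1: "AE x in sph_measure. \<bar>f x\<bar> \<le> 1" and M: "0 \<le> M"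
    and P: "AE x in sph_measure. P x"
    and lip: "\<And>x y. x \<in> S2_plus \<Longrightarrow> y \<in> S2_plus \<Longrightarrow> P x \<Longrightarrow> P y \<Longrightarrow> \<bar>f y - f x\<bar> \<le> M * norm (y - x)"
  shows "grad_Linf S2_plus f \<le> ereal (3 * M)"
proof -
  let ?M = sph_measure
  note U = S2_plus_sets
  have Us: "S2_plus \<inter> space ?M \<in> sets ?M" "S2_plus \<subseteq> S2" by (simp only: S2_plus_Int_space U) (auto simp: S2_plus_def)
  \<comment> \<open>\<open>f\<close> is bounded by 1 only almost everywhere. Truncation, followed by
    restriction to the hemisphere, makes it bounded everywhere and keeps its Lipschitz constant on
    the hemisphere.\<close>
  define F where "F x = max (-1) (min 1 (f x))" for x
  have mF: "F \<in> borel_measurable ?M" unfolding F_def[abs_def] using mf by measurable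
  have F1: "\<bar>F x\<bar> \<le> 1" for x by (auto simp: F_def)
  have Ff: "AE x in ?M. F x = f x" using f1 by eventually_elim (auto simp: F_def)
  define I where "I x = indicator S2_plus x * F x" for x
  have mI: "I \<in> borel_measurable ?M" unfolding I_def[abs_def] using mF U by measurable
  have I1: "\<bar>I x\<bar> \<le> 1" for x using F1 by (auto simp: I_def indicator_def)
  define T where "T X = (\<integral>x. I x * sph_div X x \<partial>?M)" for X
  have Fl: "\<bar>I y - I x\<bar> \<le> M * norm (y - x)" if "x \<in> S2_plus" "y \<in> S2_plus" "P x" "P y" for x y
  proof -
    have "\<bar>I y - I x\<bar> \<le> \<bar>f y - f x\<bar>" using that by (auto simp: I_def F_def)
    then show ?thesis using lip[OF that] by linarith
  qed
  have bd: "\<bar>T X\<bar> \<le> (3 * M) * (\<integral>x. norm (X x) \<partial>?M)" if X: "test_field S2_plus X" for X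
    unfolding T_def using lipschitz_sph_div_bound[OF mI I1 M _ P X] Fl by (auto intro!: AE_I2)
  have csd: "continuous_on UNIV (sph_div X)" if X: "test_field S2_plus X" for X unfolding sph_div_def[abs_def]
    by (intro continuous_on_diff continuous_on_sum continuous_on_inner continuous_on_const continuous_on_id test_fieldD(2)[OF X]
         continuous_frechet[OF test_fieldD(1)[OF X] test_fieldD(2)[OF X]])
  have lin: "T (\<lambda>x. X x + c *\<^sub>R Y x) = T X + c * T Y" if X: "test_field S2_plus X" and Y: "test_field S2_plus Y" for X Y c
  proof -
    have i: "integrable ?M (\<lambda>x. I x * sph_div Z x)" if Z: "test_field S2_plus Z" for Z
    proof -
      obtain B where B: "0 \<le> B" "\<And>x. x \<in> S2 \<Longrightarrow> norm (sph_div Z x) \<le> B" using continuous_bounded_S2[OF csd[OF Z]] by blast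
      show ?thesis by (rule integrable_sph_mult_bounded[OF mI borel_measurable_sph_continuous[OF csd[OF Z]] I1]) (use B in auto)
    qed
    have "T (\<lambda>x. X x + c *\<^sub>R Y x) = (\<integral>x. I x * sph_div X x + c * (I x * sph_div Y x) \<partial>?M)"
      unfolding T_def using test_field_add_scale(2)[OF X Y] by (intro Bochner_Integration.integral_cong) (auto simp: algebra_simps)
    also have "\<dots> = T X + c * T Y" unfolding T_def using i[OF X] i[OF Y] by simp
    finally show ?thesis .
  qed
  have M3: "0 \<le> 3 * M" using M by simp
  obtain g where g: "g \<in> borel_measurable ?M" "AE x in ?M. g x \<bullet> x = 0" "AE x in ?M. norm (g x) \<le> 3 * M"
    "\<And>X. test_field S2_plus X \<Longrightarrow> T X = - (\<integral>x. g x \<bullet> X x \<partial>?M)"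
    by (rule test_field_representation[OF lin bd M3]) blast+
  have mfr: "f \<in> borel_measurable (sph_on S2_plus)" "g \<in> borel_measurable (sph_on S2_plus)"
    using mf g(1) by (auto intro: measurable_restrict_space1)
  have li: "locally_integrable_on S2_plus h" if "h \<in> borel_measurable ?M" "AE x in ?M. norm (h x) \<le> C"
    for h :: "real^3 \<Rightarrow> 'b::euclidean_space" and C
    unfolding locally_integrable_on_def set_integrable_def
  proof (intro conjI allI impI)
    show "h \<in> borel_measurable (sph_on S2_plus)" using that(1) by (rule measurable_restrict_space1)
    fix K assume K: "compact K \<and> K \<subseteq> S2_plus"
    then have Ks: "K \<in> sets ?M" using Us by (auto simp: sets_restrict_space image_iff compact_imp_closed borel_closed intro!: bexI[of _ K])
    have "AE x in ?M. norm (indicator K x *\<^sub>R h x) \<le> C" using that(2)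
      by eventually_elim (auto simp: indicator_def intro: order_trans[OF norm_ge_zero])
    then show "integrable ?M (\<lambda>x. indicator K x *\<^sub>R h x)"
      by (rule sph.integrable_const_bound) (intro borel_measurable_scaleR borel_measurable_indicator Ks that(1))
  qed
  have "weak_gradient S2_plus f g"
    unfolding weak_gradient_def
  proof (intro conjI allI impI)
    show "locally_integrable_on S2_plus f" using f1 by (intro li[OF mf, of 1]) auto
    show "locally_integrable_on S2_plus g" by (rule li[OF g(1,3)])
    show "AE x in sph_on S2_plus. g x \<bullet> x = 0" unfolding AE_sph_on_S2_plus using g(2) by eventually_elim auto
    fix X assume X: "test_field S2_plus X"
    have "(\<integral>x. f x * sph_div X x \<partial>sph_on S2_plus) = (\<integral>x. indicator S2_plus x *\<^sub>R (f x * sph_div X x) \<partial>?M)"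
      by (rule integral_restrict_space[OF Us(1)])
    also have "\<dots> = T X" unfolding T_def
    proof (rule integral_cong_AE)
      show "AE x in ?M. indicator S2_plus x *\<^sub>R (f x * sph_div X x) = I x * sph_div X x"
        using Ff by eventually_elim (auto simp: I_def)
    qed (intro borel_measurable_scaleR borel_measurable_times borel_measurable_indicator U mf mI borel_measurable_sph_continuous[OF csd[OF X]])+
    also have "\<dots> = - (\<integral>x. g x \<bullet> X x \<partial>?M)" by (rule g(4)[OF X])
    also have "(\<integral>x. g x \<bullet> X x \<partial>?M) = (\<integral>x. indicator S2_plus x *\<^sub>R (g x \<bullet> X x) \<partial>?M)"
    proof (rule Bochner_Integration.integral_cong[OF refl])
      fix x assume x: "x \<in> space ?M"
      obtain K where K: "K \<subseteq> S2_plus" "\<forall>x\<in>S2 - K. X x = 0" using X unfolding test_field_def by blast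
      have "X x = 0" if "x \<notin> S2_plus" using K(2)[rule_format, of x] K(1) that x by auto
      then show "g x \<bullet> X x = indicator S2_plus x *\<^sub>R (g x \<bullet> X x)" by (cases "x \<in> S2_plus") auto
    qed
    also have "\<dots> = (\<integral>x. g x \<bullet> X x \<partial>sph_on S2_plus)" by (rule integral_restrict_space[OF Us(1), symmetric])
    finally show "(\<integral>x. f x * sph_div X x \<partial>sph_on S2_plus) = - (\<integral>x. g x \<bullet> X x \<partial>sph_on S2_plus)" .
  qed
  moreover have "Linf_norm S2_plus g \<le> ereal (3 * M)"
    by (rule Linf_norm_leI[OF mfr(2)]) (unfold AE_sph_on_S2_plus, use g(3) in eventually_elim, auto)
  ultimately show ?thesis unfolding grad_Linf_def by (intro Inf_lower2[of "Linf_norm S2_plus g"]) auto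
qed

section \<open>Lipschitz bounds from weak gradients\<close>

text \<open>Regularity squeezes a measurable set between a compact and an open set, and a Urysohn
  function for the pair approximates its indicator; sums and dominated limits follow by induction
  over integrable functions.\<close>

lemma continuous_dense_L1:
  fixes f :: "real^3 \<Rightarrow> real"
  assumes f: "integrable sph_measure f" and e: "0 < \<epsilon>"
  obtains h where "continuous_on UNIV h" "(\<integral>x. \<bar>f x - h x\<bar> \<partial>sph_measure) < \<epsilon>"
proof -
  let ?M = sph_measure
  have "\<forall>\<epsilon>>0. \<exists>h. continuous_on UNIV h \<and> (\<integral>x. \<bar>f x - h x\<bar> \<partial>?M) < \<epsilon>"
    using f
  proof (induction rule: integrable_induct)
    case (base A c)
    show ?case
    proof (intro allI impI)
      fix \<epsilon> :: real assume e: "0 < \<epsilon>"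
      define \<epsilon>' where "\<epsilon>' = \<epsilon> / (\<bar>c\<bar> + 1)"
      have e': "0 < \<epsilon>'" using e by (simp add: \<epsilon>'_def)
      \<comment> \<open>Regularity concerns measures on the Borel sets of the ambient space, so the
        surface measure is pushed forward to it.\<close>
      let ?N = "distr ?M borel (\<lambda>x. x)"
      have mi: "(\<lambda>x. x) \<in> measurable ?M borel" by (rule measurable_ident_sph)
      have A: "A \<in> sets borel" "A \<subseteq> S2" using base(1) by (auto simp: sets_restrict_space)
      have em: "emeasure ?N B = emeasure ?M (B \<inter> S2)" if "B \<in> sets borel" for B
        using that by (simp add: emeasure_distr[OF mi] Int_commute)
      have fin: "emeasure ?N (space ?N) \<noteq> \<infinity>" using em[of UNIV] by (simp add: sph.emeasure_eq_measure)
      interpret N: finite_measure ?N by standard (rule fin)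
      have "emeasure ?N A = (SUP K\<in>{K. K \<subseteq> A \<and> compact K}. emeasure ?N K)" "emeasure ?N A = (INF U\<in>{U. A \<subseteq> U \<and> open U}. emeasure ?N U)"
        using inner_regular[OF _ fin, of A] outer_regular[OF _ fin, of A] A by auto
      note reg = this
      have "\<exists>K\<in>{K. K \<subseteq> A \<and> compact K}. measure ?N A - \<epsilon>'/2 < measure ?N K"
      proof (rule ccontr)
        assume na: "\<not> ?thesis"
        then have "emeasure ?N K \<le> ennreal (max 0 (measure ?N A - \<epsilon>'/2))" if "K \<subseteq> A" "compact K" for K
          using that by (auto simp: N.emeasure_eq_measure not_less intro!: ennreal_leI)
        then have "emeasure ?N A \<le> ennreal (max 0 (measure ?N A - \<epsilon>'/2))" unfolding reg(1) by (intro SUP_least) auto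
        then have "measure ?N A \<le> max 0 (measure ?N A - \<epsilon>'/2)" by (simp add: N.emeasure_eq_measure)
        moreover have "{} \<in> {K. K \<subseteq> A \<and> compact K}" by simp
        then have "\<not> measure ?N A - \<epsilon>'/2 < measure ?N {}" using na by blast
        ultimately show False using e' by simp
      qed
      then obtain K where K: "K \<subseteq> A" "compact K" "measure ?N A - \<epsilon>'/2 < measure ?N K" by blast
      have "\<exists>V\<in>{V. A \<subseteq> V \<and> open V}. measure ?N V < measure ?N A + \<epsilon>'/2"
      proof (rule ccontr)
        assume "\<not> ?thesis"
        then have "ennreal (measure ?N A + \<epsilon>'/2) \<le> emeasure ?N V" if "A \<subseteq> V" "open V" for V
          using that by (auto simp: N.emeasure_eq_measure not_less intro!: ennreal_leI)
        then have "ennreal (measure ?N A + \<epsilon>'/2) \<le> emeasure ?N A" unfolding reg(2) by (intro INF_greatest) auto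
        then show False using e' by (simp add: N.emeasure_eq_measure)
      qed
      then obtain V where V: "A \<subseteq> V" "open V" "measure ?N V < measure ?N A + \<epsilon>'/2" by blast
      have cl: "closed K" "closed (- V)" "K \<inter> - V = {}"
        using K(1,2) V(1,2) by (auto intro: compact_imp_closed)
      obtain u :: "real^3 \<Rightarrow> real" where u: "continuous_on UNIV u" "\<And>x. u x \<in> closed_segment 1 0" "\<And>x. x \<in> K \<Longrightarrow> u x = 1" "\<And>x. x \<in> - V \<Longrightarrow> u x = 0"
        by (rule Urysohn[OF cl, of 1 0]) blast
      have u01: "0 \<le> u x" "u x \<le> 1" for x using u(2)[of x] by (auto simp: closed_segment_eq_real_ivl)
      have KV: "K \<in> sets borel" "V \<in> sets borel" using K V by (auto intro: borel_compact borel_open)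
      have le: "\<bar>indicator A x - u x\<bar> \<le> indicator (V - K) x" for x
        using u(3)[of x] u(4)[of x] u01[of x] K(1) V(1) by (auto simp: indicator_def)
      have mVK: "(V - K) \<inter> S2 \<in> sets ?M" using KV by (auto simp: sets_restrict_space)
      have i: "integrable ?M (\<lambda>x. \<bar>indicator A x - u x\<bar>)"
      proof (rule integrable_sph_bounded[where B=1])
        show "(\<lambda>x. \<bar>indicator A x - u x\<bar>) \<in> borel_measurable ?M"
          using borel_measurable_indicator[OF base(1)] borel_measurable_sph_continuous[OF u(1)] by measurable
        show "norm \<bar>indicator A x - u x\<bar> \<le> 1" for x using u01[of x] by (auto simp: indicator_def)
      qed
      have "(\<integral>x. \<bar>indicator A x - u x\<bar> \<partial>?M) \<le> (\<integral>x. indicator ((V - K) \<inter> S2) x \<partial>?M)"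
      proof (rule integral_mono[OF i])
        show "integrable ?M (\<lambda>x. indicator ((V - K) \<inter> S2) x :: real)"
          by (rule integrable_real_indicator[OF mVK]) (simp add: sph.emeasure_eq_measure)
        show "\<bar>indicator A x - u x\<bar> \<le> indicator ((V - K) \<inter> S2) x" if "x \<in> space ?M" for x
          using le[of x] that by (simp add: indicator_def)
      qed
      also have "\<dots> = measure ?M ((V - K) \<inter> S2)" by (simp add: Int_assoc)
      also have "\<dots> = measure ?N (V - K)" using em[of "V - K"] KV by (simp add: measure_def)
      also have "\<dots> = measure ?N V - measure ?N K" using KV K V by (intro N.finite_measure_Diff) auto
      also have "\<dots> < \<epsilon>'" using K(3) V(3) by simp
      finally have lt: "(\<integral>x. \<bar>indicator A x - u x\<bar> \<partial>?M) < \<epsilon>'" .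
      have "(\<integral>x. \<bar>indicator A x *\<^sub>R c - c * u x\<bar> \<partial>?M) = (\<integral>x. \<bar>c\<bar> * \<bar>indicator A x - u x\<bar> \<partial>?M)"
        by (intro Bochner_Integration.integral_cong refl) (simp add: abs_mult[symmetric] algebra_simps)
      also have "\<dots> = \<bar>c\<bar> * (\<integral>x. \<bar>indicator A x - u x\<bar> \<partial>?M)" using i by simp
      also have "\<dots> \<le> \<bar>c\<bar> * \<epsilon>'" using lt by (intro mult_left_mono) auto
      also have "\<dots> < \<epsilon>" unfolding \<epsilon>'_def using e by (simp add: field_simps)
      finally have "(\<integral>x. \<bar>indicator A x *\<^sub>R c - c * u x\<bar> \<partial>?M) < \<epsilon>" .
      moreover have "continuous_on UNIV (\<lambda>x. c * u x)" by (intro continuous_intros u(1))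
      ultimately show "\<exists>h. continuous_on UNIV h \<and> (\<integral>x. \<bar>indicator A x *\<^sub>R c - h x\<bar> \<partial>?M) < \<epsilon>" by blast
    qed
  next
    case (add f g)
    show ?case
    proof (intro allI impI)
      fix \<epsilon> :: real assume e: "0 < \<epsilon>"
      from add.IH e obtain h k where h: "continuous_on UNIV h" "(\<integral>x. \<bar>f x - h x\<bar> \<partial>?M) < \<epsilon>/2" and k: "continuous_on UNIV k" "(\<integral>x. \<bar>g x - k x\<bar> \<partial>?M) < \<epsilon>/2"
        by (meson half_gt_zero)
      have i: "integrable ?M (\<lambda>x. f x - h x)" "integrable ?M (\<lambda>x. g x - k x)"
        using add.hyps integrable_sph_continuous[OF h(1)] integrable_sph_continuous[OF k(1)] by auto
      have "(\<integral>x. \<bar>f x + g x - (h x + k x)\<bar> \<partial>?M) \<le> (\<integral>x. \<bar>f x - h x\<bar> + \<bar>g x - k x\<bar> \<partial>?M)"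
      proof (rule integral_mono)
        have "integrable ?M (\<lambda>x. (f x - h x) + (g x - k x))" using i by simp
        then show "integrable ?M (\<lambda>x. \<bar>f x + g x - (h x + k x)\<bar>)" by (intro integrable_abs) (simp add: algebra_simps)
      qed (use i in auto)
      also have "\<dots> < \<epsilon>" using i h k by simp
      finally show "\<exists>h. continuous_on UNIV h \<and> (\<integral>x. \<bar>f x + g x - h x\<bar> \<partial>?M) < \<epsilon>"
        using continuous_on_add[OF h(1) k(1)] by blast
    qed
  next
    case (lim f s)
    show ?case
    proof (intro allI impI)
      fix \<epsilon> :: real assume e: "0 < \<epsilon>"
      have "(\<lambda>i. \<integral>x. \<bar>f x - s i x\<bar> \<partial>?M) \<longlonglongrightarrow> (\<integral>x. 0 \<partial>?M)"
      proof (rule integral_dominated_convergence[where w="\<lambda>x. 3 * \<bar>f x\<bar>"])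
        show "AE x in ?M. (\<lambda>i. \<bar>f x - s i x\<bar>) \<longlonglongrightarrow> 0"
        proof (rule AE_I2)
          fix x assume "x \<in> space ?M"
          then have "(\<lambda>i. \<bar>f x - s i x\<bar>) \<longlonglongrightarrow> \<bar>f x - f x\<bar>" by (intro tendsto_intros lim.hyps)
          then show "(\<lambda>i. \<bar>f x - s i x\<bar>) \<longlonglongrightarrow> 0" by simp
        qed
        show "AE x in ?M. norm \<bar>f x - s i x\<bar> \<le> 3 * \<bar>f x\<bar>" for i
          using lim.hyps(3)[of _ i] by (intro AE_I2) (fastforce simp: abs_le_iff)
      qed (use lim.hyps in \<open>auto intro!: borel_measurable_abs borel_measurable_diff\<close>)
      then have "\<forall>\<^sub>F i in sequentially. (\<integral>x. \<bar>f x - s i x\<bar> \<partial>?M) < \<epsilon>/2" using e by (intro order_tendstoD(2)) auto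
      then obtain i where si: "(\<integral>x. \<bar>f x - s i x\<bar> \<partial>?M) < \<epsilon>/2" by (auto dest: eventually_happens)
      obtain h where h: "continuous_on UNIV h" "(\<integral>x. \<bar>s i x - h x\<bar> \<partial>?M) < \<epsilon>/2" using lim.IH[of i] e by (meson half_gt_zero)
      have j: "integrable ?M (\<lambda>x. f x - s i x)" "integrable ?M (\<lambda>x. s i x - h x)"
        using lim.hyps integrable_sph_continuous[OF h(1)] by auto
      have "(\<integral>x. \<bar>f x - h x\<bar> \<partial>?M) \<le> (\<integral>x. \<bar>f x - s i x\<bar> + \<bar>s i x - h x\<bar> \<partial>?M)"
      proof (rule integral_mono)
        have "integrable ?M (\<lambda>x. (f x - s i x) + (s i x - h x))" using j by (rule Bochner_Integration.integrable_add)
        then show "integrable ?M (\<lambda>x. \<bar>f x - h x\<bar>)" by (intro integrable_abs) simp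
      qed (use j in auto)
      also have "\<dots> < \<epsilon>" using j si h by simp
      finally show "\<exists>h. continuous_on UNIV h \<and> (\<integral>x. \<bar>f x - h x\<bar> \<partial>?M) < \<epsilon>" using h by blast
    qed
  qed
  then show ?thesis using e that by blast
qed

text \<open>On the sphere this bump lives on the cap of chordal radius
  \<open>sqrt (2 * \<epsilon>)\<close> about \<open>w\<close>. It depends on
  \<open>w \<bullet> z\<close> only, so rotating the centre amounts to rotating the argument
  backwards, and as a squared positive part it is C^1, as test fields must be.\<close>

definition cap_kernel :: "real \<Rightarrow> real^3 \<Rightarrow> real^3 \<Rightarrow> real" where
  "cap_kernel \<epsilon> w z = (max 0 (w \<bullet> z - (1 - \<epsilon>)))\<^sup>2"

definition cap_mass :: "real \<Rightarrow> real" where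
  "cap_mass \<epsilon> = (\<integral>z. cap_kernel \<epsilon> (axis 3 1) z \<partial>sph_measure)"

lemma continuous_cap_kernel: "continuous_on UNIV (cap_kernel \<epsilon> w)"
  unfolding cap_kernel_def[abs_def] by (intro continuous_intros)

lemma integrable_cap_kernel: "integrable sph_measure (cap_kernel \<epsilon> w)"
  by (rule integrable_sph_continuous[OF continuous_cap_kernel])

lemma integral_cap_kernel:
  assumes "w \<in> S2" shows "(\<integral>z. cap_kernel \<epsilon> w z \<partial>sph_measure) = cap_mass \<epsilon>"
proof -
  have "norm w = 1" using assms by (simp add: S2_def)
  then obtain e n where fr: "frame3 e n w" by (rule frame3_exists)
  have "cap_mass \<epsilon> = (\<integral>z. cap_kernel \<epsilon> (axis 3 1) (vector [z \<bullet> e, z \<bullet> n, z \<bullet> w]) \<partial>sph_measure)"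
    unfolding cap_mass_def
    by (rule integral_sph_orthogonal[OF orthogonal_transformation_frame3[OF fr], symmetric])
       (rule borel_measurable_sph_continuous[OF continuous_cap_kernel])
  also have "\<dots> = (\<integral>z. cap_kernel \<epsilon> w z \<partial>sph_measure)"
    by (simp add: cap_kernel_def inner_axis' inner_commute)
  finally show ?thesis by simp
qed

text \<open>In terms of the chord the bump is the squared positive part of
  \<open>\<epsilon> - r^2 / 2\<close>, at least \<open>(\<epsilon> / 2)^2\<close> up to
  \<open>r = sqrt \<epsilon>\<close>; the annulus between \<open>\<delta> / 2\<close> and
  \<open>\<delta>\<close> already has positive weight.\<close>

lemma cap_mass_pos:
  assumes "0 < \<epsilon>" shows "0 < cap_mass \<epsilon>"
proof -
  let ?a = "axis 3 1 :: real^3"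
  have a: "?a \<in> S2" by (simp add: S2_def)
  let ?h = "\<lambda>r. (max 0 (\<epsilon> - r\<^sup>2 / 2))\<^sup>2"
  have eq: "cap_kernel \<epsilon> ?a z = ?h (norm (z - ?a))" if "z \<in> S2" for z
  proof -
    have "?a \<bullet> z - (1 - \<epsilon>) = \<epsilon> - (norm (z - ?a))\<^sup>2 / 2" unfolding norm_sph_diff[OF that a] inner_commute[of z] by (simp add: field_simps)
    then show ?thesis by (simp only: cap_kernel_def)
  qed
  have m: "?h \<in> borel_measurable borel" by measurable
  define \<delta> where "\<delta> = min 2 (sqrt \<epsilon>)"
  have d: "0 < \<delta>" "\<delta> \<le> 2" "\<delta>\<^sup>2 \<le> \<epsilon>"
    using assms power_mono[of \<delta> "sqrt \<epsilon>" 2] by (auto simp: \<delta>_def)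
  have "0 < ennreal (2 * pi) * (ennreal ((\<epsilon>/2)\<^sup>2 * (\<delta> / 2)) * ennreal (\<delta> / 2))"
    using d assms by (intro ennreal_zero_less_mult_iff[THEN iffD2] conjI) (auto simp: ennreal_zero_less_mult_iff)
  also have "\<dots> = ennreal (2 * pi) * (\<integral>\<^sup>+r. ennreal ((\<epsilon>/2)\<^sup>2 * (\<delta> / 2)) * indicator {\<delta>/2..\<delta>} r \<partial>lborel)"
    using d by (simp add: nn_integral_cmult_indicator)
  also have "\<dots> \<le> ennreal (2 * pi) * (\<integral>\<^sup>+r. ennreal (?h r * r) * indicator {0..2} r \<partial>lborel)"
  proof (intro mult_left_mono nn_integral_mono)
    fix r :: real
    show "ennreal ((\<epsilon>/2)\<^sup>2 * (\<delta> / 2)) * indicator {\<delta>/2..\<delta>} r \<le> ennreal (?h r * r) * indicator {0..2} r"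
    proof (cases "r \<in> {\<delta>/2..\<delta>}")
      case True
      then have "r\<^sup>2 \<le> \<delta>\<^sup>2" using d by (intro power_mono) auto
      then have "\<epsilon>/2 \<le> \<epsilon> - r\<^sup>2 / 2" using d(3) by linarith
      then have "\<epsilon>/2 \<le> max 0 (\<epsilon> - r\<^sup>2 / 2)" by (rule max.coboundedI2)
      then have "(\<epsilon>/2)\<^sup>2 \<le> ?h r" by (rule power_mono) (use assms in simp)
      then have "(\<epsilon>/2)\<^sup>2 * (\<delta> / 2) \<le> ?h r * r" using True d by (intro mult_mono) auto
      then show ?thesis using True d by (simp add: ennreal_leI)
    qed simp
  qed simp
  also have "\<dots> = (\<integral>\<^sup>+z. ennreal (?h (norm (z - ?a))) \<partial>sph_measure)" by (rule nn_integral_sph_radial[OF m a, symmetric])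
  also have "\<dots> = (\<integral>\<^sup>+z. ennreal (cap_kernel \<epsilon> ?a z) \<partial>sph_measure)" by (intro nn_integral_cong) (simp add: eq)
  also have "\<dots> = ennreal (cap_mass \<epsilon>)" unfolding cap_mass_def
    by (rule nn_integral_eq_integral[OF integrable_cap_kernel]) (simp add: cap_kernel_def)
  finally show ?thesis by (simp add: ennreal_less_zero_iff)
qed

definition mollify :: "real \<Rightarrow> (real^3 \<Rightarrow> real) \<Rightarrow> real^3 \<Rightarrow> real" where
  "mollify \<epsilon> F w = (\<integral>z. F z * cap_kernel \<epsilon> w z \<partial>sph_measure) / cap_mass \<epsilon>"

lemma measurable_cap_kernel_pair: "(\<lambda>p. cap_kernel \<epsilon> (fst p) (snd p)) \<in> borel_measurable (sph_measure \<Otimes>\<^sub>M sph_measure)"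
proof -
  have "(\<lambda>p. fst p \<bullet> snd p) \<in> borel_measurable (sph_measure \<Otimes>\<^sub>M sph_measure)"
    by (intro borel_measurable_inner measurable_compose[OF measurable_fst measurable_ident_sph] measurable_compose[OF measurable_snd measurable_ident_sph])
  then show ?thesis unfolding cap_kernel_def by measurable
qed

lemma mollify_measurable:
  assumes F: "F \<in> borel_measurable sph_measure" shows "mollify \<epsilon> F \<in> borel_measurable sph_measure"
proof -
  have "(\<lambda>p. F (snd p) * cap_kernel \<epsilon> (fst p) (snd p)) \<in> borel_measurable (sph_measure \<Otimes>\<^sub>M sph_measure)"
    by (intro borel_measurable_times measurable_cap_kernel_pair measurable_compose[OF measurable_snd F])
  then have "(\<lambda>w. \<integral>z. F z * cap_kernel \<epsilon> w z \<partial>sph_measure) \<in> borel_measurable sph_measure"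
    by (intro sph.borel_measurable_lebesgue_integral) (simp add: case_prod_beta)
  then show ?thesis unfolding mollify_def[abs_def] by measurable
qed

lemma cap_kernel_bounds: "0 \<le> cap_kernel \<epsilon> w z" and cap_kernel_commute: "cap_kernel \<epsilon> w z = cap_kernel \<epsilon> z w"
  by (simp_all add: cap_kernel_def inner_commute)

lemma integrable_mult_cap_kernel:
  assumes F: "integrable sph_measure F" shows "integrable sph_measure (\<lambda>z. F z * cap_kernel \<epsilon> w z)"
proof -
  obtain B where B: "0 \<le> B" "\<And>x. x \<in> S2 \<Longrightarrow> norm (cap_kernel \<epsilon> w x) \<le> B" using continuous_bounded_S2[OF continuous_cap_kernel] by blast
  show ?thesis
  proof (rule Bochner_Integration.integrable_bound[of _ "\<lambda>z. B * F z"])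
    show "integrable sph_measure (\<lambda>z. B * F z)" using F by simp
    show "(\<lambda>z. F z * cap_kernel \<epsilon> w z) \<in> borel_measurable sph_measure"
      by (intro borel_measurable_times borel_measurable_integrable[OF F] borel_measurable_sph_continuous[OF continuous_cap_kernel])
    show "AE z in sph_measure. norm (F z * cap_kernel \<epsilon> w z) \<le> norm (B * F z)"
    proof (rule AE_I2)
      fix z assume "z \<in> space sph_measure"
      then show "norm (F z * cap_kernel \<epsilon> w z) \<le> norm (B * F z)"
        using mult_right_mono[OF B(2)[of z], of "\<bar>F z\<bar>"] B(1) by (simp add: abs_mult mult.commute)
    qed
  qed
qed

text \<open>Fubini, and the symmetry of the kernel: its integral over the centre equals its integral
  over the argument, which is the normalising constant.\<close>

lemma mollify_L1_contraction:
  assumes F: "integrable sph_measure F" and e: "0 < \<epsilon>"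
  shows "integrable sph_measure (mollify \<epsilon> F)" "(\<integral>x. \<bar>mollify \<epsilon> F x\<bar> \<partial>sph_measure) \<le> (\<integral>x. \<bar>F x\<bar> \<partial>sph_measure)"
proof -
  let ?M = sph_measure and ?c = "cap_mass \<epsilon>"
  interpret pair_sigma_finite ?M ?M by (intro pair_sigma_finite.intro) (rule sph.sigma_finite_measure_axioms)+
  have c: "0 < ?c" by (rule cap_mass_pos[OF e])
  have mF: "F \<in> borel_measurable ?M" using F by (rule borel_measurable_integrable)
  have mk: "(\<lambda>p. ennreal \<bar>F (snd p)\<bar> * ennreal (cap_kernel \<epsilon> (fst p) (snd p) / ?c)) \<in> borel_measurable (?M \<Otimes>\<^sub>M ?M)"
    by (intro borel_measurable_times_ennreal measurable_compose[OF _ measurable_ennreal] borel_measurable_divide borel_measurable_const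
        measurable_cap_kernel_pair borel_measurable_abs measurable_compose[OF measurable_snd mF])
  have n: "(\<integral>\<^sup>+x. ennreal (norm (mollify \<epsilon> F x)) \<partial>?M) \<le> ennreal (\<integral>x. \<bar>F x\<bar> \<partial>?M)"
  proof -
    have "(\<integral>\<^sup>+x. ennreal (norm (mollify \<epsilon> F x)) \<partial>?M) \<le> (\<integral>\<^sup>+x. \<integral>\<^sup>+z. ennreal \<bar>F z\<bar> * ennreal (cap_kernel \<epsilon> x z / ?c) \<partial>?M \<partial>?M)"
    proof (rule nn_integral_mono)
      fix x assume "x \<in> space ?M"
      have i: "integrable ?M (\<lambda>z. F z * cap_kernel \<epsilon> x z / ?c)" using integrable_mult_cap_kernel[OF F] by simp
      have "ennreal (norm (mollify \<epsilon> F x)) = ennreal (norm (\<integral>z. F z * cap_kernel \<epsilon> x z / ?c \<partial>?M))" by (simp add: mollify_def)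
      also have "\<dots> \<le> (\<integral>\<^sup>+z. ennreal (norm (F z * cap_kernel \<epsilon> x z / ?c)) \<partial>?M)" by (rule integral_norm_bound_ennreal[OF i])
      also have "\<dots> = (\<integral>\<^sup>+z. ennreal \<bar>F z\<bar> * ennreal (cap_kernel \<epsilon> x z / ?c) \<partial>?M)"
      proof (intro nn_integral_cong)
        fix z
        have "norm (F z * cap_kernel \<epsilon> x z / ?c) = \<bar>F z\<bar> * (cap_kernel \<epsilon> x z / ?c)" using c cap_kernel_bounds by (simp add: abs_mult)
        then show "ennreal (norm (F z * cap_kernel \<epsilon> x z / ?c)) = ennreal \<bar>F z\<bar> * ennreal (cap_kernel \<epsilon> x z / ?c)"
          by (simp only: ennreal_mult'[OF abs_ge_zero])
      qed
      finally show "ennreal (norm (mollify \<epsilon> F x)) \<le> (\<integral>\<^sup>+z. ennreal \<bar>F z\<bar> * ennreal (cap_kernel \<epsilon> x z / ?c) \<partial>?M)" .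
    qed
    also have "\<dots> = (\<integral>\<^sup>+z. \<integral>\<^sup>+x. ennreal \<bar>F z\<bar> * ennreal (cap_kernel \<epsilon> x z / ?c) \<partial>?M \<partial>?M)"
      using Fubini'[of "\<lambda>x z. ennreal \<bar>F z\<bar> * ennreal (cap_kernel \<epsilon> x z / ?c)"] mk by (simp add: case_prod_beta)
    also have "\<dots> = (\<integral>\<^sup>+z. ennreal \<bar>F z\<bar> \<partial>?M)"
    proof (intro nn_integral_cong)
      fix z assume z: "z \<in> space ?M"
      have "(\<integral>\<^sup>+x. ennreal (cap_kernel \<epsilon> x z / ?c) \<partial>?M) = ennreal (\<integral>x. cap_kernel \<epsilon> z x / ?c \<partial>?M)"
        unfolding cap_kernel_commute[of \<epsilon> _ z]
        by (rule nn_integral_eq_integral) (use integrable_cap_kernel[of \<epsilon> z] c cap_kernel_bounds in auto)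
      also have "(\<integral>x. cap_kernel \<epsilon> z x / ?c \<partial>?M) = 1" using integral_cap_kernel[of z \<epsilon>] z c by simp
      finally have 1: "(\<integral>\<^sup>+x. ennreal (cap_kernel \<epsilon> x z / ?c) \<partial>?M) = 1" by simp
      have "(\<integral>\<^sup>+x. ennreal \<bar>F z\<bar> * ennreal (cap_kernel \<epsilon> x z / ?c) \<partial>?M) = ennreal \<bar>F z\<bar> * (\<integral>\<^sup>+x. ennreal (cap_kernel \<epsilon> x z / ?c) \<partial>?M)"
        unfolding cap_kernel_commute[of \<epsilon> _ z]
        by (intro nn_integral_cmult measurable_compose[OF _ measurable_ennreal] borel_measurable_divide borel_measurable_const
             borel_measurable_sph_continuous[OF continuous_cap_kernel])
      then show "(\<integral>\<^sup>+x. ennreal \<bar>F z\<bar> * ennreal (cap_kernel \<epsilon> x z / ?c) \<partial>?M) = ennreal \<bar>F z\<bar>" by (simp add: 1)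
    qed
    also have "\<dots> = ennreal (\<integral>x. \<bar>F x\<bar> \<partial>?M)" by (rule nn_integral_eq_integral) (use F in auto)
    finally show ?thesis .
  qed
  have F0: "0 \<le> (\<integral>x. \<bar>F x\<bar> \<partial>?M)" by (rule integral_nonneg_AE) auto
  show im: "integrable ?M (mollify \<epsilon> F)" by (rule integrable_norm_bound(1)[OF mollify_measurable[OF mF] n F0])
  have "ennreal (\<integral>x. \<bar>mollify \<epsilon> F x\<bar> \<partial>?M) = (\<integral>\<^sup>+x. ennreal (norm (mollify \<epsilon> F x)) \<partial>?M)"
    using nn_integral_eq_integral[of ?M "\<lambda>x. \<bar>mollify \<epsilon> F x\<bar>"] im by simp
  then show "(\<integral>x. \<bar>mollify \<epsilon> F x\<bar> \<partial>?M) \<le> (\<integral>x. \<bar>F x\<bar> \<partial>?M)" using n F0 by (metis ennreal_le_iff)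
qed

text \<open>Uniform continuity on the compact sphere: for \<open>\<epsilon> \<le> d^2 / 4\<close>
  the kernel lives within distance \<open>d\<close> of its centre.\<close>

lemma mollify_continuous:
  assumes h: "continuous_on UNIV h" and e: "0 < e"
  obtains \<epsilon>0 where "0 < \<epsilon>0" "\<And>\<epsilon> x. 0 < \<epsilon> \<Longrightarrow> \<epsilon> \<le> \<epsilon>0 \<Longrightarrow> x \<in> S2 \<Longrightarrow> \<bar>mollify \<epsilon> h x - h x\<bar> \<le> e"
proof -
  have "uniformly_continuous_on S2 h" using h compact_S2 by (intro compact_uniformly_continuous) (auto intro: continuous_on_subset)
  then obtain d where d: "0 < d" "\<And>x z. x \<in> S2 \<Longrightarrow> z \<in> S2 \<Longrightarrow> dist z x < d \<Longrightarrow> dist (h z) (h x) < e"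
    unfolding uniformly_continuous_on_def using e by metis
  show ?thesis
  proof (rule that[of "d\<^sup>2 / 4"])
    show "0 < d\<^sup>2 / 4" using d by simp
    fix \<epsilon> x assume ep: "0 < \<epsilon>" "\<epsilon> \<le> d\<^sup>2 / 4" and x: "x \<in> S2"
    let ?M = sph_measure and ?c = "cap_mass \<epsilon>"
    have c: "0 < ?c" by (rule cap_mass_pos[OF ep(1)])
    have ik: "integrable ?M (\<lambda>z. h z * cap_kernel \<epsilon> x z)" by (rule integrable_mult_cap_kernel[OF integrable_sph_continuous[OF h]])
    have "mollify \<epsilon> h x - h x = (\<integral>z. h z * cap_kernel \<epsilon> x z \<partial>?M) / ?c - h x * (\<integral>z. cap_kernel \<epsilon> x z \<partial>?M) / ?c"
      using c by (simp add: mollify_def integral_cap_kernel[OF x])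
    also have "\<dots> = (\<integral>z. (h z - h x) * cap_kernel \<epsilon> x z \<partial>?M) / ?c"
      using ik integrable_cap_kernel[of \<epsilon> x] by (simp add: left_diff_distrib diff_divide_distrib)
    finally have "\<bar>mollify \<epsilon> h x - h x\<bar> = \<bar>\<integral>z. (h z - h x) * cap_kernel \<epsilon> x z \<partial>?M\<bar> / ?c" using c by simp
    also have "\<dots> \<le> (\<integral>z. e * cap_kernel \<epsilon> x z \<partial>?M) / ?c"
    proof (intro divide_right_mono)
      have "\<bar>\<integral>z. (h z - h x) * cap_kernel \<epsilon> x z \<partial>?M\<bar> \<le> (\<integral>z. \<bar>(h z - h x) * cap_kernel \<epsilon> x z\<bar> \<partial>?M)"
        using integral_norm_bound[of ?M "\<lambda>z. (h z - h x) * cap_kernel \<epsilon> x z"] by simp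
      also have "\<dots> \<le> (\<integral>z. e * cap_kernel \<epsilon> x z \<partial>?M)"
      proof (rule integral_mono)
        show "integrable ?M (\<lambda>z. \<bar>(h z - h x) * cap_kernel \<epsilon> x z\<bar>)"
          by (intro integrable_sph_continuous continuous_intros h continuous_cap_kernel)
        show "integrable ?M (\<lambda>z. e * cap_kernel \<epsilon> x z)" using integrable_cap_kernel[of \<epsilon> x] by simp
        fix z assume "z \<in> space ?M"
        then have z: "z \<in> S2" by simp
        show "\<bar>(h z - h x) * cap_kernel \<epsilon> x z\<bar> \<le> e * cap_kernel \<epsilon> x z"
        proof (cases "x \<bullet> z \<le> 1 - \<epsilon>")
          case True
          then show ?thesis by (simp add: cap_kernel_def)
        next
          case False
          have "(norm (z - x))\<^sup>2 \<le> d\<^sup>2 / 2" using norm_sph_diff[OF z x] False ep by (simp add: inner_commute)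
          also have "\<dots> < d\<^sup>2" using d by simp
          finally have "norm (z - x) < d" using d by (intro power_less_imp_less_base[of "norm (z - x)" 2 d]) auto
          then have "\<bar>h z - h x\<bar> \<le> e" using d(2)[OF x z] by (simp add: dist_norm)
          then show ?thesis unfolding abs_mult using cap_kernel_bounds by (simp add: mult_right_mono)
        qed
      qed
      finally show "\<bar>\<integral>z. (h z - h x) * cap_kernel \<epsilon> x z \<partial>?M\<bar> \<le> (\<integral>z. e * cap_kernel \<epsilon> x z \<partial>?M)" .
    qed (use c in simp)
    also have "\<dots> = e" using c integral_cap_kernel[OF x, of \<epsilon>] by simp
    finally show "\<bar>mollify \<epsilon> h x - h x\<bar> \<le> e" .
  qed
qed

text \<open>Approximation by a continuous function: the contraction controls the mollified error,
  and uniform convergence handles the continuous part.\<close>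

lemma mollify_tendsto_L1:
  assumes F: "integrable sph_measure F"
  shows "(\<lambda>n. \<integral>x. \<bar>mollify (1 / Suc n) F x - F x\<bar> \<partial>sph_measure) \<longlonglongrightarrow> 0"
proof (rule LIMSEQ_I)
  let ?M = sph_measure
  fix r :: real assume r: "0 < r"
  define S where "S = measure ?M S2"
  define e where "e = r / (4 * (S + 1))"
  have S: "0 \<le> S" by (simp add: S_def)
  have e: "0 < e" "e * S \<le> r / 4" using r S by (auto simp: e_def field_simps)
  obtain h where h: "continuous_on UNIV h" "(\<integral>x. \<bar>F x - h x\<bar> \<partial>?M) < r / 4"
    using continuous_dense_L1[OF F, of "r/4"] r by auto
  obtain \<epsilon>0 where \<epsilon>0: "0 < \<epsilon>0" "\<And>\<epsilon> x. 0 < \<epsilon> \<Longrightarrow> \<epsilon> \<le> \<epsilon>0 \<Longrightarrow> x \<in> S2 \<Longrightarrow> \<bar>mollify \<epsilon> h x - h x\<bar> \<le> e"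
    using mollify_continuous[OF h(1) e(1)] by blast
  have ih: "integrable ?M h" by (rule integrable_sph_continuous[OF h(1)])
  have iFh: "integrable ?M (\<lambda>x. F x - h x)" using F ih by simp
  obtain N where N: "1 / Suc N < \<epsilon>0" using \<epsilon>0(1) nat_approx_posE by blast
  show "\<exists>no. \<forall>n\<ge>no. norm ((\<integral>x. \<bar>mollify (1 / Suc n) F x - F x\<bar> \<partial>?M) - 0) < r"
  proof (intro exI allI impI)
    fix n assume n: "n \<ge> N"
    let ?\<epsilon> = "1 / Suc n :: real"
    have ep: "0 < ?\<epsilon>" "?\<epsilon> \<le> \<epsilon>0" using n N frac_le[of 1 1 "real (Suc N)" "real (Suc n)"] by auto
    have lin: "mollify ?\<epsilon> (\<lambda>x. F x - h x) x = mollify ?\<epsilon> F x - mollify ?\<epsilon> h x" for x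
      using integrable_mult_cap_kernel[OF F, of ?\<epsilon> x] integrable_mult_cap_kernel[OF ih, of ?\<epsilon> x]
      by (simp add: mollify_def left_diff_distrib diff_divide_distrib)
    note i = mollify_L1_contraction(1)[OF F ep(1)] mollify_L1_contraction(1)[OF ih ep(1)] mollify_L1_contraction(1)[OF iFh ep(1)]
    have "(\<integral>x. \<bar>mollify ?\<epsilon> F x - F x\<bar> \<partial>?M) \<le> (\<integral>x. \<bar>mollify ?\<epsilon> (\<lambda>x. F x - h x) x\<bar> + e + \<bar>F x - h x\<bar> \<partial>?M)"
    proof (rule integral_mono)
      show "integrable ?M (\<lambda>x. \<bar>mollify ?\<epsilon> F x - F x\<bar>)" using i F by auto
      show "integrable ?M (\<lambda>x. \<bar>mollify ?\<epsilon> (\<lambda>x. F x - h x) x\<bar> + e + \<bar>F x - h x\<bar>)" using i iFh by auto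
      fix x assume "x \<in> space ?M"
      then have "\<bar>mollify ?\<epsilon> h x - h x\<bar> \<le> e" using \<epsilon>0(2)[OF ep] by simp
      then show "\<bar>mollify ?\<epsilon> F x - F x\<bar> \<le> \<bar>mollify ?\<epsilon> (\<lambda>x. F x - h x) x\<bar> + e + \<bar>F x - h x\<bar>" unfolding lin by linarith
    qed
    also have "\<dots> = (\<integral>x. \<bar>mollify ?\<epsilon> (\<lambda>x. F x - h x) x\<bar> \<partial>?M) + e * S + (\<integral>x. \<bar>F x - h x\<bar> \<partial>?M)"
      using i iFh by (simp add: S_def)
    also have "\<dots> < r" using mollify_L1_contraction(2)[OF iFh ep(1)] h(2) e(2) r by linarith
    finally have "(\<integral>x. \<bar>mollify ?\<epsilon> F x - F x\<bar> \<partial>?M) < r" .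
    moreover have "0 \<le> (\<integral>x. \<bar>mollify ?\<epsilon> F x - F x\<bar> \<partial>?M)" by (rule integral_nonneg_AE) auto
    ultimately show "norm ((\<integral>x. \<bar>mollify ?\<epsilon> F x - F x\<bar> \<partial>?M) - 0) < r" by simp
  qed
qed

text \<open>The axis is the normalised cross product. When that vanishes the points are equal or
  antipodal, and any axis orthogonal to \<open>x\<close> serves.\<close>

lemma great_circle:
  assumes x: "x \<in> S2" and y: "y \<in> S2"
  obtains k \<tau> where "norm k = 1" "k \<bullet> x = 0" "0 \<le> \<tau>" "\<tau> \<le> pi" "cos \<tau> = x \<bullet> y"
    "y = rot3 k \<tau> x"
proof -
  have nx: "norm x = 1" "norm y = 1" "x \<bullet> x = 1" "y \<bullet> y = 1" using x y by (simp_all add: S2_def norm_eq_1)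
  define \<tau> where "\<tau> = arccos (x \<bullet> y)"
  have xy: "\<bar>x \<bullet> y\<bar> \<le> 1" using Cauchy_Schwarz_ineq2[of x y] nx by simp
  then have t: "0 \<le> \<tau>" "\<tau> \<le> pi" "cos \<tau> = x \<bullet> y" by (auto simp: \<tau>_def arccos_lbound arccos_ubound)
  have s2: "(norm (cross3 x y))\<^sup>2 = (sin \<tau>)\<^sup>2" unfolding norm_cross sin_squared_eq using nx t by simp
  have s: "norm (cross3 x y) = sin \<tau>" using s2 sin_ge_zero[OF t(1,2)] by (simp add: power2_eq_iff_nonneg)
  show ?thesis
  proof (cases "cross3 x y = 0")
    case True
    then have st: "sin \<tau> = 0" using s by simp
    obtain e n where fr: "frame3 e n x" using frame3_exists[OF nx(1)] by blast
    have k: "norm e = 1" "e \<bullet> x = 0" using fr by (auto simp: frame3_def)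
    have c2: "(cos \<tau>)\<^sup>2 = 1" using st by (simp add: cos_squared_eq)
    have "(y - cos \<tau> *\<^sub>R x) \<bullet> (y - cos \<tau> *\<^sub>R x) = 1 - (cos \<tau>)\<^sup>2"
      using nx t(3) by (simp add: inner_diff_left inner_diff_right inner_commute[of y x] power2_eq_square)
    then have "y = cos \<tau> *\<^sub>R x" using c2 by simp
    then have "y = rot3 e \<tau> x" using st k by (simp add: rot3_def)
    then show ?thesis using that k t by blast
  next
    case False
    then have sp: "0 < sin \<tau>" using s by (metis zero_less_norm_iff)
    define k where "k = (1 / sin \<tau>) *\<^sub>R cross3 x y"
    have k: "norm k = 1" "k \<bullet> x = 0" using sp s by (auto simp: k_def dot_cross_self)
    have "sin \<tau> *\<^sub>R cross3 k x = cross3 (cross3 x y) x" using sp by (simp add: k_def cross_mult_left)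
    also have "\<dots> = - cross3 x (cross3 x y)" by (rule cross_skew)
    also have "\<dots> = y - cos \<tau> *\<^sub>R x" unfolding Lagrange using nx t(3) by simp
    finally have "y = rot3 k \<tau> x" using k by (simp add: rot3_def)
    then show ?thesis using that k t by blast
  qed
qed

text \<open>The chord is \<open>2 * sin (\<tau> / 2)\<close>; the linear lower bound for the sine
  gives the factor 3.\<close>

lemma arc_length_le:
  assumes x: "x \<in> S2" and y: "y \<in> S2" and t: "0 \<le> \<tau>" "\<tau> \<le> pi" "cos \<tau> = x \<bullet> y"
  shows "\<tau> \<le> 3 * norm (x - y)"
proof -
  have "cos \<tau> = 1 - 2 * (sin (\<tau>/2))\<^sup>2" using cos_double_sin[of "\<tau>/2"] by simp
  then have e: "(norm (x - y))\<^sup>2 = (2 * sin (\<tau>/2))\<^sup>2" using norm_sph_diff[OF x y] t(3) by (simp add: power_mult_distrib)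
  have "0 \<le> sin (\<tau>/2)" using t by (intro sin_ge_zero) auto
  then have "norm (x - y) = 2 * sin (\<tau>/2)" by (intro power2_eq_imp_eq[OF e]) auto
  moreover have "\<tau>/2/3 \<le> sin (\<tau>/2)" using t by (intro sin_ge_third) auto
  ultimately show ?thesis by simp
qed

text \<open>Along a great circle the height combines its end values with weights
  \<open>sin (\<tau> - s) / sin \<tau>\<close> and \<open>sin s / sin \<tau>\<close>. On arcs
  shorter than \<open>pi\<close> these are nonnegative with sum at least 1, so a nonnegative lower
  bound persists: the open hemisphere is geodesically convex.\<close>

lemma arc_height:
  assumes k: "k \<bullet> x = 0" and t: "0 \<le> s" "s \<le> \<tau>" "\<tau> < pi" and h: "h \<le> x $ 3" "h \<le> rot3 k \<tau> x $ 3" "0 \<le> h"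
  shows "h \<le> rot3 k s x $ 3"
proof (cases "\<tau> = 0")
  case True
  then show ?thesis using t h by simp
next
  case False
  then have sp: "0 < sin \<tau>" using t by (intro sin_gt_zero) auto
  define p q where "p = x $ 3" and "q = cross3 k x $ 3"
  have r: "rot3 k u x $ 3 = cos u * p + sin u * q" for u using k by (simp add: rot3_def p_def q_def)
  have n: "0 \<le> sin (\<tau> - s)" "0 \<le> sin s" using t by (auto intro!: sin_ge_zero)
  have e: "sin \<tau> * rot3 k s x $ 3 = sin (\<tau> - s) * p + sin s * (rot3 k \<tau> x $ 3)"
    unfolding r sin_diff by (simp add: algebra_simps)
  have "sin \<tau> = sin ((\<tau> - s) + s)" by simp
  also have "\<dots> = sin (\<tau> - s) * cos s + cos (\<tau> - s) * sin s" by (rule sin_add)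
  also have "\<dots> \<le> sin (\<tau> - s) * 1 + 1 * sin s" using n by (intro add_mono mult_left_mono mult_right_mono) auto
  finally have sub: "sin \<tau> \<le> sin (\<tau> - s) + sin s" by simp
  have "sin \<tau> * h \<le> (sin (\<tau> - s) + sin s) * h" using sub h by (intro mult_right_mono) auto
  also have "\<dots> \<le> sin (\<tau> - s) * p + sin s * (rot3 k \<tau> x $ 3)"
    using n h by (simp add: distrib_right add_mono mult_left_mono p_def)
  finally show ?thesis unfolding e[symmetric] using sp by simp
qed

text \<open>The field rotates about \<open>k\<close> with the bump as amplitude. Rotation fields are
  divergence free, so only the derivative of the bump along the rotation survives.\<close>

lemma test_field_cap:
  assumes cap: "\<And>z. z \<in> S2 \<Longrightarrow> 1 - \<epsilon> \<le> w \<bullet> z \<Longrightarrow> z \<in> U"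
  shows "test_field U (\<lambda>z. cap_kernel \<epsilon> w z *\<^sub>R cross3 k z)"
    "sph_div (\<lambda>z. cap_kernel \<epsilon> w z *\<^sub>R cross3 k z) z = 2 * max 0 (w \<bullet> z - (1 - \<epsilon>)) * (w \<bullet> cross3 k z)"
proof -
  let ?\<eta> = "\<lambda>z. 2 * max 0 (w \<bullet> z - (1 - \<epsilon>))"
  have bl: "bounded_linear (cross3 k)"
    by (rule linear_conv_bounded_linear[THEN iffD1]) (rule linearI, simp_all add: cross_add_right cross_mult_right)
  have dk: "(cap_kernel \<epsilon> w has_derivative (\<lambda>v. (w \<bullet> v) * ?\<eta> z)) (at z)" for z
  proof -
    have 1: "((\<lambda>z. w \<bullet> z) has_derivative (\<lambda>v. w \<bullet> v)) (at z)" by (intro derivative_eq_intros) auto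
    have 2: "((\<lambda>s. (max 0 (s - (1 - \<epsilon>)))\<^sup>2) has_derivative (\<lambda>h. h * ?\<eta> z)) (at (w \<bullet> z))"
      using DERIV_max_square[of "1 - \<epsilon>" "w \<bullet> z"] unfolding has_field_derivative_def by (simp add: mult.commute[of _ "2 * _"])
    show ?thesis unfolding cap_kernel_def[abs_def] by (rule has_derivative_compose[OF 1 2])
  qed
  let ?X' = "\<lambda>z v. cap_kernel \<epsilon> w z *\<^sub>R cross3 k v + ((w \<bullet> v) * ?\<eta> z) *\<^sub>R cross3 k z"
  have d: "((\<lambda>z. cap_kernel \<epsilon> w z *\<^sub>R cross3 k z) has_derivative ?X' z) (at z)" for z
    by (rule has_derivative_scaleR[OF dk bounded_linear_imp_has_derivative[OF bl]])
  have cc: "continuous_on UNIV (cross3 k)" by (rule linear_continuous_on[OF bl])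
  have cm: "continuous_on UNIV ?\<eta>" by (intro continuous_intros)
  show "test_field U (\<lambda>z. cap_kernel \<epsilon> w z *\<^sub>R cross3 k z)"
  proof (rule test_fieldI[OF d])
    show "continuous_on UNIV (\<lambda>z. ?X' z v)" for v
      by (intro continuous_on_add continuous_on_scaleR continuous_on_mult continuous_on_const continuous_cap_kernel cc cm)
    show "(cap_kernel \<epsilon> w z *\<^sub>R cross3 k z) \<bullet> z = 0" for z by (simp add: dot_cross_self)
    show "compact {z \<in> S2. 1 - \<epsilon> \<le> w \<bullet> z}"
    proof -
      have "closed {z. 1 - \<epsilon> \<le> w \<bullet> z}" by (intro closed_Collect_le continuous_intros)
      then have "compact (S2 \<inter> {z. 1 - \<epsilon> \<le> w \<bullet> z})" using compact_S2 by (intro compact_Int_closed)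
      then show ?thesis by (simp add: Int_def)
    qed
    show "{z \<in> S2. 1 - \<epsilon> \<le> w \<bullet> z} \<subseteq> U" using cap by auto
    show "cap_kernel \<epsilon> w z *\<^sub>R cross3 k z = 0" if "z \<in> S2 - {z \<in> S2. 1 - \<epsilon> \<le> w \<bullet> z}" for z
      using that by (auto simp: cap_kernel_def max_def)
  qed
  have b0: "cross3 k b \<bullet> b = 0" for b by (simp add: dot_cross_self)
  have "(\<Sum>b\<in>Basis. ?X' z b \<bullet> b) = (\<Sum>b\<in>Basis. ?\<eta> z * ((w \<bullet> b) * (cross3 k z \<bullet> b)))"
    by (intro sum.cong refl) (simp add: inner_add_left b0)
  also have "\<dots> = ?\<eta> z * (w \<bullet> cross3 k z)" by (simp only: sum_distrib_left[symmetric] euclidean_inner[of w "cross3 k z"])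
  finally show "sph_div (\<lambda>z. cap_kernel \<epsilon> w z *\<^sub>R cross3 k z) z = 2 * max 0 (w \<bullet> z - (1 - \<epsilon>)) * (w \<bullet> cross3 k z)"
    unfolding sph_div_eq[OF d] by (simp add: inner_add_left dot_cross_self)
qed

text \<open>Moving the centre along the rotation differentiates the kernel in \<open>w\<close>; for
  a function of \<open>w \<bullet> z\<close> this is minus the derivative along the rotation in
  \<open>z\<close>, hence minus the divergence of a test field. The weak gradient absorbs it, and
  its bound \<open>L\<close> is averaged by the normalised kernel. The caps along the arc must lie
  in \<open>U\<close> for these fields to be admissible.\<close>

lemma mollify_arc_lipschitz:
  assumes U: "U \<in> sets sph_measure" and g: "weak_gradient U f g" and L: "0 \<le> L" "AE x in sph_on U. norm (g x) \<le> L"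
    and F: "F \<in> borel_measurable sph_measure" "\<And>x. \<bar>F x\<bar> \<le> B" and Ff: "AE x in sph_measure. F x = indicator U x * f x"
    and \<epsilon>: "0 < \<epsilon>" and k: "norm k = 1" "k \<bullet> x = 0" and x: "x \<in> S2" and \<tau>: "0 \<le> \<tau>"
    and cap: "\<And>s z. 0 \<le> s \<Longrightarrow> s \<le> \<tau> \<Longrightarrow> z \<in> S2 \<Longrightarrow> 1 - \<epsilon> \<le> rot3 k s x \<bullet> z \<Longrightarrow> z \<in> U"
  shows "\<bar>mollify \<epsilon> F (rot3 k \<tau> x) - mollify \<epsilon> F x\<bar> \<le> L * \<tau>"
proof (cases "\<tau> = 0")
  case False
  then have \<tau>p: "0 < \<tau>" using \<tau> by simp
  let ?M = sph_measure and ?c = "cap_mass \<epsilon>"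
  let ?w = "\<lambda>s. rot3 k s x"
  have Us: "U \<inter> space ?M = U" "U \<subseteq> S2" using sets.sets_into_space[OF U] by auto
  have c: "0 < ?c" by (rule cap_mass_pos[OF \<epsilon>])
  have wS: "?w s \<in> S2" for s using x norm_rot3[OF k(1)] by (simp add: S2_def)
  have B0: "0 \<le> B" using F(2)[of 0] by linarith
  define D where "D s z = 2 * max 0 (?w s \<bullet> z - (1 - \<epsilon>)) * (cross3 k (?w s) \<bullet> z)" for s z
  have iF: "integrable ?M F" by (rule integrable_sph_bounded[OF F(1), of B]) (use F(2) in auto)
  have mcap: "cap_kernel \<epsilon> w \<in> borel_measurable ?M" for w by (rule borel_measurable_sph_continuous[OF continuous_cap_kernel])
  have cD: "continuous_on UNIV (D s)" for s unfolding D_def[abs_def] by (intro continuous_intros)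
  have mD: "D s \<in> borel_measurable ?M" for s by (rule borel_measurable_sph_continuous[OF cD])
  have dD: "((\<lambda>s. cap_kernel \<epsilon> (?w s) z) has_real_derivative D s z) (at s)" for s z
  proof -
    have "((\<lambda>s. ?w s \<bullet> z) has_vector_derivative cross3 k (?w s) \<bullet> z) (at s)"
      by (rule bounded_linear.has_vector_derivative[OF bounded_linear_inner_left rot3_has_vector_derivative[OF k(1)]])
    then have 1: "((\<lambda>s. ?w s \<bullet> z) has_real_derivative cross3 k (?w s) \<bullet> z) (at s)" by (simp add: has_real_derivative_iff_has_vector_derivative)
    show ?thesis unfolding cap_kernel_def D_def by (rule DERIV_chain2[OF DERIV_max_square 1])
  qed
  have D4: "\<bar>D s z\<bar> \<le> 2 * (1 + \<epsilon>)" if z: "z \<in> S2" for s z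
  proof -
    have "?w s \<bullet> z \<le> 1" using Cauchy_Schwarz_ineq2[of "?w s" z] wS[of s] z by (simp add: S2_def)
    define q where "q = max 0 (?w s \<bullet> z - (1 - \<epsilon>))"
    have "0 \<le> q" "q \<le> 1 + \<epsilon>" unfolding q_def using \<open>?w s \<bullet> z \<le> 1\<close> \<epsilon> by (auto intro!: max.boundedI)
    then have "\<bar>2 * q\<bar> \<le> 2 * (1 + \<epsilon>)" by (simp add: abs_of_nonneg)
    then have 1: "\<bar>2 * max 0 (?w s \<bullet> z - (1 - \<epsilon>))\<bar> \<le> 2 * (1 + \<epsilon>)" unfolding q_def .
    have "\<bar>cross3 k (?w s) \<bullet> z\<bar> \<le> norm (cross3 k (?w s)) * norm z" by (rule Cauchy_Schwarz_ineq2)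
    also have "\<dots> \<le> 1" using norm_cross3_le[of k "?w s"] wS[of s] z k by (simp add: S2_def)
    finally have "\<bar>2 * max 0 (?w s \<bullet> z - (1 - \<epsilon>))\<bar> * \<bar>cross3 k (?w s) \<bullet> z\<bar> \<le> 2 * (1 + \<epsilon>) * 1" using 1 \<epsilon> by (intro mult_mono) auto
    then show ?thesis by (simp add: D_def abs_mult)
  qed
  define \<phi> where "\<phi> s = (\<integral>z. F z * cap_kernel \<epsilon> (?w s) z \<partial>?M)" for s
  have d\<phi>: "(\<phi> has_real_derivative (\<integral>z. F z * D s z \<partial>?M)) (at s)" for s
    unfolding \<phi>_def[abs_def]
  proof (rule has_real_derivative_integral[OF finite_measure_sph, where B="B * (2 * (1 + \<epsilon>))"])
    show "integrable ?M (\<lambda>z. F z * cap_kernel \<epsilon> (?w s) z)" for s by (rule integrable_mult_cap_kernel[OF iF])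
    show "((\<lambda>s. F z * cap_kernel \<epsilon> (?w s) z) has_real_derivative F z * D s z) (at s)" for s z by (rule DERIV_cmult[OF dD])
    show "\<bar>F z * D s z\<bar> \<le> B * (2 * (1 + \<epsilon>))" if "z \<in> space ?M" for s z
      unfolding abs_mult using F(2) D4[of z s] that B0 by (intro mult_mono) auto
  qed (use F(1) mcap mD in auto)
  have b: "\<bar>\<integral>z. F z * D s z \<partial>?M\<bar> \<le> L * ?c" if s: "0 \<le> s" "s \<le> \<tau>" for s
  proof -
    let ?X = "\<lambda>z. cap_kernel \<epsilon> (?w s) z *\<^sub>R cross3 k z"
    have cp: "z \<in> U" if "z \<in> S2" "1 - \<epsilon> \<le> ?w s \<bullet> z" for z using cap[OF s that] .
    note tf = test_field_cap[OF cp, where k=k]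
    have sd: "sph_div ?X z = - D s z" for z
    proof -
      have "?w s \<bullet> cross3 k z = - (cross3 k (?w s) \<bullet> z)" by (simp add: cross3_simps)
      moreover have "sph_div ?X z = 2 * max 0 (?w s \<bullet> z - (1 - \<epsilon>)) * (?w s \<bullet> cross3 k z)" by (rule tf(2))
      ultimately show ?thesis by (simp add: D_def)
    qed
    have X0: "?X z = 0" if "z \<in> S2" "z \<notin> U" for z using cp[OF that(1)] that(2) by (auto simp: cap_kernel_def max_def)
    have nX: "norm (?X z) \<le> cap_kernel \<epsilon> (?w s) z" if "z \<in> S2" for z
    proof -
      have "norm (?X z) = cap_kernel \<epsilon> (?w s) z * norm (cross3 k z)" using cap_kernel_bounds by simp
      also have "\<dots> \<le> cap_kernel \<epsilon> (?w s) z * 1" using norm_cross3_le[of k z] k that cap_kernel_bounds by (intro mult_left_mono) (auto simp: S2_def)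
      finally show ?thesis by simp
    qed
    have mi: "indicator U \<in> borel_measurable ?M" by (rule borel_measurable_indicator[OF U])
    have mf: "(\<lambda>z. indicator U z *\<^sub>R f z) \<in> borel_measurable ?M" "(\<lambda>z. indicator U z *\<^sub>R g z) \<in> borel_measurable ?M"
      using g unfolding weak_gradient_def locally_integrable_on_def
      by (simp_all only: borel_measurable_restrict_space_iff Us U)
    have "(\<integral>z. F z * D s z \<partial>?M) = - (\<integral>z. F z * sph_div ?X z \<partial>?M)" unfolding sd by simp
    also have "(\<integral>z. F z * sph_div ?X z \<partial>?M) = (\<integral>z. indicator U z *\<^sub>R (f z * sph_div ?X z) \<partial>?M)"
    proof (rule integral_cong_AE)
      show "AE z in ?M. F z * sph_div ?X z = indicator U z *\<^sub>R (f z * sph_div ?X z)" using Ff by eventually_elim simp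
      show "(\<lambda>z. F z * sph_div ?X z) \<in> borel_measurable ?M" unfolding sd using F(1) mD by (intro borel_measurable_times borel_measurable_uminus)
      have "(\<lambda>z. (indicator U z *\<^sub>R f z) * (- D s z)) \<in> borel_measurable ?M" using mf(1) mD by (intro borel_measurable_times borel_measurable_uminus)
      then show "(\<lambda>z. indicator U z *\<^sub>R (f z * sph_div ?X z)) \<in> borel_measurable ?M" unfolding sd by (simp add: mult.assoc)
    qed
    also have "\<dots> = (\<integral>z. f z * sph_div ?X z \<partial>sph_on U)" by (rule integral_restrict_space[symmetric]) (simp only: Us U)
    also have "\<dots> = - (\<integral>z. g z \<bullet> ?X z \<partial>sph_on U)" using g tf(1) unfolding weak_gradient_def by blast
    also have "(\<integral>z. g z \<bullet> ?X z \<partial>sph_on U) = (\<integral>z. indicator U z *\<^sub>R (g z \<bullet> ?X z) \<partial>?M)" by (rule integral_restrict_space) (simp only: Us U)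
    finally have eq: "(\<integral>z. F z * D s z \<partial>?M) = (\<integral>z. indicator U z *\<^sub>R (g z \<bullet> ?X z) \<partial>?M)" by simp
    have Lg: "AE z in ?M. z \<in> U \<longrightarrow> norm (g z) \<le> L"
      using L(2) by (subst (asm) AE_restrict_space_iff) (simp_all only: Us U)
    have mg: "(\<lambda>z. indicator U z *\<^sub>R (g z \<bullet> ?X z)) \<in> borel_measurable ?M"
    proof -
      have "(\<lambda>z. (indicator U z *\<^sub>R g z) \<bullet> ?X z) \<in> borel_measurable ?M"
        by (intro borel_measurable_inner mf(2) borel_measurable_sph_continuous test_fieldD(3)[OF tf(1)])
      then show ?thesis by (simp add: mult.left_commute)
    qed
    have n: "(\<integral>\<^sup>+z. ennreal (norm (indicator U z *\<^sub>R (g z \<bullet> ?X z))) \<partial>?M) \<le> ennreal (L * ?c)"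
    proof -
      have "(\<integral>\<^sup>+z. ennreal (norm (indicator U z *\<^sub>R (g z \<bullet> ?X z))) \<partial>?M) \<le> (\<integral>\<^sup>+z. ennreal (L * cap_kernel \<epsilon> (?w s) z) \<partial>?M)"
        using Lg AE_space
      proof (intro nn_integral_mono_AE, eventually_elim)
        fix z assume z: "z \<in> U \<longrightarrow> norm (g z) \<le> L" "z \<in> space ?M"
        have "norm (indicator U z *\<^sub>R (g z \<bullet> ?X z)) \<le> L * cap_kernel \<epsilon> (?w s) z"
        proof (cases "z \<in> U")
          case True
          have "\<bar>g z \<bullet> ?X z\<bar> \<le> norm (g z) * norm (?X z)" by (rule Cauchy_Schwarz_ineq2)
          also have "\<dots> \<le> L * cap_kernel \<epsilon> (?w s) z" using z True nX L(1) by (intro mult_mono) auto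
          finally show ?thesis using True by simp
        qed (use L cap_kernel_bounds in auto)
        then show "ennreal (norm (indicator U z *\<^sub>R (g z \<bullet> ?X z))) \<le> ennreal (L * cap_kernel \<epsilon> (?w s) z)" by (rule ennreal_leI)
      qed
      also have "\<dots> = ennreal (\<integral>z. L * cap_kernel \<epsilon> (?w s) z \<partial>?M)"
        by (rule nn_integral_eq_integral) (use integrable_cap_kernel L cap_kernel_bounds in auto)
      also have "(\<integral>z. L * cap_kernel \<epsilon> (?w s) z \<partial>?M) = L * ?c" using integral_cap_kernel[OF wS, of \<epsilon> s] by simp
      finally show ?thesis .
    qed
    have "0 \<le> L * ?c" using L c by simp
    from integrable_norm_bound(2)[OF mg n this] show ?thesis unfolding eq by simp
  qed
  have "norm (\<phi> \<tau> - \<phi> 0) \<le> L * ?c * \<tau> - L * ?c * 0"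
  proof (rule differentiable_bound_general[OF \<tau>p, where f=\<phi> and \<phi>="\<lambda>s. L * ?c * s"])
    show "continuous_on {0..\<tau>} \<phi>" by (rule DERIV_continuous_on[OF has_field_derivative_at_within[OF d\<phi>]])
    show "(\<phi> has_vector_derivative (\<integral>z. F z * D s z \<partial>?M)) (at s)" for s using d\<phi> by (simp add: has_real_derivative_iff_has_vector_derivative)
    show "((\<lambda>s. L * ?c * s) has_vector_derivative L * ?c) (at s)" for s
      by (auto intro!: derivative_eq_intros simp: has_real_derivative_iff_has_vector_derivative[symmetric])
    show "norm (\<integral>z. F z * D s z \<partial>?M) \<le> L * ?c" if "0 < s" "s < \<tau>" for s using b[of s] that by simp
    show "continuous_on {0..\<tau>} (\<lambda>s. L * ?c * s)" by (rule continuous_on_mult_left[OF continuous_on_id])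
  qed
  then have "\<bar>\<phi> \<tau> - \<phi> 0\<bar> \<le> L * ?c * \<tau>" by simp
  then show ?thesis using c by (simp add: mollify_def \<phi>_def diff_divide_distrib[symmetric] abs_divide divide_le_eq mult_ac)
qed simp

text \<open>Mollifications converge in \<open>L^1\<close>, hence almost everywhere along a
  subsequence; \<open>P\<close> collects the points of convergence at which the truncation agrees
  with \<open>f\<close>. There the bound along great circles passes to the limit, and the factor 3
  compares arcs with chords.\<close>

lemma W1inf_lipschitz:
  assumes U: "U = S2 \<or> U = S2_plus" and W: "W1inf U f"
  obtains L P where "0 \<le> L" "AE x in sph_measure. P x"
    "\<And>x y. x \<in> U \<Longrightarrow> y \<in> U \<Longrightarrow> P x \<Longrightarrow> P y \<Longrightarrow> \<bar>f y - f x\<bar> \<le> L * norm (y - x)"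
proof -
  let ?M = sph_measure
  have "S2 \<in> sets ?M" using sets.top[of ?M] by simp
  then have Um: "U \<in> sets ?M" using U S2_plus_sets by blast
  have Us: "U \<inter> space ?M = U" "U \<subseteq> S2" using sets.sets_into_space[OF Um] by auto
  have bnd: "\<exists>C\<ge>0. AE x in sph_on U. norm (h x) \<le> C" if fin: "Linf_norm U h < \<infinity>" for h :: "real^3 \<Rightarrow> 'b::real_normed_vector"
  proof -
    obtain C where C: "Linf_norm U h \<le> ereal C" using fin by (cases "Linf_norm U h") auto
    have "AE x in sph_on U. ereal (norm (h x)) \<le> Linf_norm U h" unfolding Linf_norm_def by (rule esssup_AE)
    then have "AE x in sph_on U. norm (h x) \<le> max C 0"
      by eventually_elim (use C in \<open>metis ereal_less_eq(3) le_max_iff_disj order_trans\<close>)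
    then show ?thesis by (intro exI[of _ "max C 0"]) auto
  qed
  obtain g where g: "weak_gradient U f g" "Linf_norm U g < \<infinity>" using W unfolding W1inf_def by blast
  obtain L where L: "0 \<le> L" "AE x in sph_on U. norm (g x) \<le> L" using bnd[OF g(2)] by blast
  obtain B where B: "0 \<le> B" "AE x in sph_on U. norm (f x) \<le> B" using bnd[of f] W unfolding W1inf_def by blast
  define F where "F x = max (-B) (min B (indicator U x *\<^sub>R f x))" for x
  have mF: "F \<in> borel_measurable ?M"
  proof -
    have "f \<in> borel_measurable (sph_on U)" using W unfolding W1inf_def by blast
    then have "(\<lambda>z. indicator U z *\<^sub>R f z) \<in> borel_measurable ?M" by (simp only: borel_measurable_restrict_space_iff Us Um)
    then show ?thesis unfolding F_def[abs_def] by measurable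
  qed
  have FB: "\<bar>F x\<bar> \<le> B" for x using B(1) by (auto simp: F_def)
  have "AE x in ?M. x \<in> U \<longrightarrow> norm (f x) \<le> B" using B(2) by (subst (asm) AE_restrict_space_iff) (simp_all only: Us Um)
  then have Ff: "AE x in ?M. F x = indicator U x * f x"
    by eventually_elim (use B(1) in \<open>auto simp: F_def indicator_def\<close>)
  have iF: "integrable ?M F" by (rule integrable_sph_bounded[OF mF, of B]) (use FB in auto)
  have iD: "integrable ?M (\<lambda>x. mollify (1 / Suc n) F x - F x)" for n
    using mollify_L1_contraction(1)[OF iF, of "1 / Suc n"] iF by simp
  have "\<exists>r::nat\<Rightarrow>nat. strict_mono r \<and> (AE x in ?M. (\<lambda>n. mollify (1 / Suc (r n)) F x - F x) \<longlonglongrightarrow> 0)"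
    by (rule tendsto_L1_AE_subseq[of ?M "\<lambda>n x. mollify (1 / Suc n) F x - F x", OF iD])
       (use mollify_tendsto_L1[OF iF] in \<open>simp only: real_norm_def\<close>)
  then obtain r :: "nat \<Rightarrow> nat" where r: "strict_mono r" "AE x in ?M. (\<lambda>n. mollify (1 / Suc (r n)) F x - F x) \<longlonglongrightarrow> 0"
    by blast
  define P where "P x \<longleftrightarrow> (\<lambda>n. mollify (1 / Suc (r n)) F x - F x) \<longlonglongrightarrow> 0 \<and> F x = indicator U x * f x" for x
  have AP: "AE x in ?M. P x" using r(2) Ff unfolding P_def by eventually_elim auto
  have e0: "(\<lambda>n. 1 / Suc (r n) :: real) \<longlonglongrightarrow> 0"
    using LIMSEQ_subseq_LIMSEQ[OF LIMSEQ_inverse_real_of_nat r(1)] by (simp add: comp_def inverse_eq_divide)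
  have main: "\<bar>f y - f x\<bar> \<le> (3 * L) * norm (y - x)" if xy: "x \<in> U" "y \<in> U" "P x" "P y" for x y
  proof -
    have xS: "x \<in> S2" "y \<in> S2" using xy Us by auto
    obtain k \<tau> where k: "norm k = 1" "k \<bullet> x = 0" "0 \<le> \<tau>" "\<tau> \<le> pi" "cos \<tau> = x \<bullet> y" "y = rot3 k \<tau> x"
      using great_circle[OF xS] by blast
    have len: "\<tau> \<le> 3 * norm (y - x)" using arc_length_le[OF xS k(3-5)] by (simp add: norm_minus_commute)
    have "\<forall>\<^sub>F n in sequentially. \<bar>mollify (1 / Suc (r n)) F y - mollify (1 / Suc (r n)) F x\<bar> \<le> L * \<tau>"
    proof -
      have "\<exists>\<epsilon>0>0. \<forall>\<epsilon>. 0 < \<epsilon> \<longrightarrow> \<epsilon> < \<epsilon>0 \<longrightarrow> (\<forall>s z. 0 \<le> s \<longrightarrow> s \<le> \<tau> \<longrightarrow> z \<in> S2 \<longrightarrow> 1 - \<epsilon> \<le> rot3 k s x \<bullet> z \<longrightarrow> z \<in> U)"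
      proof (cases "U = S2")
        case True
        then show ?thesis by (intro exI[of _ 1]) auto
      next
        case False
        then have Up: "U = S2_plus" using U by blast
        define h where "h = min (x $ 3) (y $ 3)"
        have h: "0 < h" "h \<le> x $ 3" "h \<le> y $ 3" using xy unfolding Up S2_plus_def by (auto simp: h_def)
        have "\<tau> \<noteq> pi"
        proof
          assume "\<tau> = pi"
          then have "y = - x" using k(2,6) by (simp add: rot3_def)
          then show False using h by simp
        qed
        then have tp: "\<tau> < pi" using k(4) by simp
        show ?thesis
        \<comment> \<open>The arc stays at height at least \<open>h\<close>, and for
          \<open>2 * \<epsilon> < h^2\<close> the caps reach less than \<open>h\<close> away from
          their centres, so they remain in the hemisphere.\<close>
        proof (intro exI[of _ "h\<^sup>2 / 2"] conjI allI impI)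
          show "0 < h\<^sup>2 / 2" using h by simp
          fix \<epsilon> s z assume a: "0 < \<epsilon>" "\<epsilon> < h\<^sup>2 / 2" "0 \<le> s" "s \<le> \<tau>" "z \<in> S2" "1 - \<epsilon> \<le> rot3 k s x \<bullet> z"
          let ?w = "rot3 k s x"
          have wS: "?w \<in> S2" using xS norm_rot3[OF k(1)] by (simp add: S2_def)
          have "h \<le> ?w $ 3" using arc_height[OF k(2) a(3,4) tp h(2), of ] h k(6) by simp
          moreover have "(norm (?w - z))\<^sup>2 < h\<^sup>2" using norm_sph_diff[OF wS a(5)] a by linarith
          then have "norm (?w - z) < h" by (rule power_less_imp_less_base) (use h in simp)
          then have "\<bar>(?w - z) $ 3\<bar> < h" using component_le_norm_cart[of "?w - z" 3] by linarith
          ultimately have "0 < z $ 3" by simp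
          then show "z \<in> U" using a(5) by (simp add: Up S2_plus_def)
        qed
      qed
      then obtain \<epsilon>0 where \<epsilon>0: "0 < \<epsilon>0" "\<And>\<epsilon> s z. 0 < \<epsilon> \<Longrightarrow> \<epsilon> < \<epsilon>0 \<Longrightarrow> 0 \<le> s \<Longrightarrow> s \<le> \<tau> \<Longrightarrow> z \<in> S2 \<Longrightarrow> 1 - \<epsilon> \<le> rot3 k s x \<bullet> z \<Longrightarrow> z \<in> U"
        by blast
      have "\<forall>\<^sub>F n in sequentially. 1 / Suc (r n) < \<epsilon>0" using order_tendstoD(2)[OF e0 \<epsilon>0(1)] .
      then show ?thesis
      proof eventually_elim
        fix n assume n: "1 / Suc (r n) < \<epsilon>0"
        have p: "0 < 1 / real (Suc (r n))" by simp
        show "\<bar>mollify (1 / Suc (r n)) F y - mollify (1 / Suc (r n)) F x\<bar> \<le> L * \<tau>"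
          unfolding k(6) by (rule mollify_arc_lipschitz[OF Um g(1) L mF FB Ff p k(1,2) xS(1) k(3)]) (rule \<epsilon>0(2)[OF p n])
      qed
    qed
    moreover have "(\<lambda>n. \<bar>mollify (1 / Suc (r n)) F y - mollify (1 / Suc (r n)) F x\<bar>) \<longlonglongrightarrow> \<bar>F y - F x\<bar>"
      using xy(3,4) unfolding P_def by (intro tendsto_rabs tendsto_diff) (auto simp: LIM_zero_iff)
    ultimately have "\<bar>F y - F x\<bar> \<le> L * \<tau>" by (intro tendsto_upperbound[where F=sequentially]) auto
    also have "\<dots> \<le> L * (3 * norm (y - x))" using len L(1) by (rule mult_left_mono)
    finally show ?thesis using xy unfolding P_def by (simp add: mult_ac)
  qed
  show ?thesis using that[of "3 * L" P] L(1) AP main by simp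
qed

section \<open>Strain estimates\<close>

text \<open>Sets of full measure are dense, since a bump at any point of the sphere has positive
  mass.\<close>

lemma AE_sph_near:
  assumes P: "AE z in sph_measure. P z" and m: "m \<in> S2" and r: "0 < r"
  shows "\<exists>z\<in>S2. P z \<and> norm (z - m) < r"
proof (rule ccontr)
  assume "\<not> ?thesis"
  then have n: "\<not> norm (z - m) < r" if "z \<in> S2" "P z" for z using that by blast
  let ?\<epsilon> = "r\<^sup>2 / 2"
  have "(\<integral>z. cap_kernel ?\<epsilon> m z \<partial>sph_measure) = (\<integral>z. 0 \<partial>sph_measure)"
  proof (rule integral_cong_AE)
    show "AE z in sph_measure. cap_kernel ?\<epsilon> m z = 0" using P AE_space
    proof eventually_elim
      fix z assume z: "P z" "z \<in> space sph_measure"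
      have "r\<^sup>2 \<le> (norm (z - m))\<^sup>2" using n z r by (intro power_mono) (auto simp: not_less)
      then have "m \<bullet> z - (1 - ?\<epsilon>) \<le> 0" using norm_sph_diff[of z m] z m by (simp add: inner_commute)
      then show "cap_kernel ?\<epsilon> m z = 0" by (simp add: cap_kernel_def max_def)
    qed
  qed (auto intro: borel_measurable_sph_continuous continuous_cap_kernel)
  then show False using integral_cap_kernel[OF m, of ?\<epsilon>] cap_mass_pos[of ?\<epsilon>] r by simp
qed

text \<open>The splitting estimate with \<open>\<delta> = 2 * d\<close>: the annulus is empty and no
  cancellation is used. For distances above 1 the bound 2 on each velocity is enough.\<close>

lemma velocity_log_lipschitz:
  assumes x: "x \<in> S2" and y: "y \<in> S2" and xy: "x \<noteq> y"
    and w: "\<omega> \<in> borel_measurable sph_measure" "AE z in sph_measure. \<bar>\<omega> z\<bar> \<le> 1"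
  shows "\<bar>(x - y) \<bullet> (velocity \<omega> x - velocity \<omega> y)\<bar> \<le> (norm (x - y))\<^sup>2 * (2 / pi * ln (2 / norm (x - y)) + 9)"
proof -
  define d where "d = norm (x - y)"
  have d: "0 < d" "d \<le> 2" using xy norm_triangle_ineq4[of x y] x y by (auto simp: d_def S2_def)
  have l: "0 \<le> 2 / pi * ln (2 / d)" using d by simp
  show ?thesis
  proof (cases "d \<le> 1")
    case True
    obtain e m c where fr: "frame3 e (cross3 m e) m" and c: "0 < c" "c \<le> 1" "c\<^sup>2 = 1 - d\<^sup>2 / 4"
      and xe: "x = c *\<^sub>R m + (d / 2) *\<^sub>R e" and ye: "y = c *\<^sub>R m - (d / 2) *\<^sub>R e"
      using frame3_of_pair[OF x y d_def d(1)] True by auto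
    have "\<bar>(x - y) \<bullet> (velocity \<omega> x - velocity \<omega> y)\<bar> \<le> d\<^sup>2 * (2 / pi * ln (2 / (2 * d)) + 9)"
      using pair_velocity_estimate[OF fr c xe ye x y d(1) True order_refl _ w] True by simp
    also have "\<dots> \<le> d\<^sup>2 * (2 / pi * ln (2 / d) + 9)"
      using d by (intro mult_left_mono add_right_mono) (auto simp: field_simps)
    finally show ?thesis by (simp add: d_def)
  next
    case False
    have "\<bar>(x - y) \<bullet> (velocity \<omega> x - velocity \<omega> y)\<bar> \<le> d * norm (velocity \<omega> x - velocity \<omega> y)"
      unfolding d_def by (rule Cauchy_Schwarz_ineq2)
    also have "\<dots> \<le> d * 4" using velocity_integrable(2)[OF x w] velocity_integrable(2)[OF y w] d
        norm_triangle_ineq4[of "velocity \<omega> x" "velocity \<omega> y"] by (intro mult_left_mono) auto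
    also have "\<dots> \<le> d * (d * 9)" using False d by (intro mult_left_mono) auto
    also have "\<dots> = d\<^sup>2 * 9" by (simp add: power2_eq_square)
    also have "\<dots> \<le> d\<^sup>2 * (2 / pi * ln (2 / d) + 9)" using l by (intro mult_left_mono) auto
    finally show ?thesis by (simp add: d_def)
  qed
qed

text \<open>If the vorticity has modulus of continuity \<open>H r powr \<alpha>\<close> up to the sign pattern \<open>s\<close> (constant, or
  the sign of the third coordinate), then the strain is bounded by \<open>2 / \<pi>\<close> times the logarithm of the
  scale \<open>\<delta>\<close> at which the modulus becomes small.\<close>
lemma velocity_strain_bound:
  assumes x: "x \<in> S2" and y: "y \<in> S2" and xy: "x \<noteq> y"
    and w: "\<omega> \<in> borel_measurable sph_measure" "AE z in sph_measure. \<bar>\<omega> z\<bar> \<le> 1"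
    and s: "s \<in> borel_measurable sph_measure" "\<And>z. \<bar>s z\<bar> \<le> 1"
    and S: "\<And>e n m \<rho> \<delta>. frame3 e n m \<Longrightarrow> 0 < \<rho> \<Longrightarrow> \<delta> \<le> 1 \<Longrightarrow>
      \<bar>\<integral>z. s z * (indicator {\<rho>..<\<delta>} (norm (z - m)) * quadrupole e n m z) \<partial>sph_measure\<bar> \<le> 200"
    and U: "openin (top_of_set S2) U" "\<And>c m e. x = c *\<^sub>R m + e \<Longrightarrow> y = c *\<^sub>R m - e \<Longrightarrow> 0 < c \<Longrightarrow> m \<in> S2 \<Longrightarrow> m \<in> U"
    and Q: "AE z in sph_measure. Q z"
    and H: "\<And>z m. z \<in> S2 \<Longrightarrow> m \<in> U \<Longrightarrow> Q z \<Longrightarrow> Q m \<Longrightarrow> \<bar>\<omega> z - s z * \<omega> m\<bar> \<le> H * norm (z - m) powr \<alpha>"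
    and \<alpha>: "0 < \<alpha>" "0 \<le> H" and \<delta>: "0 < \<delta>" "\<delta> \<le> 1" "H * (2 * \<delta>) powr \<alpha> / \<alpha> \<le> 1"
  shows "\<bar>(x - y) \<bullet> (velocity \<omega> x - velocity \<omega> y)\<bar> \<le> (norm (x - y))\<^sup>2 * (2 / pi * ln (4 / \<delta>) + 217)"
proof -
  define d where "d = norm (x - y)"
  have d: "0 < d" using xy by (simp add: d_def)
  show ?thesis
  proof (cases "2 * d \<le> \<delta>")
    case False
    \<comment> \<open>At distances above \<open>\<delta> / 2\<close> the logarithm of the distance
      is already controlled by that of \<open>\<delta>\<close>.\<close>
    have "\<bar>(x - y) \<bullet> (velocity \<omega> x - velocity \<omega> y)\<bar> \<le> d\<^sup>2 * (2 / pi * ln (2 / d) + 9)"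
      unfolding d_def by (rule velocity_log_lipschitz[OF x y xy w])
    also have "\<dots> \<le> d\<^sup>2 * (2 / pi * ln (4 / \<delta>) + 217)"
    proof (intro mult_left_mono add_mono)
      have "2 / d \<le> 4 / \<delta>" using False d \<delta> by (simp add: field_simps)
      then show "ln (2 / d) \<le> ln (4 / \<delta>)" using d \<delta> by (intro ln_mono) auto
    qed auto
    finally show ?thesis by (simp add: d_def)
  next
    case True
    then have d1: "d \<le> 1" "d < 2" using \<delta> d by auto
    obtain e m c where fr: "frame3 e (cross3 m e) m" and c: "0 < c" "c \<le> 1" "c\<^sup>2 = 1 - d\<^sup>2 / 4"
      and xe: "x = c *\<^sub>R m + (d / 2) *\<^sub>R e" and ye: "y = c *\<^sub>R m - (d / 2) *\<^sub>R e"
      using frame3_of_pair[OF x y d_def d d1(2)] by blast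
    have mS: "m \<in> S2" using fr by (simp add: frame3_def S2_def)
    have mU: "m \<in> U" by (rule U(2)[OF xe ye c(1) mS])
    obtain r where r: "0 < r" "\<And>z. z \<in> S2 \<Longrightarrow> dist z m < r \<Longrightarrow> z \<in> U"
      using U(1) mU unfolding openin_euclidean_subtopology_iff by blast
    have Q': "AE z in sph_measure. Q z \<and> \<bar>\<omega> z\<bar> \<le> 1" using Q w(2) by eventually_elim auto
    \<comment> \<open>The modulus of continuity holds only off a null set that may contain
      \<open>m\<close>, so \<open>m\<close> is replaced by a good point nearby. Being within
      \<open>d\<close> of \<open>m\<close>, it at most doubles distances on the annulus, which is
      why \<open>2 * \<delta>\<close> enters the hypothesis on \<open>\<delta>\<close>.\<close>
    obtain m' where m': "m' \<in> S2" "Q m' \<and> \<bar>\<omega> m'\<bar> \<le> 1" "norm (m' - m) < min r d"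
      using AE_sph_near[OF Q' mS, of "min r d"] r d by auto
    have m'U: "m' \<in> U" using r(2)[OF m'(1)] m'(3) by (simp add: dist_norm)
    have near: "AE z in sph_measure. norm (z - m) \<in> {2 * d..<\<delta>} \<longrightarrow> \<bar>\<omega> z - \<omega> m' * s z\<bar> \<le> (H * 2 powr \<alpha>) * norm (z - m) powr \<alpha>"
      using Q AE_space
    proof eventually_elim
      fix z assume z: "Q z" "z \<in> space sph_measure"
      show "norm (z - m) \<in> {2 * d..<\<delta>} \<longrightarrow> \<bar>\<omega> z - \<omega> m' * s z\<bar> \<le> (H * 2 powr \<alpha>) * norm (z - m) powr \<alpha>"
      proof
        assume n: "norm (z - m) \<in> {2 * d..<\<delta>}"
        have "norm (z - m') \<le> norm (z - m) + norm (m - m')" using norm_triangle_ineq[of "z - m" "m - m'"] by simp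
        also have "\<dots> \<le> 2 * norm (z - m)" using n m'(3) d by (simp add: norm_minus_commute)
        finally have nm: "norm (z - m') \<le> 2 * norm (z - m)" .
        have "\<bar>\<omega> z - s z * \<omega> m'\<bar> \<le> H * norm (z - m') powr \<alpha>" using H[of z m'] z m' m'U by simp
        also have "\<dots> \<le> H * (2 * norm (z - m)) powr \<alpha>" using nm \<alpha> by (intro mult_left_mono powr_mono2) auto
        also have "\<dots> = (H * 2 powr \<alpha>) * norm (z - m) powr \<alpha>" by (simp add: powr_mult)
        finally show "\<bar>\<omega> z - \<omega> m' * s z\<bar> \<le> (H * 2 powr \<alpha>) * norm (z - m) powr \<alpha>" by (simp add: mult.commute)
      qed
    qed
    have "0 < 2 * d" using d by simp
    then have "\<bar>\<integral>z. \<omega> z * (indicator {2 * d..<\<delta>} (norm (z - m)) * quadrupole e (cross3 m e) m z) \<partial>sph_measure\<bar> \<le> 200 + 2 * pi * (H * 2 powr \<alpha>) * \<delta> powr \<alpha> / \<alpha>"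
      by (intro integral_annulus_hoelder[OF fr w s S[OF fr]] near \<alpha>(1) True \<delta>(2)) (use near m' \<alpha> \<delta> in auto)
    also have "2 * pi * (H * 2 powr \<alpha>) * \<delta> powr \<alpha> / \<alpha> = 2 * pi * (H * (2 * \<delta>) powr \<alpha> / \<alpha>)" using \<delta>(1) by (simp add: powr_mult)
    also have "\<dots> \<le> 2 * pi * 1" using \<delta>(3) by (intro mult_left_mono) auto
    \<comment> \<open>208 is 200 from the sign pattern and 8 as a bound for \<open>2 * pi\<close>;
      with the 9 of the splitting estimate it makes the 217 of the statement.\<close>
    finally have I: "\<bar>\<integral>z. \<omega> z * (indicator {2 * d..<\<delta>} (norm (z - m)) * quadrupole e (cross3 m e) m z) \<partial>sph_measure\<bar> \<le> 208"
      using pi_less_4 by simp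
    have d2: "\<delta> \<le> 2" using \<delta> by simp
    have "\<bar>(x - y) \<bullet> (velocity \<omega> x - velocity \<omega> y)\<bar> \<le> d\<^sup>2 * (2 / pi * ln (2 / \<delta>) + 9 + 208)"
      by (rule order_trans[OF pair_velocity_estimate[OF fr c xe ye x y d d1(1) True d2 w]]) (intro mult_left_mono add_left_mono I, simp)
    also have "\<dots> \<le> d\<^sup>2 * (2 / pi * ln (4 / \<delta>) + 217)"
    proof -
      have "ln (2 / \<delta>) \<le> ln (4 / \<delta>)" using \<delta> by (intro ln_mono) (auto simp: divide_right_mono)
      then have "2 / pi * ln (2 / \<delta>) \<le> 2 / pi * ln (4 / \<delta>)" by (intro mult_left_mono) auto
      then show ?thesis by (intro mult_left_mono) auto
    qed
    finally show ?thesis by (simp add: d_def)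
  qed
qed

section \<open>Transported vorticity\<close>

lemma within_atLeast_interior: "0 < t \<Longrightarrow> at t within {0::real..} = at t"
  by (rule at_within_interior) simp

lemma gronwall_nonneg:
  fixes p p' :: "real \<Rightarrow> real"
  assumes d: "\<And>t. 0 \<le> t \<Longrightarrow> (p has_real_derivative p' t) (at t within {0..})"
    and le: "\<And>t. 0 \<le> t \<Longrightarrow> p' t \<le> a * p t" and t: "0 \<le> t"
  shows "p t \<le> p 0 * exp (a * t)"
proof (cases "t = 0")
  case False
  then have tp: "0 < t" using t by simp
  define r where "r u = p u * exp (- (a * u))" for u
  have dr: "(r has_real_derivative (p' u - a * p u) * exp (- (a * u))) (at u within {0..})" if "0 \<le> u" for u
    unfolding r_def using d[OF that] by (auto intro!: derivative_eq_intros simp: algebra_simps)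
  have "r t \<le> r 0"
  proof (rule DERIV_nonpos_imp_decreasing_open[OF t])
    fix u assume u: "0 < u" "u < t"
    have "(r has_real_derivative (p' u - a * p u) * exp (- (a * u))) (at u)"
      using dr[of u] u by (simp add: within_atLeast_interior)
    moreover have "(p' u - a * p u) * exp (- (a * u)) \<le> 0" using le[of u] u by (intro mult_nonpos_nonneg) auto
    ultimately show "\<exists>y. (r has_real_derivative y) (at u) \<and> y \<le> 0" by blast
  next
    show "continuous_on {0..t} r"
      by (rule DERIV_continuous_on) (rule DERIV_subset[OF dr], auto)
  qed
  then have "r t * exp (a * t) \<le> p 0 * exp (a * t)" by (simp add: r_def)
  then show ?thesis by (simp add: r_def mult.assoc exp_add[symmetric])
qed simp

text \<open>Derivatives are taken within \<open>{0..}\<close> because the flow is given for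
  nonnegative times only; at interior points they are two-sided and the mean value inequality
  applies.\<close>

lemma derivative_bound_within:
  fixes p p' :: "real \<Rightarrow> 'b::real_normed_vector"
  assumes d: "\<And>t. a \<le> t \<Longrightarrow> (p has_vector_derivative p' t) (at t within {0..})" and a: "0 \<le> a" "a \<le> b"
    and g: "\<And>t. a \<le> t \<Longrightarrow> (g has_real_derivative g' t) (at t)"
    and le: "\<And>t. a \<le> t \<Longrightarrow> t \<le> b \<Longrightarrow> norm (p' t) \<le> g' t"
  shows "norm (p b - p a) \<le> g b - g a"
proof (cases "a = b")
  case False
  then have ab: "a < b" using a by simp
  show ?thesis
  proof (rule differentiable_bound_general[OF ab])
    show "continuous_on {a..b} p"

      unfolding continuous_on_eq_continuous_within
      by (intro ballI has_vector_derivative_continuous[OF has_vector_derivative_within_subset[OF d]]) (use a in auto)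
    show "continuous_on {a..b} g" by (rule DERIV_continuous_on) (rule has_field_derivative_at_within[OF g], auto)
    fix x assume x: "a < x" "x < b"
    show "(p has_vector_derivative p' x) (at x)" using d[of x] x a by (simp add: within_atLeast_interior)
    show "(g has_vector_derivative g' x) (at x)" using g[of x] x by (simp add: has_real_derivative_iff_has_vector_derivative)
    show "norm (p' x) \<le> g' x" using le[of x] x by simp
  qed
qed simp

locale transported_vorticity =
  fixes \<omega>0 :: "real^3 \<Rightarrow> real" and \<omega> :: "real \<Rightarrow> real^3 \<Rightarrow> real" and \<Phi> :: "real \<Rightarrow> real^3 \<Rightarrow> real^3"
  assumes flow: "sph_flow (\<lambda>t. velocity (\<omega> t)) \<Phi>"
    and transport: "\<And>t x. 0 \<le> t \<Longrightarrow> x \<in> S2 \<Longrightarrow> \<omega> t x = \<omega>0 (inv_into S2 (\<Phi> t) x)"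
    and meas0: "\<omega>0 \<in> borel_measurable sph_measure" and bound0: "AE x in sph_measure. \<bar>\<omega>0 x\<bar> \<le> 1"
begin

abbreviation back_flow :: "real \<Rightarrow> real^3 \<Rightarrow> real^3" where "back_flow t \<equiv> inv_into S2 (\<Phi> t)"

lemma homeo:
  assumes "0 \<le> t" shows "homeomorphism S2 S2 (\<Phi> t) (back_flow t)"
proof -
  obtain \<Psi> where h: "homeomorphism S2 S2 (\<Phi> t) \<Psi>" using flow assms unfolding sph_flow_def by blast
  then have inj: "inj_on (\<Phi> t) S2" by (metis homeomorphism_def inj_on_inverseI)
  have "back_flow t x = \<Psi> x" if "x \<in> S2" for x
  proof -
    have "\<Psi> x \<in> S2" "\<Phi> t (\<Psi> x) = x" using h that by (auto simp: homeomorphism_def)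
    then show ?thesis using inv_into_f_f[OF inj, of "\<Psi> x"] by simp
  qed
  then show ?thesis by (intro homeomorphism_cong[OF h]) auto
qed

lemma flow_simps:
  assumes "0 \<le> t" "x \<in> S2"
  shows "\<Phi> t x \<in> S2" "back_flow t x \<in> S2" "back_flow t (\<Phi> t x) = x" "\<Phi> t (back_flow t x) = x"
  using homeo[OF assms(1)] assms(2) by (auto simp: homeomorphism_def)

lemma flow_inj: "0 \<le> t \<Longrightarrow> x \<in> S2 \<Longrightarrow> y \<in> S2 \<Longrightarrow> \<Phi> t x = \<Phi> t y \<Longrightarrow> x = y"
  by (metis flow_simps(3))

lemma flow_0: "x \<in> S2 \<Longrightarrow> \<Phi> 0 x = x"
  using flow by (simp add: sph_flow_def)

lemma flow_deriv: "x \<in> S2 \<Longrightarrow> 0 \<le> t \<Longrightarrow> ((\<lambda>s. \<Phi> s x) has_vector_derivative velocity (\<omega> t) (\<Phi> t x)) (at t within {0..})"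
  using flow by (simp add: sph_flow_def)

section \<open>Measurability and area preservation of the flow maps\<close>

lemma continuous_measurable_S2:
  fixes f :: "real^3 \<Rightarrow> real^3"
  assumes c: "continuous_on S2 f" and f: "f ` S2 \<subseteq> S2" shows "f \<in> measurable sph_measure sph_measure"
proof -
  have "f \<in> borel_measurable (restrict_space borel S2)" by (rule borel_measurable_continuous_on_restrict[OF c])
  then have "f \<in> measurable (restrict_space borel S2) (restrict_space borel S2)"
    using f by (intro measurable_restrict_space2) (auto simp: space_restrict_space)
  then show ?thesis using measurable_cong_sets[OF sets_sph_measure sets_sph_measure] by blast
qed

lemma flow_measurable: "0 \<le> t \<Longrightarrow> \<Phi> t \<in> measurable sph_measure sph_measure"
  and back_measurable: "0 \<le> t \<Longrightarrow> back_flow t \<in> measurable sph_measure sph_measure"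
  by (rule continuous_measurable_S2; use homeo[of t] in \<open>simp add: homeomorphism_def\<close>)+

lemma flow_preserves: "0 \<le> t \<Longrightarrow> distr sph_measure sph_measure (\<Phi> t) = sph_measure"
  using flow by (simp add: sph_flow_def)

lemma back_preserves:
  assumes t: "0 \<le> t" shows "distr sph_measure sph_measure (back_flow t) = sph_measure"
proof -
  have "distr sph_measure sph_measure (back_flow t) = distr (distr sph_measure sph_measure (\<Phi> t)) sph_measure (back_flow t)"
    by (simp add: flow_preserves[OF t])
  also have "\<dots> = distr sph_measure sph_measure (back_flow t \<circ> \<Phi> t)"
    by (rule distr_distr[OF back_measurable[OF t] flow_measurable[OF t]])
  also have "\<dots> = distr sph_measure sph_measure (\<lambda>x. x)"
    by (rule distr_cong) (use flow_simps[OF t] in auto)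
  finally show ?thesis by (simp add: distr_id)
qed

lemma AE_back: "0 \<le> t \<Longrightarrow> AE x in sph_measure. P x \<Longrightarrow> AE x in sph_measure. P (back_flow t x)"
  by (rule AE_sph_preserving[OF back_measurable back_preserves])

lemma vorticity_measurable:
  assumes t: "0 \<le> t" shows "\<omega> t \<in> borel_measurable sph_measure"
proof -
  have "(\<lambda>x. \<omega>0 (back_flow t x)) \<in> borel_measurable sph_measure" by (rule measurable_compose[OF back_measurable[OF t] meas0])
  then show ?thesis by (subst measurable_cong[where g="\<lambda>x. \<omega>0 (back_flow t x)"]) (simp_all add: transport[OF t])
qed

lemma vorticity_bound:
  assumes t: "0 \<le> t" shows "AE x in sph_measure. \<bar>\<omega> t x\<bar> \<le> 1"
  using AE_back[OF t bound0] AE_space by eventually_elim (simp add: transport[OF t])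

text \<open>The logarithmic derivative of the distance between two trajectories; both estimates for
  the inverse flow come from integrating bounds on it.\<close>

definition pair_rate :: "real^3 \<Rightarrow> real^3 \<Rightarrow> real \<Rightarrow> real" where
  "pair_rate x y t = ((\<Phi> t x - \<Phi> t y) \<bullet> (velocity (\<omega> t) (\<Phi> t x) - velocity (\<omega> t) (\<Phi> t y))) / (norm (\<Phi> t x - \<Phi> t y))\<^sup>2"

lemma ln_dist_deriv:
  assumes x: "x \<in> S2" and y: "y \<in> S2" and xy: "x \<noteq> y" and t: "0 \<le> t"
  shows "((\<lambda>t. ln (norm (\<Phi> t x - \<Phi> t y))) has_real_derivative pair_rate x y t) (at t within {0..})"
proof -
  let ?D = "\<lambda>t. \<Phi> t x - \<Phi> t y" and ?V = "velocity (\<omega> t) (\<Phi> t x) - velocity (\<omega> t) (\<Phi> t y)"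
  have D: "(?D has_vector_derivative ?V) (at t within {0..})"
    by (intro has_vector_derivative_diff flow_deriv x y t)
  have "((\<lambda>t. ?D t \<bullet> ?D t) has_vector_derivative ?D t \<bullet> ?V + ?V \<bullet> ?D t) (at t within {0..})"
    by (rule bounded_bilinear.has_vector_derivative[OF bounded_bilinear_inner D D])
  then have 1: "((\<lambda>t. ?D t \<bullet> ?D t) has_real_derivative 2 * (?D t \<bullet> ?V)) (at t within {0..})"
    by (simp add: has_real_derivative_iff_has_vector_derivative inner_commute)
  have nz: "?D t \<noteq> 0" using flow_inj[OF t x y] xy by auto
  then have "0 < ?D t \<bullet> ?D t" by simp
  from DERIV_chain2[OF DERIV_ln_divide[OF this] 1]
  have 2: "((\<lambda>t. ln (?D t \<bullet> ?D t)) has_real_derivative 1 / (?D t \<bullet> ?D t) * (2 * (?D t \<bullet> ?V))) (at t within {0..})" .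
  have e: "ln (norm v) = ln (v \<bullet> v) / 2" for v :: "real^3" by (simp add: norm_eq_sqrt_inner ln_sqrt)
  show ?thesis unfolding e pair_rate_def
    using DERIV_cdivide[OF 2, of 2] by (simp add: power2_norm_eq_inner)
qed

lemma pair_rate_le:
  assumes x: "x \<in> S2" and y: "y \<in> S2" and xy: "x \<noteq> y" and t: "0 \<le> t"
    and B: "\<bar>(\<Phi> t x - \<Phi> t y) \<bullet> (velocity (\<omega> t) (\<Phi> t x) - velocity (\<omega> t) (\<Phi> t y))\<bar> \<le> (norm (\<Phi> t x - \<Phi> t y))\<^sup>2 * B"
  shows "\<bar>pair_rate x y t\<bar> \<le> B"
proof -
  have "0 < (norm (\<Phi> t x - \<Phi> t y))\<^sup>2" using flow_inj[OF t x y] xy by auto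
  then show ?thesis using B unfolding pair_rate_def by (simp add: abs_divide divide_le_eq mult.commute)
qed

text \<open>For the logarithm \<open>q\<close> of the distance the log-Lipschitz estimate is linear;
  the shift \<open>c\<close> absorbs the constant 9, and Gronwall's bound for \<open>c - q\<close>
  is solved for the initial distance. The term \<open>- \<alpha> * c\<close> dropped on the way is
  not positive.\<close>

lemma back_hoelder:
  assumes x: "x \<in> S2" and y: "y \<in> S2" and t: "0 \<le> t"
  shows "norm (back_flow t x - back_flow t y) \<le> exp (ln 2 + 9 / 2 * pi) * norm (x - y) powr exp (- (2 / pi * t))"
proof (cases "x = y")
  case xy: False
  define c where "c = ln 2 + 9 / 2 * pi"
  define \<alpha> where "\<alpha> = exp (- (2 / pi * t))"
  let ?x = "back_flow t x" and ?y = "back_flow t y"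
  have S: "?x \<in> S2" "?y \<in> S2" using flow_simps[OF t] x y by auto
  have ne: "?x \<noteq> ?y" using xy flow_simps(4)[OF t x] flow_simps(4)[OF t y] by metis
  define q where "q u = ln (norm (\<Phi> u ?x - \<Phi> u ?y))" for u
  have dq: "(q has_real_derivative pair_rate ?x ?y u) (at u within {0..})" if "0 \<le> u" for u
    unfolding q_def by (rule ln_dist_deriv[OF S ne that])
  have r: "\<bar>pair_rate ?x ?y u\<bar> \<le> 2 / pi * (c - q u)" if u: "0 \<le> u" for u
  proof -
    have ne': "\<Phi> u ?x \<noteq> \<Phi> u ?y" using flow_inj[OF u S] ne by blast
    have "\<bar>pair_rate ?x ?y u\<bar> \<le> 2 / pi * ln (2 / norm (\<Phi> u ?x - \<Phi> u ?y)) + 9"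
      by (intro pair_rate_le S ne u velocity_log_lipschitz flow_simps ne' vorticity_measurable vorticity_bound)
    also have "ln (2 / norm (\<Phi> u ?x - \<Phi> u ?y)) = ln 2 - q u" using ne' by (simp add: ln_div q_def)
    also have "2 / pi * (ln 2 - q u) + 9 = 2 / pi * (c - q u)" by (simp add: c_def field_simps)
    finally show ?thesis .
  qed
  have "c - q t \<le> (c - q 0) * exp (2 / pi * t)"
  proof (rule gronwall_nonneg[where p="\<lambda>u. c - q u" and p'="\<lambda>u. - pair_rate ?x ?y u", OF _ _ t])
    show "((\<lambda>u. c - q u) has_real_derivative - pair_rate ?x ?y u) (at u within {0..})" if "0 \<le> u" for u
      using dq[OF that] by (auto intro!: derivative_eq_intros)
    show "- pair_rate ?x ?y u \<le> 2 / pi * (c - q u)" if "0 \<le> u" for u using r[OF that] by linarith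
  qed
  then have "\<alpha> * (c - q t) \<le> \<alpha> * ((c - q 0) * exp (2 / pi * t))" by (intro mult_left_mono) (auto simp: \<alpha>_def)
  also have "\<dots> = c - q 0" by (simp add: \<alpha>_def exp_minus field_simps)
  finally have "q 0 \<le> c - \<alpha> * c + \<alpha> * q t" by (simp add: algebra_simps)
  also have "\<dots> \<le> c + \<alpha> * q t" by (auto simp: \<alpha>_def c_def intro!: mult_nonneg_nonneg add_nonneg_nonneg)
  finally have "exp (q 0) \<le> exp (c + \<alpha> * q t)" by simp
  moreover have "exp (q 0) = norm (?x - ?y)" using ne S by (simp add: q_def flow_0)
  moreover have "exp (c + \<alpha> * q t) = exp c * norm (x - y) powr \<alpha>"
    using xy flow_simps(4)[OF t x] flow_simps(4)[OF t y] by (simp add: q_def exp_add powr_def)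
  ultimately show ?thesis by (simp add: c_def \<alpha>_def)
qed simp

lemma back_lipschitz:
  assumes x: "x \<in> S2" and y: "y \<in> S2" and t: "0 \<le> t"
    and B: "\<And>u. 0 \<le> u \<Longrightarrow> u \<le> t \<Longrightarrow> x \<noteq> y \<Longrightarrow> \<bar>pair_rate (back_flow t x) (back_flow t y) u\<bar> \<le> B"
  shows "norm (back_flow t x - back_flow t y) \<le> exp (B * t) * norm (x - y)"
proof (cases "x = y")
  case xy: False
  let ?x = "back_flow t x" and ?y = "back_flow t y"
  have S: "?x \<in> S2" "?y \<in> S2" using flow_simps[OF t] x y by auto
  have ne: "?x \<noteq> ?y" using xy flow_simps(4)[OF t x] flow_simps(4)[OF t y] by metis
  define q where "q u = ln (norm (\<Phi> u ?x - \<Phi> u ?y))" for u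
  have "norm (q t - q 0) \<le> B * t - B * 0"
  proof (rule derivative_bound_within[where p'="pair_rate ?x ?y" and g'="\<lambda>_. B"])
    show "(q has_vector_derivative pair_rate ?x ?y u) (at u within {0..})" if "0 \<le> u" for u
      using ln_dist_deriv[OF S ne that] unfolding q_def by (simp add: has_real_derivative_iff_has_vector_derivative)
    show "((*) B has_real_derivative B) (at u)" for u by (auto intro!: derivative_eq_intros)
  qed (use t B xy in auto)
  then have "q 0 \<le> B * t + q t" by (simp add: abs_le_iff)
  then have "exp (q 0) \<le> exp (B * t + q t)" by simp
  moreover have "exp (q 0) = norm (?x - ?y)" using ne S by (simp add: q_def flow_0)
  moreover have "exp (B * t + q t) = exp (B * t) * norm (x - y)"
    using xy flow_simps(4)[OF t x] flow_simps(4)[OF t y] by (simp add: q_def exp_add)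
  ultimately show ?thesis by simp
qed simp

end

section \<open>The reflection symmetry\<close>

lemma reflect3_nth [simp]: "reflect3 x $ 1 = x $ 1" "reflect3 x $ 2 = x $ 2" "reflect3 x $ 3 = - (x $ 3)"
  by (simp_all add: reflect3_def)

lemma linear_reflect3: "linear reflect3"
  by (rule linearI) (simp_all add: vec_eq_iff forall_3)

lemma orthogonal_transformation_reflect3: "orthogonal_transformation reflect3"
  by (simp add: orthogonal_transformation_def linear_reflect3 inner_vec_def sum_3)

lemma norm_reflect3 [simp]: "norm (reflect3 x) = norm x"
  by (rule orthogonal_transformation_norm[OF orthogonal_transformation_reflect3])

lemma reflect3_in_S2 [simp]: "reflect3 x \<in> S2 \<longleftrightarrow> x \<in> S2"
  by (simp add: S2_def)

lemma reflect3_diff: "reflect3 x - reflect3 y = reflect3 (x - y)"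
  by (simp add: linear_diff[OF linear_reflect3])

lemma bounded_linear_reflect3: "bounded_linear reflect3"
  using linear_reflect3 linear_conv_bounded_linear by blast

text \<open>The reflection reverses orientation, whence the sign.\<close>

lemma cross3_reflect3: "cross3 (reflect3 a) (reflect3 b) = - reflect3 (cross3 a b)"
  by (simp add: vec_eq_iff forall_3 cross3_def)

text \<open>The distortion of distances by inversion in the unit sphere; the velocity kernel is a
  cross product with such an inversion.\<close>

lemma norm_inversion_diff:
  fixes u v :: "'a::real_inner"
  assumes u: "u \<noteq> 0" and v: "v \<noteq> 0"
  shows "norm (u /\<^sub>R (norm u)\<^sup>2 - v /\<^sub>R (norm v)\<^sup>2) = norm (u - v) / (norm u * norm v)"
proof -
  have p: "0 < norm u" "0 < norm v" using u v by auto
  have "(norm (r *\<^sub>R u - s *\<^sub>R v))\<^sup>2 = r\<^sup>2 * (norm u)\<^sup>2 - 2 * (r * s) * (u \<bullet> v) + s\<^sup>2 * (norm v)\<^sup>2" for r s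
    unfolding power2_norm_eq_inner by (simp add: inner_diff_left inner_diff_right inner_commute[of v u] power2_eq_square algebra_simps)
  from this[of "inverse ((norm u)\<^sup>2)" "inverse ((norm v)\<^sup>2)"]
  have "(norm (u /\<^sub>R (norm u)\<^sup>2 - v /\<^sub>R (norm v)\<^sup>2))\<^sup>2
    = (norm u)\<^sup>2 / ((norm u)\<^sup>2)\<^sup>2 - 2 * (u \<bullet> v) / ((norm u)\<^sup>2 * (norm v)\<^sup>2) + (norm v)\<^sup>2 / ((norm v)\<^sup>2)\<^sup>2"
    by (simp only: power_inverse divide_inverse inverse_mult_distrib mult_ac)
  also have "\<dots> = ((norm u)\<^sup>2 - 2 * (u \<bullet> v) + (norm v)\<^sup>2) / (norm u * norm v)\<^sup>2"
    using p by (simp add: power_mult_distrib field_simps power2_eq_square)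
  also have "(norm u)\<^sup>2 - 2 * (u \<bullet> v) + (norm v)\<^sup>2 = (norm (u - v))\<^sup>2"
    by (simp add: power2_norm_eq_inner inner_diff_left inner_diff_right inner_commute[of v u])
  finally have "(norm (u /\<^sub>R (norm u)\<^sup>2 - v /\<^sub>R (norm v)\<^sup>2))\<^sup>2 = (norm (u - v) / (norm u * norm v))\<^sup>2"
    by (simp add: power_divide)
  then show ?thesis by (rule power2_eq_imp_eq) simp_all
qed

definition sph_kernel :: "real^3 \<Rightarrow> real^3 \<Rightarrow> real^3" where
  "sph_kernel a z = cross3 a z /\<^sub>R (norm (a - z))\<^sup>2"

lemma sph_kernel_commute: "sph_kernel a z = - sph_kernel z a"
  by (simp add: sph_kernel_def cross_skew[of a z] norm_minus_commute)

lemma velocity_sph_kernel: "velocity \<omega> x = (1 / (2 * pi)) *\<^sub>R (\<integral>z. \<omega> z *\<^sub>R sph_kernel x z \<partial>sph_measure)"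
  by (simp only: velocity_def sph_kernel_def scaleR_scaleR divide_inverse)

lemma sph_kernel_reflect3: "sph_kernel (reflect3 a) (reflect3 z) = - reflect3 (sph_kernel a z)"
  by (simp add: sph_kernel_def reflect3_diff cross3_reflect3 linear_cmul[OF linear_reflect3])

lemma norm_sph_kernel_le:
  assumes "a \<in> S2" shows "norm (sph_kernel a z) \<le> 1 / norm (a - z)"
proof (cases "a = z")
  case False
  then have p: "0 < norm (a - z)" by simp
  have "norm (sph_kernel a z) = norm (cross3 a z) / (norm (a - z))\<^sup>2" by (simp add: sph_kernel_def divide_inverse_commute[of "norm _"])
  also have "\<dots> \<le> norm (a - z) / (norm (a - z))\<^sup>2" using norm_cross3_diff[OF assms] by (intro divide_right_mono) auto
  finally show ?thesis using p by (simp add: power2_eq_square)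
qed (simp add: sph_kernel_def)

text \<open>Since \<open>cross3 a z = cross3 (a - z) z\<close>, the kernel is the inversion of
  \<open>a - z\<close> crossed with the unit vector \<open>z\<close>.\<close>

lemma norm_sph_kernel_diff:
  assumes z: "z \<in> S2" "a \<noteq> z" "b \<noteq> z"
  shows "norm (sph_kernel a z - sph_kernel b z) \<le> norm (a - b) / (norm (a - z) * norm (b - z))"
proof -
  have k: "sph_kernel a z = cross3 ((a - z) /\<^sub>R (norm (a - z))\<^sup>2) z" for a
    by (simp add: sph_kernel_def Cross3.left_diff_distrib cross_mult_left)
  have "sph_kernel a z - sph_kernel b z = cross3 ((a - z) /\<^sub>R (norm (a - z))\<^sup>2 - (b - z) /\<^sub>R (norm (b - z))\<^sup>2) z"
    unfolding k[of a] k[of b] by (rule Cross3.left_diff_distrib[symmetric])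
  then have "norm (sph_kernel a z - sph_kernel b z) \<le> norm ((a - z) /\<^sub>R (norm (a - z))\<^sup>2 - (b - z) /\<^sub>R (norm (b - z))\<^sup>2) * norm z"
    using norm_cross3_le by metis
  then show ?thesis using z by (simp add: norm_inversion_diff S2_def)
qed

text \<open>Controls the change of the kernel when its pole moves by at most \<open>m\<close>.
  Beyond \<open>\<rho>\<close> it stems from \<open>m / (p * q)\<close> by the arithmetic-geometric
  mean inequality, within \<open>\<rho>\<close> it is twice the size of the kernel. Being a function
  of one distance, it can be integrated after a measure preserving substitution.\<close>

definition kernel_majorant :: "real \<Rightarrow> real \<Rightarrow> real \<Rightarrow> real" where
  "kernel_majorant m \<rho> r = m / 2 * (indicator {\<rho>..} r / r\<^sup>2) + 2 * (indicator {..<\<rho>} r / r)"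

lemma kernel_majorant_nonneg: "0 \<le> m \<Longrightarrow> 0 \<le> r \<Longrightarrow> 0 \<le> kernel_majorant m \<rho> r"
  by (auto simp: kernel_majorant_def)

lemma norm_sph_kernel_diff_majorant:
  assumes a: "a \<in> S2" and b: "b \<in> S2" and z: "z \<in> S2" "a \<noteq> z" "b \<noteq> z" and m: "norm (a - b) \<le> m" and \<rho>: "0 < \<rho>"
  shows "norm (sph_kernel a z - sph_kernel b z) \<le> kernel_majorant m \<rho> (norm (z - a)) + kernel_majorant m \<rho> (norm (z - b))"
proof -
  define p q where "p = norm (z - a)" and "q = norm (z - b)"
  have p: "0 < p" "0 < q" using z by (auto simp: p_def q_def)
  have m0: "0 \<le> m" using m norm_ge_zero order_trans by blast
  have 1: "norm (sph_kernel a z - sph_kernel b z) \<le> m / (p * q)"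
  proof -
    have "norm (sph_kernel a z - sph_kernel b z) \<le> norm (a - b) / (p * q)"
      using norm_sph_kernel_diff[OF z] by (simp add: p_def q_def norm_minus_commute)
    also have "\<dots> \<le> m / (p * q)" using m p by (intro divide_right_mono) auto
    finally show ?thesis .
  qed
  have 2: "norm (sph_kernel a z - sph_kernel b z) \<le> 1 / p + 1 / q"
    using norm_triangle_ineq4[of "sph_kernel a z" "sph_kernel b z"] norm_sph_kernel_le[OF a, of z] norm_sph_kernel_le[OF b, of z]
    by (simp add: p_def q_def norm_minus_commute)
  consider "\<rho> \<le> p" "\<rho> \<le> q" | "p < \<rho>" "\<rho> \<le> q" | "\<rho> \<le> p" "q < \<rho>" | "p < \<rho>" "q < \<rho>" by linarith
  then have "norm (sph_kernel a z - sph_kernel b z) \<le> kernel_majorant m \<rho> p + kernel_majorant m \<rho> q"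
  proof cases
    case 1
    have "2 * (1 / p) * (1 / q) \<le> (1 / p)\<^sup>2 + (1 / q)\<^sup>2" by (rule sum_squares_bound)
    then have "m / 2 * (2 * (1 / p) * (1 / q)) \<le> m / 2 * ((1 / p)\<^sup>2 + (1 / q)\<^sup>2)" using m0 by (intro mult_left_mono) auto
    then have "m / (p * q) \<le> m / 2 * (1 / p\<^sup>2) + m / 2 * (1 / q\<^sup>2)" by (simp add: power_divide distrib_left)
    then show ?thesis using \<open>norm _ \<le> m / (p * q)\<close> 1 by (simp add: kernel_majorant_def)
  next
    \<comment> \<open>Only \<open>p\<close> is below \<open>\<rho>\<close>: then
      \<open>1 / q \<le> 1 / p\<close>, and the doubled inner term at \<open>p\<close> covers both
      kernels.\<close>
    case c: 2
    have "1 / q \<le> 1 / p" using c p by (intro divide_left_mono) auto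
    then show ?thesis using 2 c p m0 kernel_majorant_nonneg[of m q \<rho>] by (simp add: kernel_majorant_def[of m \<rho> p])
  next
    case c: 3
    have "1 / p \<le> 1 / q" using c p by (intro divide_left_mono) auto
    then show ?thesis using 2 c p m0 kernel_majorant_nonneg[of m p \<rho>] by (simp add: kernel_majorant_def[of m \<rho> q])
  next
    case c: 4
    have "0 \<le> 1 / p" "0 \<le> 1 / q" using p by auto
    moreover have "kernel_majorant m \<rho> p = 2 * (1 / p)" "kernel_majorant m \<rho> q = 2 * (1 / q)"
      using c by (simp_all add: kernel_majorant_def)
    ultimately show ?thesis using 2 by linarith
  qed
  then show ?thesis by (simp add: p_def q_def)
qed

lemma nn_integral_kernel_majorant:
  assumes a: "a \<in> S2" and \<rho>: "0 < \<rho>" "\<rho> \<le> 2" and m: "0 \<le> m"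
    and Z: "Z \<in> measurable sph_measure sph_measure" "distr sph_measure sph_measure Z = sph_measure"
  shows "(\<integral>\<^sup>+z. ennreal (kernel_majorant m \<rho> (norm (Z z - a))) \<partial>sph_measure) \<le> ennreal (pi * (m * ln (2 / \<rho>) + 4 * \<rho>))"
proof -
  let ?M = sph_measure
  have n[measurable]: "(\<lambda>z. norm (z - a)) \<in> borel_measurable ?M" by (rule borel_measurable_sphI) simp
  let ?f = "\<lambda>z. indicator {\<rho>..} (norm (z - a)) / (norm (z - a))\<^sup>2" and ?g = "\<lambda>z. indicator {..<\<rho>} (norm (z - a)) / norm (z - a)"
  have mf: "?f \<in> borel_measurable ?M" "?g \<in> borel_measurable ?M" by measurable
  have l: "0 \<le> ln (2 / \<rho>)" using \<rho> by simp
  have mk: "(\<lambda>z. ennreal (kernel_majorant m \<rho> (norm (z - a)))) \<in> borel_measurable ?M"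
    unfolding kernel_majorant_def by measurable
  have e: "ennreal (m / 2 * F + 2 * G) = ennreal (m / 2) * ennreal F + ennreal 2 * ennreal G" if "0 \<le> F" "0 \<le> G" for F G :: real
  proof -
    have "ennreal (m / 2 * F + 2 * G) = ennreal (m / 2 * F) + ennreal (2 * G)" by (rule ennreal_plus) (use m that in auto)
    moreover have "ennreal (m / 2 * F) = ennreal (m / 2) * ennreal F" by (rule ennreal_mult) (use m that in auto)
    moreover have "ennreal (2 * G) = ennreal 2 * ennreal G" by (rule ennreal_mult) (use that in auto)
    ultimately show ?thesis by argo
  qed
  have "(\<integral>\<^sup>+z. ennreal (kernel_majorant m \<rho> (norm (Z z - a))) \<partial>?M)
      = (\<integral>\<^sup>+z. ennreal (kernel_majorant m \<rho> (norm (z - a))) \<partial>distr ?M ?M Z)"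
    by (rule nn_integral_distr[OF Z(1), symmetric]) (unfold measurable_distr_eq1, rule mk)
  also have "\<dots> = (\<integral>\<^sup>+z. ennreal (m / 2) * ennreal (?f z) + ennreal 2 * ennreal (?g z) \<partial>?M)"
    unfolding Z(2) kernel_majorant_def
    by (intro nn_integral_cong e) auto
  also have "\<dots> = ennreal (m / 2) * (\<integral>\<^sup>+z. ennreal (?f z) \<partial>?M) + ennreal 2 * (\<integral>\<^sup>+z. ennreal (?g z) \<partial>?M)"
    using mf by (simp add: nn_integral_add nn_integral_cmult)
  also have "\<dots> \<le> ennreal (m / 2) * ennreal (2 * pi * ln (2 / \<rho>)) + ennreal 2 * ennreal (2 * pi * \<rho>)"
    using \<rho> by (intro add_mono mult_left_mono nn_integral_sph_inverse_square_far[OF a] nn_integral_sph_inverse_near[OF a]) auto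
  also have "\<dots> = ennreal (m / 2 * (2 * pi * ln (2 / \<rho>)) + 2 * (2 * pi * \<rho>))"
    by (rule e[symmetric]) (use l \<rho> in auto)
  also have "m / 2 * (2 * pi * ln (2 / \<rho>)) + 2 * (2 * pi * \<rho>) = pi * (m * ln (2 / \<rho>) + 4 * \<rho>)"
    by (simp add: algebra_simps)
  finally show ?thesis .
qed

lemma transported_kernel_integrable:
  assumes a: "a \<in> S2" and w: "w \<in> borel_measurable sph_measure" "AE z in sph_measure. \<bar>w z\<bar> \<le> 1"
    and Z: "Z \<in> measurable sph_measure sph_measure" "distr sph_measure sph_measure Z = sph_measure"
  shows "integrable sph_measure (\<lambda>z. w z *\<^sub>R sph_kernel a (Z z))"
proof -
  let ?M = sph_measure
  have "integrable ?M (\<lambda>z. (1 / (norm (a - z))\<^sup>2) *\<^sub>R cross3 a z)"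
    by (rule velocity_integrable(1)[OF a, of "\<lambda>_. 1"]) auto
  then have 1: "integrable ?M (sph_kernel a)" by (simp only: sph_kernel_def[abs_def] divide_inverse mult_1_left)
  then have 2: "integrable ?M (\<lambda>z. sph_kernel a (Z z))"
    using integrable_distr_eq[OF Z(1), of "sph_kernel a"] Z(2) borel_measurable_integrable[OF 1] by simp
  show ?thesis
  proof (rule Bochner_Integration.integrable_bound[OF 2])
    show "(\<lambda>z. w z *\<^sub>R sph_kernel a (Z z)) \<in> borel_measurable ?M"
      by (rule borel_measurable_scaleR[OF w(1) borel_measurable_integrable[OF 2]])
    show "AE z in ?M. norm (w z *\<^sub>R sph_kernel a (Z z)) \<le> norm (sph_kernel a (Z z))"
      using w(2) by eventually_elim (simp add: mult_left_le_one_le)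
  qed
qed

text \<open>First the pole moves with the argument \<open>Z z\<close> fixed, then the argument
  moves; by antisymmetry the second change is again one of the pole. Each of the four majorants has
  a fixed centre and a measure preserving argument, so all integrate to the same bound.\<close>

lemma transported_kernel_diff:
  assumes w: "w \<in> borel_measurable sph_measure" "AE z in sph_measure. \<bar>w z\<bar> \<le> 1"
    and Z: "Z \<in> measurable sph_measure sph_measure" "distr sph_measure sph_measure Z = sph_measure"
    and W: "W \<in> measurable sph_measure sph_measure" "distr sph_measure sph_measure W = sph_measure"
    and m: "\<And>z. z \<in> S2 \<Longrightarrow> norm (Z z - W z) \<le> m" and x: "x \<in> S2" and \<rho>: "0 < \<rho>" "\<rho> \<le> 2"
  shows "norm ((\<integral>z. w z *\<^sub>R sph_kernel (Z x) (Z z) \<partial>sph_measure) - (\<integral>z. w z *\<^sub>R sph_kernel (W x) (W z) \<partial>sph_measure))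
    \<le> 4 * (pi * (m * ln (2 / \<rho>) + 4 * \<rho>))"
proof -
  let ?M = sph_measure and ?C = "pi * (m * ln (2 / \<rho>) + 4 * \<rho>)"
  have ZS: "Z z \<in> S2" "W z \<in> S2" if "z \<in> S2" for z
    using measurable_space[OF Z(1), of z] measurable_space[OF W(1), of z] that by auto
  note aS = ZS(1)[OF x] and bS = ZS(2)[OF x]
  have m0: "0 \<le> m" using m[OF x] norm_ge_zero order_trans by blast
  have l: "0 \<le> ln (2 / \<rho>)" using \<rho> by simp
  have C: "0 \<le> ?C" using m0 l \<rho> by simp
  let ?f = "\<lambda>z. w z *\<^sub>R sph_kernel (Z x) (Z z) - w z *\<^sub>R sph_kernel (W x) (W z)"
  let ?G = "\<lambda>a u. kernel_majorant m \<rho> (norm (u - a))"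
  note i = transported_kernel_integrable[OF aS w Z] transported_kernel_integrable[OF bS w W]
  have mG: "(\<lambda>z. ennreal (?G a (Y z))) \<in> borel_measurable ?M" if Y: "Y \<in> measurable ?M ?M" for a Y
  proof -
    have "(\<lambda>z. norm (z - a)) \<in> borel_measurable ?M" by (rule borel_measurable_sphI) simp
    from measurable_compose[OF Y this] show ?thesis unfolding kernel_majorant_def by measurable
  qed
  have add4: "(\<integral>\<^sup>+z. (g1 z + g2 z) + (g3 z + g4 z) \<partial>?M) = ((\<integral>\<^sup>+z. g1 z \<partial>?M) + (\<integral>\<^sup>+z. g2 z \<partial>?M)) + ((\<integral>\<^sup>+z. g3 z \<partial>?M) + (\<integral>\<^sup>+z. g4 z \<partial>?M))"
    if "g1 \<in> borel_measurable ?M" "g2 \<in> borel_measurable ?M" "g3 \<in> borel_measurable ?M" "g4 \<in> borel_measurable ?M"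
    for g1 g2 g3 g4 :: "real^3 \<Rightarrow> ennreal"
    using that by (simp add: nn_integral_add)
  have "AE z in ?M. Z z \<noteq> Z x" "AE z in ?M. Z z \<noteq> W x" "AE z in ?M. W z \<noteq> W x"
    by (rule AE_sph_preserving[OF Z AE_sph_neq[OF aS]] AE_sph_preserving[OF Z AE_sph_neq[OF bS]] AE_sph_preserving[OF W AE_sph_neq[OF bS]])+
  then have "AE z in ?M. norm (?f z) \<le> (?G (Z x) (Z z) + ?G (W x) (Z z)) + (?G (W x) (Z z) + ?G (W x) (W z))"
    using w(2) AE_space
  proof eventually_elim
    fix z assume z: "Z z \<noteq> Z x" "Z z \<noteq> W x" "W z \<noteq> W x" "\<bar>w z\<bar> \<le> 1" "z \<in> space ?M"
    then have S: "Z z \<in> S2" "W z \<in> S2" using ZS by auto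
    have 1: "norm (sph_kernel (Z x) (Z z) - sph_kernel (W x) (Z z)) \<le> ?G (Z x) (Z z) + ?G (W x) (Z z)"
      using z by (intro norm_sph_kernel_diff_majorant aS bS S m x \<rho>) auto
    have "norm (sph_kernel (Z z) (W x) - sph_kernel (W z) (W x)) \<le> kernel_majorant m \<rho> (norm (W x - Z z)) + kernel_majorant m \<rho> (norm (W x - W z))"
      using z by (intro norm_sph_kernel_diff_majorant aS bS S m \<rho>) auto
    moreover have "norm (sph_kernel (W x) (Z z) - sph_kernel (W x) (W z)) = norm (sph_kernel (Z z) (W x) - sph_kernel (W z) (W x))"
      unfolding sph_kernel_commute[of "W x"] using norm_minus_commute by (metis minus_diff_minus norm_minus_cancel)
    ultimately have 2: "norm (sph_kernel (W x) (Z z) - sph_kernel (W x) (W z)) \<le> ?G (W x) (Z z) + ?G (W x) (W z)"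
      by (simp add: norm_minus_commute)
    have "norm (?f z) = \<bar>w z\<bar> * norm (sph_kernel (Z x) (Z z) - sph_kernel (W x) (W z))"
      by (simp add: scaleR_diff_right[symmetric])
    also have "\<dots> \<le> norm (sph_kernel (Z x) (Z z) - sph_kernel (W x) (W z))" using z by (simp add: mult_left_le_one_le)
    also have "\<dots> \<le> norm (sph_kernel (Z x) (Z z) - sph_kernel (W x) (Z z)) + norm (sph_kernel (W x) (Z z) - sph_kernel (W x) (W z))"
      using norm_triangle_ineq[of "sph_kernel (Z x) (Z z) - sph_kernel (W x) (Z z)" "sph_kernel (W x) (Z z) - sph_kernel (W x) (W z)"] by simp
    finally show "norm (?f z) \<le> (?G (Z x) (Z z) + ?G (W x) (Z z)) + (?G (W x) (Z z) + ?G (W x) (W z))" using 1 2 by linarith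
  qed
  then have "(\<integral>\<^sup>+z. ennreal (norm (?f z)) \<partial>?M) \<le> (\<integral>\<^sup>+z. (ennreal (?G (Z x) (Z z)) + ennreal (?G (W x) (Z z))) + (ennreal (?G (W x) (Z z)) + ennreal (?G (W x) (W z))) \<partial>?M)"
    by (intro nn_integral_mono_AE, eventually_elim)
       (simp add: kernel_majorant_nonneg m0 ennreal_plus[symmetric] ennreal_leI del: ennreal_plus)
  also have "\<dots> = ((\<integral>\<^sup>+z. ennreal (?G (Z x) (Z z)) \<partial>?M) + (\<integral>\<^sup>+z. ennreal (?G (W x) (Z z)) \<partial>?M))
     + ((\<integral>\<^sup>+z. ennreal (?G (W x) (Z z)) \<partial>?M) + (\<integral>\<^sup>+z. ennreal (?G (W x) (W z)) \<partial>?M))"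
    by (rule add4[OF mG[OF Z(1)] mG[OF Z(1)] mG[OF Z(1)] mG[OF W(1)]])
  also have "\<dots> \<le> (ennreal ?C + ennreal ?C) + (ennreal ?C + ennreal ?C)"
    by (intro add_mono nn_integral_kernel_majorant aS bS Z W \<rho> m0)
  also have "\<dots> = ennreal (4 * ?C)" using C by (simp add: ennreal_plus[symmetric] del: ennreal_plus)
  finally have "(\<integral>\<^sup>+z. ennreal (norm (?f z)) \<partial>?M) \<le> ennreal (4 * ?C)" .
  moreover have "?f \<in> borel_measurable ?M" using i by (intro borel_measurable_diff borel_measurable_integrable)
  ultimately have "norm (\<integral>z. ?f z \<partial>?M) \<le> 4 * ?C" using C by (intro integrable_norm_bound(2)) auto
  then show ?thesis using i by simp
qed

text \<open>An Osgood argument in weighted form: on an interval of length \<open>1/8\<close> the bound is halved repeatedly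
  at fixed \<open>\<Lambda>\<close>, which leaves \<open>O(exp (- \<Lambda> / 2))\<close>.\<close>
lemma osgood_vanishing:
  fixes D D' :: "real \<Rightarrow> 'a \<Rightarrow> 'b::real_normed_vector"
  assumes D0: "\<And>x. x \<in> X \<Longrightarrow> D 0 x = 0" and D2: "\<And>t x. 0 \<le> t \<Longrightarrow> x \<in> X \<Longrightarrow> norm (D t x) \<le> 2"
    and d: "\<And>t x. 0 \<le> t \<Longrightarrow> x \<in> X \<Longrightarrow> ((\<lambda>s. D s x) has_vector_derivative D' t x) (at t within {0..})"
    and le: "\<And>t x \<Lambda> m. 0 \<le> t \<Longrightarrow> x \<in> X \<Longrightarrow> 0 < \<Lambda> \<Longrightarrow> (\<And>z. z \<in> X \<Longrightarrow> norm (D t z) \<le> m) \<Longrightarrow>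
        norm (D' t x) \<le> 2 * \<Lambda> * m + 16 * exp (- \<Lambda>)"
    and t: "0 \<le> t" and x: "x \<in> X"
  shows "D t x = 0"
proof -
  have step: "D u x = 0" if s: "0 \<le> s" and Ds: "\<And>x. x \<in> X \<Longrightarrow> D s x = 0" and u: "s \<le> u" "u \<le> s + 1 / 8" and x: "x \<in> X" for s u x
  proof -
    \<comment> \<open>The weight \<open>exp (4 * \<Lambda> * (u - s))\<close> grows at twice the
      rate \<open>2 * \<Lambda>\<close> of the differential inequality, so each integration gains a
      factor 1/2, up to the contribution of the error term.\<close>
    have it: "norm (D u x) \<le> (2 / 2 ^ n + 4 * exp (- \<Lambda>)) * exp (4 * \<Lambda> * (u - s))"
      if \<Lambda>: "0 < \<Lambda>" and u: "s \<le> u" "u \<le> s + 1 / 8" and x: "x \<in> X" for n \<Lambda> u x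
      using u x
    proof (induction n arbitrary: u x)
      case 0
      have "norm (D u x) \<le> 2 * 1" using D2[of u x] 0 s by simp
      also have "\<dots> \<le> (2 / 2 ^ 0 + 4 * exp (- \<Lambda>)) * exp (4 * \<Lambda> * (u - s))"
        using 0 \<Lambda> by (intro mult_mono) auto
      finally show ?case .
    next
      case (Suc n)
      let ?M = "2 / 2 ^ n + 4 * exp (- \<Lambda>)"
      let ?g = "\<lambda>t. ?M / 2 * exp (4 * \<Lambda> * (t - s)) + 16 * exp (- \<Lambda>) * t"
      have "norm (D u x - D s x) \<le> ?g u - ?g s"
      proof (rule derivative_bound_within[where p="\<lambda>t. D t x" and p'="\<lambda>t. D' t x" and g="?g" and g'="\<lambda>t. 2 * \<Lambda> * (?M * exp (4 * \<Lambda> * (t - s))) + 16 * exp (- \<Lambda>)", OF _ s Suc.prems(1)])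
        show "((\<lambda>t. D t x) has_vector_derivative D' t x) (at t within {0..})" if "s \<le> t" for t
          using d[of t x] that s Suc.prems by simp
        show "(?g has_real_derivative 2 * \<Lambda> * (?M * exp (4 * \<Lambda> * (t - s))) + 16 * exp (- \<Lambda>)) (at t)" for t
          by (auto intro!: derivative_eq_intros)
        show "norm (D' t x) \<le> 2 * \<Lambda> * (?M * exp (4 * \<Lambda> * (t - s))) + 16 * exp (- \<Lambda>)" if "s \<le> t" "t \<le> u" for t
          by (rule le) (use that s Suc \<Lambda> in auto)
      qed
      then have "norm (D u x) \<le> ?g u - ?g s" using Ds[OF Suc.prems(3)] by simp
      also have "\<dots> \<le> ?M / 2 * exp (4 * \<Lambda> * (u - s)) + 16 * exp (- \<Lambda>) * (u - s)" by (simp add: algebra_simps add_nonneg_nonneg)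
      also have "\<dots> \<le> ?M / 2 * exp (4 * \<Lambda> * (u - s)) + 2 * exp (- \<Lambda>) * exp (4 * \<Lambda> * (u - s))"
      proof -
        have "16 * exp (- \<Lambda>) * (u - s) \<le> 16 * exp (- \<Lambda>) * (1 / 8)" using Suc.prems by (intro mult_left_mono) auto
        also have "\<dots> = 2 * exp (- \<Lambda>) * 1" by simp
        also have "\<dots> \<le> 2 * exp (- \<Lambda>) * exp (4 * \<Lambda> * (u - s))" using Suc.prems \<Lambda> by (intro mult_left_mono) auto
        finally show ?thesis by simp
      qed
      also have "\<dots> = (2 / 2 ^ Suc n + 4 * exp (- \<Lambda>)) * exp (4 * \<Lambda> * (u - s))"
        by (simp add: algebra_simps)
      finally show ?case .
    qed
    have *: "norm (D u x) \<le> 4 * exp (- (\<Lambda> / 2))" if \<Lambda>: "0 < \<Lambda>" for \<Lambda>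
    proof -
      have "(\<lambda>n. (2 / 2 ^ n + 4 * exp (- \<Lambda>)) * exp (4 * \<Lambda> * (u - s))) \<longlonglongrightarrow> (0 + 4 * exp (- \<Lambda>)) * exp (4 * \<Lambda> * (u - s))"
        by (intro tendsto_intros LIMSEQ_divide_realpow_zero) simp
      then have "norm (D u x) \<le> (0 + 4 * exp (- \<Lambda>)) * exp (4 * \<Lambda> * (u - s))"
        by (rule LIMSEQ_le_const) (use it[OF \<Lambda> u x] in auto)
      also have "\<dots> = 4 * exp (- \<Lambda> + 4 * \<Lambda> * (u - s))" by (simp add: exp_add[symmetric])
      also have "\<dots> \<le> 4 * exp (- (\<Lambda> / 2))"
      proof -
        have "4 * \<Lambda> * (u - s) \<le> 4 * \<Lambda> * (1 / 8)" using u \<Lambda> by (intro mult_left_mono) auto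
        then show ?thesis by simp
      qed
      finally show ?thesis .
    qed
    have "norm (D u x) \<le> 0"
    proof (rule ccontr)
      assume "\<not> norm (D u x) \<le> 0"
      then obtain n where n: "n = norm (D u x)" "0 < n" by simp
      \<comment> \<open>\<open>\<Lambda> = 8 / n\<close> makes the bound
        \<open>4 * exp (- (4 / n))\<close>, which is less than \<open>n\<close> because
        \<open>exp y \<ge> 1 + y\<close>.\<close>
      have "n \<le> 4 * exp (- (4 / n))" using *[of "8 / n"] n by simp
      then have "n * exp (4 / n) \<le> 4" by (simp add: exp_minus field_simps)
      moreover have "n * (1 + 4 / n) \<le> n * exp (4 / n)" using n by (intro mult_left_mono exp_ge_add_one_self) simp
      moreover have "n * (1 + 4 / n) = n + 4" using n by (simp add: field_simps)
      ultimately show False using n by linarith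
    qed
    then show ?thesis by simp
  qed
  have all: "\<forall>u x. 0 \<le> u \<longrightarrow> u \<le> real k / 8 \<longrightarrow> x \<in> X \<longrightarrow> D u x = 0" for k
  proof (induction k)
    case 0
    then show ?case using D0 by auto
  next
    case (Suc k)
    show ?case
    proof (intro allI impI)
      fix u x assume u: "0 \<le> u" "u \<le> real (Suc k) / 8" "x \<in> X"
      show "D u x = 0"
      proof (cases "u \<le> real k / 8")
        case False
        have z: "D (real k / 8) x = 0" if "x \<in> X" for x using Suc.IH[rule_format, OF _ order_refl that] by simp
        show ?thesis
          by (rule step[OF _ z _ _ u(3)]) (use u False in auto)
      qed (use Suc.IH u in auto)
    qed
  qed
  obtain k :: nat where "8 * t \<le> real k" using real_arch_simple by blast
  then have "t \<le> real k / 8" by simp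
  then show ?thesis using all[of k] t x by blast
qed

lemma reflect3_preserves: "reflect3 \<in> measurable sph_measure sph_measure" "distr sph_measure sph_measure reflect3 = sph_measure"
  by (rule measurable_sph_orthogonal[OF orthogonal_transformation_reflect3] distr_sph_orthogonal[OF orthogonal_transformation_reflect3])+

locale odd_transported_vorticity = transported_vorticity +
  assumes odd: "\<And>x. x \<in> S2 \<Longrightarrow> \<omega>0 (reflect3 x) = - \<omega>0 x"
begin

text \<open>The Lagrangian form: integrated over initial positions, the weight is the fixed
  \<open>\<omega>0\<close>, so two flows can be compared through their positions alone.\<close>

lemma velocity_along_flow:
  assumes t: "0 \<le> t" and x: "x \<in> S2"
  shows "velocity (\<omega> t) (\<Phi> t x) = (1 / (2 * pi)) *\<^sub>R (\<integral>z. \<omega>0 z *\<^sub>R sph_kernel (\<Phi> t x) (\<Phi> t z) \<partial>sph_measure)"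
proof -
  let ?M = sph_measure
  have "(\<lambda>z. \<omega> t z *\<^sub>R sph_kernel (\<Phi> t x) z) \<in> borel_measurable ?M"
    using transported_kernel_integrable[OF flow_simps(1)[OF t x] vorticity_measurable[OF t] vorticity_bound[OF t], of "\<lambda>z. z"]
    by (simp add: distr_id borel_measurable_integrable measurable_ident)
  then have "(\<integral>z. \<omega> t z *\<^sub>R sph_kernel (\<Phi> t x) z \<partial>?M) = (\<integral>z. \<omega> t (\<Phi> t z) *\<^sub>R sph_kernel (\<Phi> t x) (\<Phi> t z) \<partial>?M)"
    using integral_distr[OF flow_measurable[OF t], of "\<lambda>z. \<omega> t z *\<^sub>R sph_kernel (\<Phi> t x) z"] by (simp add: flow_preserves[OF t])
  also have "\<dots> = (\<integral>z. \<omega>0 z *\<^sub>R sph_kernel (\<Phi> t x) (\<Phi> t z) \<partial>?M)"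
    by (rule Bochner_Integration.integral_cong) (simp_all add: transport[OF t] flow_simps[OF t])
  finally show ?thesis by (simp add: velocity_sph_kernel)
qed

text \<open>Composed with the reflection on either side, the flow obeys the Lagrangian equation with
  the sign of the kernel reversed: on the one side because \<open>\<omega>0\<close> is odd, on the
  other because the reflection reverses cross products. Both compositions start from the reflection
  itself.\<close>

lemma flow_reflect3:
  assumes t: "0 \<le> t" and x: "x \<in> S2" shows "\<Phi> t (reflect3 x) = reflect3 (\<Phi> t x)"
proof -
  let ?M = sph_measure
  let ?A = "\<lambda>t x. \<Phi> t (reflect3 x)" and ?B = "\<lambda>t x. reflect3 (\<Phi> t x)"
  let ?V = "\<lambda>Z x. - (1 / (2 * pi)) *\<^sub>R (\<integral>z. \<omega>0 z *\<^sub>R sph_kernel (Z x) (Z z) \<partial>?M)"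
  have pA: "?A t \<in> measurable ?M ?M" "distr ?M ?M (?A t) = ?M"
    and pB: "?B t \<in> measurable ?M ?M" "distr ?M ?M (?B t) = ?M" if t: "0 \<le> t" for t
  proof -
    show "?A t \<in> measurable ?M ?M" by (rule measurable_compose[OF reflect3_preserves(1) flow_measurable[OF t]])
    show "?B t \<in> measurable ?M ?M" by (rule measurable_compose[OF flow_measurable[OF t] reflect3_preserves(1)])
    show "distr ?M ?M (?A t) = ?M"
      using distr_distr[OF flow_measurable[OF t] reflect3_preserves(1)] by (simp add: reflect3_preserves(2) flow_preserves[OF t] comp_def)
    show "distr ?M ?M (?B t) = ?M"
      using distr_distr[OF reflect3_preserves(1) flow_measurable[OF t]] by (simp add: reflect3_preserves(2) flow_preserves[OF t] comp_def)
  qed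
  have iA: "integrable ?M (\<lambda>z. \<omega>0 z *\<^sub>R sph_kernel a (\<Phi> t z))" if "0 \<le> t" "a \<in> S2" for t a
    by (rule transported_kernel_integrable[OF that(2) meas0 bound0 flow_measurable[OF that(1)] flow_preserves[OF that(1)]])
  have dA: "((\<lambda>s. ?A s x) has_vector_derivative ?V (?A t) x) (at t within {0..})" if t: "0 \<le> t" and x: "x \<in> S2" for t x
  proof -
    have R: "reflect3 x \<in> S2" using x by simp
    have "(\<integral>z. \<omega>0 z *\<^sub>R sph_kernel (?A t x) (\<Phi> t z) \<partial>?M) = (\<integral>z. \<omega>0 (reflect3 z) *\<^sub>R sph_kernel (?A t x) (?A t z) \<partial>?M)"
      using integral_distr[OF reflect3_preserves(1), of "\<lambda>z. \<omega>0 z *\<^sub>R sph_kernel (?A t x) (\<Phi> t z)"]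
        borel_measurable_integrable[OF iA[OF t flow_simps(1)[OF t R]]] by (simp add: reflect3_preserves(2))
    also have "\<dots> = (\<integral>z. - (\<omega>0 z *\<^sub>R sph_kernel (?A t x) (?A t z)) \<partial>?M)"
      by (rule Bochner_Integration.integral_cong) (simp_all add: odd)
    finally have "velocity (\<omega> t) (?A t x) = ?V (?A t) x" by (simp add: velocity_along_flow[OF t R])
    then show ?thesis using flow_deriv[OF R t] by simp
  qed
  have dB: "((\<lambda>s. ?B s x) has_vector_derivative ?V (?B t) x) (at t within {0..})" if t: "0 \<le> t" and x: "x \<in> S2" for t x
  proof -
    have "reflect3 (velocity (\<omega> t) (\<Phi> t x)) = (1 / (2 * pi)) *\<^sub>R reflect3 (\<integral>z. \<omega>0 z *\<^sub>R sph_kernel (\<Phi> t x) (\<Phi> t z) \<partial>?M)"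
      by (simp add: velocity_along_flow[OF t x] linear_cmul[OF linear_reflect3])
    also have "reflect3 (\<integral>z. \<omega>0 z *\<^sub>R sph_kernel (\<Phi> t x) (\<Phi> t z) \<partial>?M) = (\<integral>z. reflect3 (\<omega>0 z *\<^sub>R sph_kernel (\<Phi> t x) (\<Phi> t z)) \<partial>?M)"
      by (rule integral_bounded_linear[OF bounded_linear_reflect3 iA[OF t flow_simps(1)[OF t x]], symmetric])
    also have "\<dots> = (\<integral>z. - (\<omega>0 z *\<^sub>R sph_kernel (?B t x) (?B t z)) \<partial>?M)"
      by (simp add: sph_kernel_reflect3 linear_cmul[OF linear_reflect3])
    finally have "reflect3 (velocity (\<omega> t) (\<Phi> t x)) = ?V (?B t) x" by simp
    then show ?thesis
      using bounded_linear.has_vector_derivative[OF bounded_linear_reflect3 flow_deriv[OF x t]] by simp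
  qed
  have "?A t x - ?B t x = 0"
  proof (rule osgood_vanishing[where X=S2 and D="\<lambda>t x. ?A t x - ?B t x" and D'="\<lambda>t x. ?V (?A t) x - ?V (?B t) x", OF _ _ _ _ t x])
    show "?A 0 x - ?B 0 x = 0" if "x \<in> S2" for x using that by (simp add: flow_0)
    show "norm (?A t x - ?B t x) \<le> 2" if t: "0 \<le> t" and x: "x \<in> S2" for t x
    proof -
      have "norm (?A t x) = 1" "norm (\<Phi> t x) = 1" using flow_simps(1)[OF t x] flow_simps(1)[OF t, of "reflect3 x"] x by (auto simp: S2_def)
      then show ?thesis using norm_triangle_ineq4[of "?A t x" "?B t x"] by simp
    qed
    show "((\<lambda>s. ?A s x - ?B s x) has_vector_derivative ?V (?A t) x - ?V (?B t) x) (at t within {0..})" if "0 \<le> t" "x \<in> S2" for t x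
      by (rule has_vector_derivative_diff[OF dA[OF that] dB[OF that]])
    fix t x and \<Lambda> m :: real
    assume t: "0 \<le> t" and x: "x \<in> S2" and \<Lambda>: "0 < \<Lambda>" and m: "\<And>z. z \<in> S2 \<Longrightarrow> norm (?A t z - ?B t z) \<le> m"
    \<comment> \<open>This radius makes \<open>ln (2 / ?\<rho>)\<close> equal to
      \<open>\<Lambda>\<close>; after division by \<open>2 * pi\<close> the kernel estimate has the
      form that the Osgood argument requires.\<close>
    let ?\<rho> = "2 * exp (- \<Lambda>)"
    have \<rho>: "0 < ?\<rho>" "?\<rho> \<le> 2" using \<Lambda> by auto
    have "2 / ?\<rho> = exp \<Lambda>" by (simp add: exp_minus field_simps)
    then have l: "ln (2 / ?\<rho>) = \<Lambda>" by simp
    let ?I = "\<integral>z. \<omega>0 z *\<^sub>R sph_kernel (?A t x) (?A t z) \<partial>?M" and ?J = "\<integral>z. \<omega>0 z *\<^sub>R sph_kernel (?B t x) (?B t z) \<partial>?M"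
    have "norm (?I - ?J) \<le> 4 * (pi * (m * ln (2 / ?\<rho>) + 4 * ?\<rho>))"
      by (rule transported_kernel_diff[OF meas0 bound0 pA[OF t] pB[OF t] m x \<rho>])
    then have "norm (?I - ?J) / (2 * pi) \<le> 2 * \<Lambda> * m + 16 * exp (- \<Lambda>)"
      unfolding l by (simp add: divide_le_eq algebra_simps)
    moreover have "?V (?A t) x - ?V (?B t) x = - (1 / (2 * pi)) *\<^sub>R (?I - ?J)" by (simp only: scaleR_diff_right)
    ultimately show "norm (?V (?A t) x - ?V (?B t) x) \<le> 2 * \<Lambda> * m + 16 * exp (- \<Lambda>)" by simp
  qed
  then show ?thesis by simp
qed

text \<open>Points of the equator are fixed by the reflection, and the flow maps are injective and
  commute with it.\<close>

lemma flow_third_nonzero: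
  assumes t: "0 \<le> t" and x: "x \<in> S2" "x $ 3 \<noteq> 0" shows "\<Phi> t x $ 3 \<noteq> 0"
proof
  assume "\<Phi> t x $ 3 = 0"
  then have "reflect3 (\<Phi> t x) = \<Phi> t x" by (simp add: vec_eq_iff forall_3)
  then have "\<Phi> t (reflect3 x) = \<Phi> t x" by (simp add: flow_reflect3[OF t x(1)])
  then have "reflect3 x = x" using flow_inj[OF t _ x(1), of "reflect3 x"] x(1) by simp
  then have "reflect3 x $ 3 = x $ 3" by (rule arg_cong)
  then show False using x(2) by simp
qed

lemma flow_S2_plus:
  assumes t: "0 \<le> t" and x: "x \<in> S2_plus" shows "\<Phi> t x \<in> S2_plus"
proof (rule ccontr)
  assume n: "\<Phi> t x \<notin> S2_plus"
  have xS: "x \<in> S2" "0 < x $ 3" using x by (auto simp: S2_plus_def)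
  have "continuous_on {0..} (\<lambda>s. \<Phi> s x)"
    unfolding continuous_on_eq_continuous_within by (auto intro: has_vector_derivative_continuous[OF flow_deriv[OF xS(1)]])
  then have c: "continuous_on {0..t} (\<lambda>s. \<Phi> s x $ 3)"
    by (intro continuous_on_component) (rule continuous_on_subset, auto)
  have "\<Phi> t x $ 3 \<le> 0" using n flow_simps(1)[OF t xS(1)] by (simp add: S2_plus_def not_less)
  then obtain s where "0 \<le> s" "s \<le> t" "\<Phi> s x $ 3 = 0"
    using IVT2'[of "\<lambda>s. \<Phi> s x $ 3" t 0 0] c t xS by (auto simp: flow_0)
  then show False using flow_third_nonzero[of s x] xS by auto
qed

lemma back_flow_S2_plus:
  assumes t: "0 \<le> t" and x: "x \<in> S2_plus" shows "back_flow t x \<in> S2_plus"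
proof -
  have xS: "x \<in> S2" "0 < x $ 3" using x by (auto simp: S2_plus_def)
  let ?y = "back_flow t x"
  have yS: "?y \<in> S2" "\<Phi> t ?y = x" using flow_simps[OF t xS(1)] by auto
  have "\<not> ?y $ 3 < 0"
  proof
    assume "?y $ 3 < 0"
    then have "reflect3 ?y \<in> S2_plus" using yS by (simp add: S2_plus_def)
    from flow_S2_plus[OF t this] show False using flow_reflect3[OF t yS(1)] yS(2) xS by (simp add: S2_plus_def)
  qed
  moreover have "?y $ 3 \<noteq> 0"
  proof
    assume "?y $ 3 = 0"
    then have "reflect3 ?y = ?y" by (simp add: vec_eq_iff forall_3)
    then have "reflect3 x = x" using flow_reflect3[OF t yS(1)] yS(2) by simp
    then have "reflect3 x $ 3 = x $ 3" by (rule arg_cong)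
    then show False using xS by simp
  qed
  ultimately show ?thesis using yS by (auto simp: S2_plus_def)
qed

lemma vorticity_odd:
  assumes t: "0 \<le> t" and x: "x \<in> S2" shows "\<omega> t (reflect3 x) = - \<omega> t x"
proof -
  have y: "back_flow t x \<in> S2" "\<Phi> t (back_flow t x) = x" using flow_simps[OF t x] by auto
  have "back_flow t (reflect3 x) = reflect3 (back_flow t x)"
    using flow_simps(3)[OF t, of "reflect3 (back_flow t x)"] flow_reflect3[OF t y(1)] y by simp
  then show ?thesis using transport[OF t x] transport[OF t, of "reflect3 x"] x odd[OF y(1)] by simp
qed

end

section \<open>Double exponential growth\<close>

text \<open>The two types of initial data are treated together: \<open>U\<close> is the part of the sphere on which
  the vorticity is regular and \<open>s\<close> is the sign pattern by which it extends to the whole sphere.\<close>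
locale regular_vorticity = transported_vorticity +
  fixes U :: "(real^3) set" and s :: "real^3 \<Rightarrow> real" and L :: real and P :: "real^3 \<Rightarrow> bool"
  assumes U_S2: "U \<subseteq> S2" and S2_plus_U: "S2_plus \<subseteq> U" and U_open: "openin (top_of_set S2) U"
    and U_mid: "\<And>x y c m e. x \<in> U \<Longrightarrow> y \<in> U \<Longrightarrow> x = c *\<^sub>R m + e \<Longrightarrow> y = c *\<^sub>R m - e \<Longrightarrow> 0 < c \<Longrightarrow> m \<in> S2 \<Longrightarrow> m \<in> U"
    and U_flow: "\<And>t x. 0 \<le> t \<Longrightarrow> x \<in> U \<Longrightarrow> \<Phi> t x \<in> U" and U_back: "\<And>t x. 0 \<le> t \<Longrightarrow> x \<in> U \<Longrightarrow> back_flow t x \<in> U"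
    and s_meas: "s \<in> borel_measurable sph_measure" and s_bound: "\<And>z. \<bar>s z\<bar> \<le> 1"
    and s_annulus: "\<And>e n m \<rho> \<delta>. frame3 e n m \<Longrightarrow> 0 < \<rho> \<Longrightarrow> \<delta> \<le> 1 \<Longrightarrow>
      \<bar>\<integral>z. s z * (indicator {\<rho>..<\<delta>} (norm (z - m)) * quadrupole e n m z) \<partial>sph_measure\<bar> \<le> 200"
    and s_extend: "\<And>t C \<beta> Q. 0 \<le> t \<Longrightarrow> AE z in sph_measure. Q z \<Longrightarrow> 0 \<le> C \<Longrightarrow> 0 < \<beta> \<Longrightarrow>
      (\<And>z m. z \<in> U \<Longrightarrow> m \<in> U \<Longrightarrow> Q z \<Longrightarrow> Q m \<Longrightarrow> \<bar>\<omega> t z - \<omega> t m\<bar> \<le> C * norm (z - m) powr \<beta>) \<Longrightarrow>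
      \<exists>Q'. (AE z in sph_measure. Q' z) \<and> (\<forall>z m. z \<in> S2 \<longrightarrow> m \<in> U \<longrightarrow> Q' z \<longrightarrow> Q' m \<longrightarrow> \<bar>\<omega> t z - s z * \<omega> t m\<bar> \<le> C * norm (z - m) powr \<beta>)"
    and L: "0 \<le> L" and P: "AE z in sph_measure. P z"
    and lipschitz: "\<And>x y. x \<in> U \<Longrightarrow> y \<in> U \<Longrightarrow> P x \<Longrightarrow> P y \<Longrightarrow> \<bar>\<omega>0 y - \<omega>0 x\<bar> \<le> L * norm (y - x)"
begin

text \<open>At least 1, so that \<open>ln H\<close> is nonnegative. The other summand is the
  Lipschitz constant of the data times the constant of the Hoelder estimate for the inverse flow,
  doubled to pay for lowering the exponent at distances up to 2.\<close>

definition H :: real where "H = 1 + 2 * (L * exp (ln 2 + 9 / 2 * pi))"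

lemma H: "1 \<le> H" "2 * (L * exp (ln 2 + 9 / 2 * pi)) \<le> H"
  using L by (auto simp: H_def)

text \<open>One exponent serves all times up to \<open>t\<close>, because the strain has to be
  bounded uniformly along the trajectories.\<close>

lemma vorticity_hoelder:
  assumes u: "0 \<le> u" "u \<le> t" and z: "z \<in> U" "P (back_flow u z)" and m: "m \<in> U" "P (back_flow u m)"
  shows "\<bar>\<omega> u z - \<omega> u m\<bar> \<le> H * norm (z - m) powr exp (- (2 / pi * t))"
proof -
  let ?K = "exp (ln 2 + 9 / 2 * pi)" and ?r = "norm (z - m)"
  let ?a = "exp (- (2 / pi * u))" and ?b = "exp (- (2 / pi * t))"
  have S: "z \<in> S2" "m \<in> S2" using z m U_S2 by auto
  have r: "?r \<le> 2" using norm_triangle_ineq4[of z m] S by (simp add: S2_def)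
  have ab: "?b \<le> ?a" "?a \<le> 1" "0 < ?b" using u by (auto simp: divide_right_mono)
  have p: "?r powr ?a \<le> 2 * ?r powr ?b"
  proof (cases "?r = 0")
    case False
    then have r0: "0 < ?r" by simp
    have "?r powr ?a = ?r powr ?b * ?r powr (?a - ?b)" by (simp add: powr_add[symmetric])
    also have "\<dots> \<le> ?r powr ?b * 2"
    proof (rule mult_left_mono)
      have "?r powr (?a - ?b) \<le> 2 powr (?a - ?b)" using r ab by (intro powr_mono2) auto
      also have "\<dots> \<le> 2 powr 1"
      proof (rule powr_mono)
        show "?a - ?b \<le> 1" using ab by linarith
      qed simp
      finally show "?r powr (?a - ?b) \<le> 2" by simp
    qed simp
    finally show ?thesis by simp
  qed simp
  have "\<bar>\<omega> u z - \<omega> u m\<bar> = \<bar>\<omega>0 (back_flow u z) - \<omega>0 (back_flow u m)\<bar>" by (simp add: transport[OF u(1)] S)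
  also have "\<dots> \<le> L * norm (back_flow u z - back_flow u m)" using z m by (intro lipschitz U_back u(1)) auto
  also have "\<dots> \<le> L * (?K * ?r powr ?a)" by (intro mult_left_mono back_hoelder S u(1) L)
  also have "\<dots> \<le> L * (?K * (2 * ?r powr ?b))" by (intro mult_left_mono p L) simp
  also have "\<dots> = 2 * (L * ?K) * ?r powr ?b" by simp
  also have "\<dots> \<le> H * ?r powr ?b" by (intro mult_right_mono H(2)) simp
  finally show ?thesis .
qed

lemma strain_le:
  assumes u: "0 \<le> u" "u \<le> t" and x: "x \<in> U" and y: "y \<in> U" and xy: "x \<noteq> y"
  shows "\<bar>(x - y) \<bullet> (velocity (\<omega> u) x - velocity (\<omega> u) y)\<bar>
    \<le> (norm (x - y))\<^sup>2 * (2 / pi * (ln 8 + exp (2 / pi * t) * (ln H + 2 / pi * t)) + 217)"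
proof -
  let ?\<alpha> = "exp (- (2 / pi * t))"
  \<comment> \<open>The largest scale the strain bound admits, where
    \<open>H * (2 * \<delta>) powr ?\<alpha> / ?\<alpha>\<close> equals 1. Its logarithm has the
    size of \<open>ln (H / ?\<alpha>) / ?\<alpha>\<close>, hence the factor linear in
    \<open>t\<close>.\<close>
  define \<delta> where "\<delta> = (?\<alpha> / H) powr (1 / ?\<alpha>) / 2"
  have H0: "0 < H" using H by simp
  have \<alpha>1: "?\<alpha> \<le> 1" using u by simp
  have q: "0 < ?\<alpha> / H" "?\<alpha> / H \<le> 1" using H0 order_trans[OF \<alpha>1 H(1)] by (simp_all add: divide_le_eq)
  have \<delta>0: "0 < \<delta>" using H0 by (simp add: \<delta>_def)
  have "(?\<alpha> / H) powr (1 / ?\<alpha>) \<le> 1 powr (1 / ?\<alpha>)" using q by (intro powr_mono2) auto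
  then have \<delta>1: "\<delta> \<le> 1" by (simp add: \<delta>_def)
  have "(2 * \<delta>) powr ?\<alpha> = ?\<alpha> / H" using q(1) H0 by (simp add: \<delta>_def powr_powr)
  then have \<delta>2: "H * (2 * \<delta>) powr ?\<alpha> / ?\<alpha> \<le> 1" using H0 by simp
  have "ln \<delta> = 1 / ?\<alpha> * (ln ?\<alpha> - ln H) - ln 2" using q(1) H0 by (simp add: \<delta>_def ln_div ln_powr)
  then have "ln (4 / \<delta>) = ln 4 + ln 2 + 1 / ?\<alpha> * (ln H + 2 / pi * t)" using \<delta>0 by (simp add: ln_div algebra_simps add_divide_distrib diff_divide_distrib)
  moreover have "ln 4 + ln 2 = (ln 8 :: real)" using ln_mult[of "4::real" 2] by simp
  moreover have "1 / ?\<alpha> = exp (2 / pi * t)" by (simp add: exp_minus field_simps)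
  ultimately have l: "ln (4 / \<delta>) = ln 8 + exp (2 / pi * t) * (ln H + 2 / pi * t)" by (simp only:)
  have "AE z in sph_measure. P (back_flow u z)" by (rule AE_back[OF u(1) P])
  from s_extend[OF u(1) this, of H ?\<alpha>] vorticity_hoelder[OF u] H0
  obtain Q where Q: "AE z in sph_measure. Q z"
    "\<And>z m. z \<in> S2 \<Longrightarrow> m \<in> U \<Longrightarrow> Q z \<Longrightarrow> Q m \<Longrightarrow> \<bar>\<omega> u z - s z * \<omega> u m\<bar> \<le> H * norm (z - m) powr ?\<alpha>"
    by auto
  have S: "x \<in> S2" "y \<in> S2" using x y U_S2 by auto
  have \<alpha>H: "0 < ?\<alpha>" "0 \<le> H" using H0 by auto
  show ?thesis
    using velocity_strain_bound[OF S xy vorticity_measurable[OF u(1)] vorticity_bound[OF u(1)] s_meas s_bound s_annulus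
        U_open U_mid[OF x y] Q \<alpha>H \<delta>0 \<delta>1 \<delta>2] unfolding l .
qed

text \<open>The strain bound for \<open>t\<close> holds along the trajectories up to time
  \<open>t\<close>, so the Lipschitz constant is \<open>L * exp (B * t)\<close>; it is then
  majorised by an expression whose double logarithm can be read off.\<close>

lemma gradient_le:
  assumes t: "0 \<le> t"
  shows "grad_Linf S2_plus (\<omega> t) \<le> ereal (exp (exp (2 / pi * t) * ((1 + t)\<^sup>2 * (ln H + 225 + 3 * L))))"
proof -
  let ?E = "exp (2 / pi * t)"
  define B where "B = 2 / pi * (ln 8 + ?E * (ln H + 2 / pi * t)) + 217"
  have rate: "\<bar>pair_rate (back_flow t x) (back_flow t y) u\<bar> \<le> B" if u: "0 \<le> u" "u \<le> t" and x: "x \<in> U" and y: "y \<in> U" and xy: "x \<noteq> y" for x y u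
  proof -
    let ?x = "back_flow t x" and ?y = "back_flow t y"
    have S: "?x \<in> U" "?y \<in> U" "?x \<in> S2" "?y \<in> S2" using U_back[OF t x] U_back[OF t y] U_S2 by auto
    have ne: "?x \<noteq> ?y" using xy flow_simps(4)[OF t, of x] flow_simps(4)[OF t, of y] x y U_S2 by (metis subsetD)
    have ne': "\<Phi> u ?x \<noteq> \<Phi> u ?y" using flow_inj[OF u(1) S(3,4)] ne by blast
    show ?thesis unfolding B_def
      by (intro pair_rate_le S ne u(1) strain_le[OF u U_flow[OF u(1) S(1)] U_flow[OF u(1) S(2)] ne'])
  qed
  have lip: "\<bar>\<omega> t y - \<omega> t x\<bar> \<le> (L * exp (B * t)) * norm (y - x)"
    if x: "x \<in> S2_plus" "P (back_flow t x)" and y: "y \<in> S2_plus" "P (back_flow t y)" for x y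
  proof -
    have U: "x \<in> U" "y \<in> U" using x y S2_plus_U by auto
    then have S: "x \<in> S2" "y \<in> S2" using U_S2 by auto
    have "\<bar>\<omega> t y - \<omega> t x\<bar> = \<bar>\<omega>0 (back_flow t y) - \<omega>0 (back_flow t x)\<bar>" by (simp add: transport[OF t] S)
    also have "\<dots> \<le> L * norm (back_flow t y - back_flow t x)" using x y U by (intro lipschitz U_back t) auto
    also have "\<dots> \<le> L * (exp (B * t) * norm (y - x))"
      by (intro mult_left_mono back_lipschitz S t L rate U) auto
    finally show ?thesis by simp
  qed
  have Lt: "0 \<le> L * exp (B * t)" using L by simp
  have "grad_Linf S2_plus (\<omega> t) \<le> ereal (3 * (L * exp (B * t)))"
    by (rule grad_Linf_le_lipschitz[OF vorticity_measurable[OF t] vorticity_bound[OF t] Lt AE_back[OF t P]]) (rule lip)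
  \<comment> \<open>The factor \<open>3 * L\<close> is moved into the exponent by
    \<open>3 * L \<le> exp (3 * L)\<close>; 225 is the 217 of the strain bound plus 8 for
    \<open>ln 8\<close>.\<close>
  also have "3 * (L * exp (B * t)) \<le> exp (?E * ((1 + t)\<^sup>2 * (ln H + 225 + 3 * L)))"
  proof -
    have E: "1 \<le> ?E" using t by simp
    have lH: "0 \<le> ln H" using H by simp
    have "ln 8 \<le> (8::real) - 1" by (rule ln_le_minus_one) simp
    then have l8: "ln 8 \<le> (8::real)" by simp
    have p2: "2 / pi \<le> 1" using pi_ge_two by simp
    have pt: "0 \<le> 2 / pi * t" "2 / pi * t \<le> t" using t mult_right_mono[OF p2 t] by auto
    have "0 \<le> ln 8 + ?E * (ln H + 2 / pi * t)" using lH pt by simp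
    then have "B \<le> (ln 8 + ?E * (ln H + 2 / pi * t)) + 217"
      unfolding B_def using mult_right_mono[OF p2] by fastforce
    also have "\<dots> \<le> ?E * (ln H + t) + ?E * 225"
    proof -
      have "?E * (ln H + 2 / pi * t) \<le> ?E * (ln H + t)" using pt by (intro mult_left_mono) auto
      then show ?thesis using l8 E by linarith
    qed
    also have "\<dots> = ?E * (ln H + t + 225)" by (simp add: algebra_simps)
    also have "\<dots> \<le> ?E * ((1 + t) * (ln H + 225))"
      using t lH by (intro mult_left_mono) (auto simp: algebra_simps)
    finally have "B * t \<le> ?E * ((1 + t) * (ln H + 225)) * t" using t by (rule mult_right_mono)
    also have "\<dots> \<le> ?E * ((1 + t) * (ln H + 225)) * (1 + t)" using t lH by (intro mult_left_mono) auto
    also have "\<dots> = ?E * ((1 + t)\<^sup>2 * (ln H + 225))" by (simp add: power2_eq_square)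
    finally have Bt: "B * t \<le> ?E * ((1 + t)\<^sup>2 * (ln H + 225))" .
    have "1 * 1 \<le> ?E * (1 + t)\<^sup>2" using E t by (intro mult_mono) auto
    then have "1 * (3 * L) \<le> ?E * (1 + t)\<^sup>2 * (3 * L)" using L by (intro mult_right_mono) auto
    then have L3: "3 * L \<le> ?E * ((1 + t)\<^sup>2 * (3 * L))" by (simp add: mult_ac)
    have "3 * (L * exp (B * t)) \<le> exp (3 * L) * exp (B * t)"
    proof -
      have "3 * L \<le> exp (3 * L)" using exp_ge_add_one_self[of "3 * L"] by linarith
      from mult_right_mono[OF this, of "exp (B * t)"] show ?thesis by simp
    qed
    also have "\<dots> = exp (3 * L + B * t)" by (simp add: exp_add)
    also have "\<dots> \<le> exp (?E * ((1 + t)\<^sup>2 * (ln H + 225 + 3 * L)))"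
      using add_mono[OF L3 Bt] by (simp add: distrib_left add.commute)
    finally show ?thesis .
  qed
  finally show ?thesis by simp
qed

end

section \<open>From the gradient bound to the growth rate\<close>

lemma lnln_le:
  assumes "g \<le> ereal (exp (exp v))" shows "lnln g \<le> ereal v"
proof (cases "g \<le> 1")
  case False
  then obtain r where r: "g = ereal r" "1 < r" using assms by (cases g) auto
  then have "r \<le> exp (exp v)" using assms by simp
  then have "ln r \<le> ln (exp (exp v))" using r(2) by (subst ln_le_cancel_iff) auto
  then have "ln r \<le> exp v" by simp
  then have "ln (ln r) \<le> ln (exp v)" using r(2) by (subst ln_le_cancel_iff) auto
  then show ?thesis using r by (simp add: lnln_def)
qed (simp add: lnln_def)

text \<open>After two logarithms and division by \<open>t\<close> the factor
  \<open>(1 + t)^2 * C\<close> contributes \<open>2 * ln (1 + t) / t + ln C / t\<close>, which tends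
  to 0. It is rewritten so that the limit of \<open>ln x / x\<close> at \<open>x = 1 + t\<close>
  applies.\<close>

lemma Limsup_lnln_le:
  assumes C: "0 < C" and g: "\<And>t. 0 \<le> t \<Longrightarrow> g t \<le> ereal (exp (exp (a * t) * ((1 + t)\<^sup>2 * C)))"
  shows "Limsup at_top (\<lambda>t::real. lnln (g t) / ereal t) \<le> ereal a"
proof -
  let ?v = "\<lambda>t. a + (2 * (ln (1 + t) / (1 + t)) * (1 / t + 1) + ln C * (1 / t))"
  have inv: "((\<lambda>t::real. 1 / t) \<longlongrightarrow> 0) at_top"
    by (rule tendsto_divide_0[OF tendsto_const filterlim_at_top_imp_at_infinity[OF filterlim_ident]])
  have ln: "((\<lambda>t::real. ln (1 + t) / (1 + t)) \<longlongrightarrow> 0) at_top"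
    by (rule filterlim_compose[OF ln_x_over_x_tendsto_0 filterlim_tendsto_add_at_top[OF tendsto_const filterlim_ident]])
  have "(?v \<longlongrightarrow> a + (2 * 0 * (0 + 1) + ln C * 0)) at_top"
    by (intro tendsto_add tendsto_mult tendsto_const inv ln)
  then have lim: "((\<lambda>t. ereal (?v t)) \<longlongrightarrow> ereal a) at_top" by simp
  have ev: "\<forall>\<^sub>F t in at_top. lnln (g t) / ereal t \<le> ereal (?v t)"
    using eventually_gt_at_top[of 0]
  proof eventually_elim
    fix t :: real assume t: "0 < t"
    have q: "0 < (1 + t)\<^sup>2 * C" using t C by simp
    let ?w = "a * t + ln ((1 + t)\<^sup>2 * C)"
    have "exp (a * t) * ((1 + t)\<^sup>2 * C) = exp ?w" using q by (simp only: exp_add exp_ln)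
    then have "lnln (g t) \<le> ereal ?w" using g[of t] t by (intro lnln_le) simp
    then have "lnln (g t) / ereal t \<le> ereal ?w / ereal t" using t by (intro ereal_divide_right_mono) auto
    also have "\<dots> = ereal (?w / t)" using t by simp
    also have "?w / t = ?v t"
    proof -
      have "ln ((1 + t)\<^sup>2 * C) = 2 * ln (1 + t) + ln C" using t C by (simp add: ln_mult ln_realpow)
      moreover have "2 * (ln (1 + t) / (1 + t)) * (1 / t + 1) = 2 * ln (1 + t) / t"
      proof -
        have "1 / t + 1 = (1 + t) / t" using t by (simp add: add_divide_distrib)
        then show ?thesis using t by simp
      qed
      ultimately show ?thesis using t by (simp add: add_divide_distrib)
    qed
    finally show "lnln (g t) / ereal t \<le> ereal (?v t)" .
  qed
  have "Limsup at_top (\<lambda>t::real. lnln (g t) / ereal t) \<le> Limsup at_top (\<lambda>t. ereal (?v t))" by (rule Limsup_mono[OF ev])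
  also have "\<dots> = ereal a" by (rule lim_imp_Limsup[OF _ lim]) simp
  finally show ?thesis .
qed

lemma (in regular_vorticity) double_exponential_rate:
  "Limsup at_top (\<lambda>t::real. lnln (grad_Linf S2_plus (\<omega> t)) / ereal t) \<le> ereal (2 / pi)"
proof (rule Limsup_lnln_le[OF _ gradient_le])
  show "0 < ln H + 225 + 3 * L" using H L by (simp add: add_nonneg_pos add_pos_nonneg)
qed

lemma S2_Int_space: "S2 \<inter> space sph_measure \<in> sets sph_measure"
  using sets.top[of sph_measure] by simp

lemma AE_sph_on_S2: "AE x in sph_on S2. Q x \<Longrightarrow> AE x in sph_measure. Q x"
proof -
  assume "AE x in sph_on S2. Q x"
  then have "AE x in sph_measure. x \<in> S2 \<longrightarrow> Q x" by (subst (asm) AE_restrict_space_iff[OF S2_Int_space])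
  then show ?thesis using AE_space by eventually_elim simp
qed

lemma borel_measurable_sph_on_S2:
  fixes f :: "real^3 \<Rightarrow> real"
  assumes "f \<in> borel_measurable (sph_on S2)" shows "f \<in> borel_measurable sph_measure"
proof -
  have "(\<lambda>x. indicator S2 x *\<^sub>R f x) \<in> borel_measurable sph_measure"
    using assms by (subst (asm) borel_measurable_restrict_space_iff[OF S2_Int_space])
  then show ?thesis by (subst measurable_cong[where g="\<lambda>x. indicator S2 x *\<^sub>R f x"]) auto
qed

lemma AE_Linf_norm_le: "Linf_norm U f = ereal C \<Longrightarrow> AE x in sph_on U. norm (f x) \<le> C"
proof -
  assume C: "Linf_norm U f = ereal C"
  have "AE x in sph_on U. ereal (norm (f x)) \<le> Linf_norm U f" unfolding Linf_norm_def by (rule esssup_AE)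
  then show ?thesis unfolding C by simp
qed

text \<open>With \<open>h\<close> the restriction to the open upper hemisphere, the function is
  \<open>h x - h (reflect3 x)\<close>; on the equator, which \<open>reflect3\<close> fixes, oddness
  forces the value 0.\<close>

lemma odd_extension_regular:
  assumes f: "f \<in> borel_measurable (sph_on S2_plus)" "AE x in sph_on S2_plus. norm (f x) \<le> 1"
    and odd: "\<And>x. x \<in> S2 \<Longrightarrow> f (reflect3 x) = - f x"
  shows "f \<in> borel_measurable sph_measure" "AE x in sph_measure. \<bar>f x\<bar> \<le> (1::real)"
proof -
  let ?M = sph_measure
  have eq0: "f x = 0" if "x \<in> S2" "x $ 3 = 0" for x
  proof -
    have "reflect3 x = x" using that by (simp add: vec_eq_iff forall_3)
    then show ?thesis using odd[OF that(1)] by simp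
  qed
  have S: "S2_plus \<inter> space ?M \<in> sets ?M" by (simp only: S2_plus_Int_space S2_plus_sets)
  define h where "h x = indicator S2_plus x *\<^sub>R f x" for x
  have h: "h \<in> borel_measurable ?M" unfolding h_def[abs_def] using f(1) by (subst (asm) borel_measurable_restrict_space_iff[OF S])
  then have "(\<lambda>x. h x - h (reflect3 x)) \<in> borel_measurable ?M"
    by (intro borel_measurable_diff measurable_compose[OF reflect3_preserves(1) h])
  moreover have "f x = h x - h (reflect3 x)" if "x \<in> space ?M" for x
    using that eq0[of x] odd[of x] by (cases "x $ 3" "0::real" rule: linorder_cases) (auto simp: h_def S2_plus_def)
  ultimately show "f \<in> borel_measurable ?M" by (subst measurable_cong) auto
  have 1: "AE x in ?M. x \<in> S2_plus \<longrightarrow> \<bar>f x\<bar> \<le> 1" using f(2) by (simp add: AE_sph_on_S2_plus)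
  show "AE x in ?M. \<bar>f x\<bar> \<le> 1"
    using 1 AE_sph_preserving[OF reflect3_preserves 1] AE_space
  proof eventually_elim
    fix x assume x: "x \<in> S2_plus \<longrightarrow> \<bar>f x\<bar> \<le> 1" "reflect3 x \<in> S2_plus \<longrightarrow> \<bar>f (reflect3 x)\<bar> \<le> 1" "x \<in> space ?M"
    then show "\<bar>f x\<bar> \<le> 1" using eq0[of x] odd[of x]
      by (cases "x $ 3" "0::real" rule: linorder_cases) (auto simp: S2_plus_def)
  qed
qed

text \<open>Of a point and its mirror image, the one on the same side of the equator as
  \<open>m\<close> is at least as close to \<open>m\<close>.\<close>

lemma norm_reflect3_diff_le:
  assumes "0 \<le> a * b" "z $ 3 = - a" "m $ 3 = b"
  shows "norm (reflect3 z - m) \<le> norm (z - m)"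
proof -
  have "(norm (reflect3 z - m))\<^sup>2 \<le> (norm (z - m))\<^sup>2"
    using assms by (simp add: power2_norm_eq_inner inner_vec_def sum_3 algebra_simps)
  then show ?thesis by (rule power2_le_imp_le) simp
qed

lemma openin_S2_plus: "openin (top_of_set S2) S2_plus"
proof -
  have "open {x::real^3. 0 < x $ 3}" by (intro open_Collect_less continuous_on_const continuous_on_component continuous_on_id)
  moreover have "S2_plus = S2 \<inter> {x. 0 < x $ 3}" by (auto simp: S2_plus_def)
  ultimately show ?thesis by (metis openin_open_Int)
qed

theorem theorem1p1:
  fixes \<omega>0 :: "real^3 \<Rightarrow> real" and \<omega> :: "real \<Rightarrow> real^3 \<Rightarrow> real"
  assumes init:
    "(W1inf S2_plus \<omega>0 \<and> Linf_norm S2_plus \<omega>0 = 1 \<and> (\<forall>x\<in>S2. \<omega>0 (reflect3 x) = - \<omega>0 x)) \<or>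
     (W1inf S2 \<omega>0 \<and> Linf_norm S2 \<omega>0 = 1 \<and> (\<integral>x. \<omega>0 x \<partial>sph_measure) = 0)"
    and sol: "yudovich_solution \<omega>0 \<omega>"
  shows "Limsup at_top (\<lambda>t::real. lnln (grad_Linf S2_plus (\<omega> t)) / ereal t) \<le> ereal (2 / pi)"
proof -
  obtain \<Phi> where flow: "sph_flow (\<lambda>t. velocity (\<omega> t)) \<Phi>"
    and tr: "\<And>t x. 0 \<le> t \<Longrightarrow> x \<in> S2 \<Longrightarrow> \<omega> t x = \<omega>0 (inv_into S2 (\<Phi> t) x)"
    using sol unfolding yudovich_solution_def by blast
  from init show ?thesis
  proof (elim disjE conjE)
    assume W: "W1inf S2_plus \<omega>0" and n: "Linf_norm S2_plus \<omega>0 = 1" and odd: "\<forall>x\<in>S2. \<omega>0 (reflect3 x) = - \<omega>0 x"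
    obtain L P where L: "0 \<le> L" "AE x in sph_measure. P x"
      "\<And>x y. x \<in> S2_plus \<Longrightarrow> y \<in> S2_plus \<Longrightarrow> P x \<Longrightarrow> P y \<Longrightarrow> \<bar>\<omega>0 y - \<omega>0 x\<bar> \<le> L * norm (y - x)"
      using W1inf_lipschitz[OF _ W] by blast
    have mp: "\<omega>0 \<in> borel_measurable (sph_on S2_plus)" using W unfolding W1inf_def by blast
    have bp: "AE x in sph_on S2_plus. norm (\<omega>0 x) \<le> 1" by (rule AE_Linf_norm_le) (simp add: n one_ereal_def)
    have m: "\<omega>0 \<in> borel_measurable sph_measure" and b: "AE x in sph_measure. \<bar>\<omega>0 x\<bar> \<le> 1"
      using odd_extension_regular[OF mp bp] odd by auto
    interpret odd_transported_vorticity \<omega>0 \<omega> \<Phi>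
      using flow tr m b odd by unfold_locales auto
    have axis: "axis 3 1 \<bullet> z = z $ 3" for z :: "real^3" by (simp add: inner_axis')
    have k: "norm (axis 3 1 :: real^3) = 1" by simp
    \<comment> \<open>Regularity is known on the open hemisphere only, and the sign of the third
      coordinate accounts for the jump of an odd vorticity across the equator.\<close>
    interpret regular_vorticity \<omega>0 \<omega> \<Phi> S2_plus "\<lambda>z. sgn (z $ 3)" L P
    proof
      show "S2_plus \<subseteq> S2" by (auto simp: S2_plus_def)
      show "m \<in> S2_plus" if "x \<in> S2_plus" "y \<in> S2_plus" "x = c *\<^sub>R m + e" "y = c *\<^sub>R m - e" "0 < c" "m \<in> S2" for x y c m e
      proof -
        have "0 < c * m $ 3 + e $ 3" "0 < c * m $ 3 - e $ 3" using that(1,2) unfolding that(3,4) by (auto simp: S2_plus_def)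
        then have "0 < c * m $ 3" by linarith
        then show ?thesis using that(5,6) by (simp add: S2_plus_def zero_less_mult_iff)
      qed
      show "(\<lambda>z::real^3. sgn (z $ 3)) \<in> borel_measurable sph_measure"
        by (rule borel_measurable_sgn_real[OF borel_measurable_sphI[OF borel_measurable_vec_nth]])
      show "\<bar>sgn (z $ 3)\<bar> \<le> (1::real)" for z :: "real^3" by (simp add: sgn_if)
      show "\<bar>\<integral>z. sgn (z $ 3) * (indicator {\<rho>..<\<delta>} (norm (z - m)) * quadrupole e n m z) \<partial>sph_measure\<bar> \<le> 200"
        if "frame3 e n m" "0 < \<rho>" "\<delta> \<le> 1" for e n m \<rho> \<delta>
        using integral_annulus_sgn_bound[OF that(1) k that(2,3)] unfolding axis .
      show "\<exists>Q'. (AE z in sph_measure. Q' z) \<and> (\<forall>z m. z \<in> S2 \<longrightarrow> m \<in> S2_plus \<longrightarrow> Q' z \<longrightarrow> Q' m \<longrightarrow> \<bar>\<omega> t z - sgn (z $ 3) * \<omega> t m\<bar> \<le> C * norm (z - m) powr \<beta>)"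
        if t: "0 \<le> t" and Q: "AE z in sph_measure. Q z" and C: "0 \<le> C" "0 < \<beta>"
          and hQ: "\<And>z m. z \<in> S2_plus \<Longrightarrow> m \<in> S2_plus \<Longrightarrow> Q z \<Longrightarrow> Q m \<Longrightarrow> \<bar>\<omega> t z - \<omega> t m\<bar> \<le> C * norm (z - m) powr \<beta>"
        for t C \<beta> Q
      proof (intro exI[of _ "\<lambda>z. Q z \<and> Q (reflect3 z)"] conjI allI impI)
        show "AE z in sph_measure. Q z \<and> Q (reflect3 z)"
          using Q AE_sph_preserving[OF reflect3_preserves Q] by eventually_elim simp
        fix z m assume z: "z \<in> S2" "Q z \<and> Q (reflect3 z)" and m: "m \<in> S2_plus" "Q m \<and> Q (reflect3 m)"
        consider "0 < z $ 3" | "z $ 3 = 0" | "z $ 3 < 0" by linarith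
        then show "\<bar>\<omega> t z - sgn (z $ 3) * \<omega> t m\<bar> \<le> C * norm (z - m) powr \<beta>"
        proof cases
          case 1
          then show ?thesis using hQ[of z m] z m by (simp add: S2_plus_def)
        next
          \<comment> \<open>On the equator the vorticity is 0 by oddness, which matches the value 0
            of \<open>sgn\<close> there.\<close>
          case 2
          then have "reflect3 z = z" by (simp add: vec_eq_iff forall_3)
          then have "\<omega> t z = 0" using vorticity_odd[OF t z(1)] by simp
          then show ?thesis using 2 C by simp
        next
          \<comment> \<open>Below the equator \<open>z\<close> is replaced by its mirror image, at
            the cost of a sign and without increasing the distance to \<open>m\<close>.\<close>
          case 3
          have "\<bar>\<omega> t (reflect3 z) - \<omega> t m\<bar> \<le> C * norm (reflect3 z - m) powr \<beta>"
            using hQ[of "reflect3 z" m] z m 3 by (simp add: S2_plus_def)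
          also have "\<dots> \<le> C * norm (z - m) powr \<beta>"
            using norm_reflect3_diff_le[of "- (z $ 3)" "m $ 3" z m] 3 m C
            by (intro mult_left_mono powr_mono2) (auto simp: S2_plus_def mult_nonpos_nonneg)
          finally show ?thesis using 3 vorticity_odd[OF t z(1)] by (simp add: abs_minus_commute[of "- \<omega> t z"] abs_le_iff)
        qed
      qed
    qed (use L openin_S2_plus flow_S2_plus back_flow_S2_plus in auto)
    show ?thesis by (rule double_exponential_rate)
  next
    assume W: "W1inf S2 \<omega>0" and n: "Linf_norm S2 \<omega>0 = 1"
    obtain L P where L: "0 \<le> L" "AE x in sph_measure. P x"
      "\<And>x y. x \<in> S2 \<Longrightarrow> y \<in> S2 \<Longrightarrow> P x \<Longrightarrow> P y \<Longrightarrow> \<bar>\<omega>0 y - \<omega>0 x\<bar> \<le> L * norm (y - x)"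
      using W1inf_lipschitz[OF _ W] by blast
    have m: "\<omega>0 \<in> borel_measurable sph_measure" using W unfolding W1inf_def by (intro borel_measurable_sph_on_S2) blast
    have "AE x in sph_on S2. norm (\<omega>0 x) \<le> 1" by (rule AE_Linf_norm_le) (simp add: n one_ereal_def)
    then have b: "AE x in sph_measure. \<bar>\<omega>0 x\<bar> \<le> 1" using AE_sph_on_S2 by fastforce
    interpret transported_vorticity \<omega>0 \<omega> \<Phi>
      using flow tr m b by unfold_locales auto
    \<comment> \<open>Without a jump the pattern is constant, and its annulus integrals vanish by
      symmetry.\<close>
    interpret regular_vorticity \<omega>0 \<omega> \<Phi> S2 "\<lambda>z. 1" L P
    proof
      show "\<bar>\<integral>z. 1 * (indicator {\<rho>..<\<delta>} (norm (z - m)) * quadrupole e n m z) \<partial>sph_measure\<bar> \<le> 200"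
        if "frame3 e n m" "0 < \<rho>" "\<delta> \<le> 1" for e n m \<rho> \<delta>
        using integral_annulus_quadrupole[OF that(1), of "{\<rho>..<\<delta>}"] by simp
      show "\<exists>Q'. (AE z in sph_measure. Q' z) \<and> (\<forall>z m. z \<in> S2 \<longrightarrow> m \<in> S2 \<longrightarrow> Q' z \<longrightarrow> Q' m \<longrightarrow> \<bar>\<omega> t z - 1 * \<omega> t m\<bar> \<le> C * norm (z - m) powr \<beta>)"
        if "AE z in sph_measure. Q z"
          and "\<And>z m. z \<in> S2 \<Longrightarrow> m \<in> S2 \<Longrightarrow> Q z \<Longrightarrow> Q m \<Longrightarrow> \<bar>\<omega> t z - \<omega> t m\<bar> \<le> C * norm (z - m) powr \<beta>"
        for t C \<beta> Q
        using that by (intro exI[of _ Q]) auto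
    qed (use L flow_simps in \<open>auto simp: S2_plus_def\<close>)
    show ?thesis by (rule double_exponential_rate)
  qed
qed

end
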